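(* Let $(M,\omega)$ be a compact Hermitian manifold. Then the following identities hold. (1) The Levi-Civita Ricci curvatures are $$\mathfrak R^{(1)}=\Theta^{(1)}-\tfrac12\left(\partial\partial^*\omega+\bar\partial\bar\partial^*\omega\right);$$ $$\mathfrak R^{(2)}=\Theta^{(1)}-\tfrac12\left(\partial\partial^*\omega+\bar\partial\bar\partial^*\omega\right)-\tfrac{\sqrt{-1}}4T\circ\overline T+\tfrac{\sqrt{-1}}4T\boxdot\overline T;$$ $$\mathfrak R^{(3)}=\Theta^{(1)}-\tfrac12\left(\sqrt{-1}\Lambda(\partial\bar\partial\omega)+(\partial\partial^*\omega+\bar\partial\bar\partial^*\omega)\right)+\tfrac{\sqrt{-1}}4T\boxdot\overline T+\tfrac14T([\partial^*\omega]^{\#});$$ $$\mathfrak R^{(4)}=\Theta^{(1)}-\tfrac12\left(\sqrt{-1}\Lambda(\partial\bar\partial\omega)+(\partial\partial^*\omega+\bar\partial\bar\partial^*\omega)\right)+\tfrac{\sqrt{-1}}4T\boxdot\overline T+\tfrac14\overline{T([\partial^*\omega]^{\#})}.$$ (2) The Chern-Ricci curvatures are $$\Theta^{(2)}=\Theta^{(1)}-\sqrt{-1}\Lambda(\partial\bar\partial\omega)-(\partial\partial^*\omega+\bar\partial\bar\partial^*\omega)+\sqrt{-1}\,T\boxdot\overline T;$$ $$\Theta^{(3)}=\Theta^{(1)}-\partial\partial^*\omega;\qquad\Theta^{(4)}=\Theta^{(1)}-\bar\partial\bar\partial^*\omega.$$ (3) The Hermitian-Ricci curvatures are $$Ric_H=R^{(1)}=R^{(2)}=\Theta^{(1)}-\tfrac12\left(\partial\partial^*\omega+\bar\partial\bar\partial^*\omega\right)-\tfrac{\sqrt{-1}}4T\circ\overline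 T;$$ $$R^{(3)}=R^{(4)}=\Theta^{(1)}-\tfrac12\left(\sqrt{-1}\Lambda(\partial\bar\partial\omega)+(\partial\partial^*\omega+\bar\partial\bar\partial^*\omega)\right)+\tfrac{\sqrt{-1}}4T\boxdot\overline T+\tfrac14\left(\overline{T([\partial^*\omega]^{\#})}+T([\partial^*\omega]^{\#})\right).$$ (4) The $(1,1)$-component of the complexified Riemannian Ricci curvature is $$\mathscr Ric=\Theta^{(1)}-\sqrt{-1}(\Lambda\partial\bar\partial\omega)-\tfrac12(\partial\partial^*\omega+\bar\partial\bar\partial^*\omega)+\tfrac{\sqrt{-1}}4\left(2T\boxdot\overline T+T\circ\overline T\right)+\tfrac12\left(T([\partial^*\omega]^{\#})+\overline{T([\partial^*\omega]^{\#})}\right).$$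
   Context: A Hermitian manifold is a complex manifold $M$ of complex dimension $n$ with a $J$-invariant Riemannian metric $g$, extended $\mathbb C$-bilinearly to $T_{\mathbb C}M$; $h_{i\bar j}=g(\partial/\partial z^i,\partial/\partial\bar z^j)$, $h^{i\bar\ell}h_{k\bar\ell}=\delta^i_k$, $\omega=\sqrt{-1}\,h_{i\bar j}dz^i\wedge d\bar z^j$. Summation convention. Curvatures. Let $\nabla$ be the Levi-Civita connection of $g$, extended $\mathbb C$-linearly. - $R(X,Y,Z,W)=g(\nabla_X\nabla_YZ-\nabla_Y\nabla_XZ-\nabla_{[X,Y]}Z,W)$, extended $\mathbb C$-multilinearly; $R_{i\bar jk\bar\ell}=R(\partial_{z^i},\partial_{\bar z^j},\partial_{z^k},\partial_{\bar z^\ell})$. - $\hat\nabla=\pi\circ\nabla$ is the connection induced on $T^{1,0}M$ ($\pi:T_{\mathbb C}M\to T^{1,0}M$ the projection), with curvature $\mathfrak R(X,Y)s=\hat\nabla_X\hat\nabla_Ys-\hat\nabla_Y\hat\nabla_Xs-\hat\nabla_{[X,Y]}s$; $\mathfrak R(\partial_{z^i},\partial_{\bar z^j})\partial_{z^k}=\mathfrak R_{i\bar jk}^{s}\partial_{z^s}$, $\mathfrak R_{i\bar jk\bar\ell}=\mathfrak R_{i\bar jk}^sh_{s\bar\ell}$. - The Chern curvature is $\Theta_{i\bar jk\bar\ell}=-\frac{\partial^2h_{k\bar\ell}}{\partial z^i\partial\bar z^j}+h^{p\bar q}\frac{\partial h_{p\bar\ell}}{\partial\bar z^j}\frac{\partial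 h_{k\bar q}}{\partial z^i}$. For each $A\in\{R,\mathfrak R,\Theta\}$ define $A^{(a)}=\sqrt{-1}A^{(a)}_{i\bar j}dz^i\wedge d\bar z^j$ with $A^{(1)}_{i\bar j}=h^{k\bar\ell}A_{i\bar jk\bar\ell}$, $A^{(2)}_{i\bar j}=h^{k\bar\ell}A_{k\bar\ell i\bar j}$, $A^{(3)}_{i\bar j}=h^{k\bar\ell}A_{i\bar\ell k\bar j}$, $A^{(4)}_{i\bar j}=h^{k\bar\ell}A_{k\bar ji\bar\ell}$. $Ric_H=R^{(1)}$. The Riemannian Ricci tensor is $Ric(X,Y)=\sum_{a=1}^{2n}R(e_a,X,Y,e_a)$ for a $g$-orthonormal basis $\{e_a\}$ of $T_{\mathbb R}M$, extended $\mathbb C$-bilinearly, and $\mathscr Ric=\sqrt{-1}\,Ric(\partial_{z^i},\partial_{\bar z^j})\,dz^i\wedge d\bar z^j$. Torsion: $T_{ij}^k=h^{k\bar\ell}\left(\frac{\partial h_{j\bar\ell}}{\partial z^i}-\frac{\partial h_{i\bar\ell}}{\partial z^j}\right)$, and $T\boxdot\overline T=h^{p\bar q}h_{k\bar\ell}T_{ip}^k\overline{T_{jq}^\ell}\,dz^i\wedge d\bar z^j$, $\ T\circ\overline T=h^{p\bar q}h^{s\bar t}h_{k\bar j}h_{i\bar\ell}T_{sp}^k\overline{T_{tq}^\ell}\,dz^i\wedge d\bar z^j$. If $\partial^*\omega=\alpha_{\bar s}d\bar z^s$, its dual $(1,0)$-vector is $[\partial^*\omega]^{\#}=V^p\partial_{z^p}$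 with $V^p=h^{p\bar s}\alpha_{\bar s}$, and $T([\partial^*\omega]^{\#})$ is the $(1,1)$-form $h_{k\bar j}T_{pi}^kV^p\,dz^i\wedge d\bar z^j$; the bar over it denotes complex conjugation of forms. $\partial^*,\bar\partial^*$ are the formal adjoints of $\partial,\bar\partial$, and $\Lambda$ the adjoint of $\omega\wedge\cdot$, with respect to $(\phi,\psi)=\int_M\langle\phi,\psi\rangle\omega^n/n!$, where for $\phi=\frac1{p!q!}\sum\phi_{i_1\cdots i_p\bar j_1\cdots\bar j_q}dz^{i_1}\wedge\cdots\wedge d\bar z^{j_q}$ one has $\langle\phi,\phi\rangle=\frac1{p!q!}h^{i_1\bar\ell_1}\cdots h^{i_p\bar\ell_p}h^{k_1\bar j_1}\cdots h^{k_q\bar j_q}\phi_{i_1\cdots\bar j_q}\overline{\phi_{\ell_1\cdots\bar k_q}}$. *)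

theory Defs
  imports "HOL-Analysis.Analysis" "HOL-Library.Function_Algebras"
begin

section \<open>Smooth and holomorphic maps\<close>

text \<open>Both notions are only used on open sets.\<close>

primrec Ck_on :: "nat \<Rightarrow> ('a::euclidean_space \<Rightarrow> 'b::real_normed_vector) \<Rightarrow> 'a set \<Rightarrow> bool" where
  "Ck_on 0 f S = continuous_on S f"
| "Ck_on (Suc k) f S =
     (f differentiable_on S \<and> (\<forall>v. Ck_on k (\<lambda>x. frechet_derivative f (at x) v) S))"

definition smooth_on :: "('a::euclidean_space \<Rightarrow> 'b::real_normed_vector) \<Rightarrow> 'a set \<Rightarrow> bool" where
  "smooth_on f S \<longleftrightarrow> (\<forall>k. Ck_on k f S)"

definition holomorphic_map_on :: "(complex^'n \<Rightarrow> complex^'n) \<Rightarrow> (complex^'n) set \<Rightarrow> bool" where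
  "holomorphic_map_on f S \<longleftrightarrow>
     (\<forall>x\<in>S. \<exists>f'. (f has_derivative f') (at x) \<and> (\<forall>v. f' (\<i> *s v) = \<i> *s f' v))"

section \<open>Complex manifolds\<close>

text \<open>The manifold is the whole type \<open>'m\<close>; its complex dimension is \<open>CARD('n)\<close>.
  A chart is a domain together with a coordinate map.\<close>

type_synonym ('m, 'n) chart = "'m set \<times> ('m \<Rightarrow> complex^'n)"

definition im :: "('m, 'n) chart \<Rightarrow> (complex^'n) set" where
  "im c = snd c ` fst c"

definition transition :: "('m, 'n) chart \<Rightarrow> ('m, 'n) chart \<Rightarrow> complex^'n \<Rightarrow> complex^'n" where
  "transition c c' = snd c' \<circ> inv_into (fst c) (snd c)"

definition overlap :: "('m, 'n) chart \<Rightarrow> ('m, 'n) chart \<Rightarrow> (complex^'n) set" where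
  "overlap c c' = snd c ` (fst c \<inter> fst c')"

definition complex_atlas :: "('m::t2_space, 'n::finite) chart set \<Rightarrow> bool" where
  "complex_atlas A \<longleftrightarrow>
     (\<Union>c\<in>A. fst c) = UNIV \<and>
     (\<forall>c\<in>A. open (fst c) \<and> open (im c) \<and>
        homeomorphism (fst c) (im c) (snd c) (inv_into (fst c) (snd c))) \<and>
     (\<forall>c\<in>A. \<forall>c'\<in>A. holomorphic_map_on (transition c c') (overlap c c'))"

text \<open>\<open>g c x v w\<close> is the metric at the point with coordinates \<open>x\<close> in the chart \<open>c\<close>.  The real
  tangent space there is \<open>complex^'n\<close>, regarded as a real vector space, and \<open>J\<close> is
  multiplication by \<open>\<i>\<close>.\<close>

type_synonym ('m, 'n) metric =
  "('m, 'n) chart \<Rightarrow> complex^'n \<Rightarrow> complex^'n \<Rightarrow> complex^'n \<Rightarrow> real"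

definition hermitian_metric ::
    "('m::t2_space, 'n::finite) chart set \<Rightarrow> ('m, 'n) metric \<Rightarrow> bool" where
  "hermitian_metric A g \<longleftrightarrow>
     (\<forall>c\<in>A. \<forall>x\<in>im c.
        bilinear (g c x) \<and>
        (\<forall>v w. g c x v w = g c x w v) \<and>
        (\<forall>v. v \<noteq> 0 \<longrightarrow> g c x v v > 0) \<and>
        (\<forall>v w. g c x (\<i> *s v) (\<i> *s w) = g c x v w)) \<and>
     (\<forall>c\<in>A. \<forall>v w. smooth_on (\<lambda>x. g c x v w) (im c)) \<and>
     (\<forall>c\<in>A. \<forall>c'\<in>A. \<forall>x\<in>overlap c c'. \<forall>v w.
        g c x v w = g c' (transition c c' x)
          (frechet_derivative (transition c c') (at x) v)
          (frechet_derivative (transition c c') (at x) w))"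

section \<open>The complexified tangent space\<close>

text \<open>The pair \<open>(X, Y)\<close> of real tangent vectors stands for \<open>X + \<i> Y\<close>.\<close>

type_synonym 'n cvec = "(complex^'n) \<times> (complex^'n)"
type_synonym 'n cfield = "complex^'n \<Rightarrow> 'n cvec"

definition dz :: "'n::finite \<Rightarrow> 'n cvec" where  \<comment> \<open>\<open>\<partial>/\<partial>z\<^sup>i = (\<partial>/\<partial>x\<^sup>i - \<i> \<partial>/\<partial>y\<^sup>i) / 2\<close>\<close>
  "dz i = ((1/2) *\<^sub>R axis i 1, - (1/2) *\<^sub>R axis i \<i>)"

definition dzb :: "'n::finite \<Rightarrow> 'n cvec" where
  "dzb i = ((1/2) *\<^sub>R axis i 1, (1/2) *\<^sub>R axis i \<i>)"

definition zcoeff :: "'n cvec \<Rightarrow> 'n::finite \<Rightarrow> complex" where  \<comment> \<open>the covector \<open>dz\<^sup>s\<close>\<close>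
  "zcoeff Z s = fst Z $ s + \<i> * snd Z $ s"

definition proj10 :: "'n cvec \<Rightarrow> 'n::finite cvec" where  \<comment> \<open>\<open>\<pi> Z = (Z - \<i> J Z) / 2\<close>\<close>
  "proj10 Z = (1/2) *\<^sub>R (fst Z + \<i> *s snd Z, snd Z - \<i> *s fst Z)"

definition cderiv :: "'n::finite cvec \<Rightarrow> (complex^'n \<Rightarrow> complex) \<Rightarrow> complex^'n \<Rightarrow> complex" where
  "cderiv Z f x = frechet_derivative f (at x) (fst Z) + \<i> * frechet_derivative f (at x) (snd Z)"

definition gC :: "('m, 'n) metric \<Rightarrow> ('m, 'n::finite) chart \<Rightarrow> complex^'n \<Rightarrow> 'n cvec \<Rightarrow> 'n cvec \<Rightarrow> complex" where
  "gC g c x Z W = Complex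
     (g c x (fst Z) (fst W) - g c x (snd Z) (snd W))
     (g c x (fst Z) (snd W) + g c x (snd Z) (fst W))"

definition herm :: "('m, 'n) metric \<Rightarrow> ('m, 'n::finite) chart \<Rightarrow> complex^'n \<Rightarrow> 'n \<Rightarrow> 'n \<Rightarrow> complex" where
  "herm g c x i j = gC g c x (dz i) (dzb j)"

text \<open>\<open>hinv g c x i l\<close> is \<open>h\<^sup>i\<^sup>l\<close> with \<open>(\<Sum>l. hinv g c x i l * herm g c x k l) = \<delta>\<^sub>i\<^sub>k\<close>; whence the
  transpose.\<close>

definition hinv :: "('m, 'n) metric \<Rightarrow> ('m, 'n::finite) chart \<Rightarrow> complex^'n \<Rightarrow> 'n \<Rightarrow> 'n \<Rightarrow> complex" where
  "hinv g c x i l = matrix_inv (\<chi> l k. herm g c x k l) $ i $ l"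

section \<open>Connections and curvature in a chart\<close>

text \<open>A connection in a chart has the form \<open>\<nabla>\<^sub>X Y = DY(X) + \<Gamma>(X, Y)\<close>.  The Levi-Civita connection
  is the one which is torsion free (\<open>\<Gamma>\<close> is symmetric) and metric.\<close>

definition levi_civita ::
    "('m, 'n) metric \<Rightarrow> ('m, 'n::finite) chart \<Rightarrow> complex^'n \<Rightarrow> complex^'n \<Rightarrow> complex^'n \<Rightarrow> complex^'n" where
  "levi_civita g c x = (THE \<Gamma>. bilinear \<Gamma> \<and>
     (\<forall>u v. \<Gamma> u v = \<Gamma> v u) \<and>
     (\<forall>u v w. frechet_derivative (\<lambda>y. g c y v w) (at x) u = g c x (\<Gamma> u v) w + g c x v (\<Gamma> u w)))"

definition nabla ::
    "('m, 'n) metric \<Rightarrow> ('m, 'n::finite) chart \<Rightarrow> (complex^'n \<Rightarrow> complex^'n) \<Rightarrow> (complex^'n \<Rightarrow> complex^'n) \<Rightarrow>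
     complex^'n \<Rightarrow> complex^'n" where
  "nabla g c X Y x = frechet_derivative Y (at x) (X x) + levi_civita g c x (X x) (Y x)"

definition bracket ::
    "(complex^'n \<Rightarrow> complex^'n) \<Rightarrow> (complex^'n \<Rightarrow> complex^'n) \<Rightarrow> complex^'n \<Rightarrow> complex^'n::finite" where
  "bracket X Y x = frechet_derivative Y (at x) (X x) - frechet_derivative X (at x) (Y x)"

text \<open>Complex bilinear extension of a real bilinear operation on vector fields.\<close>

definition complexify ::
    "((complex^'n \<Rightarrow> complex^'n) \<Rightarrow> (complex^'n \<Rightarrow> complex^'n) \<Rightarrow> complex^'n \<Rightarrow> complex^'n::finite) \<Rightarrow>
     'n cfield \<Rightarrow> 'n cfield \<Rightarrow> 'n cfield" where
  "complexify op Z W = (\<lambda>x.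
     (op (fst \<circ> Z) (fst \<circ> W) x - op (snd \<circ> Z) (snd \<circ> W) x,
      op (fst \<circ> Z) (snd \<circ> W) x + op (snd \<circ> Z) (fst \<circ> W) x))"

definition nablaC :: "('m, 'n) metric \<Rightarrow> ('m, 'n::finite) chart \<Rightarrow> 'n cfield \<Rightarrow> 'n cfield \<Rightarrow> 'n cfield" where
  "nablaC g c = complexify (nabla g c)"

definition nabla_hat :: "('m, 'n) metric \<Rightarrow> ('m, 'n::finite) chart \<Rightarrow> 'n cfield \<Rightarrow> 'n cfield \<Rightarrow> 'n cfield" where
  "nabla_hat g c X s = (\<lambda>x. proj10 (nablaC g c X s x))"

definition curvature ::
    "('n cfield \<Rightarrow> 'n cfield \<Rightarrow> 'n cfield) \<Rightarrow> 'n cfield \<Rightarrow> 'n cfield \<Rightarrow> 'n cfield \<Rightarrow> 'n::finite cfield" where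
  "curvature D X Y s = (\<lambda>x. D X (D Y s) x - D Y (D X s) x - D (complexify bracket X Y) s x)"

text \<open>The tensor \<open>R\<close> at a point, evaluated by extending vectors to constant vector fields in the
  chart.\<close>

definition Rm ::
    "('m, 'n) metric \<Rightarrow> ('m, 'n::finite) chart \<Rightarrow> complex^'n \<Rightarrow> 'n cvec \<Rightarrow> 'n cvec \<Rightarrow> 'n cvec \<Rightarrow> 'n cvec \<Rightarrow> complex" where
  "Rm g c x X Y Z W = gC g c x (curvature (nablaC g c) (\<lambda>_. X) (\<lambda>_. Y) (\<lambda>_. Z) x) W"

text \<open>\<open>Q c x i j k l\<close> stands for the component with barred second and fourth index.\<close>

type_synonym ('m, 'n) curv = "('m, 'n) chart \<Rightarrow> complex^'n \<Rightarrow> 'n \<Rightarrow> 'n \<Rightarrow> 'n \<Rightarrow> 'n \<Rightarrow> complex"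

definition riem :: "('m, 'n) metric \<Rightarrow> ('m, 'n::finite) curv" where
  "riem g c x i j k l = Rm g c x (dz i) (dzb j) (dz k) (dzb l)"

definition lc_curv :: "('m, 'n) metric \<Rightarrow> ('m, 'n::finite) curv" where
  "lc_curv g c x i j k l =
     (\<Sum>s\<in>UNIV. zcoeff (curvature (nabla_hat g c) (\<lambda>_. dz i) (\<lambda>_. dzb j) (\<lambda>_. dz k) x) s * herm g c x s l)"

definition chern :: "('m, 'n) metric \<Rightarrow> ('m, 'n::finite) curv" where
  "chern g c x i j k l =
     - cderiv (dz i) (\<lambda>y. cderiv (dzb j) (\<lambda>u. herm g c u k l) y) x
     + (\<Sum>p\<in>UNIV. \<Sum>q\<in>UNIV. hinv g c x p q *
          cderiv (dzb j) (\<lambda>y. herm g c y p l) x * cderiv (dz i) (\<lambda>y. herm g c y k q) x)"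

definition orthonormal_basis ::
    "('m, 'n) metric \<Rightarrow> ('m, 'n::finite) chart \<Rightarrow> complex^'n \<Rightarrow> (complex^'n) set \<Rightarrow> bool" where
  "orthonormal_basis g c x E \<longleftrightarrow> card E = 2 * CARD('n) \<and>
     (\<forall>u\<in>E. \<forall>v\<in>E. g c x u v = (if u = v then 1 else 0))"

definition Ric ::
    "('m, 'n) metric \<Rightarrow> ('m, 'n::finite) chart \<Rightarrow> complex^'n \<Rightarrow> 'n cvec \<Rightarrow> 'n cvec \<Rightarrow> complex" where
  "Ric g c x X Y = (\<Sum>e\<in>(SOME E. orthonormal_basis g c x E). Rm g c x (e, 0) X Y (e, 0))"

section \<open>Forms of type (p,q)\<close>

text \<open>\<open>\<phi> c x I J\<close> is the component with holomorphic indices \<open>I\<close> and antiholomorphic indices \<open>J\<close>,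
  in the normalisation \<open>\<phi> = 1/(p! q!) \<Sum> \<phi>\<^sub>I\<^sub>J dz\<^sup>I \<and> dz\<^sup>J\<close> (second factor conjugated).
  Arguments which are meaningless for a form of type (p,q) give 0, so that equality of
  forms is equality of functions.\<close>

type_synonym ('m, 'n) form = "('m, 'n) chart \<Rightarrow> complex^'n \<Rightarrow> 'n list \<Rightarrow> 'n list \<Rightarrow> complex"

definition forms :: "('m::t2_space, 'n::finite) chart set \<Rightarrow> nat \<Rightarrow> nat \<Rightarrow> ('m, 'n) form set" where
  "forms A p q = {\<phi>.
     (\<forall>c x I J. \<not> (c \<in> A \<and> x \<in> im c \<and> length I = p \<and> length J = q) \<longrightarrow> \<phi> c x I J = 0) \<and>
     (\<forall>c x I J a b. a < b \<and> b < length I \<longrightarrow> \<phi> c x (I[a := I!b, b := I!a]) J = - \<phi> c x I J) \<and>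
     (\<forall>c x I J a b. a < b \<and> b < length J \<longrightarrow> \<phi> c x I (J[a := J!b, b := J!a]) = - \<phi> c x I J) \<and>
     (\<forall>c\<in>A. \<forall>I J. smooth_on (\<lambda>x. \<phi> c x I J) (im c)) \<and>
     (\<forall>c\<in>A. \<forall>c'\<in>A. \<forall>x\<in>overlap c c'. \<forall>I J. \<phi> c x I J =
        (\<Sum>K | length K = length I. \<Sum>L | length L = length J.
           (\<Prod>a<length I. cderiv (dz (I!a)) (\<lambda>y. transition c c' y $ (K!a)) x) *
           (\<Prod>b<length J. cnj (cderiv (dz (J!b)) (\<lambda>y. transition c c' y $ (L!b)) x)) *
           \<phi> c' (transition c c' x) K L))}"

definition scale :: "complex \<Rightarrow> ('m, 'n) form \<Rightarrow> ('m, 'n) form" (infixr "\<cdot>" 75) where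
  "a \<cdot> \<phi> = (\<lambda>c x I J. a * \<phi> c x I J)"

definition conj_form :: "('m, 'n) form \<Rightarrow> ('m, 'n) form" where
  "conj_form \<phi> = (\<lambda>c x I J. (-1) ^ (length I * length J) * cnj (\<phi> c x J I))"

text \<open>The (1,1)-form \<open>\<Sum> a\<^sub>i\<^sub>j dz\<^sup>i \<and> dz\<^sup>j\<close> (second factor conjugated).\<close>

definition form11 ::
    "('m, 'n) chart set \<Rightarrow> (('m, 'n) chart \<Rightarrow> complex^'n \<Rightarrow> 'n \<Rightarrow> 'n \<Rightarrow> complex) \<Rightarrow> ('m, 'n) form" where
  "form11 A a = (\<lambda>c x I J.
     if c \<in> A \<and> x \<in> im c \<and> length I = 1 \<and> length J = 1 then a c x (hd I) (hd J) else 0)"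

definition omega :: "('m, 'n) chart set \<Rightarrow> ('m, 'n) metric \<Rightarrow> ('m, 'n::finite) form" where
  "omega A g = form11 A (\<lambda>c x i j. \<i> * herm g c x i j)"

definition omit :: "nat \<Rightarrow> 'a list \<Rightarrow> 'a list" where
  "omit a I = take a I @ drop (Suc a) I"

definition del :: "('m, 'n::finite) form \<Rightarrow> ('m, 'n) form" where
  "del \<phi> = (\<lambda>c x I J. if x \<in> im c then
     (\<Sum>a<length I. (-1) ^ a * cderiv (dz (I!a)) (\<lambda>y. \<phi> c y (omit a I) J) x) else 0)"

text \<open>The sign \<open>(-1)\<^sup>p\<close> comes from moving the new antiholomorphic differential past \<open>dz\<^sup>I\<close>.\<close>

definition delbar :: "('m, 'n::finite) form \<Rightarrow> ('m, 'n) form" where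
  "delbar \<phi> = (\<lambda>c x I J. if x \<in> im c then
     (-1) ^ length I * (\<Sum>b<length J. (-1) ^ b * cderiv (dzb (J!b)) (\<lambda>y. \<phi> c y I (omit b J)) x) else 0)"

text \<open>Exterior product of a (1,1)-form \<open>\<psi>\<close> with a (p,q)-form; here \<open>p = length I - 1\<close>.\<close>

definition wedge11 :: "('m, 'n) form \<Rightarrow> ('m, 'n) form \<Rightarrow> ('m, 'n) form" where
  "wedge11 \<psi> \<phi> = (\<lambda>c x I J. (-1) ^ (length I - 1) *
     (\<Sum>a<length I. \<Sum>b<length J. (-1) ^ (a + b) * \<psi> c x [I!a] [J!b] * \<phi> c x (omit a I) (omit b J)))"

section \<open>The inner product and formal adjoints\<close>

text \<open>The measure \<open>\<omega>\<^sup>n/n!\<close>: in a chart it is \<open>det h \<Prod> (\<i> dz\<^sup>i \<and> dz\<^sup>i)\<close> (second factor conjugated)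
  and each factor is \<open>2 dx\<^sup>i \<and> dy\<^sup>i\<close>.\<close>

definition volume :: "('m::t2_space, 'n::finite) chart set \<Rightarrow> ('m, 'n) metric \<Rightarrow> 'm measure" where
  "volume A g = (THE \<mu>. sets \<mu> = sets borel \<and>
     (\<forall>c\<in>A. \<forall>B\<in>sets borel. B \<subseteq> fst c \<longrightarrow>
        emeasure \<mu> B = (\<integral>\<^sup>+x. ennreal (2 ^ CARD('n) * Re (det (\<chi> i j. herm g c x i j)))
                              * indicator (snd c ` B) x \<partial>lborel)))"

definition pt_inner ::
    "('m, 'n) metric \<Rightarrow> nat \<Rightarrow> nat \<Rightarrow> ('m, 'n::finite) form \<Rightarrow> ('m, 'n) form \<Rightarrow>
     ('m, 'n) chart \<Rightarrow> complex^'n \<Rightarrow> complex" where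
  "pt_inner g p q \<phi> \<psi> c x = 1 / (fact p * fact q) *
     (\<Sum>I | length I = p. \<Sum>L | length L = p. \<Sum>J | length J = q. \<Sum>K | length K = q.
        (\<Prod>a<p. hinv g c x (I!a) (L!a)) * (\<Prod>b<q. hinv g c x (K!b) (J!b)) *
        \<phi> c x I J * cnj (\<psi> c x L K))"

definition chart_at :: "('m, 'n) chart set \<Rightarrow> 'm \<Rightarrow> ('m, 'n) chart" where
  "chart_at A m = (SOME c. c \<in> A \<and> m \<in> fst c)"

definition inner_prod ::
    "('m::t2_space, 'n::finite) chart set \<Rightarrow> ('m, 'n) metric \<Rightarrow> nat \<Rightarrow> nat \<Rightarrow>
     ('m, 'n) form \<Rightarrow> ('m, 'n) form \<Rightarrow> complex" where
  "inner_prod A g p q \<phi> \<psi> =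
     (\<integral>m. pt_inner g p q \<phi> \<psi> (chart_at A m) (snd (chart_at A m) m) \<partial>volume A g)"

text \<open>The adjoint of an operator \<open>P\<close> from (p,q)-forms to (r,s)-forms.\<close>

definition formal_adjoint ::
    "('m::t2_space, 'n::finite) chart set \<Rightarrow> ('m, 'n) metric \<Rightarrow> nat \<Rightarrow> nat \<Rightarrow> nat \<Rightarrow> nat \<Rightarrow>
     (('m, 'n) form \<Rightarrow> ('m, 'n) form) \<Rightarrow> ('m, 'n) form \<Rightarrow> ('m, 'n) form" where
  "formal_adjoint A g p q r s P \<phi> = (THE \<psi>. \<psi> \<in> forms A p q \<and>
     (\<forall>\<eta>\<in>forms A p q. inner_prod A g r s (P \<eta>) \<phi> = inner_prod A g p q \<eta> \<psi>))"

text \<open>In the next three definitions \<open>p q\<close> is the bidegree of the result.\<close>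

definition del_star ::
    "('m::t2_space, 'n::finite) chart set \<Rightarrow> ('m, 'n) metric \<Rightarrow> nat \<Rightarrow> nat \<Rightarrow> ('m, 'n) form \<Rightarrow> ('m, 'n) form" where
  "del_star A g p q = formal_adjoint A g p q (p + 1) q del"

definition delbar_star ::
    "('m::t2_space, 'n::finite) chart set \<Rightarrow> ('m, 'n) metric \<Rightarrow> nat \<Rightarrow> nat \<Rightarrow> ('m, 'n) form \<Rightarrow> ('m, 'n) form" where
  "delbar_star A g p q = formal_adjoint A g p q p (q + 1) delbar"

definition Lambda ::
    "('m::t2_space, 'n::finite) chart set \<Rightarrow> ('m, 'n) metric \<Rightarrow> nat \<Rightarrow> nat \<Rightarrow> ('m, 'n) form \<Rightarrow> ('m, 'n) form" where
  "Lambda A g p q = formal_adjoint A g p q (p + 1) (q + 1) (wedge11 (omega A g))"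

section \<open>Torsion\<close>

definition torsion :: "('m, 'n) metric \<Rightarrow> ('m, 'n::finite) chart \<Rightarrow> complex^'n \<Rightarrow> 'n \<Rightarrow> 'n \<Rightarrow> 'n \<Rightarrow> complex" where
  \<comment> \<open>\<open>torsion g c x i j k\<close> has lower indices \<open>i j\<close> and upper index \<open>k\<close>\<close>
  "torsion g c x i j k = (\<Sum>l\<in>UNIV. hinv g c x k l *
     (cderiv (dz i) (\<lambda>y. herm g c y j l) x - cderiv (dz j) (\<lambda>y. herm g c y i l) x))"

definition T_box :: "('m, 'n) chart set \<Rightarrow> ('m, 'n) metric \<Rightarrow> ('m, 'n::finite) form" where
  "T_box A g = form11 A (\<lambda>c x i j. \<Sum>p\<in>UNIV. \<Sum>q\<in>UNIV. \<Sum>k\<in>UNIV. \<Sum>l\<in>UNIV.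
     hinv g c x p q * herm g c x k l * torsion g c x i p k * cnj (torsion g c x j q l))"

definition T_circ :: "('m, 'n) chart set \<Rightarrow> ('m, 'n) metric \<Rightarrow> ('m, 'n::finite) form" where
  "T_circ A g = form11 A (\<lambda>c x i j.
     \<Sum>p\<in>UNIV. \<Sum>q\<in>UNIV. \<Sum>s\<in>UNIV. \<Sum>t\<in>UNIV. \<Sum>k\<in>UNIV. \<Sum>l\<in>UNIV.
       hinv g c x p q * hinv g c x s t * herm g c x k j * herm g c x i l *
       torsion g c x s p k * cnj (torsion g c x t q l))"

text \<open>The form \<open>T(\<alpha>\<^sup>#)\<close> for a (0,1)-form \<open>\<alpha>\<close> with dual vector \<open>V\<^sup>p = h\<^sup>p\<^sup>s \<alpha>\<^sub>s\<close>.\<close>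

definition T_sharp :: "('m, 'n) chart set \<Rightarrow> ('m, 'n) metric \<Rightarrow> ('m, 'n) form \<Rightarrow> ('m, 'n::finite) form" where
  "T_sharp A g \<alpha> = form11 A (\<lambda>c x i j. \<Sum>p\<in>UNIV. \<Sum>k\<in>UNIV.
     herm g c x k j * torsion g c x p i k * (\<Sum>s\<in>UNIV. hinv g c x p s * \<alpha> c x [] [s]))"

section \<open>Ricci curvatures\<close>

definition ric1 :: "('m, 'n) chart set \<Rightarrow> ('m, 'n) metric \<Rightarrow> ('m, 'n::finite) curv \<Rightarrow> ('m, 'n) form" where
  "ric1 A g Q = form11 A (\<lambda>c x i j. \<i> * (\<Sum>k\<in>UNIV. \<Sum>l\<in>UNIV. hinv g c x k l * Q c x i j k l))"

definition ric2 :: "('m, 'n) chart set \<Rightarrow> ('m, 'n) metric \<Rightarrow> ('m, 'n::finite) curv \<Rightarrow> ('m, 'n) form" where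
  "ric2 A g Q = form11 A (\<lambda>c x i j. \<i> * (\<Sum>k\<in>UNIV. \<Sum>l\<in>UNIV. hinv g c x k l * Q c x k l i j))"

definition ric3 :: "('m, 'n) chart set \<Rightarrow> ('m, 'n) metric \<Rightarrow> ('m, 'n::finite) curv \<Rightarrow> ('m, 'n) form" where
  "ric3 A g Q = form11 A (\<lambda>c x i j. \<i> * (\<Sum>k\<in>UNIV. \<Sum>l\<in>UNIV. hinv g c x k l * Q c x i l k j))"

definition ric4 :: "('m, 'n) chart set \<Rightarrow> ('m, 'n) metric \<Rightarrow> ('m, 'n::finite) curv \<Rightarrow> ('m, 'n) form" where
  "ric4 A g Q = form11 A (\<lambda>c x i j. \<i> * (\<Sum>k\<in>UNIV. \<Sum>l\<in>UNIV. hinv g c x k l * Q c x k j i l))"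

definition Ric_H :: "('m, 'n) chart set \<Rightarrow> ('m, 'n) metric \<Rightarrow> ('m, 'n::finite) form" where
  "Ric_H A g = ric1 A g (riem g)"

definition scr_Ric :: "('m, 'n) chart set \<Rightarrow> ('m, 'n) metric \<Rightarrow> ('m, 'n::finite) form" where
  "scr_Ric A g = form11 A (\<lambda>c x i j. \<i> * Ric g c x (dz i) (dzb j))"

end

theory Submission
  imports Defs "HOL-Complex_Analysis.Cauchy_Integral_Formula" "HOL-Library.Numeral_Type" "HOL-Computational_Algebra.Polynomial"
begin

text \<open>
  All identities are pointwise once three global operators are known in coordinates: the adjoints
  of \<open>\<partial>\<close> and of its conjugate at \<open>\<omega>\<close>, and \<open>\<Lambda>\<close> at \<open>\<partial>\<partial>\<omega>\<close>,
  where the second \<open>\<partial>\<close> in \<open>\<partial>\<partial>\<omega>\<close> is always barred.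

  \<^emph>\<open>Curvature.\<close>  Koszul's formula expresses the Christoffel symbols, hence the curvatures, by first and
  second derivatives of \<open>h\<close> (\<open>riem_components\<close>, \<open>lc_curv_components\<close>, \<open>chern_components\<close>).  The
  curvatures differ in the order of indices in the second derivatives and in products of first
  derivatives of which at least one is antisymmetrised, that is, torsion.  Exchanging
  indices in a second derivative produces components of \<open>\<partial>\<partial>\<^sup>*\<omega>\<close>, of its
  conjugate or of \<open>\<Lambda>(\<partial>\<partial>\<omega>)\<close> after contraction, since all of these are contractions of
  antisymmetrised derivatives of \<open>h\<close>; this gives the lemmas \<open>tr_chern2\<close> up to
  \<open>tr_riem4\<close>.  The Riemannian Ricci tensor is a combination of three Hermitian traces by the Bianchi
  identity (\<open>Ric_formula\<close>).

  \<^emph>\<open>The adjoint of\<close> \<open>\<partial>\<close>.  Let \<open>psi\<close> be the (0,1)-form with components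
  \<open>- \<i> h\<^sup>k\<^sup>l\<close> times the conjugate of \<open>\<partial>\<^sub>s h\<^sub>l\<^sub>k - \<partial>\<^sub>l h\<^sub>s\<^sub>k\<close>.  For every (0,1)-form \<open>\<eta>\<close> the function
  \<open>\<langle>\<partial>\<eta>, \<omega>\<rangle> - \<langle>\<eta>, psi\<rangle>\<close>, multiplied by the density of the volume, is a divergence in every chart
  (\<open>divop_divergence\<close>, which rests on Jacobi's formula for the derivative of \<open>det h\<close>).  A
  partition of unity and integration by parts show that its integral is 0 (\<open>integral_divop\<close>), so
  \<open>psi\<close> is an adjoint.  It is the only one because the inner product is positive definite on
  smooth forms.  For this the volume must exist as a measure, be finite, and charge
  open sets: it is glued from the measures of finitely many charts, which agree on overlaps because
  the real Jacobian of a holomorphic map is \<open>\<bar>det\<bar>\<^sup>2\<close> of the complex one (\<open>det_realify\<close>).  The conjugate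
  operator follows by complex conjugation, \<open>\<omega>\<close> being real.

  \<^emph>\<open>The operator\<close> \<open>\<Lambda>\<close>.  Here the adjoint is algebraic (\<open>wedge_omega_inner\<close>).  The form so
  obtained is global since \<open>\<partial>\<partial>\<omega>\<close> is a tensor, in other words since derivatives of the Jacobian of a
  coordinate change cancel in the alternation (\<open>alt22_change\<close>); likewise \<open>psi\<close> is a tensor
  (\<open>psi_change\<close>).  Transition maps are only assumed to be once complex differentiable; their
  smoothness is a consequence of Cauchy's formula on complex lines.
\<close>

section \<open>Calculus of smooth functions\<close>

lemma frechet_eq: "(f has_derivative f') (at x) \<Longrightarrow> frechet_derivative f (at x) = f'"
  by (metis frechet_derivative_at)

lemma frechet_cong_open:
  assumes "open S" "x \<in> S" "\<And>y. y \<in> S \<Longrightarrow> f y = g y"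
  shows "frechet_derivative f (at x) = frechet_derivative g (at x)"
proof -
  have "(f has_derivative D) (at x) \<longleftrightarrow> (g has_derivative D) (at x)" for D
    using has_derivative_transform_within_open[of f D x UNIV S g]
          has_derivative_transform_within_open[of g D x UNIV S f] assms by auto
  then show ?thesis by (simp add: frechet_derivative_def)
qed

lemma differentiable_cong_open:
  assumes "open S" "x \<in> S" "\<And>y. y \<in> S \<Longrightarrow> f y = g y" "f differentiable at x"
  shows "g differentiable at x"
  using assms has_derivative_transform_within_open[of f _ x UNIV S g]
  unfolding differentiable_def by blast

lemma has_frechet: "f differentiable at x \<Longrightarrow> (f has_derivative frechet_derivative f (at x)) (at x)"
  by (simp add: frechet_derivative_works)

lemma Ck_on_cong:
  assumes "open S" "\<And>x. x \<in> S \<Longrightarrow> f x = g x" "Ck_on k f S"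
  shows "Ck_on k g S"
  using assms
proof (induction k arbitrary: f g)
  case 0
  then show ?case using continuous_on_cong by force
next
  case (Suc k)
  have "g differentiable_on S"
    using Suc.prems differentiable_cong_open[of S _ f g]
    by (auto simp: differentiable_on_eq_differentiable_at)
  moreover have "Ck_on k (\<lambda>x. frechet_derivative g (at x) v) S" for v
    by (rule Suc.IH[of "\<lambda>x. frechet_derivative f (at x) v"])
       (use Suc.prems frechet_cong_open[of S _ f g] in auto)
  ultimately show ?case by simp
qed

lemma Ck_on_Suc_imp: "open S \<Longrightarrow> Ck_on (Suc k) f S \<Longrightarrow> Ck_on k f S"
proof (induction k arbitrary: f)
  case 0 then show ?case by (simp add: differentiable_imp_continuous_on)
next
  case (Suc k)
  have "f differentiable_on S" using Suc.prems(2) by simp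
  moreover have "Ck_on k (\<lambda>x. frechet_derivative f (at x) v) S" for v
    by (rule Suc.IH[OF Suc.prems(1)]) (use Suc.prems(2) in simp)
  ultimately show ?case by simp
qed

lemma Ck_on_SucI:
  assumes "open S" "\<And>x. x \<in> S \<Longrightarrow> (f has_derivative f' x) (at x)"
    "\<And>v. Ck_on k (\<lambda>x. f' x v) S"
  shows "Ck_on (Suc k) f S"
proof -
  have "f differentiable_on S"
    using assms(1,2) by (auto simp: differentiable_on_eq_differentiable_at differentiable_def)
  moreover have "Ck_on k (\<lambda>x. frechet_derivative f (at x) v) S" for v
    by (rule Ck_on_cong[OF assms(1) _ assms(3)[of v]]) (simp add: frechet_eq[OF assms(2)])
  ultimately show ?thesis by simp
qed

lemma Ck_on_SucD:
  assumes "open S" "Ck_on (Suc k) f S"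
  shows "x \<in> S \<Longrightarrow> (f has_derivative frechet_derivative f (at x)) (at x)"
    "Ck_on k (\<lambda>x. frechet_derivative f (at x) v) S"
  using assms by (auto simp: differentiable_on_eq_differentiable_at has_frechet)

lemma Ck_on_const: "open S \<Longrightarrow> Ck_on k (\<lambda>x. c) S"
proof (induction k arbitrary: c)
  case (Suc k)
  show ?case by (rule Ck_on_SucI[where f'="\<lambda>x v. 0"]) (use Suc in auto)
qed simp

lemma Ck_on_add: "open S \<Longrightarrow> Ck_on k f S \<Longrightarrow> Ck_on k g S \<Longrightarrow> Ck_on k (\<lambda>x. f x + g x) S"
proof (induction k arbitrary: f g)
  case 0 then show ?case by (auto intro: continuous_on_add)
next
  case (Suc k)
  note f = Ck_on_SucD[OF Suc.prems(1,2)] and g = Ck_on_SucD[OF Suc.prems(1,3)]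
  show ?case
    by (rule Ck_on_SucI[OF Suc.prems(1) has_derivative_add[OF f(1) g(1)] Suc.IH[OF Suc.prems(1) f(2) g(2)]])
qed

lemma Ck_on_bounded_linear:
  assumes L: "bounded_linear L"
  shows "open S \<Longrightarrow> Ck_on k f S \<Longrightarrow> Ck_on k (\<lambda>x. L (f x)) S"
proof (induction k arbitrary: f)
  case 0 then show ?case using bounded_linear.continuous_on[OF L] by auto
next
  case (Suc k)
  note f = Ck_on_SucD[OF Suc.prems]
  show ?case
    by (rule Ck_on_SucI[OF Suc.prems(1) bounded_linear.has_derivative[OF L f(1)] Suc.IH[OF Suc.prems(1) f(2)]])
qed

lemma Ck_on_mult:
  fixes f g :: "'a::euclidean_space \<Rightarrow> 'b::real_normed_algebra"
  shows "open S \<Longrightarrow> Ck_on k f S \<Longrightarrow> Ck_on k g S \<Longrightarrow> Ck_on k (\<lambda>x. f x * g x) S"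
proof (induction k arbitrary: f g)
  case 0 then show ?case by (auto intro: continuous_on_mult)
next
  case (Suc k)
  note f = Ck_on_SucD[OF Suc.prems(1,2)] and g = Ck_on_SucD[OF Suc.prems(1,3)]
  note fk = Ck_on_Suc_imp[OF Suc.prems(1,2)] and gk = Ck_on_Suc_imp[OF Suc.prems(1,3)]
  show ?case
    by (rule Ck_on_SucI[OF Suc.prems(1) has_derivative_mult[OF f(1) g(1)]
          Ck_on_add[OF Suc.prems(1) Suc.IH[OF Suc.prems(1) fk g(2)] Suc.IH[OF Suc.prems(1) f(2) gk]]])
qed

text \<open>The derivative of \<open>1 / f\<close> is \<open>- (1 / f)\<^sup>2 f'\<close>, which has one order of regularity less by induction.\<close>

lemma Ck_on_inverse:
  fixes f :: "'a::euclidean_space \<Rightarrow> 'b::real_normed_field"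
  assumes nz: "\<And>x. x \<in> S \<Longrightarrow> f x \<noteq> 0"
  shows "open S \<Longrightarrow> Ck_on k f S \<Longrightarrow> Ck_on k (\<lambda>x. inverse (f x)) S"
proof (induction k)
  case 0 then show ?case using assms by (auto intro: continuous_on_inverse)
next
  case (Suc k)
  note f = Ck_on_SucD[OF Suc.prems] and o = Suc.prems(1)
  note i = Suc.IH[OF o Ck_on_Suc_imp[OF Suc.prems]]
  show ?case
    by (rule Ck_on_SucI[OF o Deriv.has_derivative_inverse[OF nz f(1)]
          Ck_on_bounded_linear[OF bounded_linear_minus[OF bounded_linear_ident] o
            Ck_on_mult[OF o Ck_on_mult[OF o i f(2)] i]]])
qed

lemma Ck_on_sum: "open S \<Longrightarrow> (\<And>i. i \<in> I \<Longrightarrow> Ck_on k (f i) S) \<Longrightarrow> Ck_on k (\<lambda>x. \<Sum>i\<in>I. f i x) S"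
  by (induction I rule: infinite_finite_induct) (auto intro: Ck_on_const Ck_on_add)

lemma Ck_on_prod:
  fixes f :: "'i \<Rightarrow> 'a::euclidean_space \<Rightarrow> 'b::real_normed_field"
  shows "open S \<Longrightarrow> (\<And>i. i \<in> I \<Longrightarrow> Ck_on k (f i) S) \<Longrightarrow> Ck_on k (\<lambda>x. \<Prod>i\<in>I. f i x) S"
  by (induction I rule: infinite_finite_induct) (auto intro: Ck_on_const Ck_on_mult)

lemma smooth_on_cong: "open S \<Longrightarrow> smooth_on f S \<Longrightarrow> (\<And>x. x \<in> S \<Longrightarrow> f x = g x) \<Longrightarrow> smooth_on g S"
  unfolding smooth_on_def using Ck_on_cong by blast

lemma smooth_on_const: "open S \<Longrightarrow> smooth_on (\<lambda>x. c) S"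
  by (simp add: smooth_on_def Ck_on_const)

lemma smooth_on_add: "open S \<Longrightarrow> smooth_on f S \<Longrightarrow> smooth_on g S \<Longrightarrow> smooth_on (\<lambda>x. f x + g x) S"
  by (simp add: smooth_on_def Ck_on_add)

lemma smooth_on_bounded_linear:
  "bounded_linear L \<Longrightarrow> open S \<Longrightarrow> smooth_on f S \<Longrightarrow> smooth_on (\<lambda>x. L (f x)) S"
  by (simp add: smooth_on_def Ck_on_bounded_linear)

lemma smooth_on_mult:
  fixes f g :: "'a::euclidean_space \<Rightarrow> 'b::real_normed_algebra"
  shows "open S \<Longrightarrow> smooth_on f S \<Longrightarrow> smooth_on g S \<Longrightarrow> smooth_on (\<lambda>x. f x * g x) S"
  by (simp add: smooth_on_def Ck_on_mult)

lemma smooth_on_inverse: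
  fixes f :: "'a::euclidean_space \<Rightarrow> 'b::real_normed_field"
  shows "open S \<Longrightarrow> smooth_on f S \<Longrightarrow> (\<And>x. x \<in> S \<Longrightarrow> f x \<noteq> 0) \<Longrightarrow> smooth_on (\<lambda>x. inverse (f x)) S"
  by (simp add: smooth_on_def Ck_on_inverse)

lemma smooth_on_sum: "open S \<Longrightarrow> (\<And>i. i \<in> I \<Longrightarrow> smooth_on (f i) S) \<Longrightarrow> smooth_on (\<lambda>x. \<Sum>i\<in>I. f i x) S"
  by (simp add: smooth_on_def Ck_on_sum)

lemma smooth_on_prod:
  fixes f :: "'i \<Rightarrow> 'a::euclidean_space \<Rightarrow> 'b::real_normed_field"
  shows "open S \<Longrightarrow> (\<And>i. i \<in> I \<Longrightarrow> smooth_on (f i) S) \<Longrightarrow> smooth_on (\<lambda>x. \<Prod>i\<in>I. f i x) S"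
  by (simp add: smooth_on_def Ck_on_prod)

lemma smooth_on_minus: "open S \<Longrightarrow> smooth_on f S \<Longrightarrow> smooth_on (\<lambda>x. - f x) S"
  by (rule smooth_on_bounded_linear[OF bounded_linear_minus[OF bounded_linear_ident]])

lemma smooth_on_diff:
  "open S \<Longrightarrow> smooth_on f S \<Longrightarrow> smooth_on g S \<Longrightarrow> smooth_on (\<lambda>x. f x - g x) S"
  using smooth_on_add[of S f "\<lambda>x. - g x"] smooth_on_minus[of S g] by simp

lemma smooth_on_cnj: "open S \<Longrightarrow> smooth_on f S \<Longrightarrow> smooth_on (\<lambda>x. cnj (f x)) S"
  by (rule smooth_on_bounded_linear[OF bounded_linear_cnj])

lemma smooth_on_of_real: "open S \<Longrightarrow> smooth_on f S \<Longrightarrow> smooth_on (\<lambda>x. complex_of_real (f x)) S"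
  by (rule smooth_on_bounded_linear[OF bounded_linear_of_real])

lemma smooth_on_frechet: "smooth_on f S \<Longrightarrow> smooth_on (\<lambda>x. frechet_derivative f (at x) v) S"
  unfolding smooth_on_def using Ck_on.simps(2) by blast

lemma smooth_on_differentiable: "open S \<Longrightarrow> smooth_on f S \<Longrightarrow> x \<in> S \<Longrightarrow> f differentiable at x"
  unfolding smooth_on_def using Ck_on.simps(2) differentiable_on_eq_differentiable_at by blast

lemma smooth_on_continuous: "smooth_on f S \<Longrightarrow> continuous_on S f"
  unfolding smooth_on_def using Ck_on.simps(1) by blast

lemma smooth_on_cderiv: "open S \<Longrightarrow> smooth_on f S \<Longrightarrow> smooth_on (cderiv Z f) S"
  unfolding cderiv_def
  by (intro smooth_on_add smooth_on_mult smooth_on_const smooth_on_frechet)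

lemma has_vector_derivative_line:
  assumes "(g has_derivative g') (at (p + r *\<^sub>R w))"
  shows "((\<lambda>r. g (p + r *\<^sub>R w)) has_vector_derivative g' w) (at r within T)"
proof -
  have "((\<lambda>r. p + r *\<^sub>R w) has_derivative (\<lambda>h. h *\<^sub>R w)) (at r within T)"
    by (auto intro!: derivative_eq_intros)
  then have "((\<lambda>r. g (p + r *\<^sub>R w)) has_derivative (\<lambda>h. g' (h *\<^sub>R w))) (at r within T)"
    using assms by (rule has_derivative_compose)
  then show ?thesis
    using has_derivative_linear[OF assms] by (simp add: has_vector_derivative_def linear_cmul)
qed

text \<open>Symmetry of second derivatives.  Integrate \<open>\<partial>\<^sub>v f\<close> along \<open>v\<close>, differentiate under the integral in the direction \<open>u\<close>, and
  differentiate the result along \<open>v\<close> again.\<close>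

lemma frechet_derivative_commute:
  fixes f :: "'a::euclidean_space \<Rightarrow> complex"
  assumes S: "open S" "x \<in> S" and C2: "Ck_on 2 f S"
  shows "frechet_derivative (\<lambda>y. frechet_derivative f (at y) u) (at x) v =
    frechet_derivative (\<lambda>y. frechet_derivative f (at y) v) (at x) u"
proof -
  define D where "D w y = frechet_derivative f (at y) w" for w y
  define DD where "DD w z y = frechet_derivative (D w) (at y) z" for w z y
  have C2': "Ck_on (Suc (Suc 0)) f S" using C2 by (simp only: numeral_2_eq_2)
  have df: "(f has_derivative (\<lambda>w. D w y)) (at y)" if "y \<in> S" for y
    using Ck_on_SucD(1)[OF S(1) C2' that] by (simp add: D_def[abs_def])
  have dD: "(D w has_derivative (\<lambda>z. DD w z y)) (at y)" if "y \<in> S" for y w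
    using Ck_on_SucD(1)[OF S(1) Ck_on_SucD(2)[OF S(1) C2'] that, of w]
    by (simp add: DD_def[abs_def] D_def[abs_def])
  have cDD: "continuous_on S (DD w z)" for w z
    using Ck_on_SucD(2)[OF S(1) Ck_on_SucD(2)[OF S(1) C2'], of w z]
    by (simp add: DD_def[abs_def] D_def[abs_def])
  have cD: "continuous_on S (D w)" for w
    using dD has_derivative_continuous by (fastforce intro: continuous_at_imp_continuous_on)
  obtain r where r: "r > 0" "cball x r \<subseteq> S" using S open_contains_cball by blast
  \<comment> \<open>The step \<open>e\<close> is so small that \<open>x + s u + t v\<close> stays in \<open>S\<close> for \<open>s\<close> and \<open>t\<close> of modulus at most \<open>e\<close>.\<close>
  define N where "N = 1 + norm u + norm v"
  have N: "N > 0" unfolding N_def using norm_ge_zero[of u] norm_ge_zero[of v] by linarith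
  define e where "e = r / (2 * N)"
  have e: "e > 0" using r N by (simp add: e_def)
  have inS: "x + s *\<^sub>R u + t *\<^sub>R v \<in> S" if "\<bar>s\<bar> \<le> e" "\<bar>t\<bar> \<le> e" for s t
  proof -
    have "norm (s *\<^sub>R u + t *\<^sub>R v) \<le> e * norm u + e * norm v"
      by (rule order_trans[OF norm_triangle_ineq]) (use that in \<open>auto intro!: add_mono mult_right_mono\<close>)
    also have "\<dots> \<le> e * N" using e by (simp add: N_def algebra_simps)
    also have "\<dots> = r / 2" using N by (simp add: e_def)
    also have "\<dots> \<le> r" using r by simp
    finally have "dist x (x + (s *\<^sub>R u + t *\<^sub>R v)) \<le> r"
      by (metis add_diff_cancel_left' dist_commute dist_norm)
    then show ?thesis using r(2) by (auto simp: add.assoc)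
  qed
  let ?U = "{-e<..<e}"
  have line: "((\<lambda>t. f (x + s *\<^sub>R u + t *\<^sub>R v)) has_vector_derivative D v (x + s *\<^sub>R u + t *\<^sub>R v)) (at t within T)"
    if "\<bar>s\<bar> \<le> e" "\<bar>t\<bar> \<le> e" for s t T
    using has_vector_derivative_line[OF df[OF inS[OF that]]] .
  have lineu: "((\<lambda>s. g (x + s *\<^sub>R u + t *\<^sub>R v)) has_vector_derivative g' (x + s *\<^sub>R u + t *\<^sub>R v) u) (at s within T)"
    if "\<bar>s\<bar> \<le> e" "\<bar>t\<bar> \<le> e" "\<And>y. y \<in> S \<Longrightarrow> (g has_derivative g' y) (at y)" for s t T g and g' :: "'a \<Rightarrow> 'a \<Rightarrow> complex"
  proof -
    have eq: "x + s *\<^sub>R u + t *\<^sub>R v = (x + t *\<^sub>R v) + s *\<^sub>R u" for s by simp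
    show ?thesis
      unfolding eq by (rule has_vector_derivative_line) (use that(3)[OF inS[OF that(1,2)]] in \<open>simp only: eq\<close>)
  qed
  have ftc: "integral {0..t} (\<lambda>\<tau>. D v (x + s *\<^sub>R u + \<tau> *\<^sub>R v)) = f (x + s *\<^sub>R u + t *\<^sub>R v) - f (x + s *\<^sub>R u)"
    if "\<bar>s\<bar> \<le> e" "0 \<le> t" "t \<le> e" for s t
    using fundamental_theorem_of_calculus[of 0 t "\<lambda>t. f (x + s *\<^sub>R u + t *\<^sub>R v)" "\<lambda>t. D v (x + s *\<^sub>R u + t *\<^sub>R v)"]
      line that by (auto intro!: integral_unique)
  have contDD: "continuous_on (?U \<times> cbox 0 t) (\<lambda>(s, \<tau>). DD v u (x + s *\<^sub>R u + \<tau> *\<^sub>R v))"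
    if "t \<le> e" for t :: real
    unfolding split_beta
    by (rule continuous_on_compose2[OF cDD]) (use that inS in \<open>auto intro!: continuous_intros\<close>)
  have key: "integral {0..t} (\<lambda>\<tau>. DD v u (x + \<tau> *\<^sub>R v)) = D u (x + t *\<^sub>R v) - D u x"
    if t: "0 \<le> t" "t \<le> e" for t
  proof -
    have "((\<lambda>s. integral (cbox 0 t) (\<lambda>\<tau>. D v (x + s *\<^sub>R u + \<tau> *\<^sub>R v))) has_vector_derivative
        integral (cbox 0 t) (\<lambda>\<tau>. DD v u (x + 0 *\<^sub>R u + \<tau> *\<^sub>R v))) (at 0 within ?U)"
    proof (rule leibniz_rule_vector_derivative[where fx="\<lambda>s \<tau>. DD v u (x + s *\<^sub>R u + \<tau> *\<^sub>R v)"])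
      show "((\<lambda>s. D v (x + s *\<^sub>R u + \<tau> *\<^sub>R v)) has_vector_derivative DD v u (x + s *\<^sub>R u + \<tau> *\<^sub>R v)) (at s within ?U)"
        if "s \<in> ?U" "\<tau> \<in> cbox 0 t" for s \<tau>
        by (rule lineu[where g'="\<lambda>y z. DD v z y"]) (use that t dD in auto)
      show "(\<lambda>\<tau>. D v (x + s *\<^sub>R u + \<tau> *\<^sub>R v)) integrable_on cbox 0 t" if "s \<in> ?U" for s
        by (rule integrable_continuous, rule continuous_on_compose2[OF cD])
           (use that t inS in \<open>auto intro!: continuous_intros\<close>)
    qed (use contDD t e in auto)
    moreover have "((\<lambda>s. f (x + s *\<^sub>R u + t *\<^sub>R v) - f (x + s *\<^sub>R u)) has_vector_derivative
        (D u (x + 0 *\<^sub>R u + t *\<^sub>R v) - D u (x + 0 *\<^sub>R u + 0 *\<^sub>R v))) (at 0 within ?U)"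
      using has_vector_derivative_diff[OF lineu[of 0 t f "\<lambda>y z. D z y" ?U] lineu[of 0 0 f "\<lambda>y z. D z y" ?U]] df e t by simp
    then have "((\<lambda>s. integral (cbox 0 t) (\<lambda>\<tau>. D v (x + s *\<^sub>R u + \<tau> *\<^sub>R v))) has_vector_derivative
        (D u (x + 0 *\<^sub>R u + t *\<^sub>R v) - D u (x + 0 *\<^sub>R u + 0 *\<^sub>R v))) (at 0 within ?U)"
      by (rule has_vector_derivative_transform[rotated 2]) (use ftc t e in auto)
    ultimately have "integral (cbox 0 t) (\<lambda>\<tau>. DD v u (x + 0 *\<^sub>R u + \<tau> *\<^sub>R v)) =
        D u (x + 0 *\<^sub>R u + t *\<^sub>R v) - D u (x + 0 *\<^sub>R u + 0 *\<^sub>R v)"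
      using vector_derivative_unique_within[of 0 ?U] e
      by (metis (no_types, lifting) at_within_open greaterThanLessThan_iff neg_less_0_iff_less open_greaterThanLessThan trivial_limit_at)
    then show ?thesis by simp
  qed
  have "((\<lambda>t. integral {0..t} (\<lambda>\<tau>. DD v u (x + \<tau> *\<^sub>R v))) has_vector_derivative DD v u (x + 0 *\<^sub>R v)) (at 0 within {0..e})"
    by (rule integral_has_vector_derivative, rule continuous_on_compose2[OF cDD])
       (use inS[of 0] e in \<open>auto intro!: continuous_intros\<close>)
  then have 1: "((\<lambda>t. D u (x + t *\<^sub>R v) - D u x) has_vector_derivative DD v u x) (at 0 within {0..e})"
    by (auto intro: has_vector_derivative_transform[rotated 2] simp: key e less_imp_le)
  have "((\<lambda>t. D u (x + t *\<^sub>R v)) has_vector_derivative DD u v x) (at 0 within {0..e})"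
    by (rule has_vector_derivative_line) (use dD[OF S(2)] in simp)
  then have "((\<lambda>t. D u (x + t *\<^sub>R v) - D u x) has_vector_derivative DD u v x) (at 0 within {0..e})"
    by (auto intro: derivative_eq_intros)
  then have "DD v u x = DD u v x"
    using 1 vector_derivative_unique_within_closed_interval[of 0 e 0] e
    by (metis atLeastAtMost_iff box_real(2) less_imp_le order_refl)
  then show ?thesis by (simp add: DD_def D_def[abs_def])
qed

section \<open>Linear algebra of the complexified tangent space\<close>

text \<open>The covector conjugate to \<open>dz\<^sup>s\<close>.\<close>

definition zbcoeff :: "'n cvec \<Rightarrow> 'n::finite \<Rightarrow> complex" where
  "zbcoeff Z s = cnj (fst Z $ s) + \<i> * cnj (snd Z $ s)"

text \<open>Complex linearity on \<open>'n cvec\<close>, where multiplication by \<open>\<i>\<close> is \<open>(X, Y) \<mapsto> (- Y, X)\<close>.\<close>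

definition clin :: "('n::finite cvec \<Rightarrow> complex) \<Rightarrow> bool" where
  "clin F \<longleftrightarrow> linear F \<and> (\<forall>X Y. F (- Y, X) = \<i> * F (X, Y))"

text \<open>The complex linear extension of a real linear functional.\<close>

definition cext :: "(complex^'n \<Rightarrow> complex) \<Rightarrow> 'n::finite cvec \<Rightarrow> complex" where
  "cext L Z = L (fst Z) + \<i> * L (snd Z)"

lemma clin_cext: assumes L: "linear L" shows "clin (cext L)"
proof -
  have "linear (cext L)"
    by (rule linearI)
       (simp_all add: cext_def linear_add[OF L] linear_scale[OF L] distrib_left scaleR_right_distrib)
  moreover have "cext L (- Y, X) = \<i> * cext L (X, Y)" for X Y
    by (simp add: cext_def linear_neg[OF L] distrib_left mult.assoc[symmetric])
  ultimately show ?thesis by (simp add: clin_def)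
qed

lemma cderiv_cext: "cderiv Z f x = cext (frechet_derivative f (at x)) Z"
  by (simp add: cderiv_def cext_def)

lemma zcoeff_dz [simp]: "zcoeff (dz i) k = (if i = k then 1 else 0)"
  by (auto simp: zcoeff_def dz_def axis_def complex_eq_iff)

lemma zcoeff_dzb [simp]: "zcoeff (dzb i) k = 0"
  by (auto simp: zcoeff_def dzb_def axis_def complex_eq_iff)

lemma zbcoeff_dz [simp]: "zbcoeff (dz i) k = 0"
  by (auto simp: zbcoeff_def dz_def axis_def complex_eq_iff)

lemma zbcoeff_dzb [simp]: "zbcoeff (dzb i) k = (if i = k then 1 else 0)"
  by (auto simp: zbcoeff_def dzb_def axis_def complex_eq_iff)

lemma zcoeff_real [simp]: "zcoeff (v, 0) k = v $ k" and zbcoeff_real [simp]: "zbcoeff (v, 0) k = cnj (v $ k)"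
  by (simp_all add: zcoeff_def zbcoeff_def)

text \<open>Scalar multiplication under the identification of \<open>(X, Y)\<close> with \<open>X + \<i> Y\<close>.\<close>

definition csc :: "complex \<Rightarrow> 'n::finite cvec \<Rightarrow> 'n cvec" where
  "csc a Z = Re a *\<^sub>R Z + Im a *\<^sub>R (- snd Z, fst Z)"

lemma clin_csc: assumes "clin F" shows "F (csc a Z) = a * F Z"
proof -
  have l: "linear F" and i: "F (- snd Z, fst Z) = \<i> * F Z" using assms by (auto simp: clin_def)
  have "F (csc a Z) = Re a *\<^sub>R F Z + Im a *\<^sub>R (\<i> * F Z)"
    unfolding csc_def by (simp only: linear_add[OF l] linear_cmul[OF l] i)
  then show ?thesis by (simp add: complex_eq_iff)
qed

lemma cvec_decomp: "Z = (\<Sum>k\<in>UNIV. csc (zcoeff Z k) (dz k) + csc (zbcoeff Z k) (dzb k))"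
proof (rule prod_eqI)
  show "fst Z = fst (\<Sum>k\<in>UNIV. csc (zcoeff Z k) (dz k) + csc (zbcoeff Z k) (dzb k))"
    by (auto simp: vec_eq_iff fst_sum csc_def dz_def dzb_def axis_def zcoeff_def zbcoeff_def
      complex_eq_iff if_distrib sum.delta cong: if_cong)
       (simp_all add: field_simps)
  show "snd Z = snd (\<Sum>k\<in>UNIV. csc (zcoeff Z k) (dz k) + csc (zbcoeff Z k) (dzb k))"
    by (auto simp: vec_eq_iff snd_sum csc_def dz_def dzb_def axis_def zcoeff_def zbcoeff_def
      complex_eq_iff if_distrib sum.delta cong: if_cong)
       (simp_all add: field_simps)
qed

lemma clin_expand:
  assumes "clin F"
  shows "F Z = (\<Sum>k\<in>UNIV. zcoeff Z k * F (dz k) + zbcoeff Z k * F (dzb k))"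
proof -
  have l: "linear F" using assms by (auto simp: clin_def)
  have "F Z = F (\<Sum>k\<in>UNIV. csc (zcoeff Z k) (dz k) + csc (zbcoeff Z k) (dzb k))"
    using arg_cong[OF cvec_decomp[of Z], of F] .
  also have "\<dots> = (\<Sum>k\<in>UNIV. F (csc (zcoeff Z k) (dz k)) + F (csc (zbcoeff Z k) (dzb k)))"
    by (simp only: linear_sum[OF l] linear_add[OF l])
  finally show ?thesis by (simp only: clin_csc[OF assms])
qed

lemma real_linear_expand:
  assumes "linear L"
  shows "L v = (\<Sum>k\<in>UNIV. v $ k * cext L (dz k) + cnj (v $ k) * cext L (dzb k))"
  using clin_expand[OF clin_cext[OF assms], of "(v, 0)"] linear_0[OF assms]
  by (simp add: cext_def[of L "(v, 0)"])

definition conjv :: "'n cvec \<Rightarrow> 'n::finite cvec" where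
  "conjv Z = (fst Z, - snd Z)"

lemma conjv_dz [simp]: "conjv (dz i) = dzb i" and conjv_dzb [simp]: "conjv (dzb i) = dz i"
  and conjv_real [simp]: "conjv (v, 0) = (v, 0)"
  by (simp_all add: conjv_def dz_def dzb_def)

definition hermitian_form :: "(complex^'n \<Rightarrow> complex^'n \<Rightarrow> real) \<Rightarrow> bool" where
  "hermitian_form B \<longleftrightarrow> bilinear B \<and> (\<forall>v w. B v w = B w v) \<and> (\<forall>v. v \<noteq> 0 \<longrightarrow> B v v > 0) \<and>
     (\<forall>v w. B (\<i> *s v) (\<i> *s w) = B v w)"

definition hermitian_at :: "('m, 'n) metric \<Rightarrow> ('m, 'n::finite) chart \<Rightarrow> complex^'n \<Rightarrow> bool" where
  "hermitian_at g c x \<longleftrightarrow> hermitian_form (g c x)"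

lemma delta_mult [simp]: "a * (if P then 1 else 0) = (if P then a else (0::complex))"
  "(if P then 1 else 0) * a = (if P then a else (0::complex))"
  by auto

lemma gC_sym: "hermitian_at g c x \<Longrightarrow> gC g c x Z W = gC g c x W Z"
  unfolding gC_def hermitian_at_def hermitian_form_def by (metis add.commute)

lemma clin_gC:
  assumes "hermitian_at g c x" shows "clin (\<lambda>Z. gC g c x Z W)"
proof -
  have b: "bilinear (g c x)" using assms by (simp add: hermitian_at_def hermitian_form_def)
  show ?thesis unfolding clin_def gC_def
    by (auto intro!: linearI simp: complex_eq_iff bilinear_ladd[OF b] bilinear_lmul[OF b] bilinear_lneg[OF b] algebra_simps)
qed

lemma clin_gC2:
  assumes "hermitian_at g c x" shows "clin (gC g c x Z)"
  using clin_gC[OF assms, of Z] by (simp add: gC_sym[OF assms, of _ Z])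

lemma gC_real: "hermitian_at g c x \<Longrightarrow> gC g c x (v, 0) (w, 0) = g c x v w"
  by (simp add: hermitian_at_def hermitian_form_def gC_def bilinear_lzero bilinear_rzero complex_eq_iff)

lemma cnj_gC: "hermitian_at g c x \<Longrightarrow> cnj (gC g c x Z W) = gC g c x (conjv Z) (conjv W)"
  by (simp add: hermitian_at_def hermitian_form_def gC_def conjv_def bilinear_lneg bilinear_rneg complex_eq_iff)

lemma axis_i: "\<i> *s axis k 1 = (axis k \<i> :: complex^'n)" "\<i> *s axis k \<i> = (- axis k 1 :: complex^'n)"
  by (auto simp: vec_eq_iff axis_def)

context
  fixes g :: "('m, 'n::finite) metric" and c x
  assumes hf: "hermitian_at g c x"
begin

lemma hf_bil: "bilinear (g c x)" and hf_sym: "g c x v w = g c x w v"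
  and hf_pos: "v \<noteq> 0 \<Longrightarrow> g c x v v > 0"
  and hf_J: "g c x (\<i> *s v) (\<i> *s w) = g c x v w"
  using hf unfolding hermitian_at_def hermitian_form_def by blast+

text \<open>Since \<open>\<partial>/\<partial>z\<close> is an eigenvector of \<open>J\<close> for the eigenvalue \<open>\<i>\<close> and \<open>g\<close> is \<open>J\<close>-invariant, the value equals
  its own negative.\<close>

lemma gC_dz_dz [simp]: "gC g c x (dz i) (dz j) = 0"
proof -
  have 1: "g c x (axis i \<i>) (axis j \<i>) = g c x (axis i 1) (axis j 1)"
    using hf_J[of "axis i 1" "axis j 1"] by (simp add: axis_i)
  have 2: "g c x (axis i \<i>) (axis j 1) = - g c x (axis i 1) (axis j \<i>)"
    using hf_J[of "axis i 1" "axis j \<i>"] by (simp add: axis_i bilinear_rneg[OF hf_bil])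
  show ?thesis
    by (simp add: gC_def dz_def complex_eq_iff bilinear_lmul[OF hf_bil] bilinear_rmul[OF hf_bil]
      bilinear_lneg[OF hf_bil] bilinear_rneg[OF hf_bil] 1 2)
qed

lemma cnj_herm: "cnj (herm g c x i j) = herm g c x j i"
  unfolding herm_def cnj_gC[OF hf] by (simp add: gC_sym[OF hf])

lemma gC_dzb_dzb [simp]: "gC g c x (dzb i) (dzb j) = 0"
  using cnj_gC[OF hf, of "dz i" "dz j"] by simp

lemma gC_dz_dzb: "gC g c x (dz i) (dzb j) = herm g c x i j" "gC g c x (dzb j) (dz i) = herm g c x i j"
  by (simp_all add: herm_def gC_sym[OF hf])

lemma gC_dzb: "gC g c x Z (dzb l) = (\<Sum>k\<in>UNIV. zcoeff Z k * herm g c x k l)"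
  by (subst clin_expand[OF clin_gC[OF hf]]) (simp add: gC_dz_dzb)

lemma gC_dz: "gC g c x Z (dz k) = (\<Sum>l\<in>UNIV. zbcoeff Z l * herm g c x k l)"
  by (subst clin_expand[OF clin_gC[OF hf]]) (simp add: gC_dz_dzb)

lemma gC_coeffs: "gC g c x Z W = (\<Sum>k\<in>UNIV. zcoeff Z k * gC g c x W (dz k) + zbcoeff Z k * gC g c x W (dzb k))"
  by (subst clin_expand[OF clin_gC[OF hf]]) (simp add: gC_sym[OF hf, of W])

text \<open>A real vector is the sum of its (1,0)-part and the conjugate of that part, and both parts are
  isotropic, so only the two mixed terms remain; they are equal.\<close>

lemma herm_pos:
  "complex_of_real (g c x v v) = 2 * (\<Sum>k\<in>UNIV. \<Sum>l\<in>UNIV. v $ k * cnj (v $ l) * herm g c x k l)"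
proof -
  have "complex_of_real (g c x v v) = gC g c x (v, 0) (v, 0)" by (simp add: gC_real[OF hf])
  also have "\<dots> = (\<Sum>k\<in>UNIV. v $ k * (\<Sum>l\<in>UNIV. cnj (v $ l) * herm g c x k l)) +
      (\<Sum>k\<in>UNIV. cnj (v $ k) * (\<Sum>l\<in>UNIV. v $ l * herm g c x l k))"
    by (subst gC_coeffs) (simp add: gC_dz gC_dzb sum.distrib)
  also have "(\<Sum>k\<in>UNIV. cnj (v $ k) * (\<Sum>l\<in>UNIV. v $ l * herm g c x l k)) =
      (\<Sum>k\<in>UNIV. v $ k * (\<Sum>l\<in>UNIV. cnj (v $ l) * herm g c x k l))"
    unfolding sum_distrib_left by (subst sum.swap) (simp add: mult_ac)
  finally show ?thesis by (simp add: sum_distrib_left mult_ac)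
qed

text \<open>A vector in the kernel would have length 0 by the previous formula.\<close>

lemma herm_invertible: "invertible (\<chi> l k. herm g c x k l)"
proof -
  have "w = 0" if "(\<chi> l k. herm g c x k l) *v w = 0" for w
  proof (rule ccontr)
    assume "w \<noteq> 0"
    have z: "(\<Sum>k\<in>UNIV. herm g c x k l * w $ k) = 0" for l
      using that by (simp add: vec_eq_iff matrix_vector_mult_def)
    have "complex_of_real (g c x w w) = 2 * (\<Sum>l\<in>UNIV. cnj (w $ l) * (\<Sum>k\<in>UNIV. herm g c x k l * w $ k))"
      unfolding herm_pos sum_distrib_left by (subst sum.swap) (simp add: mult_ac)
    then have "g c x w w = 0" by (simp add: z)
    then show False using hf_pos[OF \<open>w \<noteq> 0\<close>] by simp
  qed
  then show ?thesis
    using matrix_left_invertible_ker[of "\<chi> l k. herm g c x k l"] invertible_left_inverse by blast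
qed

lemma matrix_inv_herm:
  "matrix_inv (\<chi> l k. herm g c x k l) ** (\<chi> l k. herm g c x k l) = mat 1"
  "(\<chi> l k. herm g c x k l) ** matrix_inv (\<chi> l k. herm g c x k l) = mat 1"
  using someI_ex[OF herm_invertible[unfolded invertible_def]] by (auto simp: matrix_inv_def)

lemma hinv_herm: "(\<Sum>l\<in>UNIV. hinv g c x i l * herm g c x k l) = (if i = k then 1 else 0)"
proof -
  have "(matrix_inv (\<chi> l k. herm g c x k l) ** (\<chi> l k. herm g c x k l)) $ i $ k = mat 1 $ i $ k"
    by (simp only: matrix_inv_herm)
  then show ?thesis by (simp add: matrix_matrix_mult_def hinv_def mat_def)
qed

lemma herm_hinv: "(\<Sum>k\<in>UNIV. hinv g c x k m * herm g c x k l) = (if l = m then 1 else 0)"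
proof -
  have "((\<chi> l k. herm g c x k l) ** matrix_inv (\<chi> l k. herm g c x k l)) $ l $ m = mat 1 $ l $ m"
    by (simp only: matrix_inv_herm)
  then show ?thesis by (simp add: matrix_matrix_mult_def hinv_def mat_def mult.commute)
qed

lemma hinv_unique:
  assumes "\<And>i k. (\<Sum>l\<in>UNIV. P i l * herm g c x k l) = (if i = k then 1 else 0)"
  shows "P i m = hinv g c x i m"
proof -
  have "P i m = (\<Sum>l\<in>UNIV. P i l * (\<Sum>k\<in>UNIV. hinv g c x k m * herm g c x k l))"
    by (simp add: herm_hinv)
  also have "\<dots> = (\<Sum>k\<in>UNIV. hinv g c x k m * (\<Sum>l\<in>UNIV. P i l * herm g c x k l))"
    unfolding sum_distrib_left by (subst sum.swap) (simp add: mult_ac)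
  also have "\<dots> = hinv g c x i m" by (simp add: assms)
  finally show ?thesis .
qed

lemma cnj_hinv: "cnj (hinv g c x i j) = hinv g c x j i"
proof -
  have "(\<Sum>l\<in>UNIV. cnj (hinv g c x l i) * herm g c x k l) = (if i = k then 1 else 0)" for i k
    using arg_cong[OF herm_hinv[of i k], of cnj] by (auto simp: cnj_herm split: if_splits)
  then have "cnj (hinv g c x j i) = hinv g c x i j"
    by (rule hinv_unique[of "\<lambda>i l. cnj (hinv g c x l i)"])
  then show ?thesis by (metis complex_cnj_cnj)
qed

lemma zcoeff_gC: "zcoeff Z p = (\<Sum>q\<in>UNIV. hinv g c x p q * gC g c x Z (dzb q))"
proof -
  have "(\<Sum>q\<in>UNIV. hinv g c x p q * gC g c x Z (dzb q)) =
     (\<Sum>k\<in>UNIV. zcoeff Z k * (\<Sum>q\<in>UNIV. hinv g c x p q * herm g c x k q))"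
    unfolding gC_dzb sum_distrib_left by (subst sum.swap) (simp add: mult_ac)
  then show ?thesis by (simp add: hinv_herm)
qed

lemma zbcoeff_gC: "zbcoeff Z q = (\<Sum>p\<in>UNIV. hinv g c x p q * gC g c x Z (dz p))"
proof -
  have "(\<Sum>p\<in>UNIV. hinv g c x p q * gC g c x Z (dz p)) =
     (\<Sum>l\<in>UNIV. zbcoeff Z l * (\<Sum>p\<in>UNIV. hinv g c x p q * herm g c x p l))"
    unfolding gC_dz sum_distrib_left by (subst sum.swap) (simp add: mult_ac)
  then show ?thesis by (simp add: herm_hinv)
qed

lemma gC_hinv: "gC g c x V W = (\<Sum>p\<in>UNIV. \<Sum>q\<in>UNIV. hinv g c x p q *
    (gC g c x V (dzb q) * gC g c x W (dz p) + gC g c x V (dz p) * gC g c x W (dzb q)))"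
proof -
  have "gC g c x V W = (\<Sum>p\<in>UNIV. (\<Sum>q\<in>UNIV. hinv g c x p q * gC g c x V (dzb q)) * gC g c x W (dz p)) +
    (\<Sum>q\<in>UNIV. (\<Sum>p\<in>UNIV. hinv g c x p q * gC g c x V (dz p)) * gC g c x W (dzb q))"
    by (subst gC_coeffs) (simp only: sum.distrib zcoeff_gC[of V] zbcoeff_gC[of V])
  also have "(\<Sum>q\<in>UNIV. (\<Sum>p\<in>UNIV. hinv g c x p q * gC g c x V (dz p)) * gC g c x W (dzb q)) =
     (\<Sum>p\<in>UNIV. \<Sum>q\<in>UNIV. hinv g c x p q * gC g c x V (dz p) * gC g c x W (dzb q))"
    unfolding sum_distrib_right by (rule sum.swap)
  finally have "gC g c x V W =
      (\<Sum>p\<in>UNIV. \<Sum>q\<in>UNIV. hinv g c x p q * gC g c x V (dzb q) * gC g c x W (dz p)) +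
      (\<Sum>p\<in>UNIV. \<Sum>q\<in>UNIV. hinv g c x p q * gC g c x V (dz p) * gC g c x W (dzb q))"
    by (simp only: sum_distrib_right)
  then show ?thesis by (simp only: sum.distrib[symmetric] distrib_left mult.assoc)
qed

subsection \<open>Orthonormal bases\<close>

text \<open>Orthonormal sets, from which a basis is built one vector at a time.\<close>

definition "onset E \<longleftrightarrow> finite E \<and> (\<forall>u\<in>E. \<forall>v\<in>E. g c x u v = (if u = v then 1 else 0))"

lemma onset_inner: "onset E \<Longrightarrow> u \<in> E \<Longrightarrow> g c x (\<Sum>e\<in>E. a e *\<^sub>R e) u = a u"
proof -
  assume E: "onset E" "u \<in> E"
  have f: "finite E" using E by (simp add: onset_def)
  have l: "linear (\<lambda>v. g c x v u)" using hf_bil by (simp add: bilinear_def)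
  have "g c x (\<Sum>e\<in>E. a e *\<^sub>R e) u = (\<Sum>e\<in>E. a e * g c x e u)"
    by (simp add: linear_sum[OF l] linear_cmul[OF l])
  also have "\<dots> = (\<Sum>e\<in>E. if e = u then a e else 0)"
    using E by (intro sum.cong) (auto simp: onset_def)
  also have "\<dots> = a u" using f E by simp
  finally show ?thesis .
qed

lemma onset_independent: "onset E \<Longrightarrow> independent E"
proof -
  assume E: "onset E"
  then have f: "finite E" by (simp add: onset_def)
  show ?thesis
    unfolding independent_explicit_finite_subsets
  proof (intro allI impI ballI)
    fix A u a assume A: "A \<subseteq> E" "finite A" "(\<Sum>v\<in>A. u v *\<^sub>R v) = 0" "a \<in> A"
    have "onset A" using E A f unfolding onset_def by (meson finite_subset subsetD)
    from onset_inner[OF this A(4), of u] A(3) show "u a = 0"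
      by (simp add: bilinear_lzero[OF hf_bil])
  qed
qed

text \<open>Gram-Schmidt: as long as an orthonormal set does not span, a vector outside of its span can be
  made orthogonal to it and normalised.\<close>

lemma ex_orthonormal_basis: "\<exists>E. orthonormal_basis g c x E"
proof -
  have "\<exists>E. onset E \<and> card E = k" if "k \<le> 2 * CARD('n)" for k
    using that
  proof (induction k)
    case 0 show ?case by (rule exI[of _ "{}"]) (simp add: onset_def)
  next
    case (Suc k)
    then obtain E where E: "onset E" "card E = k" by auto
    have f: "finite E" using E by (simp add: onset_def)
    have "span E \<noteq> UNIV"
    proof
      assume "span E = UNIV"
      then have "dim E = DIM(complex^'n)" by (metis dim_UNIV dim_span)
      moreover have "dim E \<le> card E" using dim_le_card'[OF f] .
      ultimately show False using Suc.prems E by simp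
    qed
    then obtain v where v: "v \<notin> span E" by auto
    define w where "w = v - (\<Sum>e\<in>E. g c x v e *\<^sub>R e)"
    have "w \<noteq> 0"
    proof
      assume "w = 0"
      then have "v = (\<Sum>e\<in>E. g c x v e *\<^sub>R e)" by (simp add: w_def)
      moreover have "(\<Sum>e\<in>E. g c x v e *\<^sub>R e) \<in> span E"
        by (intro span_sum span_scale span_base)
      ultimately show False using v by simp
    qed
    then have wp: "g c x w w > 0" by (rule hf_pos)
    define n where "n = (1 / sqrt (g c x w w)) *\<^sub>R w"
    have wE: "g c x w e = 0" if "e \<in> E" for e
      using onset_inner[OF E(1) that, of "g c x v"] by (simp add: w_def bilinear_lsub[OF hf_bil])
    have nE1: "g c x n e = 0" if "e \<in> E" for e
      using wE[OF that] by (simp add: n_def bilinear_lmul[OF hf_bil])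
    have nE2: "g c x e n = 0" if "e \<in> E" for e
      using nE1[OF that] by (subst hf_sym)
    note nE = nE1 nE2
    have nn: "g c x n n = 1"
      using wp by (simp add: n_def bilinear_lmul[OF hf_bil] bilinear_rmul[OF hf_bil])
    have "n \<notin> E" using nE nn by force
    then have "onset (insert n E)" "card (insert n E) = Suc k"
      using E nE nn f by (auto simp: onset_def)
    then show ?case by blast
  qed
  then obtain E where "onset E" "card E = 2 * CARD('n)" by auto
  then show ?thesis by (auto simp: orthonormal_basis_def onset_def)
qed

lemma orthonormal_basis_expand:
  assumes E: "orthonormal_basis g c x E"
  shows "v = (\<Sum>e\<in>E. g c x v e *\<^sub>R e)"
proof -
  have c: "card E = 2 * CARD('n)" using E by (simp add: orthonormal_basis_def)
  then have f: "finite E" by (metis card_ge_0_finite zero_less_card_finite nat_0_less_mult_iff zero_less_numeral)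
  then have o: "onset E" using E by (simp add: orthonormal_basis_def onset_def)
  define w where "w = v - (\<Sum>e\<in>E. g c x v e *\<^sub>R e)"
  have wE: "g c x w e = 0" if "e \<in> E" for e
    using onset_inner[OF o that, of "g c x v"] by (simp add: w_def bilinear_lsub[OF hf_bil])
  have "E \<subseteq> span E" by (rule span_superset)
  have "w = 0"
  proof (rule ccontr)
    assume "w \<noteq> 0"
    then have wp: "g c x w w > 0" by (rule hf_pos)
    have "w \<in> span E"
      using card_ge_dim_independent[of E UNIV] onset_independent[OF o] c by auto
    moreover have "g c x w u = 0" if "u \<in> span E" for u
      using that
    proof (induction rule: span_induct_alt)
      case base show ?case by (simp add: bilinear_rzero[OF hf_bil])
    next
      case (step a u z) then show ?case
        by (simp add: bilinear_radd[OF hf_bil] bilinear_rmul[OF hf_bil] wE)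
    qed
    ultimately show False using wp by simp
  qed
  then show ?thesis by (simp add: w_def)
qed

lemma orthonormal_basis_coeff:
  assumes E: "orthonormal_basis g c x E"
  shows "zcoeff Z k = (\<Sum>e\<in>E. gC g c x Z (e, 0) * e $ k)"
    and "zbcoeff Z k = (\<Sum>e\<in>E. gC g c x Z (e, 0) * cnj (e $ k))"
proof -
  have G: "gC g c x Z (e, 0) = g c x (fst Z) e + \<i> * g c x (snd Z) e" for e
    by (simp add: gC_def bilinear_rzero[OF hf_bil] complex_eq_iff)
  have v: "v $ k = (\<Sum>e\<in>E. complex_of_real (g c x v e) * e $ k)" for v
  proof -
    have "v $ k = (\<Sum>e\<in>E. g c x v e *\<^sub>R (e $ k))"
      using arg_cong[OF orthonormal_basis_expand[OF E, of v], of "\<lambda>v. v $ k"]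
      by (simp only: sum_component vector_scaleR_component)
    then show ?thesis by (simp only: scaleR_conv_of_real)
  qed
  have vc: "cnj (v $ k) = (\<Sum>e\<in>E. complex_of_real (g c x v e) * cnj (e $ k))" for v
    unfolding v[of v] by simp
  show "zcoeff Z k = (\<Sum>e\<in>E. gC g c x Z (e, 0) * e $ k)"
    unfolding zcoeff_def G v[of "fst Z"] v[of "snd Z"]
    by (simp add: distrib_right sum.distrib sum_distrib_left mult.assoc)
  show "zbcoeff Z k = (\<Sum>e\<in>E. gC g c x Z (e, 0) * cnj (e $ k))"
    unfolding zbcoeff_def G vc[of "fst Z"] vc[of "snd Z"]
    by (simp add: distrib_right sum.distrib sum_distrib_left mult.assoc)
qed

text \<open>Expanding \<open>\<partial>/\<partial>z\<^sup>m\<close> in the basis shows that the right-hand side inverts the matrix \<open>h\<close>.\<close>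

lemma hinv_orthonormal:
  assumes E: "orthonormal_basis g c x E"
  shows "hinv g c x k l = (\<Sum>e\<in>E. e $ k * cnj (e $ l))"
proof -
  have "(\<Sum>l\<in>UNIV. (\<Sum>e\<in>E. e $ k * cnj (e $ l)) * herm g c x m l) = (if k = m then 1 else 0)" for k m
  proof -
    have "(\<Sum>l\<in>UNIV. (\<Sum>e\<in>E. e $ k * cnj (e $ l)) * herm g c x m l) =
       (\<Sum>e\<in>E. gC g c x (dz m) (e, 0) * e $ k)"
      unfolding gC_sym[OF hf, of "dz m"] gC_dz sum_distrib_right by (subst sum.swap) (simp add: mult_ac)
    then show ?thesis using orthonormal_basis_coeff(1)[OF E, of "dz m" k] by (auto split: if_splits)
  qed
  then show ?thesis by (rule hinv_unique[symmetric])
qed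

text \<open>The same expansion, now with the conjugate coordinates of \<open>\<partial>/\<partial>z\<^sup>m\<close>, which vanish.\<close>

lemma orthonormal_basis_isotropic:
  assumes E: "orthonormal_basis g c x E"
  shows "(\<Sum>e\<in>E. cnj (e $ k) * cnj (e $ l)) = 0"
proof -
  have z: "(\<Sum>j\<in>UNIV. herm g c x m j * (\<Sum>e\<in>E. cnj (e $ j) * cnj (e $ l))) = 0" for m
  proof -
    have "(\<Sum>j\<in>UNIV. herm g c x m j * (\<Sum>e\<in>E. cnj (e $ j) * cnj (e $ l))) =
       (\<Sum>e\<in>E. gC g c x (dz m) (e, 0) * cnj (e $ l))"
      unfolding gC_sym[OF hf, of "dz m"] gC_dz sum_distrib_right sum_distrib_left
      by (subst sum.swap) (simp add: mult_ac)
    then show ?thesis using orthonormal_basis_coeff(2)[OF E, of "dz m" l] by simp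
  qed
  have "(\<Sum>e\<in>E. cnj (e $ k) * cnj (e $ l)) =
    (\<Sum>j\<in>UNIV. (\<Sum>m\<in>UNIV. hinv g c x m k * herm g c x m j) * (\<Sum>e\<in>E. cnj (e $ j) * cnj (e $ l)))"
    by (simp add: herm_hinv)
  also have "\<dots> = (\<Sum>m\<in>UNIV. hinv g c x m k * (\<Sum>j\<in>UNIV. herm g c x m j * (\<Sum>e\<in>E. cnj (e $ j) * cnj (e $ l))))"
    unfolding sum_distrib_right by (subst sum.swap) (simp add: sum_distrib_left mult_ac)
  also have "\<dots> = 0" by (simp add: z)
  finally show ?thesis .
qed

text \<open>Split each basis vector into its (1,0)- and (0,1)-parts: the pure terms cancel and the mixed
  ones sum to the inverse metric.  This turns the real trace in the Ricci tensor into a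
  Hermitian one.\<close>

lemma orthonormal_trace:
  assumes E: "orthonormal_basis g c x E"
    and F1: "\<And>W. clin (\<lambda>Z. F Z W)" and F2: "\<And>Z. clin (F Z)"
  shows "(\<Sum>e\<in>E. F (e, 0) (e, 0)) =
    (\<Sum>k\<in>UNIV. \<Sum>l\<in>UNIV. hinv g c x k l * (F (dz k) (dzb l) + F (dzb l) (dz k)))"
proof -
  have iso: "(\<Sum>e\<in>E. e $ k * e $ l) = 0" for k l
    using arg_cong[OF orthonormal_basis_isotropic[OF E, of k l], of cnj] by simp
  have ex: "F (e, 0) (e, 0) = (\<Sum>k\<in>UNIV. \<Sum>l\<in>UNIV. (e $ k * e $ l) * F (dz k) (dz l) +
      (e $ k * cnj (e $ l)) * F (dz k) (dzb l) + (e $ l * cnj (e $ k)) * F (dzb k) (dz l)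
      + (cnj (e $ k) * cnj (e $ l)) * F (dzb k) (dzb l))" for e
  proof -
    have 1: "F (e, 0) W = (\<Sum>k\<in>UNIV. e $ k * F (dz k) W + cnj (e $ k) * F (dzb k) W)" for W
      using clin_expand[OF F1, of "(e, 0)" W] by simp
    have 2: "F Z (e, 0) = (\<Sum>k\<in>UNIV. e $ k * F Z (dz k) + cnj (e $ k) * F Z (dzb k))" for Z
      using clin_expand[OF F2, of Z "(e, 0)"] by simp
    have "F (e, 0) (e, 0) = (\<Sum>k\<in>UNIV. e $ k * F (dz k) (e, 0) + cnj (e $ k) * F (dzb k) (e, 0))"
      by (rule 1)
    also have "\<dots> = (\<Sum>k\<in>UNIV. \<Sum>l\<in>UNIV. (e $ k * e $ l) * F (dz k) (dz l) +
      (e $ k * cnj (e $ l)) * F (dz k) (dzb l) + (e $ l * cnj (e $ k)) * F (dzb k) (dz l)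
      + (cnj (e $ k) * cnj (e $ l)) * F (dzb k) (dzb l))"
      unfolding 2 by (simp add: sum_distrib_left sum.distrib distrib_left add_ac mult_ac)
    finally show ?thesis .
  qed
  have "(\<Sum>e\<in>E. F (e, 0) (e, 0)) = (\<Sum>k\<in>UNIV. \<Sum>l\<in>UNIV. (\<Sum>e\<in>E. e $ k * e $ l) * F (dz k) (dz l) +
      (\<Sum>e\<in>E. e $ k * cnj (e $ l)) * F (dz k) (dzb l) + (\<Sum>e\<in>E. e $ l * cnj (e $ k)) * F (dzb k) (dz l)
      + (\<Sum>e\<in>E. cnj (e $ k) * cnj (e $ l)) * F (dzb k) (dzb l))"
    unfolding ex sum_distrib_right
    by (subst sum.swap, rule sum.cong[OF refl], subst sum.swap, rule sum.cong[OF refl]) (simp add: sum.distrib)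
  also have "\<dots> = (\<Sum>k\<in>UNIV. \<Sum>l\<in>UNIV. hinv g c x k l * F (dz k) (dzb l)) +
      (\<Sum>k\<in>UNIV. \<Sum>l\<in>UNIV. hinv g c x l k * F (dzb k) (dz l))"
    by (simp add: iso orthonormal_basis_isotropic[OF E] hinv_orthonormal[OF E] sum.distrib)
  also have "(\<Sum>k\<in>UNIV. \<Sum>l\<in>UNIV. hinv g c x l k * F (dzb k) (dz l)) =
      (\<Sum>k\<in>UNIV. \<Sum>l\<in>UNIV. hinv g c x k l * F (dzb l) (dz k))" by (rule sum.swap)
  finally show ?thesis by (simp add: sum.distrib algebra_simps)
qed

end

section \<open>Wirtinger derivatives\<close>

lemma cderiv_has: "(f has_derivative f') (at x) \<Longrightarrow> cderiv Z f x = f' (fst Z) + \<i> * f' (snd Z)"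
  by (simp add: cderiv_def frechet_eq)

lemma cderiv_cong_open:
  assumes "open S" "x \<in> S" "\<And>y. y \<in> S \<Longrightarrow> f y = g y"
  shows "cderiv Z f x = cderiv Z g x"
  unfolding cderiv_def using frechet_cong_open[OF assms] by simp

lemma cderiv_const [simp]: "cderiv Z (\<lambda>y. a) x = 0"
  using cderiv_has[OF has_derivative_const] by simp

lemma cderiv_add:
  "f differentiable at x \<Longrightarrow> h differentiable at x \<Longrightarrow> cderiv Z (\<lambda>y. f y + h y) x = cderiv Z f x + cderiv Z h x"
  by (subst cderiv_has[OF has_derivative_add[OF has_frechet has_frechet]])
     (auto simp: cderiv_def distrib_left)

lemma cderiv_mult:
  "f differentiable at x \<Longrightarrow> h differentiable at x \<Longrightarrow>
    cderiv Z (\<lambda>y. f y * h y) x = cderiv Z f x * h x + f x * cderiv Z h x"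
  by (subst cderiv_has[OF has_derivative_mult[OF has_frechet has_frechet]])
     (auto simp: cderiv_def algebra_simps)

lemma cderiv_cmult: "f differentiable at x \<Longrightarrow> cderiv Z (\<lambda>y. a * f y) x = a * cderiv Z f x"
  by (simp add: cderiv_mult)

lemma cderiv_minus: "f differentiable at x \<Longrightarrow> cderiv Z (\<lambda>y. - f y) x = - cderiv Z f x"
  using cderiv_cmult[of f x Z "-1"] by simp

lemma cderiv_diff:
  "f differentiable at x \<Longrightarrow> h differentiable at x \<Longrightarrow> cderiv Z (\<lambda>y. f y - h y) x = cderiv Z f x - cderiv Z h x"
  using cderiv_add[of f x "\<lambda>y. - h y" Z] by (simp add: cderiv_minus)

lemma cderiv_sum:
  assumes "finite I" "\<And>i. i \<in> I \<Longrightarrow> f i differentiable at x"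
  shows "cderiv Z (\<lambda>y. \<Sum>i\<in>I. f i y) x = (\<Sum>i\<in>I. cderiv Z (f i) x)"
  using assms
proof (induction I rule: finite_induct)
  case (insert i I)
  then show ?case by (simp add: cderiv_add differentiable_sum)
qed simp

lemma differentiable_cnj: "f differentiable at x \<Longrightarrow> (\<lambda>y. cnj (f y)) differentiable at x"
  using bounded_linear.has_derivative[OF bounded_linear_cnj] unfolding differentiable_def by blast

lemma cnj_cderiv: 
  assumes "f differentiable at x" shows "cnj (cderiv Z f x) = cderiv (conjv Z) (\<lambda>y. cnj (f y)) x"
proof -
  have l: "linear (frechet_derivative f (at x))"
    by (rule has_derivative_linear[OF has_frechet[OF assms]])
  show ?thesis
    unfolding cderiv_has[OF bounded_linear.has_derivative[OF bounded_linear_cnj has_frechet[OF assms]]]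
    by (simp add: cderiv_def conjv_def linear_neg[OF l])
qed

lemma cderiv_cnj:
  assumes "f differentiable at x" shows "cderiv Z (\<lambda>y. cnj (f y)) x = cnj (cderiv (conjv Z) f x)"
  using cnj_cderiv[OF assms, of "conjv Z"] by (simp add: conjv_def)

lemma clin_cderiv: "f differentiable at x \<Longrightarrow> clin (\<lambda>Z. cderiv Z f x)"
  unfolding cderiv_cext by (rule clin_cext) (metis has_frechet has_derivative_linear)

lemma cderiv_commute:
  assumes "open S" "x \<in> S" "smooth_on f S"
  shows "cderiv Z (cderiv W f) x = cderiv W (cderiv Z f) x"
proof -
  have d: "(\<lambda>y. frechet_derivative f (at y) v) differentiable at x" for v
    using smooth_on_differentiable[OF assms(1) smooth_on_frechet[OF assms(3)] assms(2)] .
  have "Ck_on 2 f S" using assms by (simp only: smooth_on_def)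
  note c = frechet_derivative_commute[OF assms(1,2) this]
  have "cderiv Z (cderiv W f) x = cderiv Z (\<lambda>y. frechet_derivative f (at y) (fst W)) x
     + \<i> * cderiv Z (\<lambda>y. frechet_derivative f (at y) (snd W)) x" for Z W
    unfolding cderiv_def[of W f, abs_def] using d
    by (simp add: cderiv_add cderiv_cmult differentiable_mult differentiable_const)
  note e = this
  show ?thesis
    unfolding e[of Z W] e[of W Z]
    using c[of "fst Z" "fst W"] c[of "snd Z" "fst W"] c[of "fst Z" "snd W"] c[of "snd Z" "snd W"]
    by (simp add: cderiv_def algebra_simps)
qed

lemma clinI:
  assumes "\<And>Y Z. F (Y + Z) = F Y + F Z" "\<And>a Z. F (csc a Z) = a * F Z" shows "clin F"
proof -
  have "F (r *\<^sub>R Z) = r *\<^sub>R F Z" for r Z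
    using assms(2)[of "complex_of_real r" Z] by (simp add: csc_def scaleR_conv_of_real zero_prod_def[symmetric])
  moreover have "F (- Y, X) = \<i> * F (X, Y)" for X Y
    using assms(2)[of \<i> "(X, Y)"] by (simp add: csc_def)
  moreover have "linear F" by (rule linearI) fact+
  ultimately show ?thesis by (simp add: clin_def)
qed

lemma clin_addD: "clin F \<Longrightarrow> F (Y + Z) = F Y + F Z"
  by (simp add: clin_def linear_add)

lemma clin_eqI:
  assumes "clin F" "clin G" "\<And>k. F (dz k) = G (dz k)" "\<And>k. F (dzb k) = G (dzb k)"
  shows "F Z = G Z"
  unfolding clin_expand[OF assms(1), of Z] clin_expand[OF assms(2), of Z] by (simp add: assms(3,4))

lemma clin_pair: assumes "clin F" shows "F Z = F (fst Z, 0) + \<i> * F (snd Z, 0)"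
proof -
  have "Z = (fst Z, 0) + csc \<i> (snd Z, 0)" by (simp add: csc_def prod_eq_iff)
  then show ?thesis using clin_addD[OF assms] clin_csc[OF assms] by metis
qed

lemma clin_add: "clin F \<Longrightarrow> clin G \<Longrightarrow> clin (\<lambda>Z. F Z + G Z)"
  by (rule clinI) (simp_all add: clin_addD clin_csc distrib_left)

lemma clin_cmult: "clin F \<Longrightarrow> clin (\<lambda>Z. a * F Z)"
  by (rule clinI) (simp_all add: clin_addD clin_csc distrib_left)

lemma clin_diff: "clin F \<Longrightarrow> clin G \<Longrightarrow> clin (\<lambda>Z. F Z - G Z)"
  by (rule clinI) (simp_all add: clin_addD clin_csc algebra_simps)

lemma smooth_on_det:
  fixes M :: "'a::euclidean_space \<Rightarrow> complex^'n^'n"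
  assumes "open S" "\<And>i j. smooth_on (\<lambda>x. M x $ i $ j) S"
  shows "smooth_on (\<lambda>x. det (M x)) S"
  unfolding det_def using assms by (intro smooth_on_sum smooth_on_mult smooth_on_const smooth_on_prod)

section \<open>The Levi-Civita connection in a chart\<close>

text \<open>The right-hand side of Koszul's formula for \<open>g (\<nabla>\<^sub>X Y, W)\<close>, for vector fields with constant
  coefficients.\<close>

definition kos :: "('m, 'n) metric \<Rightarrow> ('m, 'n::finite) chart \<Rightarrow> complex^'n \<Rightarrow> 'n cvec \<Rightarrow> 'n cvec \<Rightarrow> 'n cvec \<Rightarrow> complex" where
  "kos g c x X Y W = (cderiv X (\<lambda>y. gC g c y Y W) x + cderiv Y (\<lambda>y. gC g c y X W) x
     - cderiv W (\<lambda>y. gC g c y X Y) x) / 2"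

text \<open>The complex bilinear extension of the Christoffel symbol.\<close>

definition lcC :: "('m, 'n) metric \<Rightarrow> ('m, 'n::finite) chart \<Rightarrow> complex^'n \<Rightarrow> 'n cvec \<Rightarrow> 'n cvec \<Rightarrow> 'n cvec" where
  "lcC g c x Y Z = (levi_civita g c x (fst Y) (fst Z) - levi_civita g c x (snd Y) (snd Z),
     levi_civita g c x (fst Y) (snd Z) + levi_civita g c x (snd Y) (fst Z))"

text \<open>A Hermitian metric on an open subset of a coordinate domain; the subset is arbitrary because
  the overlap of two charts is needed as well.\<close>

locale hermitian_chart =
  fixes g :: "('m, 'n::finite) metric" and c :: "('m, 'n) chart" and U :: "(complex^'n) set"
  assumes U: "open U"
    and hat: "\<And>x. x \<in> U \<Longrightarrow> hermitian_at g c x"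
    and smooth_g: "\<And>v w. smooth_on (\<lambda>x. g c x v w) U"
begin

lemma smooth_gC: "smooth_on (\<lambda>x. gC g c x Z W) U"
proof -
  have "smooth_on (\<lambda>x. complex_of_real (g c x (fst Z) (fst W) - g c x (snd Z) (snd W)) +
      \<i> * complex_of_real (g c x (fst Z) (snd W) + g c x (snd Z) (fst W))) U"
    by (intro smooth_on_add smooth_on_mult smooth_on_const smooth_on_of_real smooth_on_diff smooth_g U)
  then show ?thesis by (rule smooth_on_cong[OF U]) (simp add: gC_def complex_eq_iff)
qed

lemma smooth_herm: "smooth_on (\<lambda>x. herm g c x k l) U"
  unfolding herm_def by (rule smooth_gC)

lemma det_herm_nz: "x \<in> U \<Longrightarrow> det (\<chi> l k. herm g c x k l) \<noteq> 0"
  using herm_invertible[OF hat] invertible_det_nz by blast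

lemma smooth_hinv: "smooth_on (\<lambda>x. hinv g c x k m) U"
proof -
  have "smooth_on (\<lambda>x. det (\<chi> i j. if j = k then axis m 1 $ i else herm g c x j i) *
      inverse (det (\<chi> l k. herm g c x k l))) U"
  proof (intro smooth_on_mult smooth_on_inverse smooth_on_det det_herm_nz U)
    show "smooth_on (\<lambda>x. (\<chi> i j. if j = k then axis m 1 $ i else herm g c x j i) $ i $ j) U" for i j
      by (cases "j = k") (simp_all add: smooth_herm smooth_on_const U)
  qed (simp add: smooth_herm)
  then show ?thesis
  proof (rule smooth_on_cong[OF U])
    fix x assume x: "x \<in> U"
    have "(\<chi> l k. herm g c x k l) *v (\<chi> k. hinv g c x k m) = axis m 1"
      using herm_hinv[OF hat[OF x]] by (simp add: vec_eq_iff matrix_vector_mult_def axis_def mult.commute)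
    then show "det (\<chi> i j. if j = k then axis m 1 $ i else herm g c x j i) *
      inverse (det (\<chi> l k. herm g c x k l)) = hinv g c x k m"
      unfolding cramer[OF det_herm_nz[OF x]] by (simp add: vec_eq_iff divide_inverse cong: if_cong)
  qed
qed

lemmas diff_gC = smooth_on_differentiable[OF U smooth_gC]
lemmas diff_herm = smooth_on_differentiable[OF U smooth_herm]
lemmas diff_hinv = smooth_on_differentiable[OF U smooth_hinv]

lemma clin_cderiv_gC:
  assumes x: "x \<in> U" shows "clin (\<lambda>Y. cderiv X (\<lambda>y. gC g c y Y W) x)"
proof (rule clinI)
  fix Y Z a
  have "cderiv X (\<lambda>y. gC g c y (Y + Z) W) x = cderiv X (\<lambda>y. gC g c y Y W + gC g c y Z W) x"
    by (rule cderiv_cong_open[OF U x]) (rule clin_addD[OF clin_gC[OF hat]])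
  then show "cderiv X (\<lambda>y. gC g c y (Y + Z) W) x = cderiv X (\<lambda>y. gC g c y Y W) x + cderiv X (\<lambda>y. gC g c y Z W) x"
    using diff_gC[OF x] by (simp add: cderiv_add)
  have "cderiv X (\<lambda>y. gC g c y (csc a Z) W) x = cderiv X (\<lambda>y. a * gC g c y Z W) x"
    by (rule cderiv_cong_open[OF U x]) (rule clin_csc[OF clin_gC[OF hat]])
  then show "cderiv X (\<lambda>y. gC g c y (csc a Z) W) x = a * cderiv X (\<lambda>y. gC g c y Z W) x"
    using diff_gC[OF x] by (simp add: cderiv_cmult)
qed

lemma cderiv_gC_sym: "x \<in> U \<Longrightarrow> cderiv X (\<lambda>y. gC g c y Y W) x = cderiv X (\<lambda>y. gC g c y W Y) x"
  by (rule cderiv_cong_open[OF U]) (auto intro: gC_sym hat)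

lemma clin_cderiv_gC2: "x \<in> U \<Longrightarrow> clin (\<lambda>W. cderiv X (\<lambda>y. gC g c y Y W) x)"
  using clin_cderiv_gC[of x X Y] by (simp add: cderiv_gC_sym[of x X Y])

lemma kos_sym: "x \<in> U \<Longrightarrow> kos g c x X Y W = kos g c x Y X W"
  unfolding kos_def using cderiv_gC_sym[of x W X Y] by simp

lemma kos_metric: "x \<in> U \<Longrightarrow> kos g c x X Y W + kos g c x X W Y = cderiv X (\<lambda>y. gC g c y Y W) x"
  unfolding kos_def using cderiv_gC_sym[of x X Y W] cderiv_gC_sym[of x W X Y] cderiv_gC_sym[of x Y X W]
  by (simp add: field_simps)

lemma clin_half: "clin F \<Longrightarrow> clin (\<lambda>Z. F Z / 2)"
  using clin_cmult[of F "1/2"] by simp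

lemma clin_kos:
  assumes x: "x \<in> U"
  shows "clin (\<lambda>X. kos g c x X Y W)" "clin (\<lambda>Y. kos g c x X Y W)" "clin (kos g c x X Y)"
  unfolding kos_def
  by (intro clin_half clin_add clin_diff clin_cderiv_gC clin_cderiv_gC2 clin_cderiv diff_gC x)+

lemma smooth_kos: "smooth_on (\<lambda>x. kos g c x X Y W) U"
proof -
  have "smooth_on (\<lambda>x. (1/2) * (cderiv X (\<lambda>y. gC g c y Y W) x + cderiv Y (\<lambda>y. gC g c y X W) x
     - cderiv W (\<lambda>y. gC g c y X Y) x)) U"
    by (intro smooth_on_mult smooth_on_const smooth_on_add smooth_on_diff smooth_on_cderiv smooth_gC U)
  then show ?thesis by (simp add: kos_def)
qed

lemma cnj_kos: "x \<in> U \<Longrightarrow> cnj (kos g c x X Y W) = kos g c x (conjv X) (conjv Y) (conjv W)"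
proof -
  assume x: "x \<in> U"
  have "cnj (cderiv X (\<lambda>y. gC g c y Y W) x) = cderiv (conjv X) (\<lambda>y. gC g c y (conjv Y) (conjv W)) x" for X Y W
    unfolding cnj_cderiv[OF diff_gC[OF x]]
    by (rule cderiv_cong_open[OF U x]) (rule cnj_gC[OF hat])
  then show ?thesis by (simp add: kos_def)
qed

text \<open>The vector that Koszul's formula determines, in components.\<close>

definition lc0 :: "complex^'n \<Rightarrow> complex^'n \<Rightarrow> complex^'n \<Rightarrow> complex^'n" where
  "lc0 x u v = (\<chi> s. \<Sum>l\<in>UNIV. hinv g c x s l * kos g c x (u, 0) (v, 0) (dzb l))"

lemma gC_lc0:
  assumes x: "x \<in> U" shows "gC g c x (lc0 x u v, 0) W = kos g c x (u, 0) (v, 0) W"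
proof (rule clin_eqI[OF clin_gC2[OF hat[OF x]] clin_kos(3)[OF x]])
  fix k
  have "gC g c x (lc0 x u v, 0) (dzb k) =
    (\<Sum>j\<in>UNIV. (\<Sum>l\<in>UNIV. hinv g c x j l * kos g c x (u, 0) (v, 0) (dzb l)) * herm g c x j k)"
    by (simp add: gC_dzb[OF hat[OF x]] lc0_def)
  also have "\<dots> = (\<Sum>l\<in>UNIV. kos g c x (u, 0) (v, 0) (dzb l) * (\<Sum>j\<in>UNIV. hinv g c x j l * herm g c x j k))"
    unfolding sum_distrib_right sum_distrib_left by (subst sum.swap) (simp add: mult_ac)
  also have "\<dots> = kos g c x (u, 0) (v, 0) (dzb k)"
    by (simp add: herm_hinv[OF hat[OF x]])
  finally show 1: "gC g c x (lc0 x u v, 0) (dzb k) = kos g c x (u, 0) (v, 0) (dzb k)" .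
  have "gC g c x (lc0 x u v, 0) (dz k) = cnj (gC g c x (lc0 x u v, 0) (dzb k))"
    by (simp add: cnj_gC[OF hat[OF x]])
  then show "gC g c x (lc0 x u v, 0) (dz k) = kos g c x (u, 0) (v, 0) (dz k)"
    by (simp add: 1 cnj_kos[OF x])
qed

lemma g_lc0: "x \<in> U \<Longrightarrow> complex_of_real (g c x (lc0 x u v) w) = kos g c x (u, 0) (v, 0) (w, 0)"
  using gC_lc0[of x u v "(w, 0)"] gC_real[OF hat, of x] by simp

lemma cderiv_g: "x \<in> U \<Longrightarrow>
  cderiv (u, 0) (\<lambda>y. gC g c y (v, 0) (w, 0)) x = complex_of_real (frechet_derivative (\<lambda>y. g c y v w) (at x) u)"
proof -
  assume x: "x \<in> U"
  have d: "(\<lambda>y. g c y v w) differentiable at x"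
    by (rule smooth_on_differentiable[OF U smooth_g x])
  have "cderiv (u, 0) (\<lambda>y. gC g c y (v, 0) (w, 0)) x = cderiv (u, 0) (\<lambda>y. complex_of_real (g c y v w)) x"
    by (rule cderiv_cong_open[OF U x]) (rule gC_real[OF hat])
  also have "\<dots> = complex_of_real (frechet_derivative (\<lambda>y. g c y v w) (at x) u)"
    using cderiv_has[OF bounded_linear.has_derivative[OF bounded_linear_of_real has_frechet[OF d]], of "(u, 0)"]
      linear_0[OF has_derivative_linear[OF has_frechet[OF d]]]
    by simp
  finally show ?thesis .
qed

lemma bilinear_lc0: assumes x: "x \<in> U" shows "bilinear (lc0 x)"
proof -
  have real: "linear (\<lambda>u. F (u, 0))" if "clin F" for F :: "'n cvec \<Rightarrow> complex"
  proof (rule linearI)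
    have l: "linear F" using that by (simp add: clin_def)
    show "F (u + v, 0) = F (u, 0) + F (v, 0)" for u v
      using linear_add[OF l, of "(u, 0)" "(v, 0)"] by simp
    show "F (r *\<^sub>R u, 0) = r *\<^sub>R F (u, 0)" for r u
      using linear_scale[OF l, of r "(u, 0)"] by simp
  qed
  note 1 = real[OF clin_kos(1)[OF x]] and 2 = real[OF clin_kos(2)[OF x]]
  show ?thesis
    unfolding bilinear_def
    by (auto intro!: linearI simp: lc0_def vec_eq_iff linear_add[OF 1] linear_add[OF 2] linear_scale[OF 1]
      linear_scale[OF 2] distrib_left sum.distrib scaleR_sum_right)
qed

text \<open>Koszul's formula determines \<open>\<Gamma>\<close> because the metric is nondegenerate.\<close>

lemma levi_civita_eq: assumes x: "x \<in> U" shows "levi_civita g c x = lc0 x"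
  unfolding levi_civita_def
proof (rule the_equality)
  have s: "lc0 x u v = lc0 x v u" for u v
    unfolding lc0_def using kos_sym[OF x, of "(u, 0)" "(v, 0)"] by simp
  have "frechet_derivative (\<lambda>y. g c y v w) (at x) u = g c x (lc0 x u v) w + g c x v (lc0 x u w)" for u v w
  proof -
    have "complex_of_real (frechet_derivative (\<lambda>y. g c y v w) (at x) u) =
      complex_of_real (g c x (lc0 x u v) w + g c x (lc0 x u w) v)"
      using kos_metric[OF x, of "(u, 0)" "(v, 0)" "(w, 0)"] by (simp add: g_lc0[OF x] cderiv_g[OF x])
    then show ?thesis using hf_sym[OF hat[OF x]] of_real_eq_iff by metis
  qed
  then show "bilinear (lc0 x) \<and> (\<forall>u v. lc0 x u v = lc0 x v u) \<and>
     (\<forall>u v w. frechet_derivative (\<lambda>y. g c y v w) (at x) u = g c x (lc0 x u v) w + g c x v (lc0 x u w))"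
    using bilinear_lc0[OF x] s by blast
  fix G assume G: "bilinear G \<and> (\<forall>u v. G u v = G v u) \<and>
     (\<forall>u v w. frechet_derivative (\<lambda>y. g c y v w) (at x) u = g c x (G u v) w + g c x v (G u w))"
  show "G = lc0 x"
  proof (intro ext)
    fix u v
    note sy = hf_sym[OF hat[OF x]] and b = hf_bil[OF hat[OF x]]
    have e: "g c x (G u v) w = g c x (lc0 x u v) w" for w
    proof -
      define F where "F u v w = frechet_derivative (\<lambda>y. g c y v w) (at x) u" for u v w
      have F: "F u v w = g c x (G u v) w + g c x v (G u w)" for u v w using G by (simp add: F_def)
      have Gs: "G u v = G v u" for u v using G by blast
      have "F u v w + F v u w - F w u v = 2 * g c x (G u v) w"
        unfolding F using Gs[of u v] Gs[of u w] Gs[of v w] sy[of v "G u w"] sy[of u "G v w"] by simp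
      moreover have "complex_of_real (F u v w + F v u w - F w u v) = complex_of_real (2 * g c x (lc0 x u v) w)"
        unfolding F_def by (simp add: cderiv_g[OF x, symmetric] g_lc0[OF x] kos_def)
      then have "F u v w + F v u w - F w u v = 2 * g c x (lc0 x u v) w" using of_real_eq_iff by blast
      ultimately show ?thesis by simp
    qed
    have "g c x (G u v - lc0 x u v) (G u v - lc0 x u v) = 0"
      using e[of "G u v - lc0 x u v"] by (simp add: bilinear_lsub[OF b])
    then show "G u v = lc0 x u v" using hf_pos[OF hat[OF x], of "G u v - lc0 x u v"] by fastforce
  qed
qed

lemma gC_lcC: assumes x: "x \<in> U" shows "gC g c x (lcC g c x Y Z) W = kos g c x Y Z W"
proof -
  note c = clin_gC[OF hat[OF x], of W]
  have "gC g c x (lcC g c x Y Z) W = gC g c x (fst (lcC g c x Y Z), 0) W + \<i> * gC g c x (snd (lcC g c x Y Z), 0) W"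
    by (rule clin_pair[OF c])
  also have "(fst (lcC g c x Y Z), 0) = (lc0 x (fst Y) (fst Z), 0) + csc (-1) (lc0 x (snd Y) (snd Z), 0)"
    by (simp add: lcC_def levi_civita_eq[OF x] csc_def)
  also have "(snd (lcC g c x Y Z), 0::complex^'n) = (lc0 x (fst Y) (snd Z), 0) + (lc0 x (snd Y) (fst Z), 0)"
    by (simp add: lcC_def levi_civita_eq[OF x])
  finally have "gC g c x (lcC g c x Y Z) W = kos g c x (fst Y, 0) (fst Z, 0) W - kos g c x (snd Y, 0) (snd Z, 0) W
    + \<i> * (kos g c x (fst Y, 0) (snd Z, 0) W + kos g c x (snd Y, 0) (fst Z, 0) W)"
    by (simp only: clin_addD[OF c] clin_csc[OF c] gC_lc0[OF x]) simp
  moreover have "kos g c x Y Z W = kos g c x (fst Y, 0) Z W + \<i> * kos g c x (snd Y, 0) Z W"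
    by (rule clin_pair[OF clin_kos(1)[OF x]])
  ultimately have "gC g c x (lcC g c x Y Z) W - kos g c x Y Z W = kos g c x (fst Y, 0) (fst Z, 0) W - kos g c x (snd Y, 0) (snd Z, 0) W
    + \<i> * (kos g c x (fst Y, 0) (snd Z, 0) W + kos g c x (snd Y, 0) (fst Z, 0) W) -
    (kos g c x (fst Y, 0) Z W + \<i> * kos g c x (snd Y, 0) Z W)" by simp
  moreover have "kos g c x Y Z W = kos g c x Y (fst Z, 0) W + \<i> * kos g c x Y (snd Z, 0) W" for Y
    by (rule clin_pair[OF clin_kos(2)[OF x]])
  note this[of "(fst Y, 0)"] this[of "(snd Y, 0)"]
  ultimately show ?thesis by (simp add: algebra_simps)
qed

lemma differentiable_lcC:
  assumes x: "x \<in> U"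
  shows "(\<lambda>y. fst (lcC g c y Y Z)) differentiable at x" "(\<lambda>y. snd (lcC g c y Y Z)) differentiable at x"
proof -
  have comp: "(\<lambda>y. levi_civita g c y u v $ s) differentiable at x" for u v s
  proof (rule differentiable_cong_open[OF U x])
    show "(\<Sum>l\<in>UNIV. hinv g c y s l * kos g c y (u, 0) (v, 0) (dzb l)) = levi_civita g c y u v $ s" if "y \<in> U" for y
      by (simp add: levi_civita_eq[OF that] lc0_def)
    show "(\<lambda>y. \<Sum>l\<in>UNIV. hinv g c y s l * kos g c y (u, 0) (v, 0) (dzb l)) differentiable at x"
      by (intro smooth_on_differentiable[OF U _ x] smooth_on_sum smooth_on_mult smooth_hinv smooth_kos U)
  qed
  have "(\<lambda>y. levi_civita g c y u v) differentiable at x" for u v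
  proof -
    have "((\<lambda>y. levi_civita g c y u v) has_derivative (\<lambda>h. \<chi> s. frechet_derivative (\<lambda>y. levi_civita g c y u v $ s) (at x) h)) (at x)"
      using has_frechet[OF comp[of u v]] by (simp add: has_derivative_componentwise_within[where f="\<lambda>y. levi_civita g c y u v"] Basis_vec_def inner_axis) 
         (metis has_derivative_inner_left)
    then show ?thesis by (auto simp: differentiable_def)
  qed
  then show "(\<lambda>y. fst (lcC g c y Y Z)) differentiable at x" "(\<lambda>y. snd (lcC g c y Y Z)) differentiable at x"
    by (auto simp: lcC_def intro!: differentiable_diff differentiable_add)
qed

text \<open>\<open>\<nabla>\<close> is metric, also on complex vector fields.\<close>

lemma gC_nablaC:
  assumes x: "x \<in> U" and V: "(\<lambda>y. fst (V y)) differentiable at x" "(\<lambda>y. snd (V y)) differentiable at x"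
  shows "gC g c x (nablaC g c (\<lambda>_. X) V x) W =
    cderiv X (\<lambda>y. gC g c y (V y) W) x - gC g c x (V x) (lcC g c x X W)"
proof -
  define V1 V2 where "V1 y = fst (V y)" and "V2 y = snd (V y)" for y
  have V1: "(V1 has_derivative frechet_derivative V1 (at x)) (at x)"
    and V2: "(V2 has_derivative frechet_derivative V2 (at x)) (at x)"
    using V has_frechet by (auto simp: V1_def[abs_def] V2_def[abs_def])
  define D where "D = (frechet_derivative V1 (at x) (fst X) - frechet_derivative V2 (at x) (snd X),
     frechet_derivative V2 (at x) (fst X) + frechet_derivative V1 (at x) (snd X))"
  have n: "nablaC g c (\<lambda>_. X) V x = D + lcC g c x X (V x)"
    by (simp add: nablaC_def complexify_def nabla_def o_def D_def lcC_def V1_def[abs_def] V2_def[abs_def])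
  have z: "((\<lambda>y. zcoeff (V y) k) has_derivative (\<lambda>h. frechet_derivative V1 (at x) h $ k + \<i> * frechet_derivative V2 (at x) h $ k)) (at x)" for k
    unfolding zcoeff_def V1_def[symmetric] V2_def[symmetric]
    by (intro has_derivative_add has_derivative_mult_right bounded_linear.has_derivative[OF bounded_linear_vec_nth] V1 V2)
  have zb: "((\<lambda>y. zbcoeff (V y) k) has_derivative (\<lambda>h. cnj (frechet_derivative V1 (at x) h $ k) + \<i> * cnj (frechet_derivative V2 (at x) h $ k))) (at x)" for k
    unfolding zbcoeff_def V1_def[symmetric] V2_def[symmetric]
    by (intro has_derivative_add has_derivative_mult_right bounded_linear.has_derivative[OF bounded_linear_cnj] bounded_linear.has_derivative[OF bounded_linear_vec_nth] V1 V2)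
  have zD: "cderiv X (\<lambda>y. zcoeff (V y) k) x = zcoeff D k" "cderiv X (\<lambda>y. zbcoeff (V y) k) x = zbcoeff D k" for k
    unfolding cderiv_has[OF z] cderiv_has[OF zb] by (simp_all add: D_def zcoeff_def zbcoeff_def algebra_simps)
  have dz1: "(\<lambda>y. zcoeff (V y) k) differentiable at x" "(\<lambda>y. zbcoeff (V y) k) differentiable at x" for k
    using z zb by (auto simp: differentiable_def)
  have "cderiv X (\<lambda>y. gC g c y (V y) W) x =
     cderiv X (\<lambda>y. \<Sum>k\<in>UNIV. zcoeff (V y) k * gC g c y (dz k) W + zbcoeff (V y) k * gC g c y (dzb k) W) x"
    by (rule cderiv_cong_open[OF U x]) (rule clin_expand[OF clin_gC[OF hat]])
  also have "\<dots> = (\<Sum>k\<in>UNIV. zcoeff D k * gC g c x (dz k) W + zbcoeff D k * gC g c x (dzb k) W) +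
     (\<Sum>k\<in>UNIV. zcoeff (V x) k * cderiv X (\<lambda>y. gC g c y (dz k) W) x + zbcoeff (V x) k * cderiv X (\<lambda>y. gC g c y (dzb k) W) x)"
    by (subst cderiv_sum)
       (auto simp: cderiv_add cderiv_mult dz1 diff_gC[OF x] zD sum.distrib intro!: differentiable_add differentiable_mult)
  also have "\<dots> = gC g c x D W + cderiv X (\<lambda>y. gC g c y (V x) W) x"
    using clin_expand[OF clin_gC[OF hat[OF x]], of D W] clin_expand[OF clin_cderiv_gC[OF x, of X W], of "V x"] by simp
  also have "cderiv X (\<lambda>y. gC g c y (V x) W) x = gC g c x (lcC g c x X (V x)) W + gC g c x (lcC g c x X W) (V x)"
    using kos_metric[OF x, of X "V x" W] by (simp add: gC_lcC[OF x])
  finally show ?thesis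
    unfolding n clin_addD[OF clin_gC[OF hat[OF x]]] using gC_sym[OF hat[OF x], of "V x"] by simp
qed

end

section \<open>Curvature components\<close>

definition dh :: "('m, 'n) metric \<Rightarrow> ('m, 'n::finite) chart \<Rightarrow> complex^'n \<Rightarrow> 'n \<Rightarrow> 'n \<Rightarrow> 'n \<Rightarrow> complex" where
  "dh g c x i k l = cderiv (dz i) (\<lambda>y. herm g c y k l) x"

definition ddh :: "('m, 'n) metric \<Rightarrow> ('m, 'n::finite) chart \<Rightarrow> complex^'n \<Rightarrow> 'n \<Rightarrow> 'n \<Rightarrow> 'n \<Rightarrow> 'n \<Rightarrow> complex" where
  "ddh g c x i j k l = cderiv (dz i) (\<lambda>y. cderiv (dzb j) (\<lambda>u. herm g c u k l) y) x"

lemma zcoeff_proj10 [simp]: "zcoeff (proj10 Z) k = zcoeff Z k"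
  by (simp add: zcoeff_def proj10_def complex_eq_iff field_simps)

lemma zbcoeff_proj10 [simp]: "zbcoeff (proj10 Z) k = 0"
  by (simp add: zbcoeff_def proj10_def complex_eq_iff field_simps)

lemma clin_diffD: "clin F \<Longrightarrow> F (A - B) = F A - F B"
  unfolding clin_def using linear_diff by blast

lemma clin_zero: "clin F \<Longrightarrow> F 0 = 0"
  unfolding clin_def using linear_0 by blast

context hermitian_chart
begin

lemma nablaC_const: "nablaC g c (\<lambda>_. Y) (\<lambda>_. Z) = (\<lambda>y. lcC g c y Y Z)"
proof -
  have "frechet_derivative (\<lambda>_. v) (at x) = (\<lambda>_. 0)" for v x :: "complex^'n"
    by (rule frechet_eq) (rule has_derivative_const)
  then show ?thesis by (simp add: nablaC_def complexify_def nabla_def lcC_def o_def)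
qed

lemma bracket_const: "complexify bracket (\<lambda>_. Y) (\<lambda>_. Z) = (\<lambda>_. (0, 0) :: 'n cvec)"
proof -
  have "frechet_derivative (\<lambda>_. v) (at x) = (\<lambda>_. 0)" for v x :: "complex^'n"
    by (rule frechet_eq) (rule has_derivative_const)
  then show ?thesis by (simp add: complexify_def bracket_def o_def)
qed

lemma lcC_zero: "x \<in> U \<Longrightarrow> lcC g c x (0, 0) Z = 0"
  by (simp add: lcC_def levi_civita_eq bilinear_lzero[OF bilinear_lc0] zero_prod_def)

lemma gC_lcC2: "x \<in> U \<Longrightarrow> gC g c x V (lcC g c x Y Z) = kos g c x Y Z V"
  by (simp add: gC_sym[OF hat, of x V] gC_lcC)

lemma gC_diff1: "x \<in> U \<Longrightarrow> gC g c x (A - B) W = gC g c x A W - gC g c x B W"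
  by (rule clin_diffD[OF clin_gC[OF hat]])

text \<open>Evaluate the curvature with \<open>\<nabla>\<close> moved off the differentiated field by metric
  compatibility; the remaining first order terms are given by Koszul's formula.\<close>

lemma Rm_formula:
  assumes x: "x \<in> U"
  shows "Rm g c x X Y Z W = cderiv X (\<lambda>y. kos g c y Y Z W) x - cderiv Y (\<lambda>y. kos g c y X Z W) x
    - gC g c x (lcC g c x Y Z) (lcC g c x X W) + gC g c x (lcC g c x X Z) (lcC g c x Y W)"
proof -
  have e: "gC g c x (nablaC g c (\<lambda>_. X) (\<lambda>y. lcC g c y Y Z) x) W =
     cderiv X (\<lambda>y. kos g c y Y Z W) x - gC g c x (lcC g c x Y Z) (lcC g c x X W)" for X Y
  proof -
    have "cderiv X (\<lambda>y. gC g c y (lcC g c y Y Z) W) x = cderiv X (\<lambda>y. kos g c y Y Z W) x"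
      by (rule cderiv_cong_open[OF U x]) (rule gC_lcC)
    then show ?thesis by (simp add: gC_nablaC[OF x differentiable_lcC[OF x]])
  qed
  have z: "gC g c x 0 W = 0"
    by (rule clin_zero[OF clin_gC[OF hat[OF x]]])
  show ?thesis
    unfolding Rm_def curvature_def bracket_const nablaC_const
    by (simp add: gC_diff1[OF x] e lcC_zero[OF x] z)
qed

text \<open>The same computation as for the Riemann tensor, except that the projection to the
  (1,0)-part enters in the products of Christoffel symbols.  It can be dropped in the pairing
  with \<open>dzb l\<close>, to which every (0,1)-vector is orthogonal.\<close>

lemma lc_curv_formula:
  assumes x: "x \<in> U"
  shows "lc_curv g c x i j k l =
    cderiv (dz i) (\<lambda>y. kos g c y (dzb j) (dz k) (dzb l)) x - cderiv (dzb j) (\<lambda>y. kos g c y (dz i) (dz k) (dzb l)) x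
    - gC g c x (proj10 (lcC g c x (dzb j) (dz k))) (lcC g c x (dz i) (dzb l))
    + gC g c x (proj10 (lcC g c x (dz i) (dz k))) (lcC g c x (dzb j) (dzb l))"
proof -
  have p: "gC g c y (proj10 V) (dzb l) = gC g c y V (dzb l)" if "y \<in> U" for V y
    by (simp add: gC_dzb[OF hat[OF that]])
  have lin: "bounded_linear (\<lambda>v::complex^'n. \<i> *s v)"
    unfolding vec_eq_iff by (rule linear_conv_bounded_linear[THEN iffD1])
      (auto intro!: linearI simp: vec_eq_iff algebra_simps)
  have d: "(\<lambda>y. fst (proj10 (lcC g c y Y Z))) differentiable at x"
    "(\<lambda>y. snd (proj10 (lcC g c y Y Z))) differentiable at x" for Y Z
  proof -
    have J: "(\<lambda>y. \<i> *s f y) differentiable at x" if "f differentiable at x" for f :: "complex^'n \<Rightarrow> complex^'n"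
      using that bounded_linear.has_derivative[OF lin] unfolding differentiable_def by blast
    show "(\<lambda>y. fst (proj10 (lcC g c y Y Z))) differentiable at x"
      "(\<lambda>y. snd (proj10 (lcC g c y Y Z))) differentiable at x"
      by (auto simp: proj10_def intro!: differentiable_scaleR differentiable_add differentiable_diff J differentiable_lcC[OF x])
  qed
  have e: "gC g c x (nablaC g c (\<lambda>_. X) (\<lambda>y. proj10 (lcC g c y Y Z)) x) (dzb l) =
     cderiv X (\<lambda>y. kos g c y Y Z (dzb l)) x - gC g c x (proj10 (lcC g c x Y Z)) (lcC g c x X (dzb l))" for X Y Z
  proof -
    have "cderiv X (\<lambda>y. gC g c y (proj10 (lcC g c y Y Z)) (dzb l)) x = cderiv X (\<lambda>y. kos g c y Y Z (dzb l)) x"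
      by (rule cderiv_cong_open[OF U x]) (simp add: p gC_lcC)
    then show ?thesis by (simp add: gC_nablaC[OF x d])
  qed
  have z: "gC g c x 0 W = 0" for W
    by (rule clin_zero[OF clin_gC[OF hat[OF x]]])
  have h: "nabla_hat g c (\<lambda>_. Y) (\<lambda>_. Z) = (\<lambda>y. proj10 (lcC g c y Y Z))" for Y Z
    by (simp add: nabla_hat_def nablaC_const)
  have "lc_curv g c x i j k l = gC g c x (curvature (nabla_hat g c) (\<lambda>_. dz i) (\<lambda>_. dzb j) (\<lambda>_. dz k) x) (dzb l)"
    by (simp add: lc_curv_def gC_dzb[OF hat[OF x]])
  also have "\<dots> = gC g c x (nabla_hat g c (\<lambda>_. dz i) (\<lambda>y. proj10 (lcC g c y (dzb j) (dz k))) x) (dzb l)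
     - gC g c x (nabla_hat g c (\<lambda>_. dzb j) (\<lambda>y. proj10 (lcC g c y (dz i) (dz k))) x) (dzb l)"
    unfolding curvature_def bracket_const h by (simp add: gC_diff1[OF x] lcC_zero[OF x] p[OF x] z)
  finally show ?thesis
    unfolding nabla_hat_def p[OF x] e by simp
qed

subsection \<open>Symmetries of the Riemann tensor\<close>

lemma diff_kos: "x \<in> U \<Longrightarrow> (\<lambda>y. kos g c y X Y W) differentiable at x"
  by (rule smooth_on_differentiable[OF U smooth_kos])

lemma Rm_antisym12: "x \<in> U \<Longrightarrow> Rm g c x Y X Z W = - Rm g c x X Y Z W"
  by (simp add: Rm_formula)

text \<open>The second order terms of the curvature formula add up to
  \<open>X Y g(Z, W) - Y X g(Z, W)\<close>, which is 0 by the symmetry of second derivatives.\<close>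

lemma Rm_antisym34: assumes x: "x \<in> U" shows "Rm g c x X Y W Z = - Rm g c x X Y Z W"
proof -
  have k: "cderiv X (\<lambda>y. kos g c y Y Z W) x + cderiv X (\<lambda>y. kos g c y Y W Z) x = cderiv X (cderiv Y (\<lambda>y. gC g c y Z W)) x" for X Y
  proof -
    have "cderiv X (\<lambda>y. kos g c y Y Z W + kos g c y Y W Z) x = cderiv X (cderiv Y (\<lambda>y. gC g c y Z W)) x"
      by (rule cderiv_cong_open[OF U x]) (rule kos_metric)
    then show ?thesis by (simp add: cderiv_add diff_kos[OF x])
  qed
  have "Rm g c x X Y W Z + Rm g c x X Y Z W = 0"
    unfolding Rm_formula[OF x] gC_sym[OF hat[OF x], of "lcC g c x Y W"] gC_sym[OF hat[OF x], of "lcC g c x X W"]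
    using k[of X Y] k[of Y X] cderiv_commute[OF U x smooth_gC, of X Y Z W] by (simp add: algebra_simps)
  then show ?thesis by (simp add: add_eq_0_iff)
qed

lemma Rm_bianchi: assumes x: "x \<in> U" shows "Rm g c x X Y Z W + Rm g c x Y Z X W + Rm g c x Z X Y W = 0"
proof -
  have s: "lcC g c x Y Z = lcC g c x Z Y" for Y Z
    by (simp add: lcC_def levi_civita_eq[OF x] lc0_def kos_sym[OF x, of "(fst Y, 0)"] kos_sym[OF x, of "(snd Y, 0)"] add.commute)
  have k: "cderiv X (\<lambda>y. kos g c y Y Z W) x = cderiv X (\<lambda>y. kos g c y Z Y W) x" for X Y Z
    by (rule cderiv_cong_open[OF U x]) (rule kos_sym)
  show ?thesis
    unfolding Rm_formula[OF x]
    using k[of X Y Z] k[of Y Z X] k[of Z X Y] s[of X Y] s[of Y Z] s[of Z X] by simp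
qed

lemma clin_Rm:
  assumes x: "x \<in> U" shows "clin (\<lambda>X. Rm g c x X Y Z W)" "clin (\<lambda>W. Rm g c x X Y Z W)"
proof -
  have ck: "clin (\<lambda>X. cderiv Y (\<lambda>y. kos g c y X Z W) x)"
  proof (rule clinI)
    fix V V' a
    have "cderiv Y (\<lambda>y. kos g c y (V + V') Z W) x = cderiv Y (\<lambda>y. kos g c y V Z W + kos g c y V' Z W) x"
      by (rule cderiv_cong_open[OF U x]) (rule clin_addD[OF clin_kos(1)])
    then show "cderiv Y (\<lambda>y. kos g c y (V + V') Z W) x = cderiv Y (\<lambda>y. kos g c y V Z W) x + cderiv Y (\<lambda>y. kos g c y V' Z W) x"
      by (simp add: cderiv_add diff_kos[OF x])
    have "cderiv Y (\<lambda>y. kos g c y (csc a V) Z W) x = cderiv Y (\<lambda>y. a * kos g c y V Z W) x"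
      by (rule cderiv_cong_open[OF U x]) (rule clin_csc[OF clin_kos(1)])
    then show "cderiv Y (\<lambda>y. kos g c y (csc a V) Z W) x = a * cderiv Y (\<lambda>y. kos g c y V Z W) x"
      by (simp add: cderiv_cmult diff_kos[OF x])
  qed
  have t2: "gC g c x (lcC g c x Y Z) (lcC g c x V W) = kos g c x V W (lcC g c x Y Z)" for V
    by (rule gC_lcC2[OF x])
  have t3: "gC g c x (lcC g c x V Z) (lcC g c x Y W) = kos g c x V Z (lcC g c x Y W)" for V
    by (rule gC_lcC[OF x])
  show "clin (\<lambda>X. Rm g c x X Y Z W)"
    unfolding Rm_formula[OF x] t2 t3
    by (intro clin_add clin_diff clin_kos ck clin_cderiv diff_kos x)
  show "clin (\<lambda>W. Rm g c x X Y Z W)"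
    unfolding Rm_def by (rule clin_gC2[OF hat[OF x]])
qed

text \<open>Write the trace over a basis in its Hermitian form.  The first Bianchi identity rewrites the
  summands in which the first two arguments are both holomorphic.\<close>

lemma Ric_formula:
  assumes x: "x \<in> U"
  shows "Ric g c x (dz i) (dzb j) = (\<Sum>k\<in>UNIV. \<Sum>l\<in>UNIV. hinv g c x k l *
    (riem g c x i l k j + riem g c x k j i l - riem g c x i j k l))"
proof -
  have E: "orthonormal_basis g c x (SOME E. orthonormal_basis g c x E)"
    using ex_orthonormal_basis[OF hat[OF x]] by (rule someI_ex)
  have 1: "Rm g c x (dz k) (dz i) (dzb j) (dzb l) = riem g c x k j i l - riem g c x i j k l" for k l
    using Rm_bianchi[OF x, of "dz k" "dz i" "dzb j" "dzb l"] Rm_antisym12[OF x, of "dz k" "dzb j" "dz i" "dzb l"]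
    by (simp add: riem_def add_eq_0_iff)
  have 2: "Rm g c x (dzb l) (dz i) (dzb j) (dz k) = riem g c x i l k j" for k l
    using Rm_antisym12[OF x, of "dzb l" "dz i" "dzb j" "dz k"] Rm_antisym34[OF x, of "dz i" "dzb l" "dzb j" "dz k"]
    by (simp add: riem_def)
  show ?thesis
    unfolding Ric_def
    by (subst orthonormal_trace[OF hat[OF x] E, of "\<lambda>Z W. Rm g c x Z (dz i) (dzb j) W"])
       (auto intro: clin_Rm[OF x] simp: 1 2 algebra_simps)
qed

subsection \<open>Components\<close>

lemma dbh: "x \<in> U \<Longrightarrow> cderiv (dzb j) (\<lambda>y. herm g c y k l) x = cnj (dh g c x j l k)"
proof -
  assume x: "x \<in> U"
  have "cnj (dh g c x j l k) = cderiv (dzb j) (\<lambda>y. cnj (herm g c y l k)) x"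
    by (simp add: dh_def cnj_cderiv[OF diff_herm[OF x]])
  also have "\<dots> = cderiv (dzb j) (\<lambda>y. herm g c y k l) x"
    by (rule cderiv_cong_open[OF U x]) (rule cnj_herm[OF hat])
  finally show ?thesis by simp
qed

lemma ddh_commute: "x \<in> U \<Longrightarrow> cderiv (dzb j) (\<lambda>y. cderiv (dz i) (\<lambda>u. herm g c u k l) y) x = ddh g c x i j k l"
  unfolding ddh_def using cderiv_commute[OF U _ smooth_herm] by simp

lemma cnj_ddh: "x \<in> U \<Longrightarrow> cnj (ddh g c x i j k l) = ddh g c x j i l k"
proof -
  assume x: "x \<in> U"
  have "cnj (ddh g c x i j k l) = cderiv (dzb i) (\<lambda>y. cnj (cderiv (dzb j) (\<lambda>u. herm g c u k l) y)) x"
    unfolding ddh_def by (simp add: cnj_cderiv[OF smooth_on_differentiable[OF U smooth_on_cderiv[OF U smooth_herm] x]])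
  also have "\<dots> = cderiv (dzb i) (\<lambda>y. cderiv (dz j) (\<lambda>u. herm g c u l k) y) x"
    by (rule cderiv_cong_open[OF U x]) (simp add: dbh dh_def)
  finally show ?thesis by (simp add: ddh_commute[OF x])
qed

lemma cderiv_gC_components:
  assumes x: "x \<in> U"
  shows "cderiv X (\<lambda>y. gC g c y (dz i) (dz j)) x = 0" "cderiv X (\<lambda>y. gC g c y (dzb i) (dzb j)) x = 0"
    "cderiv (dz i) (\<lambda>y. gC g c y (dz k) (dzb l)) x = dh g c x i k l"
    "cderiv (dz i) (\<lambda>y. gC g c y (dzb l) (dz k)) x = dh g c x i k l"
    "cderiv (dzb j) (\<lambda>y. gC g c y (dz k) (dzb l)) x = cnj (dh g c x j l k)"
    "cderiv (dzb j) (\<lambda>y. gC g c y (dzb l) (dz k)) x = cnj (dh g c x j l k)"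
proof -
  have "cderiv X (\<lambda>y. gC g c y (dz i) (dz j)) x = cderiv X (\<lambda>y. 0) x"
    by (rule cderiv_cong_open[OF U x]) (rule gC_dz_dz[OF hat])
  then show "cderiv X (\<lambda>y. gC g c y (dz i) (dz j)) x = 0" by simp
  have "cderiv X (\<lambda>y. gC g c y (dzb i) (dzb j)) x = cderiv X (\<lambda>y. 0) x"
    by (rule cderiv_cong_open[OF U x]) (rule gC_dzb_dzb[OF hat])
  then show "cderiv X (\<lambda>y. gC g c y (dzb i) (dzb j)) x = 0" by simp
  show 3: "cderiv (dz i) (\<lambda>y. gC g c y (dz k) (dzb l)) x = dh g c x i k l"
    by (simp add: dh_def herm_def)
  show 5: "cderiv (dzb j) (\<lambda>y. gC g c y (dz k) (dzb l)) x = cnj (dh g c x j l k)"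
    by (simp add: dbh[OF x, symmetric] herm_def)
  show "cderiv (dz i) (\<lambda>y. gC g c y (dzb l) (dz k)) x = dh g c x i k l"
    "cderiv (dzb j) (\<lambda>y. gC g c y (dzb l) (dz k)) x = cnj (dh g c x j l k)"
    by (simp_all add: 3 5 cderiv_gC_sym[OF x, of _ "dzb l"])
qed

text \<open>The unmixed products \<open>g(\<partial>/\<partial>z\<^sup>i, \<partial>/\<partial>z\<^sup>k)\<close> vanish, so that at most two terms of Koszul's formula
  survive: a symmetrised derivative of \<open>h\<close>, or an antisymmetrised one, that is, torsion.\<close>

lemma kos_components:
  assumes x: "x \<in> U"
  shows "kos g c x (dz i) (dz k) (dzb l) = (dh g c x i k l + dh g c x k i l) / 2"
    "kos g c x (dz i) (dz k) (dz l) = 0"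
    "kos g c x (dzb j) (dzb l) (dz p) = cnj (dh g c x j l p + dh g c x l j p) / 2"
    "kos g c x (dzb j) (dzb l) (dzb p) = 0"
    "kos g c x (dzb j) (dz k) (dzb q) = cnj (dh g c x j q k - dh g c x q j k) / 2"
    "kos g c x (dz k) (dzb j) (dzb q) = cnj (dh g c x j q k - dh g c x q j k) / 2"
    "kos g c x (dzb j) (dz k) (dz p) = (dh g c x k p j - dh g c x p k j) / 2"
    "kos g c x (dz k) (dzb j) (dz p) = (dh g c x k p j - dh g c x p k j) / 2"
  by (simp_all add: kos_def cderiv_gC_components[OF x])

lemma cderiv_kos_components:
  assumes x: "x \<in> U"
  shows "cderiv (dz i) (\<lambda>y. kos g c y (dzb j) (dz k) (dzb l)) x = (ddh g c x i j k l - ddh g c x i l k j) / 2"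
    and "cderiv (dzb j) (\<lambda>y. kos g c y (dz i) (dz k) (dzb l)) x = (ddh g c x i j k l + ddh g c x k j i l) / 2"
proof -
  have d: "cderiv Z (\<lambda>y. herm g c y k l) differentiable at x" for Z k l
    by (rule smooth_on_differentiable[OF U smooth_on_cderiv[OF U smooth_herm] x])
  have "cderiv (dz i) (\<lambda>y. kos g c y (dzb j) (dz k) (dzb l)) x =
    cderiv (dz i) (\<lambda>y. (1/2) * (cderiv (dzb j) (\<lambda>y. herm g c y k l) y - cderiv (dzb l) (\<lambda>y. herm g c y k j) y)) x"
    by (rule cderiv_cong_open[OF U x]) (simp add: kos_components dbh)
  also have "\<dots> = (ddh g c x i j k l - ddh g c x i l k j) / 2"
    by (subst cderiv_cmult) (auto intro!: differentiable_diff d simp: cderiv_diff d ddh_def)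
  finally show "cderiv (dz i) (\<lambda>y. kos g c y (dzb j) (dz k) (dzb l)) x = (ddh g c x i j k l - ddh g c x i l k j) / 2" .
  have "cderiv (dzb j) (\<lambda>y. kos g c y (dz i) (dz k) (dzb l)) x =
    cderiv (dzb j) (\<lambda>y. (1/2) * (cderiv (dz i) (\<lambda>y. herm g c y k l) y + cderiv (dz k) (\<lambda>y. herm g c y i l) y)) x"
    by (rule cderiv_cong_open[OF U x]) (simp add: kos_components dh_def)
  also have "\<dots> = (ddh g c x i j k l + ddh g c x k j i l) / 2"
    by (subst cderiv_cmult) (auto intro!: differentiable_add d simp: cderiv_add d ddh_commute[OF x])
  finally show "cderiv (dzb j) (\<lambda>y. kos g c y (dz i) (dz k) (dzb l)) x = (ddh g c x i j k l + ddh g c x k j i l) / 2" .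
qed

text \<open>The first product comes from the unmixed Christoffel symbols, which are of type (1,0) or (0,1).
  The other two come from the mixed ones, whose (1,0)- and (0,1)-parts are both torsion.\<close>

lemma riem_components:
  assumes x: "x \<in> U"
  shows "riem g c x i j k l = - (ddh g c x i l k j + ddh g c x k j i l) / 2 + (\<Sum>p\<in>UNIV. \<Sum>q\<in>UNIV. hinv g c x p q *
    ((dh g c x i k q + dh g c x k i q) * cnj (dh g c x j l p + dh g c x l j p)
     - cnj (dh g c x j q k - dh g c x q j k) * (dh g c x i p l - dh g c x p i l)
     - (dh g c x k p j - dh g c x p k j) * cnj (dh g c x l q i - dh g c x q l i))) / 4"
proof -
  let ?S = "\<Sum>p\<in>UNIV. \<Sum>q\<in>UNIV. hinv g c x p q *
    ((dh g c x i k q + dh g c x k i q) * cnj (dh g c x j l p + dh g c x l j p)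
     - cnj (dh g c x j q k - dh g c x q j k) * (dh g c x i p l - dh g c x p i l)
     - (dh g c x k p j - dh g c x p k j) * cnj (dh g c x l q i - dh g c x q l i))"
  have "gC g c x (lcC g c x (dz i) (dz k)) (lcC g c x (dzb j) (dzb l)) -
    gC g c x (lcC g c x (dzb j) (dz k)) (lcC g c x (dz i) (dzb l)) = ?S / 4"
    unfolding gC_hinv[OF hat[OF x], of "lcC g c x _ _" "lcC g c x _ _"]
    unfolding gC_lcC[OF x] kos_components[OF x]
      sum_subtractf[symmetric] sum_divide_distrib
    by (intro sum.cong refl) (simp add: field_simps)
  then show ?thesis
    unfolding riem_def Rm_formula[OF x] cderiv_kos_components[OF x] by (simp add: field_simps)
qed

text \<open>Compared with the Riemann tensor, the (0,1)-part of the mixed Christoffel symbol is projected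
  away, which removes the last product.\<close>

lemma lc_curv_components:
  assumes x: "x \<in> U"
  shows "lc_curv g c x i j k l = - (ddh g c x i l k j + ddh g c x k j i l) / 2 + (\<Sum>p\<in>UNIV. \<Sum>q\<in>UNIV. hinv g c x p q *
    ((dh g c x i k q + dh g c x k i q) * cnj (dh g c x j l p + dh g c x l j p)
     - cnj (dh g c x j q k - dh g c x q j k) * (dh g c x i p l - dh g c x p i l))) / 4"
proof -
  have p: "gC g c x (proj10 V) (dzb q) = gC g c x V (dzb q)" "gC g c x (proj10 V) (dz q) = 0" for V q
    by (simp_all add: gC_dzb[OF hat[OF x]] gC_dz[OF hat[OF x]])
  let ?S = "\<Sum>p\<in>UNIV. \<Sum>q\<in>UNIV. hinv g c x p q *
    ((dh g c x i k q + dh g c x k i q) * cnj (dh g c x j l p + dh g c x l j p)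
     - cnj (dh g c x j q k - dh g c x q j k) * (dh g c x i p l - dh g c x p i l))"
  have "gC g c x (proj10 (lcC g c x (dz i) (dz k))) (lcC g c x (dzb j) (dzb l)) -
    gC g c x (proj10 (lcC g c x (dzb j) (dz k))) (lcC g c x (dz i) (dzb l)) = ?S / 4"
    unfolding gC_hinv[OF hat[OF x], of "proj10 _" "lcC g c x _ _"] p gC_lcC[OF x] kos_components[OF x]
      sum_subtractf[symmetric] sum_divide_distrib
    by (intro sum.cong refl) (simp add: field_simps)
  then show ?thesis
    unfolding lc_curv_formula[OF x] cderiv_kos_components[OF x] by (simp add: field_simps)
qed

lemma chern_components:
  assumes x: "x \<in> U"
  shows "chern g c x i j k l = - ddh g c x i j k l +
    (\<Sum>p\<in>UNIV. \<Sum>q\<in>UNIV. hinv g c x p q * (cnj (dh g c x j l p) * dh g c x i k q))"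
  unfolding chern_def ddh_def[symmetric] dbh[OF x] dh_def[symmetric] by (simp add: mult.assoc)

end

section \<open>Traces of the curvature components\<close>

text \<open>The trace of a (1,1)-tensor by \<open>h\<close>, which is going to be the inverse metric.\<close>

definition tr2 :: "('n::finite \<Rightarrow> 'n \<Rightarrow> complex) \<Rightarrow> ('n \<Rightarrow> 'n \<Rightarrow> complex) \<Rightarrow> complex" where
  "tr2 h f = (\<Sum>k\<in>UNIV. \<Sum>l\<in>UNIV. h k l * f k l)"

definition tr4 :: "('n::finite \<Rightarrow> 'n \<Rightarrow> complex) \<Rightarrow> ('n \<Rightarrow> 'n \<Rightarrow> 'n \<Rightarrow> 'n \<Rightarrow> complex) \<Rightarrow> complex" where
  "tr4 h f = tr2 h (\<lambda>k l. tr2 h (f k l))"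

lemma tr2_add: "tr2 h (\<lambda>k l. f k l + f' k l) = tr2 h f + tr2 h f'"
  and tr2_diff: "tr2 h (\<lambda>k l. f k l - f' k l) = tr2 h f - tr2 h f'"
  and tr2_cmult: "tr2 h (\<lambda>k l. a * f k l) = a * tr2 h f"
  by (simp_all add: tr2_def sum.distrib sum_subtractf distrib_left right_diff_distrib sum_distrib_left mult_ac)

lemma tr4_add: "tr4 h (\<lambda>k l p q. f k l p q + f' k l p q) = tr4 h f + tr4 h f'"
  and tr4_diff: "tr4 h (\<lambda>k l p q. f k l p q - f' k l p q) = tr4 h f - tr4 h f'"
  and tr4_cmult: "tr4 h (\<lambda>k l p q. a * f k l p q) = a * tr4 h f"
  by (simp_all add: tr4_def tr2_add tr2_diff tr2_cmult)

lemmas tr_linear = tr2_add tr2_diff tr2_cmult tr4_add tr4_diff tr4_cmult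

lemma tr2_swap: "tr2 h (\<lambda>k l. tr2 h' (\<lambda>p q. f k l p q)) = tr2 h' (\<lambda>p q. tr2 h (\<lambda>k l. f k l p q))"
proof -
  have "(\<Sum>k\<in>UNIV. \<Sum>l\<in>UNIV. \<Sum>p\<in>UNIV. \<Sum>q\<in>UNIV. F k l p q) = (\<Sum>p\<in>UNIV. \<Sum>q\<in>UNIV. \<Sum>k\<in>UNIV. \<Sum>l\<in>UNIV. F k l p q)"
    for F :: "'a \<Rightarrow> 'a \<Rightarrow> 'b \<Rightarrow> 'b \<Rightarrow> complex"
  proof -
    have "(\<Sum>k\<in>UNIV. \<Sum>l\<in>UNIV. \<Sum>p\<in>UNIV. \<Sum>q\<in>UNIV. F k l p q) = (\<Sum>k\<in>UNIV. \<Sum>p\<in>UNIV. \<Sum>l\<in>UNIV. \<Sum>q\<in>UNIV. F k l p q)"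
      by (intro sum.cong refl sum.swap)
    also have "\<dots> = (\<Sum>p\<in>UNIV. \<Sum>k\<in>UNIV. \<Sum>q\<in>UNIV. \<Sum>l\<in>UNIV. F k l p q)"
      by (subst sum.swap) (intro sum.cong refl sum.swap)
    also have "\<dots> = (\<Sum>p\<in>UNIV. \<Sum>q\<in>UNIV. \<Sum>k\<in>UNIV. \<Sum>l\<in>UNIV. F k l p q)"
      by (intro sum.cong refl sum.swap)
    finally show ?thesis .
  qed
  then show ?thesis
    by (simp add: tr2_def sum_distrib_left mult.left_commute)
qed

text \<open>Exchanging the two contracted pairs of indices does not change a double trace.  All
  identities between double traces that are needed follow from this symmetry alone.\<close>

lemma tr4_eq_0:
  assumes "\<And>k l p q. f k l p q + f p q k l = 0"
  shows "tr4 h f = 0"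
proof -
  have "tr4 h f = tr4 h (\<lambda>k l p q. f p q k l)"
    unfolding tr4_def by (rule tr2_swap)
  then have "2 * tr4 h f = tr4 h (\<lambda>k l p q. f k l p q + f p q k l)"
    by (simp add: tr4_add)
  also have "\<dots> = 0" by (simp add: assms tr4_def tr2_def)
  finally show ?thesis by simp
qed

text \<open>All curvatures have the shape (linear in second derivatives of \<open>h\<close>) + (quadratic in first
  derivatives).  In the following definitions \<open>a i k l\<close> stands for \<open>\<partial>\<^sub>i h\<^sub>k\<^sub>l\<close> and \<open>D i j k l\<close> for
  \<open>\<partial>\<^sub>i \<partial>\<^sub>j h\<^sub>k\<^sub>l\<close>, with \<open>j\<close> and \<open>l\<close> barred.\<close>

definition lcD :: "('n \<Rightarrow> 'n \<Rightarrow> 'n \<Rightarrow> 'n \<Rightarrow> complex) \<Rightarrow> 'n \<Rightarrow> 'n \<Rightarrow> 'n \<Rightarrow> 'n \<Rightarrow> complex" where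
  "lcD D i j k l = - (D i l k j + D k j i l) / 2"

definition lcQ :: "('n \<Rightarrow> 'n \<Rightarrow> 'n \<Rightarrow> complex) \<Rightarrow> 'n \<Rightarrow> 'n \<Rightarrow> 'n \<Rightarrow> 'n \<Rightarrow> 'n \<Rightarrow> 'n \<Rightarrow> complex" where
  "lcQ a i j k l p q = ((a i k q + a k i q) * cnj (a j l p + a l j p)
     - cnj (a j q k - a q j k) * (a i p l - a p i l)) / 4"

definition riemQ :: "('n \<Rightarrow> 'n \<Rightarrow> 'n \<Rightarrow> complex) \<Rightarrow> 'n \<Rightarrow> 'n \<Rightarrow> 'n \<Rightarrow> 'n \<Rightarrow> 'n \<Rightarrow> 'n \<Rightarrow> complex" where
  "riemQ a i j k l p q = ((a i k q + a k i q) * cnj (a j l p + a l j p)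
     - cnj (a j q k - a q j k) * (a i p l - a p i l)
     - (a k p j - a p k j) * cnj (a l q i - a q l i)) / 4"

definition chernQ :: "('n \<Rightarrow> 'n \<Rightarrow> 'n \<Rightarrow> complex) \<Rightarrow> 'n \<Rightarrow> 'n \<Rightarrow> 'n \<Rightarrow> 'n \<Rightarrow> 'n \<Rightarrow> 'n \<Rightarrow> complex" where
  "chernQ a i j k l p q = cnj (a j l p) * a i k q"

text \<open>\<open>dpsi\<close> and \<open>dbpsi\<close> are the components of \<open>\<partial>\<partial>\<^sup>*\<omega>\<close> and of its conjugate; \<open>Lform\<close> belongs to
  \<open>\<i>\<Lambda>(\<partial>\<partial>\<omega>)\<close> with the second \<open>\<partial>\<close> barred; \<open>TBform\<close>, \<open>TCform\<close>, \<open>TSform\<close> and \<open>cTSform\<close> belong to the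
  quadratic torsion forms \<open>T_box\<close>, \<open>T_circ\<close>, \<open>T_sharp\<close> and to the conjugate of the last.\<close>

definition dpsi where
  "dpsi h a D i j = - \<i> * (tr2 h (\<lambda>k l. D i j k l - D i l k j)
     - tr4 h (\<lambda>k l p q. a i p l * cnj (a j q k - a q j k)))"

definition dbpsi where
  "dbpsi h a D i j = - \<i> * (tr2 h (\<lambda>k l. D i j k l - D k j i l)
     - tr4 h (\<lambda>k l p q. cnj (a j q k) * (a i p l - a p i l)))"

definition Lform where
  "Lform h D i j = \<i> * tr2 h (\<lambda>p q. D p q i j - D p j i q - D i q p j + D i j p q)"

definition TBform where
  "TBform h a i j = tr4 h (\<lambda>k l p q. (a i p l - a p i l) * cnj (a j q k - a q j k))"

definition TCform where
  "TCform h a i j = tr4 h (\<lambda>k l p q. (a k p j - a p k j) * cnj (a l q i - a q l i))"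

definition TSform where
  "TSform h a i j = - \<i> * tr4 h (\<lambda>k l p q. (a p i j - a i p j) * cnj (a q l k - a l q k))"

definition cTSform where
  "cTSform h a i j = - \<i> * tr4 h (\<lambda>k l p q. cnj (a q j i - a j q i) * (a p k l - a k p l))"

named_theorems curv_unfold
declare lcQ_def[curv_unfold] riemQ_def[curv_unfold] chernQ_def[curv_unfold] lcD_def[curv_unfold]

text \<open>The pointwise content of the theorem: every trace of a curvature differs from the trace \<open>Th1\<close>,
  the component of \<open>\<Theta>\<^sup>(\<^sup>1\<^sup>)\<close>, by a combination of the forms above.  In each case the terms with second
  derivatives cancel literally, and the double traces cancel after exchanging the two contracted
  pairs.\<close>

context
  fixes h :: "'n::finite \<Rightarrow> 'n \<Rightarrow> complex" and a :: "'n \<Rightarrow> 'n \<Rightarrow> 'n \<Rightarrow> complex"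
    and D :: "'n \<Rightarrow> 'n \<Rightarrow> 'n \<Rightarrow> 'n \<Rightarrow> complex" and i j :: 'n
begin

definition "Th1 = \<i> * (tr2 h (\<lambda>k l. - D i j k l) + tr4 h (\<lambda>k l p q. chernQ a i j k l p q))"

lemmas ricdefs = Th1_def dpsi_def dbpsi_def Lform_def TBform_def TCform_def TSform_def cTSform_def

lemma tr_chern2: "\<i> * (tr2 h (\<lambda>k l. - D k l i j) + tr4 h (\<lambda>k l p q. chernQ a k l i j p q)) =
  Th1 - 1 * Lform h D i j - 1 * dpsi h a D i j - 1 * dbpsi h a D i j + 1 * (\<i> * TBform h a i j)" (is "?l = ?r")
proof -
  have F: "tr2 h (\<lambda>k l. - D k l i j - - D i j k l + 1 * (D k l i j - D k j i l - D i l k j + D i j k l) - 1 * (D i j k l - D i l k j) - 1 * (D i j k l - D k j i l)) = 0"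
    by (simp add: tr2_def curv_unfold field_simps)
  have G: "tr4 h (\<lambda>k l p q. chernQ a k l i j p q - chernQ a i j k l p q + 1 * (a i p l * cnj (a j q k - a q j k)) + 1 * (cnj (a j q k) * (a i p l - a p i l)) - 1 * ((a i p l - a p i l) * cnj (a j q k - a q j k))) = 0"
    by (rule tr4_eq_0) (simp add: curv_unfold field_simps)
  show ?thesis
    using F G unfolding ricdefs tr_linear by algebra
qed

lemma tr_chern3: "\<i> * (tr2 h (\<lambda>k l. - D i l k j) + tr4 h (\<lambda>k l p q. chernQ a i l k j p q)) =
  Th1 - 1 * dpsi h a D i j" (is "?l = ?r")
proof -
  have F: "tr2 h (\<lambda>k l. - D i l k j - - D i j k l - 1 * (D i j k l - D i l k j)) = 0"
    by (simp add: tr2_def curv_unfold field_simps)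
  have G: "tr4 h (\<lambda>k l p q. chernQ a i l k j p q - chernQ a i j k l p q + 1 * (a i p l * cnj (a j q k - a q j k))) = 0"
    by (rule tr4_eq_0) (simp add: curv_unfold field_simps)
  show ?thesis
    using F G unfolding ricdefs tr_linear by algebra
qed

lemma tr_chern4: "\<i> * (tr2 h (\<lambda>k l. - D k j i l) + tr4 h (\<lambda>k l p q. chernQ a k j i l p q)) =
  Th1 - 1 * dbpsi h a D i j" (is "?l = ?r")
proof -
  have F: "tr2 h (\<lambda>k l. - D k j i l - - D i j k l - 1 * (D i j k l - D k j i l)) = 0"
    by (simp add: tr2_def curv_unfold field_simps)
  have G: "tr4 h (\<lambda>k l p q. chernQ a k j i l p q - chernQ a i j k l p q + 1 * (cnj (a j q k) * (a i p l - a p i l))) = 0"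
    by (rule tr4_eq_0) (simp add: curv_unfold field_simps)
  show ?thesis
    using F G unfolding ricdefs tr_linear by algebra
qed

lemma tr_lc1: "\<i> * (tr2 h (\<lambda>k l. lcD D i j k l) + tr4 h (\<lambda>k l p q. lcQ a i j k l p q)) =
  Th1 - (1/2) * dpsi h a D i j - (1/2) * dbpsi h a D i j" (is "?l = ?r")
proof -
  have F: "tr2 h (\<lambda>k l. lcD D i j k l - - D i j k l - (1/2) * (D i j k l - D i l k j) - (1/2) * (D i j k l - D k j i l)) = 0"
    by (simp add: tr2_def curv_unfold field_simps)
  have G: "tr4 h (\<lambda>k l p q. lcQ a i j k l p q - chernQ a i j k l p q + (1/2) * (a i p l * cnj (a j q k - a q j k)) + (1/2) * (cnj (a j q k) * (a i p l - a p i l))) = 0"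
    by (rule tr4_eq_0) (simp add: curv_unfold field_simps)
  show ?thesis
    using F G unfolding ricdefs tr_linear by algebra
qed

lemma tr_lc2: "\<i> * (tr2 h (\<lambda>k l. lcD D k l i j) + tr4 h (\<lambda>k l p q. lcQ a k l i j p q)) =
  Th1 - (1/2) * dpsi h a D i j - (1/2) * dbpsi h a D i j - (1/4) * (\<i> * TCform h a i j) + (1/4) * (\<i> * TBform h a i j)" (is "?l = ?r")
proof -
  have F: "tr2 h (\<lambda>k l. lcD D k l i j - - D i j k l - (1/2) * (D i j k l - D i l k j) - (1/2) * (D i j k l - D k j i l)) = 0"
    by (simp add: tr2_def curv_unfold field_simps)
  have G: "tr4 h (\<lambda>k l p q. lcQ a k l i j p q - chernQ a i j k l p q + (1/2) * (a i p l * cnj (a j q k - a q j k)) + (1/2) * (cnj (a j q k) * (a i p l - a p i l)) + (1/4) * ((a k p j - a p k j) * cnj (a l q i - a q l i)) - (1/4) * ((a i p l - a p i l) * cnj (a j q k - a q j k))) = 0"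
    by (rule tr4_eq_0) (simp add: curv_unfold field_simps)
  show ?thesis
    using F G unfolding ricdefs tr_linear by algebra
qed

lemma tr_lc3: "\<i> * (tr2 h (\<lambda>k l. lcD D i l k j) + tr4 h (\<lambda>k l p q. lcQ a i l k j p q)) =
  Th1 - (1/2) * Lform h D i j - (1/2) * dpsi h a D i j - (1/2) * dbpsi h a D i j + (1/4) * (\<i> * TBform h a i j) + (1/4) * TSform h a i j" (is "?l = ?r")
proof -
  have F: "tr2 h (\<lambda>k l. lcD D i l k j - - D i j k l + (1/2) * (D k l i j - D k j i l - D i l k j + D i j k l) - (1/2) * (D i j k l - D i l k j) - (1/2) * (D i j k l - D k j i l)) = 0"
    by (simp add: tr2_def curv_unfold field_simps)
  have G: "tr4 h (\<lambda>k l p q. lcQ a i l k j p q - chernQ a i j k l p q + (1/2) * (a i p l * cnj (a j q k - a q j k)) + (1/2) * (cnj (a j q k) * (a i p l - a p i l)) - (1/4) * ((a i p l - a p i l) * cnj (a j q k - a q j k)) + (1/4) * ((a p i j - a i p j) * cnj (a q l k - a l q k))) = 0"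
    by (rule tr4_eq_0) (simp add: curv_unfold field_simps)
  show ?thesis
    using F G unfolding ricdefs tr_linear by algebra
qed

lemma tr_lc4: "\<i> * (tr2 h (\<lambda>k l. lcD D k j i l) + tr4 h (\<lambda>k l p q. lcQ a k j i l p q)) =
  Th1 - (1/2) * Lform h D i j - (1/2) * dpsi h a D i j - (1/2) * dbpsi h a D i j + (1/4) * (\<i> * TBform h a i j) + (1/4) * cTSform h a i j" (is "?l = ?r")
proof -
  have F: "tr2 h (\<lambda>k l. lcD D k j i l - - D i j k l + (1/2) * (D k l i j - D k j i l - D i l k j + D i j k l) - (1/2) * (D i j k l - D i l k j) - (1/2) * (D i j k l - D k j i l)) = 0"
    by (simp add: tr2_def curv_unfold field_simps)
  have G: "tr4 h (\<lambda>k l p q. lcQ a k j i l p q - chernQ a i j k l p q + (1/2) * (a i p l * cnj (a j q k - a q j k)) + (1/2) * (cnj (a j q k) * (a i p l - a p i l)) - (1/4) * ((a i p l - a p i l) * cnj (a j q k - a q j k)) + (1/4) * (cnj (a q j i - a j q i) * (a p k l - a k p l))) = 0"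
    by (rule tr4_eq_0) (simp add: curv_unfold field_simps)
  show ?thesis
    using F G unfolding ricdefs tr_linear by algebra
qed

lemma tr_riem1: "\<i> * (tr2 h (\<lambda>k l. lcD D i j k l) + tr4 h (\<lambda>k l p q. riemQ a i j k l p q)) =
  Th1 - (1/2) * dpsi h a D i j - (1/2) * dbpsi h a D i j - (1/4) * (\<i> * TCform h a i j)" (is "?l = ?r")
proof -
  have F: "tr2 h (\<lambda>k l. lcD D i j k l - - D i j k l - (1/2) * (D i j k l - D i l k j) - (1/2) * (D i j k l - D k j i l)) = 0"
    by (simp add: tr2_def curv_unfold field_simps)
  have G: "tr4 h (\<lambda>k l p q. riemQ a i j k l p q - chernQ a i j k l p q + (1/2) * (a i p l * cnj (a j q k - a q j k)) + (1/2) * (cnj (a j q k) * (a i p l - a p i l)) + (1/4) * ((a k p j - a p k j) * cnj (a l q i - a q l i))) = 0"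
    by (rule tr4_eq_0) (simp add: curv_unfold field_simps)
  show ?thesis
    using F G unfolding ricdefs tr_linear by algebra
qed

lemma tr_riem2: "\<i> * (tr2 h (\<lambda>k l. lcD D k l i j) + tr4 h (\<lambda>k l p q. riemQ a k l i j p q)) =
  Th1 - (1/2) * dpsi h a D i j - (1/2) * dbpsi h a D i j - (1/4) * (\<i> * TCform h a i j)" (is "?l = ?r")
proof -
  have F: "tr2 h (\<lambda>k l. lcD D k l i j - - D i j k l - (1/2) * (D i j k l - D i l k j) - (1/2) * (D i j k l - D k j i l)) = 0"
    by (simp add: tr2_def curv_unfold field_simps)
  have G: "tr4 h (\<lambda>k l p q. riemQ a k l i j p q - chernQ a i j k l p q + (1/2) * (a i p l * cnj (a j q k - a q j k)) + (1/2) * (cnj (a j q k) * (a i p l - a p i l)) + (1/4) * ((a k p j - a p k j) * cnj (a l q i - a q l i))) = 0"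
    by (rule tr4_eq_0) (simp add: curv_unfold field_simps)
  show ?thesis
    using F G unfolding ricdefs tr_linear by algebra
qed

lemma tr_riem3: "\<i> * (tr2 h (\<lambda>k l. lcD D i l k j) + tr4 h (\<lambda>k l p q. riemQ a i l k j p q)) =
  Th1 - (1/2) * Lform h D i j - (1/2) * dpsi h a D i j - (1/2) * dbpsi h a D i j + (1/4) * (\<i> * TBform h a i j) + (1/4) * TSform h a i j + (1/4) * cTSform h a i j" (is "?l = ?r")
proof -
  have F: "tr2 h (\<lambda>k l. lcD D i l k j - - D i j k l + (1/2) * (D k l i j - D k j i l - D i l k j + D i j k l) - (1/2) * (D i j k l - D i l k j) - (1/2) * (D i j k l - D k j i l)) = 0"
    by (simp add: tr2_def curv_unfold field_simps)
  have G: "tr4 h (\<lambda>k l p q. riemQ a i l k j p q - chernQ a i j k l p q + (1/2) * (a i p l * cnj (a j q k - a q j k)) + (1/2) * (cnj (a j q k) * (a i p l - a p i l)) - (1/4) * ((a i p l - a p i l) * cnj (a j q k - a q j k)) + (1/4) * ((a p i j - a i p j) * cnj (a q l k - a l q k)) + (1/4) * (cnj (a q j i - a j q i) * (a p k l - a k p l))) = 0"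
    by (rule tr4_eq_0) (simp add: curv_unfold field_simps)
  show ?thesis
    using F G unfolding ricdefs tr_linear by algebra
qed

lemma tr_riem4: "\<i> * (tr2 h (\<lambda>k l. lcD D k j i l) + tr4 h (\<lambda>k l p q. riemQ a k j i l p q)) =
  Th1 - (1/2) * Lform h D i j - (1/2) * dpsi h a D i j - (1/2) * dbpsi h a D i j + (1/4) * (\<i> * TBform h a i j) + (1/4) * TSform h a i j + (1/4) * cTSform h a i j" (is "?l = ?r")
proof -
  have F: "tr2 h (\<lambda>k l. lcD D k j i l - - D i j k l + (1/2) * (D k l i j - D k j i l - D i l k j + D i j k l) - (1/2) * (D i j k l - D i l k j) - (1/2) * (D i j k l - D k j i l)) = 0"
    by (simp add: tr2_def curv_unfold field_simps)
  have G: "tr4 h (\<lambda>k l p q. riemQ a k j i l p q - chernQ a i j k l p q + (1/2) * (a i p l * cnj (a j q k - a q j k)) + (1/2) * (cnj (a j q k) * (a i p l - a p i l)) - (1/4) * ((a i p l - a p i l) * cnj (a j q k - a q j k)) + (1/4) * ((a p i j - a i p j) * cnj (a q l k - a l q k)) + (1/4) * (cnj (a q j i - a j q i) * (a p k l - a k p l))) = 0"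
    by (rule tr4_eq_0) (simp add: curv_unfold field_simps)
  show ?thesis
    using F G unfolding ricdefs tr_linear by algebra
qed

end

section \<open>Torsion and \<open>\<partial>\<^sup>*\<omega>\<close> in a chart\<close>

text \<open>The components of \<open>\<partial>\<^sup>*\<omega>\<close>: up to a constant, the contraction of the conjugate of \<open>\<partial>\<omega>\<close> with the
  inverse metric.\<close>

definition psi :: "('m, 'n) metric \<Rightarrow> ('m, 'n::finite) chart \<Rightarrow> complex^'n \<Rightarrow> 'n \<Rightarrow> complex" where
  "psi g c x s = - \<i> * tr2 (hinv g c x) (\<lambda>k l. cnj (dh g c x s l k - dh g c x l s k))"

lemma cnj_tr2:
  assumes "\<And>k l. cnj (h k l) = h l k"
  shows "cnj (tr2 h f) = tr2 h (\<lambda>k l. cnj (f l k))"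
  unfolding tr2_def by (simp add: assms) (rule sum.swap)

context hermitian_chart
begin

text \<open>Lowering the upper index of the torsion removes the inverse metric from its definition.\<close>

lemma herm_torsion:
  assumes x: "x \<in> U"
  shows "(\<Sum>k\<in>UNIV. herm g c x k l * torsion g c x i p k) = dh g c x i p l - dh g c x p i l"
proof -
  have "(\<Sum>k\<in>UNIV. herm g c x k l * torsion g c x i p k) =
    (\<Sum>m\<in>UNIV. (\<Sum>k\<in>UNIV. hinv g c x k m * herm g c x k l) * (dh g c x i p m - dh g c x p i m))"
    unfolding torsion_def dh_def[symmetric] sum_distrib_left sum_distrib_right
    by (subst sum.swap) (simp add: mult_ac)
  then show ?thesis by (simp add: herm_hinv[OF hat[OF x]])
qed

lemma cnj_herm_torsion:
  assumes x: "x \<in> U"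
  shows "(\<Sum>l\<in>UNIV. herm g c x i l * cnj (torsion g c x t q l)) = cnj (dh g c x t q i - dh g c x q t i)"
  using arg_cong[OF herm_torsion[OF x, of i t q], of cnj] by (simp add: cnj_herm[OF hat[OF x]])

lemma T_box_component:
  assumes x: "x \<in> U"
  shows "(\<Sum>p\<in>UNIV. \<Sum>q\<in>UNIV. \<Sum>k\<in>UNIV. \<Sum>l\<in>UNIV.
     hinv g c x p q * herm g c x k l * torsion g c x i p k * cnj (torsion g c x j q l)) =
     TBform (hinv g c x) (dh g c x) i j"
proof -
  have e: "(\<Sum>k\<in>UNIV. \<Sum>l\<in>UNIV. hinv g c x p q * herm g c x k l * torsion g c x i p k * cnj (torsion g c x j q l)) =
     hinv g c x p q * tr2 (hinv g c x) (\<lambda>k l. (dh g c x i p l - dh g c x p i l) * cnj (dh g c x j q k - dh g c x q j k))" for p q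
  proof -
    have "(\<Sum>k\<in>UNIV. \<Sum>l\<in>UNIV. hinv g c x p q * herm g c x k l * torsion g c x i p k * cnj (torsion g c x j q l)) =
       hinv g c x p q * (\<Sum>l\<in>UNIV. (\<Sum>k\<in>UNIV. herm g c x k l * torsion g c x i p k) * cnj (torsion g c x j q l))"
      unfolding sum_distrib_left sum_distrib_right by (subst sum.swap) (simp add: mult_ac)
    also have "(\<Sum>l\<in>UNIV. (\<Sum>k\<in>UNIV. herm g c x k l * torsion g c x i p k) * cnj (torsion g c x j q l)) =
       (\<Sum>l\<in>UNIV. (dh g c x i p l - dh g c x p i l) * (\<Sum>k\<in>UNIV. hinv g c x k l * cnj (dh g c x j q k - dh g c x q j k)))"
      unfolding herm_torsion[OF x] by (simp add: torsion_def dh_def[symmetric] cnj_hinv[OF hat[OF x]])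
    also have "\<dots> = tr2 (hinv g c x) (\<lambda>k l. (dh g c x i p l - dh g c x p i l) * cnj (dh g c x j q k - dh g c x q j k))"
      unfolding tr2_def sum_distrib_left by (subst sum.swap) (simp add: mult_ac)
    finally show ?thesis .
  qed
  have "(\<Sum>p\<in>UNIV. \<Sum>q\<in>UNIV. \<Sum>k\<in>UNIV. \<Sum>l\<in>UNIV.
     hinv g c x p q * herm g c x k l * torsion g c x i p k * cnj (torsion g c x j q l)) =
    tr2 (hinv g c x) (\<lambda>p q. tr2 (hinv g c x) (\<lambda>k l. (dh g c x i p l - dh g c x p i l) * cnj (dh g c x j q k - dh g c x q j k)))"
    unfolding e by (simp add: tr2_def)
  also have "\<dots> = TBform (hinv g c x) (dh g c x) i j"
    unfolding TBform_def tr4_def by (rule tr2_swap)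
  finally show ?thesis .
qed

lemma T_circ_component:
  assumes x: "x \<in> U"
  shows "(\<Sum>p\<in>UNIV. \<Sum>q\<in>UNIV. \<Sum>s\<in>UNIV. \<Sum>t\<in>UNIV. \<Sum>k\<in>UNIV. \<Sum>l\<in>UNIV.
       hinv g c x p q * hinv g c x s t * herm g c x k j * herm g c x i l *
       torsion g c x s p k * cnj (torsion g c x t q l)) = TCform (hinv g c x) (dh g c x) i j"
proof -
  have e: "(\<Sum>k\<in>UNIV. \<Sum>l\<in>UNIV. hinv g c x p q * hinv g c x s t * herm g c x k j * herm g c x i l *
       torsion g c x s p k * cnj (torsion g c x t q l)) =
     hinv g c x p q * (hinv g c x s t * ((dh g c x s p j - dh g c x p s j) * cnj (dh g c x t q i - dh g c x q t i)))" for p q s t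
  proof -
    have "(\<Sum>k\<in>UNIV. \<Sum>l\<in>UNIV. hinv g c x p q * hinv g c x s t * herm g c x k j * herm g c x i l *
       torsion g c x s p k * cnj (torsion g c x t q l)) =
      hinv g c x p q * (hinv g c x s t * ((\<Sum>k\<in>UNIV. herm g c x k j * torsion g c x s p k) *
        (\<Sum>l\<in>UNIV. herm g c x i l * cnj (torsion g c x t q l))))"
      unfolding sum_product by (simp add: sum_distrib_left mult_ac)
    then show ?thesis by (simp only: herm_torsion[OF x] cnj_herm_torsion[OF x])
  qed
  have "(\<Sum>p\<in>UNIV. \<Sum>q\<in>UNIV. \<Sum>s\<in>UNIV. \<Sum>t\<in>UNIV. \<Sum>k\<in>UNIV. \<Sum>l\<in>UNIV.
       hinv g c x p q * hinv g c x s t * herm g c x k j * herm g c x i l *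
       torsion g c x s p k * cnj (torsion g c x t q l)) =
    tr2 (hinv g c x) (\<lambda>p q. tr2 (hinv g c x) (\<lambda>s t. (dh g c x s p j - dh g c x p s j) * cnj (dh g c x t q i - dh g c x q t i)))"
    unfolding e by (simp add: tr2_def sum_distrib_left)
  also have "\<dots> = TCform (hinv g c x) (dh g c x) i j"
    unfolding TCform_def tr4_def by (rule tr2_swap)
  finally show ?thesis .
qed

lemma T_sharp_component:
  assumes x: "x \<in> U"
  shows "(\<Sum>p\<in>UNIV. \<Sum>k\<in>UNIV. herm g c x k j * torsion g c x p i k * (\<Sum>s\<in>UNIV. hinv g c x p s * psi g c x s)) =
    TSform (hinv g c x) (dh g c x) i j"
proof -
  have "(\<Sum>p\<in>UNIV. \<Sum>k\<in>UNIV. herm g c x k j * torsion g c x p i k * (\<Sum>s\<in>UNIV. hinv g c x p s * psi g c x s)) =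
    (\<Sum>p\<in>UNIV. (dh g c x p i j - dh g c x i p j) * (\<Sum>s\<in>UNIV. hinv g c x p s * psi g c x s))"
    by (simp only: sum_distrib_right[symmetric] herm_torsion[OF x])
  also have "\<dots> = tr2 (hinv g c x) (\<lambda>p q. (dh g c x p i j - dh g c x i p j) * psi g c x q)"
    by (simp add: tr2_def sum_distrib_left mult_ac)
  also have "\<dots> = - \<i> * tr2 (hinv g c x) (\<lambda>p q. tr2 (hinv g c x) (\<lambda>k l. (dh g c x p i j - dh g c x i p j) * cnj (dh g c x q l k - dh g c x l q k)))"
    unfolding psi_def tr2_cmult[symmetric] by (simp add: tr2_cmult mult_ac)
  also have "\<dots> = TSform (hinv g c x) (dh g c x) i j"
    unfolding TSform_def tr4_def by (subst tr2_swap) (rule refl)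
  finally show ?thesis .
qed

lemma cnj_TSform:
  assumes x: "x \<in> U"
  shows "- cnj (TSform (hinv g c x) (dh g c x) j i) = cTSform (hinv g c x) (dh g c x) i j"
  unfolding TSform_def cTSform_def tr4_def
  by (simp add: cnj_tr2 cnj_hinv[OF hat[OF x]])

lemma smooth_dh: "smooth_on (\<lambda>x. dh g c x i k l) U"
  unfolding dh_def by (rule smooth_on_cderiv[OF U smooth_herm])

lemma smooth_ddh: "smooth_on (\<lambda>x. ddh g c x i j k l) U"
  unfolding ddh_def by (intro smooth_on_cderiv[OF U] smooth_herm)

lemma smooth_tr2:
  "(\<And>k l. smooth_on (\<lambda>x. f x k l) U) \<Longrightarrow> smooth_on (\<lambda>x. tr2 (hinv g c x) (f x)) U"
  unfolding tr2_def by (intro smooth_on_sum smooth_on_mult smooth_hinv U)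

lemma smooth_psi: "smooth_on (\<lambda>x. psi g c x s) U"
  unfolding psi_def by (intro smooth_on_mult smooth_on_const smooth_tr2 smooth_on_cnj smooth_on_diff smooth_dh U)

text \<open>Differentiate \<open>h\<^sup>-\<^sup>1 h = 1\<close> and multiply by \<open>h\<^sup>-\<^sup>1\<close>.\<close>

lemma cderiv_hinv:
  assumes x: "x \<in> U"
  shows "cderiv (dz i) (\<lambda>y. hinv g c y k l) x = - (\<Sum>p\<in>UNIV. \<Sum>q\<in>UNIV. hinv g c x k q * hinv g c x p l * dh g c x i p q)"
proof -
  define P where "P l = cderiv (dz i) (\<lambda>y. hinv g c y k l) x" for l
  have z: "(\<Sum>q\<in>UNIV. P q * herm g c x p q) = - (\<Sum>q\<in>UNIV. hinv g c x k q * dh g c x i p q)" for p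
  proof -
    have "cderiv (dz i) (\<lambda>y. \<Sum>q\<in>UNIV. hinv g c y k q * herm g c y p q) x = cderiv (dz i) (\<lambda>y. if k = p then 1 else 0) x"
      by (rule cderiv_cong_open[OF U x]) (rule hinv_herm[OF hat])
    then have "(\<Sum>q\<in>UNIV. P q * herm g c x p q + hinv g c x k q * dh g c x i p q) = 0"
      by (simp add: cderiv_sum cderiv_mult diff_hinv[OF x] diff_herm[OF x] P_def dh_def)
    then show ?thesis by (simp add: sum.distrib add_eq_0_iff2)
  qed
  have "P l = (\<Sum>q\<in>UNIV. P q * (\<Sum>p\<in>UNIV. hinv g c x p l * herm g c x p q))"
    by (simp add: herm_hinv[OF hat[OF x]])
  also have "\<dots> = (\<Sum>p\<in>UNIV. hinv g c x p l * (\<Sum>q\<in>UNIV. P q * herm g c x p q))"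
    unfolding sum_distrib_left by (subst sum.swap) (simp add: mult_ac)
  also have "\<dots> = - (\<Sum>p\<in>UNIV. \<Sum>q\<in>UNIV. hinv g c x k q * hinv g c x p l * dh g c x i p q)"
    unfolding z by (simp add: sum_distrib_left sum_negf mult_ac)
  finally show ?thesis by (simp add: P_def)
qed

text \<open>The derivative of the inverse metric contributes a product of first derivatives of \<open>h\<close>, which
  accounts for the quadratic part of \<open>dpsi\<close>.\<close>

lemma cderiv_psi:
  assumes x: "x \<in> U"
  shows "cderiv (dz i) (\<lambda>y. psi g c y j) x = dpsi (hinv g c x) (dh g c x) (ddh g c x) i j"
proof -
  note dd = smooth_on_differentiable[OF U _ x]
  define t where "t y k l = cnj (dh g c y j l k - dh g c y l j k)" for y k l
  have st: "smooth_on (\<lambda>y. t y k l) U" for k l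
    unfolding t_def by (intro smooth_on_cnj smooth_on_diff smooth_dh U)
  have dt: "cderiv (dz i) (\<lambda>y. t y k l) x = ddh g c x i j k l - ddh g c x i l k j" for k l
  proof -
    have "cderiv (dz i) (\<lambda>y. t y k l) x = cderiv (dz i) (\<lambda>y. cderiv (dzb j) (\<lambda>u. herm g c u k l) y - cderiv (dzb l) (\<lambda>u. herm g c u k j) y) x"
      by (rule cderiv_cong_open[OF U x]) (simp add: dbh t_def)
    then show ?thesis
      by (simp add: cderiv_diff dd[OF smooth_on_cderiv[OF U smooth_herm]] ddh_def)
  qed
  have "cderiv (dz i) (\<lambda>y. psi g c y j) x = - \<i> * (\<Sum>k\<in>UNIV. \<Sum>l\<in>UNIV.
     cderiv (dz i) (\<lambda>y. hinv g c y k l) x * t x k l + hinv g c x k l * (ddh g c x i j k l - ddh g c x i l k j))"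
    unfolding psi_def t_def[symmetric] tr2_def
    by (simp add: cderiv_minus cderiv_cmult cderiv_sum cderiv_mult dt
       dd[OF st] diff_hinv[OF x] differentiable_sum differentiable_mult)
  also have "\<dots> = - \<i> * ((\<Sum>k\<in>UNIV. \<Sum>l\<in>UNIV. cderiv (dz i) (\<lambda>y. hinv g c y k l) x * t x k l) +
      tr2 (hinv g c x) (\<lambda>k l. ddh g c x i j k l - ddh g c x i l k j))"
    by (simp add: sum.distrib tr2_def)
  also have "(\<Sum>k\<in>UNIV. \<Sum>l\<in>UNIV. cderiv (dz i) (\<lambda>y. hinv g c y k l) x * t x k l) =
     - (\<Sum>k\<in>UNIV. \<Sum>l\<in>UNIV. \<Sum>p\<in>UNIV. \<Sum>q\<in>UNIV. hinv g c x k q * (hinv g c x p l * (dh g c x i p q * t x k l)))"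
    unfolding cderiv_hinv[OF x] by (simp add: sum_distrib_right sum_distrib_left sum_negf mult_ac)
  also have "(\<Sum>k\<in>UNIV. \<Sum>l\<in>UNIV. \<Sum>p\<in>UNIV. \<Sum>q\<in>UNIV. hinv g c x k q * (hinv g c x p l * (dh g c x i p q * t x k l))) =
     (\<Sum>k\<in>UNIV. \<Sum>q\<in>UNIV. \<Sum>p\<in>UNIV. \<Sum>l\<in>UNIV. hinv g c x k q * (hinv g c x p l * (dh g c x i p q * t x k l)))"
  proof (rule sum.cong[OF refl])
    fix k
    have "(\<Sum>l\<in>UNIV. \<Sum>p\<in>UNIV. \<Sum>q\<in>UNIV. F l p q) = (\<Sum>q\<in>UNIV. \<Sum>p\<in>UNIV. \<Sum>l\<in>UNIV. F l p q)" for F :: "'n \<Rightarrow> 'n \<Rightarrow> 'n \<Rightarrow> complex"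
    proof -
      have "(\<Sum>l\<in>UNIV. \<Sum>p\<in>UNIV. \<Sum>q\<in>UNIV. F l p q) = (\<Sum>p\<in>UNIV. \<Sum>l\<in>UNIV. \<Sum>q\<in>UNIV. F l p q)" by (rule sum.swap)
      also have "\<dots> = (\<Sum>p\<in>UNIV. \<Sum>q\<in>UNIV. \<Sum>l\<in>UNIV. F l p q)" by (intro sum.cong refl sum.swap)
      also have "\<dots> = (\<Sum>q\<in>UNIV. \<Sum>p\<in>UNIV. \<Sum>l\<in>UNIV. F l p q)" by (rule sum.swap)
      finally show ?thesis .
    qed
    then show "(\<Sum>l\<in>UNIV. \<Sum>p\<in>UNIV. \<Sum>q\<in>UNIV. hinv g c x k q * (hinv g c x p l * (dh g c x i p q * t x k l))) =
     (\<Sum>q\<in>UNIV. \<Sum>p\<in>UNIV. \<Sum>l\<in>UNIV. hinv g c x k q * (hinv g c x p l * (dh g c x i p q * t x k l)))" .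
  qed
  also have "\<dots> = tr4 (hinv g c x) (\<lambda>k l p q. dh g c x i p l * cnj (dh g c x j q k - dh g c x q j k))"
    by (simp add: tr4_def tr2_def sum_distrib_left t_def)
  finally show ?thesis by (simp add: dpsi_def)
qed

lemma cnj_dpsi:
  assumes x: "x \<in> U"
  shows "- cnj (dpsi (hinv g c x) (dh g c x) (ddh g c x) j i) = dbpsi (hinv g c x) (dh g c x) (ddh g c x) i j"
  unfolding dpsi_def dbpsi_def tr4_def
  by (simp add: cnj_tr2 cnj_hinv[OF hat[OF x]] cnj_ddh[OF x])

lemma cderiv_cnj_psi:
  assumes x: "x \<in> U"
  shows "- cderiv (dzb j) (\<lambda>y. cnj (psi g c y i)) x = dbpsi (hinv g c x) (dh g c x) (ddh g c x) i j"
  using cnj_dpsi[OF x, of j i] smooth_on_differentiable[OF U smooth_psi x, of i]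
  by (simp add: cderiv_cnj cderiv_psi[OF x])

subsection \<open>Ricci traces\<close>

lemma lc_trace:
  assumes x: "x \<in> U"
  shows "(\<Sum>k\<in>UNIV. \<Sum>l\<in>UNIV. hinv g c x k l * lc_curv g c x (w k l) (y k l) (z k l) (v k l)) =
    tr2 (hinv g c x) (\<lambda>k l. lcD (ddh g c x) (w k l) (y k l) (z k l) (v k l)) +
    tr4 (hinv g c x) (\<lambda>k l. lcQ (dh g c x) (w k l) (y k l) (z k l) (v k l))"
  unfolding lc_curv_components[OF x] tr4_def tr2_add[symmetric] tr2_def[of _ "\<lambda>k l. _ k l + _ k l"]
  by (intro sum.cong refl arg_cong2[where f="(*)"]) (simp add: lcD_def lcQ_def tr2_def sum_divide_distrib)

lemma riem_trace:
  assumes x: "x \<in> U"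
  shows "(\<Sum>k\<in>UNIV. \<Sum>l\<in>UNIV. hinv g c x k l * riem g c x (w k l) (y k l) (z k l) (v k l)) =
    tr2 (hinv g c x) (\<lambda>k l. lcD (ddh g c x) (w k l) (y k l) (z k l) (v k l)) +
    tr4 (hinv g c x) (\<lambda>k l. riemQ (dh g c x) (w k l) (y k l) (z k l) (v k l))"
  unfolding riem_components[OF x] tr4_def tr2_add[symmetric] tr2_def[of _ "\<lambda>k l. _ k l + _ k l"]
  by (intro sum.cong refl arg_cong2[where f="(*)"]) (simp add: lcD_def riemQ_def tr2_def sum_divide_distrib)

lemma chern_trace:
  assumes x: "x \<in> U"
  shows "(\<Sum>k\<in>UNIV. \<Sum>l\<in>UNIV. hinv g c x k l * chern g c x (w k l) (y k l) (z k l) (v k l)) =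
    tr2 (hinv g c x) (\<lambda>k l. - ddh g c x (w k l) (y k l) (z k l) (v k l)) +
    tr4 (hinv g c x) (\<lambda>k l. chernQ (dh g c x) (w k l) (y k l) (z k l) (v k l))"
  unfolding chern_components[OF x] tr4_def tr2_add[symmetric] tr2_def[of _ "\<lambda>k l. _ k l + _ k l"]
  by (intro sum.cong refl arg_cong2[where f="(*)"]) (simp add: chernQ_def tr2_def)

end

section \<open>Holomorphic functions of several variables\<close>

definition holo_on :: "(complex^'n::finite \<Rightarrow> complex) \<Rightarrow> (complex^'n) set \<Rightarrow> bool" where
  "holo_on f S \<longleftrightarrow> (\<forall>x\<in>S. \<exists>f'. (f has_derivative f') (at x) \<and> (\<forall>v. f' (\<i> *s v) = \<i> * f' v))"

lemma holo_on_has: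
  assumes "holo_on f S" "x \<in> S"
  shows "(f has_derivative frechet_derivative f (at x)) (at x)"
    and "frechet_derivative f (at x) (\<i> *s v) = \<i> * frechet_derivative f (at x) v"
  using assms frechet_eq unfolding holo_on_def by (metis)+

lemma scal_decomp: "a *s v = Re a *\<^sub>R v + Im a *\<^sub>R (\<i> *s (v :: complex^'n))"
  by (simp add: vec_eq_iff complex_eq_iff)

lemma holo_on_scal:
  assumes "holo_on f S" "x \<in> S"
  shows "frechet_derivative f (at x) (a *s v) = a * frechet_derivative f (at x) v"
proof -
  note l = has_derivative_linear[OF holo_on_has(1)[OF assms]]
  show ?thesis
    by (subst scal_decomp) (simp add: linear_add[OF l] linear_scale[OF l] holo_on_has(2)[OF assms] complex_eq_iff)
qed

lemma bounded_linear_scal: "bounded_linear (\<lambda>a. a *s (v :: complex^'n))"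
  by (rule linear_conv_bounded_linear[THEN iffD1]) (auto intro!: linearI simp: vec_eq_iff algebra_simps)

lemma norm_scal: "norm (a *s (v :: complex^'n)) = cmod a * norm v"
  by (simp add: norm_vec_def L2_set_def norm_mult power_mult_distrib sum_distrib_left[symmetric] real_sqrt_mult)

text \<open>Cauchy's formula for the derivative, written as a mean over the circle.\<close>

lemma deriv_circle_mean:
  assumes "continuous_on (cball 0 r) F" "F holomorphic_on ball 0 r" and r: "r > 0"
  shows "deriv F 0 = integral {0..1} (\<lambda>t. F (r * exp (2 * of_real pi * \<i> * of_real t)) / (r * exp (2 * of_real pi * \<i> * of_real t)))"
proof -
  have "contour_integral (circlepath 0 r) (\<lambda>u. F u / (u - 0)^2) = (2 * pi * \<i>) * deriv F 0"
    by (rule Cauchy_contour_integral_circlepath_2) (use assms in auto)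
  moreover have "contour_integral (circlepath 0 r) (\<lambda>u. F u / (u - 0)^2) =
     integral {0..1} (\<lambda>t. (2 * pi * \<i>) * (F (r * exp (2 * of_real pi * \<i> * of_real t)) / (r * exp (2 * of_real pi * \<i> * of_real t))))"
    unfolding contour_integral_integral
  proof (rule integral_cong)
    fix t :: real
    have "vector_derivative (circlepath 0 r) (at t) = 2 * pi * \<i> * r * exp (2 * of_real pi * \<i> * of_real t)"
      by (rule vector_derivative_circlepath)
    then show "F (circlepath 0 r t) / (circlepath 0 r t - 0)\<^sup>2 * vector_derivative (circlepath 0 r) (at t) =
      (2 * pi * \<i>) * (F (r * exp (2 * of_real pi * \<i> * of_real t)) / (r * exp (2 * of_real pi * \<i> * of_real t)))"
      using r by (simp only:) (simp add: circlepath power2_eq_square field_simps)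
  qed
  ultimately have "(2 * pi * \<i>) * deriv F 0 = integral {0..1} (\<lambda>t. (2 * pi * \<i>) *
      (F (r * exp (2 * of_real pi * \<i> * of_real t)) / (r * exp (2 * of_real pi * \<i> * of_real t))))"
    by (rule trans[OF sym])
  then show ?thesis unfolding integral_mult_right by simp
qed

lemma holo_on_continuous: "holo_on f S \<Longrightarrow> continuous_on S f"
  using holo_on_has(1) has_derivative_continuous by (fastforce intro: continuous_at_imp_continuous_on)

text \<open>Cauchy's formula on the complex line through \<open>y\<close> in the direction \<open>v\<close>.\<close>

lemma holo_on_cauchy:
  assumes f: "holo_on f S" and S: "open S" and r: "r > 0"
    and sub: "\<And>a. cmod a \<le> r \<Longrightarrow> y + a *s v \<in> S"
  shows "frechet_derivative f (at y) v = integral {0..1} (\<lambda>t.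
    f (y + (r * exp (2 * of_real pi * \<i> * of_real t)) *s v) / (r * exp (2 * of_real pi * \<i> * of_real t)))"
proof -
  define F where "F a = f (y + a *s v)" for a
  have der: "(F has_field_derivative frechet_derivative f (at (y + a *s v)) v) (at a)" if "cmod a \<le> r" for a
  proof -
    have "((\<lambda>a. y + a *s v) has_derivative (\<lambda>h. h *s v)) (at a)"
      using has_derivative_add[OF has_derivative_const bounded_linear.has_derivative[OF bounded_linear_scal has_derivative_ident]]
      by simp
    then have "(F has_derivative (\<lambda>h. frechet_derivative f (at (y + a *s v)) (h *s v))) (at a)"
      unfolding F_def by (rule has_derivative_compose) (rule holo_on_has(1)[OF f sub[OF that]])
    moreover have "(\<lambda>h. frechet_derivative f (at (y + a *s v)) (h *s v)) = (*) (frechet_derivative f (at (y + a *s v)) v)"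
      by (simp add: fun_eq_iff holo_on_scal[OF f sub[OF that]])
    ultimately show ?thesis by (simp add: has_field_derivative_def)
  qed
  have "deriv F 0 = frechet_derivative f (at y) v"
    using der[of 0] r by (simp add: DERIV_imp_deriv)
  moreover have "continuous_on (cball 0 r) F"
    using der DERIV_isCont by (force intro!: continuous_at_imp_continuous_on)
  moreover have "F holomorphic_on ball 0 r"
    using der field_differentiable_at_within by (auto simp: holomorphic_on_def field_differentiable_def) (metis DERIV_subset less_imp_le subset_UNIV)
  ultimately show ?thesis using deriv_circle_mean[of r F] r by (simp add: F_def)
qed

text \<open>Small complex discs in the direction \<open>v\<close> stay inside \<open>S\<close>, uniformly near \<open>x\<close>.\<close>

lemma holo_on_nbhd:
  assumes "open S" "x \<in> S"
  obtains \<rho> r where "\<rho> > 0" "r > 0" "\<And>y a. y \<in> ball x \<rho> \<Longrightarrow> cmod a \<le> r \<Longrightarrow> y + a *s v \<in> S" "ball x \<rho> \<subseteq> S"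
proof -
  obtain e where e: "e > 0" "ball x e \<subseteq> S" using assms open_contains_ball by blast
  define r where "r = e / (2 * (1 + norm v))"
  have n: "1 + norm v > 0" using norm_ge_zero[of v] by linarith
  have rv: "r * norm v < e / 2"
  proof -
    have "r > 0" using e n by (simp add: r_def)
    then have "r * norm v < r * (1 + norm v)" by (intro mult_strict_left_mono) auto
    also have "\<dots> = e / 2" using n by (simp add: r_def field_simps)
    finally show ?thesis .
  qed
  show ?thesis
  proof (rule that[of "e / 2" r])
    show "0 < e / 2" "0 < r" using e n by (auto simp: r_def)
    fix y a assume y: "y \<in> ball x (e / 2)" and a: "cmod a \<le> r"
    have "cmod a * norm v \<le> r * norm v" using a by (simp add: mult_right_mono)
    then have "norm (a *s v) < e / 2" using rv by (simp add: norm_scal)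
    then have "dist x (y + a *s v) < e"
      using y dist_triangle[of x "y + a *s v" y] by (simp add: dist_norm norm_minus_commute)
    then show "y + a *s v \<in> S" using e by auto
  qed (use e in auto)
qed

lemma cont_circle_arg:
  "continuous_on (U \<times> {0..1}) (\<lambda>(y, t). y + (of_real r * exp (2 * of_real pi * \<i> * of_real t)) *s (v :: complex^'n))"
  unfolding split_beta
  by (intro continuous_intros bounded_linear.continuous_on[OF bounded_linear_scal])

lemma holo_on_frechet_continuous:
  assumes f: "holo_on f S" and S: "open S"
  shows "continuous_on S (\<lambda>y. frechet_derivative f (at y) v)"
proof (rule continuous_at_imp_continuous_on, rule ballI)
  fix x assume "x \<in> S"
  then obtain \<rho> r where r: "\<rho> > 0" "r > 0" "\<And>y a. y \<in> ball x \<rho> \<Longrightarrow> cmod a \<le> r \<Longrightarrow> y + a *s v \<in> S" "ball x \<rho> \<subseteq> S"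
    using holo_on_nbhd[OF S] by metis
  have "continuous_on (ball x \<rho>) (\<lambda>y. integral (cbox 0 1) (\<lambda>t.
    f (y + (r * exp (2 * of_real pi * \<i> * of_real t)) *s v) / (r * exp (2 * of_real pi * \<i> * of_real t))))"
  proof (rule integral_continuous_on_param)
    show "continuous_on (ball x \<rho> \<times> cbox 0 1) (\<lambda>(y, t). f (y + (of_real r * exp (2 * of_real pi * \<i> * of_real t)) *s v) /
      (of_real r * exp (2 * of_real pi * \<i> * of_real t)))"
      unfolding split_beta
    proof (intro continuous_on_divide)
      show "continuous_on (ball x \<rho> \<times> cbox 0 1) (\<lambda>z. f (fst z + (of_real r * exp (2 * of_real pi * \<i> * of_real (snd z))) *s v))"
        using cont_circle_arg[of "ball x \<rho>" r v]
        by (intro continuous_on_compose2[OF holo_on_continuous[OF f], where f="\<lambda>z. fst z + (of_real r * exp (2 * of_real pi * \<i> * of_real (snd z))) *s v"])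
           (use r in \<open>auto simp: norm_mult split_beta intro!: r(3)\<close>)
    qed (use r in \<open>auto intro!: continuous_intros\<close>)
  qed
  then have "continuous_on (ball x \<rho>) (\<lambda>y. frechet_derivative f (at y) v)"
    by (rule continuous_on_eq) (use holo_on_cauchy[OF f S r(2) r(3)] in simp)
  then show "continuous (at x) (\<lambda>y. frechet_derivative f (at y) v)"
    using r(1) by (metis centre_in_ball continuous_on_interior interior_ball)
qed

text \<open>Differentiate Cauchy's formula under the integral sign.\<close>

lemma holo_on_frechet:
  assumes f: "holo_on f S" and S: "open S"
  shows "holo_on (\<lambda>y. frechet_derivative f (at y) v) S"
  unfolding holo_on_def
proof (rule ballI)
  fix x assume "x \<in> S"
  then obtain \<rho> r where r: "\<rho> > 0" "r > 0" "\<And>y a. y \<in> ball x \<rho> \<Longrightarrow> cmod a \<le> r \<Longrightarrow> y + a *s v \<in> S" "ball x \<rho> \<subseteq> S"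
    using holo_on_nbhd[OF S] by metis
  define e where "e t = of_real r * exp (2 * of_real pi * \<i> * of_real t)" for t :: real
  have e: "cmod (e t) \<le> r" "e t \<noteq> 0" for t using r by (auto simp: e_def norm_mult)
  have ce: "continuous_on T e" for T unfolding e_def by (intro continuous_intros)
  have inS: "y + e t *s v \<in> S" if "y \<in> ball x \<rho>" for y t using r(3)[OF that e(1)] .
  define fx where "fx y t = Blinfun (\<lambda>h. frechet_derivative f (at (y + e t *s v)) h / e t)" for y t
  have bl: "bounded_linear (\<lambda>h. frechet_derivative f (at (y + e t *s v)) h / e t)" if "y \<in> ball x \<rho>" for y t
    using bounded_linear_compose[OF bounded_linear_divide has_derivative_bounded_linear[OF holo_on_has(1)[OF f inS[OF that]]]]
    by simp
  have app: "blinfun_apply (fx y t) h = frechet_derivative f (at (y + e t *s v)) h / e t" if "y \<in> ball x \<rho>" for y t h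
    unfolding fx_def using bounded_linear_Blinfun_apply[OF bl[OF that]] by simp
  have carg: "continuous_on (ball x \<rho> \<times> cbox 0 1) (\<lambda>z. fst z + e (snd z) *s v)"
    using cont_circle_arg[of "ball x \<rho>" r v] by (simp add: split_beta e_def)
  have cont: "continuous_on (ball x \<rho> \<times> cbox 0 1) (\<lambda>(y, t). fx y t)"
  proof (rule continuous_on_blinfun_componentwise)
    fix h :: "complex^'a"
    have "continuous_on (ball x \<rho> \<times> cbox 0 1) (\<lambda>z. frechet_derivative f (at (fst z + e (snd z) *s v)) h / e (snd z))"
      by (intro continuous_on_divide continuous_on_compose2[OF holo_on_frechet_continuous[OF f S] carg]
          continuous_on_compose2[OF ce]) (use e inS in \<open>auto intro!: continuous_intros\<close>)
    then show "continuous_on (ball x \<rho> \<times> cbox 0 1) (\<lambda>z. blinfun_apply (case z of (y, t) \<Rightarrow> fx y t) h)"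
      by (rule continuous_on_eq) (use app in auto)
  qed
  have x: "x \<in> ball x \<rho>" using r by simp
  have "((\<lambda>y. integral (cbox 0 1) (\<lambda>t. f (y + e t *s v) / e t)) has_derivative integral (cbox 0 1) (fx x)) (at x within ball x \<rho>)"
  proof (rule leibniz_rule[OF _ _ cont x convex_ball])
    fix y t assume y: "y \<in> ball x \<rho>"
    have "((\<lambda>y. f (y + e t *s v)) has_derivative (\<lambda>h. frechet_derivative f (at (y + e t *s v)) h)) (at y within ball x \<rho>)"
      by (rule has_derivative_compose[of "\<lambda>y. y + e t *s v" "\<lambda>h. h" y "ball x \<rho>" f])
         (auto intro!: derivative_eq_intros holo_on_has(1)[OF f inS[OF y]])
    then have "((\<lambda>y. f (y + e t *s v) / e t) has_derivative (\<lambda>h. frechet_derivative f (at (y + e t *s v)) h / e t)) (at y within ball x \<rho>)"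
      by (rule bounded_linear.has_derivative[OF bounded_linear_divide])
    then show "((\<lambda>y. f (y + e t *s v) / e t) has_derivative blinfun_apply (fx y t)) (at y within ball x \<rho>)"
      by (simp add: app[OF y, abs_def])
  next
    fix y assume y: "y \<in> ball x \<rho>"
    have "continuous_on (cbox 0 1) (\<lambda>t. y + e t *s v)"
      by (intro continuous_intros bounded_linear.continuous_on[OF bounded_linear_scal] ce)
    then have "continuous_on (cbox 0 1) (\<lambda>t. f (y + e t *s v))"
      by (rule continuous_on_compose2[OF holo_on_continuous[OF f]]) (use inS[OF y] in auto)
    then show "(\<lambda>t. f (y + e t *s v) / e t) integrable_on cbox 0 1"
      by (intro integrable_continuous continuous_on_divide ce) (use e in auto)
  qed
  then have "((\<lambda>y. integral (cbox 0 1) (\<lambda>t. f (y + e t *s v) / e t)) has_derivative integral (cbox 0 1) (fx x)) (at x)"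
    using at_within_open[OF x open_ball] by simp
  then have D: "((\<lambda>y. frechet_derivative f (at y) v) has_derivative integral (cbox 0 1) (fx x)) (at x)"
    by (rule has_derivative_transform_within_open[OF _ open_ball x])
       (use holo_on_cauchy[OF f S r(2) r(3)] in \<open>simp add: e_def\<close>)
  have int: "fx x integrable_on cbox 0 1"
  proof (rule integrable_continuous)
    have "continuous_on (cbox 0 1) (\<lambda>t. (x, t))" by (intro continuous_intros)
    moreover have "Pair x ` cbox 0 1 \<subseteq> ball x \<rho> \<times> cbox (0::real) 1" using x by blast
    ultimately have "continuous_on (cbox 0 1) (\<lambda>t. case (x, t) of (y, t) \<Rightarrow> fx y t)"
      by (rule continuous_on_compose2[OF cont])
    then show "continuous_on (cbox 0 1) (fx x)" by simp
  qed
  have "blinfun_apply (integral (cbox 0 1) (fx x)) (\<i> *s h) = \<i> * blinfun_apply (integral (cbox 0 1) (fx x)) h" for h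
  proof -
    have "integral (cbox 0 1) (\<lambda>t. blinfun_apply (fx x t) (\<i> *s h)) = integral (cbox 0 1) (\<lambda>t. \<i> * blinfun_apply (fx x t) h)"
      by (rule integral_cong) (simp add: app[OF x] holo_on_has(2)[OF f inS[OF x]])
    then show ?thesis unfolding blinfun_apply_integral[OF int] by simp
  qed
  with D show "\<exists>f'. ((\<lambda>y. frechet_derivative f (at y) v) has_derivative f') (at x) \<and> (\<forall>v. f' (\<i> *s v) = \<i> * f' v)"
    by blast
qed

text \<open>The derivative of a holomorphic function is holomorphic, hence continuous; iterate.\<close>

lemma holo_on_Ck: "open S \<Longrightarrow> holo_on f S \<Longrightarrow> Ck_on k f S"
proof (induction k arbitrary: f)
  case 0 then show ?case by (simp add: holo_on_continuous)
next
  case (Suc k)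
  show ?case
    by (rule Ck_on_SucI[OF Suc.prems(1) holo_on_has(1)[OF Suc.prems(2)] Suc.IH[OF Suc.prems(1) holo_on_frechet[OF Suc.prems(2,1)]]])
qed

lemma holo_on_smooth: "open S \<Longrightarrow> holo_on f S \<Longrightarrow> smooth_on f S"
  by (simp add: smooth_on_def holo_on_Ck)

lemma holo_on_cderiv_dz:
  assumes "holo_on f S" "x \<in> S"
  shows "cderiv (dz k) f x = frechet_derivative f (at x) (axis k 1)"
proof -
  note l = has_derivative_linear[OF holo_on_has(1)[OF assms]]
  have "frechet_derivative f (at x) (axis k \<i>) = \<i> * frechet_derivative f (at x) (axis k 1)"
    using holo_on_has(2)[OF assms, of "axis k 1"] by (simp add: axis_i)
  then show ?thesis
    by (simp add: cderiv_def dz_def linear_scale[OF l] linear_neg[OF l] complex_eq_iff)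
qed

lemma holo_on_cderiv_dzb:
  assumes "holo_on f S" "x \<in> S"
  shows "cderiv (dzb k) f x = 0"
proof -
  note l = has_derivative_linear[OF holo_on_has(1)[OF assms]]
  have "frechet_derivative f (at x) (axis k \<i>) = \<i> * frechet_derivative f (at x) (axis k 1)"
    using holo_on_has(2)[OF assms, of "axis k 1"] by (simp add: axis_i)
  then show ?thesis
    by (simp add: cderiv_def dzb_def linear_scale[OF l] linear_neg[OF l] complex_eq_iff)
qed

lemma holo_on_cong: "open S \<Longrightarrow> holo_on f S \<Longrightarrow> (\<And>x. x \<in> S \<Longrightarrow> f x = g x) \<Longrightarrow> holo_on g S"
  unfolding holo_on_def by (metis has_derivative_transform_within_open)

lemma holo_on_cderiv: "holo_on f S \<Longrightarrow> open S \<Longrightarrow> holo_on (cderiv (dz k) f) S"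
  using holo_on_cong[OF _ holo_on_frechet[of f S "axis k 1"]] holo_on_cderiv_dz by metis

lemma holo_on_frechet_expand:
  assumes "holo_on f S" "x \<in> S"
  shows "frechet_derivative f (at x) v = (\<Sum>k\<in>UNIV. v $ k * cderiv (dz k) f x)"
  using real_linear_expand[OF has_derivative_linear[OF holo_on_has(1)[OF assms]], of v]
  by (simp add: cderiv_cext[symmetric] holo_on_cderiv_dzb[OF assms])

lemma cderiv_compose:
  fixes \<phi> :: "complex^'n \<Rightarrow> complex^'n"
  assumes \<phi>: "(\<phi> has_derivative \<phi>') (at x)" and h: "h differentiable at (\<phi> x)"
  shows "cderiv Z (\<lambda>y. h (\<phi> y)) x = (\<Sum>a\<in>UNIV. cderiv Z (\<lambda>y. \<phi> y $ a) x * cderiv (dz a) h (\<phi> x)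
    + cderiv Z (\<lambda>y. cnj (\<phi> y $ a)) x * cderiv (dzb a) h (\<phi> x))"
proof -
  have c: "((\<lambda>y. \<phi> y $ a) has_derivative (\<lambda>v. \<phi>' v $ a)) (at x)" for a
    by (rule bounded_linear.has_derivative[OF bounded_linear_vec_nth \<phi>])
  have cc: "((\<lambda>y. cnj (\<phi> y $ a)) has_derivative (\<lambda>v. cnj (\<phi>' v $ a))) (at x)" for a
    by (rule bounded_linear.has_derivative[OF bounded_linear_cnj c])
  have D: "frechet_derivative h (at (\<phi> x)) w = (\<Sum>a\<in>UNIV. w $ a * cderiv (dz a) h (\<phi> x) + cnj (w $ a) * cderiv (dzb a) h (\<phi> x))" for w
    using real_linear_expand[OF has_derivative_linear[OF has_frechet[OF h]]] by (simp add: cderiv_cext)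
  have "((\<lambda>y. h (\<phi> y)) has_derivative (\<lambda>v. frechet_derivative h (at (\<phi> x)) (\<phi>' v))) (at x)"
    using has_derivative_compose[OF \<phi> has_frechet[OF h]] .
  from cderiv_has[OF this] show ?thesis
    by (simp add: cderiv_has[OF c] cderiv_has[OF cc] D sum_distrib_left sum.distrib algebra_simps)
qed

section \<open>Change of holomorphic coordinates\<close>

text \<open>The complex Jacobian matrix \<open>\<partial>\<phi>\<^sup>a/\<partial>z\<^sup>k\<close>.\<close>

definition jac :: "(complex^'n \<Rightarrow> complex^'n) \<Rightarrow> complex^'n \<Rightarrow> 'n::finite \<Rightarrow> 'n \<Rightarrow> complex" where
  "jac \<phi> x k a = cderiv (dz k) (\<lambda>y. \<phi> y $ a) x"

text \<open>Two charts of a Hermitian manifold, seen in coordinates: \<open>\<phi>\<close> is a holomorphic isometry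
  from the open set \<open>S\<close> into the chart domain \<open>U'\<close>.\<close>

locale chart_change = C1: hermitian_chart g c S + C2: hermitian_chart g c' U'
  for g :: "('m, 'n::finite) metric" and c c' S U' +
  fixes \<phi> :: "complex^'n \<Rightarrow> complex^'n"
  assumes holo: "holomorphic_map_on \<phi> S"
    and maps: "\<And>x. x \<in> S \<Longrightarrow> \<phi> x \<in> U'"
    and isometry: "\<And>x v w. x \<in> S \<Longrightarrow> g c x v w =
      g c' (\<phi> x) (frechet_derivative \<phi> (at x) v) (frechet_derivative \<phi> (at x) w)"
begin

lemma phi_has: "x \<in> S \<Longrightarrow> (\<phi> has_derivative frechet_derivative \<phi> (at x)) (at x)"
  using holo unfolding holomorphic_map_on_def by (metis frechet_eq)

lemma phi_component_has: "x \<in> S \<Longrightarrow> ((\<lambda>y. \<phi> y $ a) has_derivative (\<lambda>v. frechet_derivative \<phi> (at x) v $ a)) (at x)"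
  by (rule bounded_linear.has_derivative[OF bounded_linear_vec_nth phi_has])

lemma holo_phi: "holo_on (\<lambda>y. \<phi> y $ a) S"
  unfolding holo_on_def
proof (rule ballI)
  fix x assume x: "x \<in> S"
  obtain f' where f: "(\<phi> has_derivative f') (at x)" "\<And>v. f' (\<i> *s v) = \<i> *s f' v"
    using holo x unfolding holomorphic_map_on_def by blast
  have "((\<lambda>y. \<phi> y $ a) has_derivative (\<lambda>v. f' v $ a)) (at x)"
    by (rule bounded_linear.has_derivative[OF bounded_linear_vec_nth f(1)])
  then show "\<exists>f'. ((\<lambda>y. \<phi> y $ a) has_derivative f') (at x) \<and> (\<forall>v. f' (\<i> *s v) = \<i> * f' v)"
    using f(2) by (intro exI[of _ "\<lambda>v. f' v $ a"]) simp
qed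

lemma phi_frechet: "x \<in> S \<Longrightarrow> frechet_derivative \<phi> (at x) v $ a = (\<Sum>k\<in>UNIV. v $ k * jac \<phi> x k a)"
  using holo_on_frechet_expand[OF holo_phi, of x a v] frechet_eq[OF phi_component_has[of x a]]
  by (simp add: jac_def)

lemma holo_jac: "holo_on (\<lambda>x. jac \<phi> x k a) S"
  unfolding jac_def by (rule holo_on_cderiv[OF holo_phi C1.U])

lemma smooth_jac: "smooth_on (\<lambda>x. jac \<phi> x k a) S"
  by (rule holo_on_smooth[OF C1.U holo_jac])

lemma diff_jac: "x \<in> S \<Longrightarrow> (\<lambda>x. jac \<phi> x k a) differentiable at x"
  by (rule smooth_on_differentiable[OF C1.U smooth_jac])

lemma dzb_jac: "x \<in> S \<Longrightarrow> cderiv (dzb j) (\<lambda>x. jac \<phi> x k a) x = 0"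
  by (rule holo_on_cderiv_dzb[OF holo_jac])

lemma dz_cnj_jac: "x \<in> S \<Longrightarrow> cderiv (dz j) (\<lambda>x. cnj (jac \<phi> x k a)) x = 0"
  by (simp add: cderiv_cnj[OF diff_jac] dzb_jac)

lemma jac_sym: "x \<in> S \<Longrightarrow> cderiv (dz i) (\<lambda>x. jac \<phi> x k a) x = cderiv (dz k) (\<lambda>x. jac \<phi> x i a) x"
  unfolding jac_def by (rule cderiv_commute[OF C1.U _ holo_on_smooth[OF C1.U holo_phi]])

lemma cderiv_phi:
  assumes x: "x \<in> S" and h: "h differentiable at (\<phi> x)"
  shows "cderiv (dz i) (\<lambda>y. h (\<phi> y)) x = (\<Sum>a\<in>UNIV. jac \<phi> x i a * cderiv (dz a) h (\<phi> x))"
    and "cderiv (dzb i) (\<lambda>y. h (\<phi> y)) x = (\<Sum>a\<in>UNIV. cnj (jac \<phi> x i a) * cderiv (dzb a) h (\<phi> x))"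
proof -
  have d: "(\<lambda>y. \<phi> y $ a) differentiable at x" for a
    using phi_component_has[OF x] by (auto simp: differentiable_def)
  have z: "cderiv (dzb i) (\<lambda>y. \<phi> y $ a) x = 0" for a
    by (rule holo_on_cderiv_dzb[OF holo_phi x])
  show "cderiv (dz i) (\<lambda>y. h (\<phi> y)) x = (\<Sum>a\<in>UNIV. jac \<phi> x i a * cderiv (dz a) h (\<phi> x))"
    "cderiv (dzb i) (\<lambda>y. h (\<phi> y)) x = (\<Sum>a\<in>UNIV. cnj (jac \<phi> x i a) * cderiv (dzb a) h (\<phi> x))"
    unfolding cderiv_compose[OF phi_has[OF x] h] by (simp_all add: cderiv_cnj[OF d] z jac_def)
qed

lemma diff_compose_phi: "x \<in> S \<Longrightarrow> h differentiable at (\<phi> x) \<Longrightarrow> (\<lambda>y. h (\<phi> y)) differentiable at x"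
  using has_derivative_compose[OF phi_has has_frechet] unfolding differentiable_def by blast

text \<open>The complexified differential of \<open>\<phi>\<close>.\<close>

definition push :: "complex^'n \<Rightarrow> 'n cvec \<Rightarrow> 'n cvec" where
  "push x Z = (frechet_derivative \<phi> (at x) (fst Z), frechet_derivative \<phi> (at x) (snd Z))"

lemma gC_push: "x \<in> S \<Longrightarrow> gC g c x Z W = gC g c' (\<phi> x) (push x Z) (push x W)"
  by (simp add: gC_def push_def isometry)

lemma zcoeff_push: "x \<in> S \<Longrightarrow> zcoeff (push x Z) a = (\<Sum>k\<in>UNIV. zcoeff Z k * jac \<phi> x k a)"
  by (simp add: zcoeff_def push_def phi_frechet sum_distrib_left sum.distrib algebra_simps)

lemma zbcoeff_push: "x \<in> S \<Longrightarrow> zbcoeff (push x Z) a = (\<Sum>k\<in>UNIV. zbcoeff Z k * cnj (jac \<phi> x k a))"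
  by (simp add: zbcoeff_def push_def phi_frechet sum_distrib_left sum.distrib algebra_simps)

lemma herm_change:
  assumes x: "x \<in> S"
  shows "herm g c x k l = (\<Sum>a\<in>UNIV. \<Sum>b\<in>UNIV. jac \<phi> x k a * cnj (jac \<phi> x l b) * herm g c' (\<phi> x) a b)"
proof -
  note h = C2.hat[OF maps[OF x]]
  have "herm g c x k l = gC g c' (\<phi> x) (push x (dz k)) (push x (dzb l))"
    by (simp add: herm_def gC_push[OF x])
  also have "\<dots> = (\<Sum>a\<in>UNIV. jac \<phi> x k a * (\<Sum>b\<in>UNIV. cnj (jac \<phi> x l b) * herm g c' (\<phi> x) a b))"
    unfolding gC_coeffs[OF h, of "push x (dz k)"] gC_dz[OF h, of "push x (dzb l)"]
    by (simp add: zcoeff_push[OF x] zbcoeff_push[OF x])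
  finally show ?thesis by (simp add: sum_distrib_left mult.assoc)
qed

text \<open>An orthonormal basis is mapped to an orthonormal basis.\<close>

lemma hinv_change:
  assumes x: "x \<in> S"
  shows "hinv g c' (\<phi> x) a b = (\<Sum>k\<in>UNIV. \<Sum>l\<in>UNIV. jac \<phi> x k a * cnj (jac \<phi> x l b) * hinv g c x k l)"
proof -
  define T where "T = frechet_derivative \<phi> (at x)"
  have lT: "linear T" unfolding T_def by (rule has_derivative_linear[OF phi_has[OF x]])
  obtain E where E: "orthonormal_basis g c x E" using ex_orthonormal_basis[OF C1.hat[OF x]] by blast
  have g: "g c' (\<phi> x) (T u) (T v) = g c x u v" for u v by (simp add: T_def isometry[OF x])
  have inj: "inj_on T E"
  proof (rule inj_onI)
    fix u v assume uv: "u \<in> E" "v \<in> E" "T u = T v"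
    then have "T (u - v) = 0" by (simp add: linear_diff[OF lT])
    then have "g c x (u - v) (u - v) = 0"
      by (metis g bilinear_lzero[OF hf_bil[OF C2.hat[OF maps[OF x]]]])
    then show "u = v" using hf_pos[OF C1.hat[OF x], of "u - v"] by fastforce
  qed
  have "orthonormal_basis g c' (\<phi> x) (T ` E)"
    using E inj unfolding orthonormal_basis_def by (auto simp: card_image g dest: inj_onD)
  from hinv_orthonormal[OF C2.hat[OF maps[OF x]] this]
  have "hinv g c' (\<phi> x) a b = (\<Sum>e\<in>E. T e $ a * cnj (T e $ b))"
    by (simp add: sum.reindex[OF inj])
  also have "\<dots> = (\<Sum>e\<in>E. \<Sum>k\<in>UNIV. \<Sum>l\<in>UNIV. jac \<phi> x k a * cnj (jac \<phi> x l b) * (e $ k * cnj (e $ l)))"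
    by (simp add: T_def phi_frechet[OF x] sum_product mult_ac)
  also have "\<dots> = (\<Sum>k\<in>UNIV. \<Sum>e\<in>E. \<Sum>l\<in>UNIV. jac \<phi> x k a * cnj (jac \<phi> x l b) * (e $ k * cnj (e $ l)))"
    by (rule sum.swap)
  also have "\<dots> = (\<Sum>k\<in>UNIV. \<Sum>l\<in>UNIV. \<Sum>e\<in>E. jac \<phi> x k a * cnj (jac \<phi> x l b) * (e $ k * cnj (e $ l)))"
    by (intro sum.cong refl sum.swap)
  finally show ?thesis
    by (simp add: hinv_orthonormal[OF C1.hat[OF x] E] sum_distrib_left)
qed

lemma tr2_change:
  assumes x: "x \<in> S"
  shows "tr2 (hinv g c x) (\<lambda>k l. \<Sum>a\<in>UNIV. \<Sum>b\<in>UNIV. jac \<phi> x k a * cnj (jac \<phi> x l b) * F a b) =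
    tr2 (hinv g c' (\<phi> x)) F"
proof -
  have "tr2 (hinv g c x) (\<lambda>k l. \<Sum>a\<in>UNIV. \<Sum>b\<in>UNIV. jac \<phi> x k a * cnj (jac \<phi> x l b) * F a b) =
    tr2 (\<lambda>_ _. 1) (\<lambda>k l. tr2 (\<lambda>_ _. 1) (\<lambda>a b. jac \<phi> x k a * cnj (jac \<phi> x l b) * hinv g c x k l * F a b))"
    by (simp add: tr2_def sum_distrib_left mult_ac)
  also have "\<dots> = tr2 (\<lambda>_ _. 1) (\<lambda>a b. tr2 (\<lambda>_ _. 1) (\<lambda>k l. jac \<phi> x k a * cnj (jac \<phi> x l b) * hinv g c x k l * F a b))"
    by (rule tr2_swap)
  also have "\<dots> = tr2 (hinv g c' (\<phi> x)) F"
    unfolding hinv_change[OF x] by (simp add: tr2_def sum_distrib_right sum_distrib_left)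
  finally show ?thesis .
qed

lemma det_herm_change:
  assumes x: "x \<in> S"
  shows "det (\<chi> i j. herm g c x i j) =
    det (\<chi> k a. jac \<phi> x k a) * cnj (det (\<chi> k a. jac \<phi> x k a)) * det (\<chi> i j. herm g c' (\<phi> x) i j)"
proof -
  let ?J = "\<chi> k a. jac \<phi> x k a" and ?K = "\<chi> l b. cnj (jac \<phi> x l b)" and ?H = "\<chi> i j. herm g c' (\<phi> x) i j"
  have "(\<chi> i j. herm g c x i j) = ?J ** ?H ** transpose ?K"
    unfolding herm_change[OF x]
    by (simp add: vec_eq_iff matrix_matrix_mult_def transpose_def sum_distrib_right)
       (intro allI, subst sum.swap, simp add: mult_ac)
  moreover have "det ?K = cnj (det ?J)" by (simp add: det_def)
  ultimately show ?thesis by (simp add: det_mul det_transpose mult_ac)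
qed

subsection \<open>Derivatives of the metric\<close>

lemma cderiv_herm_change:
  assumes x: "x \<in> S"
  shows "dh g c x i k l = (\<Sum>a\<in>UNIV. \<Sum>b\<in>UNIV.
     cderiv (dz i) (\<lambda>x. jac \<phi> x k a) x * cnj (jac \<phi> x l b) * herm g c' (\<phi> x) a b
     + jac \<phi> x k a * cnj (jac \<phi> x l b) * (\<Sum>e\<in>UNIV. jac \<phi> x i e * dh g c' (\<phi> x) e a b))"
proof -
  have "dh g c x i k l = cderiv (dz i) (\<lambda>y. \<Sum>a\<in>UNIV. \<Sum>b\<in>UNIV. jac \<phi> y k a * cnj (jac \<phi> y l b) * herm g c' (\<phi> y) a b) x"
    unfolding dh_def by (rule cderiv_cong_open[OF C1.U x]) (rule herm_change)
  also have "\<dots> = (\<Sum>a\<in>UNIV. \<Sum>b\<in>UNIV.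
     cderiv (dz i) (\<lambda>x. jac \<phi> x k a) x * cnj (jac \<phi> x l b) * herm g c' (\<phi> x) a b
     + jac \<phi> x k a * cnj (jac \<phi> x l b) * cderiv (dz i) (\<lambda>y. herm g c' (\<phi> y) a b) x)"
    by (simp add: cderiv_sum cderiv_mult differentiable_sum differentiable_mult diff_jac[OF x] differentiable_cnj[OF diff_jac[OF x]]
      diff_compose_phi[OF x C2.diff_herm[OF maps[OF x]]] dz_cnj_jac[OF x])
  also have "\<dots> = (\<Sum>a\<in>UNIV. \<Sum>b\<in>UNIV.
     cderiv (dz i) (\<lambda>x. jac \<phi> x k a) x * cnj (jac \<phi> x l b) * herm g c' (\<phi> x) a b
     + jac \<phi> x k a * cnj (jac \<phi> x l b) * (\<Sum>e\<in>UNIV. jac \<phi> x i e * dh g c' (\<phi> x) e a b))"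
    by (simp add: cderiv_phi(1)[OF x C2.diff_herm[OF maps[OF x]]] dh_def)
  finally show ?thesis .
qed

text \<open>In the antisymmetrisation the second derivatives of \<open>\<phi>\<close> cancel: \<open>\<partial>\<omega>\<close> is a tensor.\<close>

lemma torsion_change:
  assumes x: "x \<in> S"
  shows "dh g c x i k l - dh g c x k i l = (\<Sum>e\<in>UNIV. \<Sum>a\<in>UNIV. \<Sum>b\<in>UNIV.
    jac \<phi> x i e * jac \<phi> x k a * cnj (jac \<phi> x l b) * (dh g c' (\<phi> x) e a b - dh g c' (\<phi> x) a e b))"
proof -
  define R where "R i k = (\<Sum>a\<in>UNIV. \<Sum>b\<in>UNIV. cderiv (dz i) (\<lambda>x. jac \<phi> x k a) x * cnj (jac \<phi> x l b) * herm g c' (\<phi> x) a b)" for i k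
  define Q where "Q i k = (\<Sum>e\<in>UNIV. \<Sum>a\<in>UNIV. \<Sum>b\<in>UNIV. jac \<phi> x i e * jac \<phi> x k a * cnj (jac \<phi> x l b) * dh g c' (\<phi> x) e a b)" for i k
  have 1: "dh g c x i k l = R i k + Q i k" for i k
  proof -
    have "(\<Sum>a\<in>UNIV. \<Sum>b\<in>UNIV. \<Sum>e\<in>UNIV. F a b e) = (\<Sum>e\<in>UNIV. \<Sum>a\<in>UNIV. \<Sum>b\<in>UNIV. F a b e)" for F :: "'n \<Rightarrow> 'n \<Rightarrow> 'n \<Rightarrow> complex"
    proof -
      have "(\<Sum>a\<in>UNIV. \<Sum>b\<in>UNIV. \<Sum>e\<in>UNIV. F a b e) = (\<Sum>a\<in>UNIV. \<Sum>e\<in>UNIV. \<Sum>b\<in>UNIV. F a b e)"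
        by (intro sum.cong refl sum.swap)
      also have "\<dots> = (\<Sum>e\<in>UNIV. \<Sum>a\<in>UNIV. \<Sum>b\<in>UNIV. F a b e)" by (rule sum.swap)
      finally show ?thesis .
    qed
    note sw = this
    have "Q i k = (\<Sum>a\<in>UNIV. \<Sum>b\<in>UNIV. jac \<phi> x k a * cnj (jac \<phi> x l b) * (\<Sum>e\<in>UNIV. jac \<phi> x i e * dh g c' (\<phi> x) e a b))"
    proof -
      have "Q i k = (\<Sum>a\<in>UNIV. \<Sum>b\<in>UNIV. \<Sum>e\<in>UNIV. jac \<phi> x i e * jac \<phi> x k a * cnj (jac \<phi> x l b) * dh g c' (\<phi> x) e a b)"
        unfolding Q_def by (rule sw[symmetric])
      then show ?thesis by (simp add: sum_distrib_left mult_ac)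
    qed
    then show ?thesis unfolding cderiv_herm_change[OF x] R_def by (simp add: sum.distrib)
  qed
  have "R i k = R k i" unfolding R_def using jac_sym[OF x, of i k] by simp
  moreover have "Q k i = (\<Sum>e\<in>UNIV. \<Sum>a\<in>UNIV. \<Sum>b\<in>UNIV. jac \<phi> x i e * jac \<phi> x k a * cnj (jac \<phi> x l b) * dh g c' (\<phi> x) a e b)"
    unfolding Q_def by (subst sum.swap) (simp add: mult_ac)
  ultimately show ?thesis
    unfolding 1 by (simp add: Q_def[of i k] sum_subtractf right_diff_distrib)
qed

text \<open>\<open>psi\<close> is the contraction of the tensor \<open>\<partial>\<omega>\<close>, conjugated, with the inverse metric.\<close>

lemma psi_change:
  assumes x: "x \<in> S"
  shows "psi g c x s = (\<Sum>e\<in>UNIV. cnj (jac \<phi> x s e) * psi g c' (\<phi> x) e)"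
proof -
  define t where "t e a b = cnj (dh g c' (\<phi> x) e a b - dh g c' (\<phi> x) a e b)" for e a b
  have "cnj (dh g c x s l k - dh g c x l s k) =
    (\<Sum>e\<in>UNIV. cnj (jac \<phi> x s e) * (\<Sum>b\<in>UNIV. \<Sum>a\<in>UNIV. jac \<phi> x k b * cnj (jac \<phi> x l a) * t e a b))" for k l
    unfolding torsion_change[OF x] t_def
    by (simp add: sum_distrib_left mult_ac) (intro sum.cong refl sum.swap)
  then have "psi g c x s = - \<i> * tr2 (hinv g c x) (\<lambda>k l. \<Sum>e\<in>UNIV. cnj (jac \<phi> x s e) * (\<Sum>b\<in>UNIV. \<Sum>a\<in>UNIV. jac \<phi> x k b * cnj (jac \<phi> x l a) * t e a b))"
    by (simp add: psi_def)
  also have "tr2 (hinv g c x) (\<lambda>k l. \<Sum>e\<in>UNIV. cnj (jac \<phi> x s e) * (\<Sum>b\<in>UNIV. \<Sum>a\<in>UNIV. jac \<phi> x k b * cnj (jac \<phi> x l a) * t e a b)) =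
    (\<Sum>e\<in>UNIV. cnj (jac \<phi> x s e) * tr2 (hinv g c x) (\<lambda>k l. \<Sum>b\<in>UNIV. \<Sum>a\<in>UNIV. jac \<phi> x k b * cnj (jac \<phi> x l a) * t e a b))"
  proof -
    have "tr2 h (\<lambda>k l. \<Sum>e\<in>UNIV. f e * G e k l) = (\<Sum>e\<in>UNIV. f e * tr2 h (G e))"
      for h :: "'n \<Rightarrow> 'n \<Rightarrow> complex" and f :: "'n \<Rightarrow> complex" and G :: "'n \<Rightarrow> 'n \<Rightarrow> 'n \<Rightarrow> complex"
    proof -
      have "tr2 h (\<lambda>k l. \<Sum>e\<in>UNIV. f e * G e k l) = (\<Sum>k\<in>UNIV. \<Sum>l\<in>UNIV. \<Sum>e\<in>UNIV. f e * (h k l * G e k l))"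
        by (simp add: tr2_def sum_distrib_left mult.left_commute)
      also have "\<dots> = (\<Sum>k\<in>UNIV. \<Sum>e\<in>UNIV. \<Sum>l\<in>UNIV. f e * (h k l * G e k l))"
        by (intro sum.cong refl sum.swap)
      also have "\<dots> = (\<Sum>e\<in>UNIV. \<Sum>k\<in>UNIV. \<Sum>l\<in>UNIV. f e * (h k l * G e k l))" by (rule sum.swap)
      finally show ?thesis by (simp add: tr2_def sum_distrib_left)
    qed
    then show ?thesis .
  qed
  finally show ?thesis
    unfolding tr2_change[OF x] by (simp add: psi_def t_def sum_distrib_left mult_ac)
qed

subsection \<open>Tensors of type (1,1) and the form \<open>\<partial>\<partial>\<omega>\<close> (second \<open>\<partial>\<close> barred)\<close>

definition pull :: "complex^'n \<Rightarrow> 'n \<Rightarrow> 'n \<Rightarrow> 'n \<Rightarrow> 'n \<Rightarrow> complex" where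
  "pull x i j = (\<lambda>e f. jac \<phi> x i e * cnj (jac \<phi> x j f))"

lemma tr2_pull: "x \<in> S \<Longrightarrow> tr2 (hinv g c x) (\<lambda>k l. tr2 (pull x k l) F) = tr2 (hinv g c' (\<phi> x)) F"
  using tr2_change[of x F] by (simp add: pull_def tr2_def[of "\<lambda>e f. jac \<phi> x _ e * cnj (jac \<phi> x _ f)"])

lemma sum3_rev: "(\<Sum>x\<in>UNIV. \<Sum>y\<in>UNIV. \<Sum>z\<in>UNIV. F x y z) = (\<Sum>z\<in>UNIV. \<Sum>y\<in>UNIV. \<Sum>x\<in>UNIV. F x y z)"
  for F :: "'n \<Rightarrow> 'n \<Rightarrow> 'n \<Rightarrow> complex"
proof -
  have "(\<Sum>x\<in>UNIV. \<Sum>y\<in>UNIV. \<Sum>z\<in>UNIV. F x y z) = (\<Sum>y\<in>UNIV. \<Sum>x\<in>UNIV. \<Sum>z\<in>UNIV. F x y z)" by (rule sum.swap)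
  also have "\<dots> = (\<Sum>y\<in>UNIV. \<Sum>z\<in>UNIV. \<Sum>x\<in>UNIV. F x y z)" by (intro sum.cong refl sum.swap)
  also have "\<dots> = (\<Sum>z\<in>UNIV. \<Sum>y\<in>UNIV. \<Sum>x\<in>UNIV. F x y z)" by (rule sum.swap)
  finally show ?thesis .
qed

lemma dzb_herm_change:
  assumes x: "x \<in> S"
  shows "cderiv (dzb j) (\<lambda>y. herm g c y k l) x = (\<Sum>a\<in>UNIV. \<Sum>b\<in>UNIV.
     jac \<phi> x k a * cnj (cderiv (dz j) (\<lambda>x. jac \<phi> x l b) x) * herm g c' (\<phi> x) a b
     + jac \<phi> x k a * cnj (jac \<phi> x l b) * (\<Sum>f\<in>UNIV. cnj (jac \<phi> x j f) * cderiv (dzb f) (\<lambda>u. herm g c' u a b) (\<phi> x)))"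
proof -
  have "cderiv (dzb j) (\<lambda>y. herm g c y k l) x = cderiv (dzb j) (\<lambda>y. \<Sum>a\<in>UNIV. \<Sum>b\<in>UNIV. jac \<phi> y k a * cnj (jac \<phi> y l b) * herm g c' (\<phi> y) a b) x"
    by (rule cderiv_cong_open[OF C1.U x]) (rule herm_change)
  also have "\<dots> = (\<Sum>a\<in>UNIV. \<Sum>b\<in>UNIV.
     jac \<phi> x k a * cnj (cderiv (dz j) (\<lambda>x. jac \<phi> x l b) x) * herm g c' (\<phi> x) a b
     + jac \<phi> x k a * cnj (jac \<phi> x l b) * cderiv (dzb j) (\<lambda>y. herm g c' (\<phi> y) a b) x)"
    by (simp add: cderiv_sum cderiv_mult differentiable_sum differentiable_mult diff_jac[OF x] differentiable_cnj[OF diff_jac[OF x]]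
      diff_compose_phi[OF x C2.diff_herm[OF maps[OF x]]] dzb_jac[OF x] cderiv_cnj[OF diff_jac[OF x]])
  finally show ?thesis
    by (simp add: cderiv_phi(2)[OF x C2.diff_herm[OF maps[OF x]]])
qed

text \<open>The second derivatives of the metric are not tensorial.  The three error terms contain
  derivatives of the Jacobian in one or both of the two kinds of variables, and only the main term has
  the form of a change of basis.\<close>

definition "ddh_res1 x i j k l = (\<Sum>a\<in>UNIV. \<Sum>b\<in>UNIV. cderiv (dz i) (\<lambda>x. jac \<phi> x k a) x *
  cnj (cderiv (dz j) (\<lambda>x. jac \<phi> x l b) x) * herm g c' (\<phi> x) a b)"
definition "ddh_res2 x i j k l = (\<Sum>a\<in>UNIV. \<Sum>b\<in>UNIV. jac \<phi> x k a *
  cnj (cderiv (dz j) (\<lambda>x. jac \<phi> x l b) x) * (\<Sum>e\<in>UNIV. jac \<phi> x i e * dh g c' (\<phi> x) e a b))"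
definition "ddh_res3 x i j k l = (\<Sum>a\<in>UNIV. \<Sum>b\<in>UNIV. cderiv (dz i) (\<lambda>x. jac \<phi> x k a) x * cnj (jac \<phi> x l b) *
  (\<Sum>f\<in>UNIV. cnj (jac \<phi> x j f) * cderiv (dzb f) (\<lambda>u. herm g c' u a b) (\<phi> x)))"
definition "ddh_main x i j k l = (\<Sum>a\<in>UNIV. \<Sum>b\<in>UNIV. \<Sum>f\<in>UNIV. \<Sum>e\<in>UNIV. jac \<phi> x k a * cnj (jac \<phi> x l b) *
  cnj (jac \<phi> x j f) * jac \<phi> x i e * ddh g c' (\<phi> x) e f a b)"

lemma ddh_change:
  assumes x: "x \<in> S"
  shows "ddh g c x i j k l = ddh_res1 x i j k l + ddh_res2 x i j k l + ddh_res3 x i j k l + ddh_main x i j k l"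
proof -
  let ?Jd = "\<lambda>j l b x. cderiv (dz j) (\<lambda>x. jac \<phi> x l b) x"
  let ?B = "\<lambda>f a b z. cderiv (dzb f) (\<lambda>u. herm g c' u a b) z"
  have holoJd: "holo_on (?Jd j l b) S" for j l b
    using holo_on_cderiv[OF holo_jac C1.U] by simp
  have dJd: "(?Jd j l b) differentiable at x" for j l b
    by (rule smooth_on_differentiable[OF C1.U holo_on_smooth[OF C1.U holoJd] x])
  have zJd: "cderiv (dz i) (\<lambda>x. cnj (?Jd j l b x)) x = 0" for j l b
    using holo_on_cderiv_dzb[OF holoJd x, of i j l b] by (simp add: cderiv_cnj[OF dJd])
  have dB: "?B f a b differentiable at (\<phi> x)" for f a b
    by (rule smooth_on_differentiable[OF C2.U smooth_on_cderiv[OF C2.U C2.smooth_herm] maps[OF x]])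
  note dBp = diff_compose_phi[OF x dB]
  note dHp = diff_compose_phi[OF x C2.diff_herm[OF maps[OF x]]]
  note dJ = diff_jac[OF x] note dcJ = differentiable_cnj[OF dJ]
  have s: "cderiv (dz i) (\<lambda>y. \<Sum>f\<in>UNIV. cnj (jac \<phi> y j f) * ?B f a b (\<phi> y)) x =
     (\<Sum>f\<in>UNIV. \<Sum>e\<in>UNIV. cnj (jac \<phi> x j f) * (jac \<phi> x i e * ddh g c' (\<phi> x) e f a b))" for a b
    by (simp add: cderiv_sum cderiv_mult differentiable_mult dcJ dBp dz_cnj_jac[OF x] cderiv_phi(1)[OF x dB] ddh_def sum_distrib_left)
  have ds: "(\<lambda>y. \<Sum>f\<in>UNIV. cnj (jac \<phi> y j f) * ?B f a b (\<phi> y)) differentiable at x" for a b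
    by (simp add: differentiable_sum differentiable_mult dcJ dBp)
  have "ddh g c x i j k l = cderiv (dz i) (\<lambda>x. \<Sum>a\<in>UNIV. \<Sum>b\<in>UNIV.
     jac \<phi> x k a * cnj (?Jd j l b x) * herm g c' (\<phi> x) a b
     + jac \<phi> x k a * cnj (jac \<phi> x l b) * (\<Sum>f\<in>UNIV. cnj (jac \<phi> x j f) * ?B f a b (\<phi> x))) x"
    unfolding ddh_def by (rule cderiv_cong_open[OF C1.U x]) (rule dzb_herm_change)
  also have "\<dots> = (\<Sum>a\<in>UNIV. \<Sum>b\<in>UNIV.
     cderiv (dz i) (\<lambda>y. jac \<phi> y k a * cnj (?Jd j l b y) * herm g c' (\<phi> y) a b) x +
     cderiv (dz i) (\<lambda>y. jac \<phi> y k a * cnj (jac \<phi> y l b) * (\<Sum>f\<in>UNIV. cnj (jac \<phi> y j f) * ?B f a b (\<phi> y))) x)"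
    by (simp add: cderiv_sum cderiv_add differentiable_sum differentiable_mult differentiable_add dJ dcJ dHp differentiable_cnj[OF dJd] ds)
  also have "\<dots> = (\<Sum>a\<in>UNIV. \<Sum>b\<in>UNIV.
     (?Jd i k a x * cnj (?Jd j l b x) * herm g c' (\<phi> x) a b +
      jac \<phi> x k a * cnj (?Jd j l b x) * (\<Sum>e\<in>UNIV. jac \<phi> x i e * dh g c' (\<phi> x) e a b)) +
     (?Jd i k a x * cnj (jac \<phi> x l b) * (\<Sum>f\<in>UNIV. cnj (jac \<phi> x j f) * ?B f a b (\<phi> x)) +
      jac \<phi> x k a * cnj (jac \<phi> x l b) * (\<Sum>f\<in>UNIV. \<Sum>e\<in>UNIV. cnj (jac \<phi> x j f) * (jac \<phi> x i e * ddh g c' (\<phi> x) e f a b))))"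
    by (intro sum.cong refl)
       (simp only: cderiv_mult differentiable_mult dJ dcJ dHp differentiable_cnj[OF dJd] ds s zJd dz_cnj_jac[OF x]
         cderiv_phi(1)[OF x C2.diff_herm[OF maps[OF x]]] dh_def[symmetric] mult_zero_left mult_zero_right add_0_right)
  finally show ?thesis
    by (simp add: ddh_res1_def ddh_res2_def ddh_res3_def ddh_main_def sum.distrib sum_distrib_left mult.assoc)
qed

text \<open>The alternation corresponds to the components of \<open>\<partial>\<partial>\<omega>\<close> with the second \<open>\<partial>\<close> barred.\<close>

definition alt22 :: "('n \<Rightarrow> 'n \<Rightarrow> 'n \<Rightarrow> 'n \<Rightarrow> complex) \<Rightarrow> 'n \<Rightarrow> 'n \<Rightarrow> 'n \<Rightarrow> 'n \<Rightarrow> complex" where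
  "alt22 D p q i j = D p q i j - D p j i q - D i q p j + D i j p q"

text \<open>Each of the error terms is symmetric in \<open>p\<close> and \<open>i\<close> or in \<open>q\<close> and \<open>j\<close>, because derivatives of the
  Jacobian are symmetric, and disappears under alternation.\<close>

lemma alt22_change:
  assumes x: "x \<in> S"
  shows "alt22 (ddh g c x) p q i j = tr2 (pull x p q) (\<lambda>e f. tr2 (pull x i j) (alt22 (ddh g c' (\<phi> x)) e f))"
proof -
  have 1: "ddh_res1 x i j k l = ddh_res1 x k j i l" for i j k l
    unfolding ddh_res1_def using jac_sym[OF x] by simp
  have 3: "ddh_res3 x i j k l = ddh_res3 x k j i l" for i j k l
    unfolding ddh_res3_def using jac_sym[OF x] by simp
  have 2: "ddh_res2 x i j k l = ddh_res2 x i l k j" for i j k l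
    unfolding ddh_res2_def using jac_sym[OF x, of j l] by simp
  let ?M = "\<lambda>D i j k l. tr2 (pull x i j) (\<lambda>e f. tr2 (pull x k l) (D e f))"
  have expand: "?M D i j k l = (\<Sum>e\<in>UNIV. \<Sum>f\<in>UNIV. \<Sum>a\<in>UNIV. \<Sum>b\<in>UNIV. jac \<phi> x i e * (cnj (jac \<phi> x j f) * (jac \<phi> x k a * (cnj (jac \<phi> x l b) * D e f a b))))" for D i j k l
    by (simp add: tr2_def pull_def sum_distrib_left mult.assoc)
  have 4: "ddh_main x i j k l = ?M (ddh g c' (\<phi> x)) i j k l" for i j k l
  proof -
    have "ddh_main x i j k l = (\<Sum>a\<in>UNIV. \<Sum>b\<in>UNIV. \<Sum>e\<in>UNIV. \<Sum>f\<in>UNIV. jac \<phi> x i e * (cnj (jac \<phi> x j f) * (jac \<phi> x k a * (cnj (jac \<phi> x l b) * ddh g c' (\<phi> x) e f a b))))"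
      unfolding ddh_main_def by (intro sum.cong refl trans[OF sum.swap] ) (simp add: mult_ac)
    also have "\<dots> = tr2 (pull x k l) (\<lambda>a b. tr2 (pull x i j) (\<lambda>e f. ddh g c' (\<phi> x) e f a b))"
      by (simp add: tr2_def pull_def sum_distrib_left mult_ac)
    also have "\<dots> = ?M (ddh g c' (\<phi> x)) i j k l" by (rule tr2_swap)
    finally show ?thesis .
  qed
  have e1: "?M D i l k j = ?M (\<lambda>e f a b. D e b a f) i j k l" for D i j k l
    unfolding expand by (rule sum.cong[OF refl], subst sum3_rev) (simp add: mult_ac)
  have e2: "?M D k j i l = ?M (\<lambda>e f a b. D a f e b) i j k l" for D i j k l
  proof -
    have r: "(\<Sum>e\<in>UNIV. \<Sum>f\<in>UNIV. \<Sum>a\<in>UNIV. \<Sum>b\<in>UNIV. F e f a b) = (\<Sum>a\<in>UNIV. \<Sum>f\<in>UNIV. \<Sum>e\<in>UNIV. \<Sum>b\<in>UNIV. F e f a b)"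
      for F :: "'n \<Rightarrow> 'n \<Rightarrow> 'n \<Rightarrow> 'n \<Rightarrow> complex" by (rule sum3_rev)
    show ?thesis unfolding expand by (subst r) (simp add: mult_ac)
  qed
  have e3: "?M D k l i j = ?M (\<lambda>e f a b. D a b e f) i j k l" for D i j k l
    by (rule tr2_swap)
  have lin: "?M (alt22 D) i j k l = ?M D i j k l - ?M (\<lambda>e f a b. D e b a f) i j k l
     - ?M (\<lambda>e f a b. D a f e b) i j k l + ?M (\<lambda>e f a b. D a b e f) i j k l" for D i j k l
    by (simp add: alt22_def[abs_def] tr2_add tr2_diff)
  let ?D = "ddh g c' (\<phi> x)"
  have "tr2 (pull x p q) (\<lambda>e f. tr2 (pull x i j) (alt22 ?D e f)) =
    ?M ?D p q i j - ?M ?D p j i q - ?M ?D i q p j + ?M ?D i j p q"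
    unfolding lin[where D="?D"] e1[where D="?D" and i=p and j=q and k=i and l=j] e2[where D="?D" and i=p and j=q and k=i and l=j] e3[where D="?D" and i=p and j=q and k=i and l=j] ..
  then show ?thesis
    unfolding 4[symmetric] alt22_def[of "ddh g c x"] ddh_change[OF x]
    using 1[of p q i j] 1[of p j i q] 3[of p q i j] 3[of p j i q] 2[of p q i j] 2[of i q p j] by simp
qed

lemma Lform_change:
  assumes x: "x \<in> S"
  shows "Lform (hinv g c x) (ddh g c x) i j = tr2 (pull x i j) (Lform (hinv g c' (\<phi> x)) (ddh g c' (\<phi> x)))"
proof -
  have L: "Lform h D i j = \<i> * tr2 h (\<lambda>p q. alt22 D p q i j)" for h :: "'n \<Rightarrow> 'n \<Rightarrow> complex" and D i j
    by (simp add: Lform_def alt22_def)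
  have "Lform (hinv g c x) (ddh g c x) i j = \<i> * tr2 (hinv g c x) (\<lambda>p q. tr2 (pull x p q) (\<lambda>e f. tr2 (pull x i j) (alt22 (ddh g c' (\<phi> x)) e f)))"
    unfolding L alt22_change[OF x] ..
  also have "\<dots> = \<i> * tr2 (pull x i j) (\<lambda>a b. tr2 (hinv g c' (\<phi> x)) (\<lambda>e f. alt22 (ddh g c' (\<phi> x)) e f a b))"
    unfolding tr2_pull[OF x] by (subst tr2_swap) (rule refl)
  finally show ?thesis by (simp add: L[abs_def] tr2_cmult)
qed

text \<open>For a \<open>(0,1)\<close>-form \<open>\<eta>\<close> the components of \<open>\<partial>\<eta>\<close> again transform as a tensor.\<close>

lemma dz_change01:
  assumes x: "x \<in> S" and e: "\<And>y j. y \<in> S \<Longrightarrow> eta y j = (\<Sum>b\<in>UNIV. cnj (jac \<phi> y j b) * eta' (\<phi> y) b)"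
    and d: "\<And>b. (\<lambda>z. eta' z b) differentiable at (\<phi> x)"
  shows "cderiv (dz i) (\<lambda>y. eta y j) x = tr2 (pull x i j) (\<lambda>a b. cderiv (dz a) (\<lambda>z. eta' z b) (\<phi> x))"
proof -
  have "cderiv (dz i) (\<lambda>y. eta y j) x = cderiv (dz i) (\<lambda>y. \<Sum>b\<in>UNIV. cnj (jac \<phi> y j b) * eta' (\<phi> y) b) x"
    by (rule cderiv_cong_open[OF C1.U x]) (rule e)
  also have "\<dots> = (\<Sum>b\<in>UNIV. \<Sum>a\<in>UNIV. cnj (jac \<phi> x j b) * (jac \<phi> x i a * cderiv (dz a) (\<lambda>z. eta' z b) (\<phi> x)))"
    by (simp add: cderiv_sum cderiv_mult differentiable_mult differentiable_cnj[OF diff_jac[OF x]] diff_compose_phi[OF x d]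
       dz_cnj_jac[OF x] cderiv_phi(1)[OF x d] sum_distrib_left)
  also have "\<dots> = tr2 (pull x i j) (\<lambda>a b. cderiv (dz a) (\<lambda>z. eta' z b) (\<phi> x))"
    unfolding tr2_def pull_def by (subst sum.swap) (simp add: mult_ac)
  finally show ?thesis .
qed

end

section \<open>Determinants\<close>

text \<open>Jacobi's formula: the partial derivative of the determinant in the entry \<open>(i, j)\<close> is the
  cofactor, that is, \<open>det M\<close> times the entry \<open>(j, i)\<close> of the inverse \<open>N\<close>.\<close>

lemma has_derivative_det:
  fixes M :: "'a::real_normed_vector \<Rightarrow> 'f::real_normed_field^'k^'k"
  assumes d: "\<And>i j. ((\<lambda>x. M x $ i $ j) has_derivative M' i j) (at x)"
    and inv: "N ** M x = mat 1"
  shows "((\<lambda>x. det (M x)) has_derivative (\<lambda>v. det (M x) * (\<Sum>i\<in>UNIV. \<Sum>j\<in>UNIV. M' i j v * N $ j $ i))) (at x)"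
proof -
  let ?P = "{p. p permutes (UNIV :: 'k set)}"
  have "((\<lambda>x. det (M x)) has_derivative (\<lambda>v. \<Sum>p\<in>?P. of_int (sign p) * (\<Sum>i\<in>UNIV. M' i (p i) v * (\<Prod>j\<in>UNIV - {i}. M x $ j $ p j)))) (at x)"
    unfolding det_def by (intro has_derivative_sum has_derivative_mult_right has_derivative_prod d)
  moreover have "(\<Sum>p\<in>?P. of_int (sign p) * (\<Sum>i\<in>UNIV. M' i (p i) v * (\<Prod>j\<in>UNIV - {i}. M x $ j $ p j))) =
     det (M x) * (\<Sum>i\<in>UNIV. \<Sum>j\<in>UNIV. M' i j v * N $ j $ i)" for v
  proof -
    have "(\<Sum>p\<in>?P. of_int (sign p) * (\<Sum>i\<in>UNIV. M' i (p i) v * (\<Prod>j\<in>UNIV - {i}. M x $ j $ p j))) =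
       (\<Sum>i\<in>UNIV. \<Sum>p\<in>?P. of_int (sign p) * (M' i (p i) v * (\<Prod>j\<in>UNIV - {i}. M x $ j $ p j)))"
      unfolding sum_distrib_left by (rule sum.swap)
    also have "\<dots> = (\<Sum>i\<in>UNIV. det (\<chi> r. if r = i then (\<chi> j. M' i j v) else M x $ r))"
    proof (intro sum.cong refl)
      fix i
      have "(\<Prod>r\<in>UNIV. (\<chi> r. if r = i then (\<chi> j. M' i j v) else M x $ r) $ r $ p r) =
          M' i (p i) v * (\<Prod>j\<in>UNIV - {i}. M x $ j $ p j)" for p
        by (subst prod.remove[of _ i]) (auto intro!: arg_cong2[where f="(*)"] prod.cong)
      then show "(\<Sum>p\<in>?P. of_int (sign p) * (M' i (p i) v * (\<Prod>j\<in>UNIV - {i}. M x $ j $ p j))) =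
          det (\<chi> r. if r = i then (\<chi> j. M' i j v) else M x $ r)"
        unfolding det_def by simp
    qed
    also have "\<dots> = (\<Sum>i\<in>UNIV. det (M x) * (\<Sum>j\<in>UNIV. M' i j v * N $ j $ i))"
    proof (intro sum.cong refl)
      fix i
      define w where "w = (\<chi> j. M' i j v)"
      have rowM: "row r (M x) = M x $ r" for r by (simp add: row_def vec_eq_iff)
      define y where "y = w v* N"
      have "(\<Sum>r\<in>UNIV. y $ r *s row r (M x)) = w"
      proof -
        have "(\<Sum>r\<in>UNIV. y $ r *s row r (M x)) = y v* M x"
          by (simp add: vec_eq_iff vector_matrix_mult_def row_def mult.commute)
        also have "\<dots> = w" unfolding y_def by (simp add: vector_matrix_mul_assoc inv)
        finally show ?thesis .
      qed
      then have "det (\<chi> r. if r = i then w else row r (M x)) = y $ i * det (M x)"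
        using cramer_lemma_transpose[of i y "M x"] by (simp only:)
      then show "det (\<chi> r. if r = i then (\<chi> j. M' i j v) else M x $ r) = det (M x) * (\<Sum>j\<in>UNIV. M' i j v * N $ j $ i)"
        unfolding rowM w_def by (simp add: y_def w_def vector_matrix_mult_def mult_ac)
    qed
    finally show ?thesis by (simp add: sum_distrib_left)
  qed
  ultimately show ?thesis by (simp only:)
qed

section \<open>Lebesgue measure on \<open>complex^'n\<close>\<close>

text \<open>The Jacobian determinant in the change of variables formula belongs to a real matrix, so
  \<open>complex^'n\<close> is identified with a coordinate space.  The index type \<open>'n bit0\<close> has twice as many
  elements as \<open>'n\<close> and is well-ordered; the enumeration of the standard basis can be arbitrary,
  since it affects neither determinants nor Lebesgue measure.\<close>

definition enum_basis :: "'n::finite bit0 \<Rightarrow> complex^'n" where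
  "enum_basis = (SOME b. bij_betw b UNIV Basis)"

lemma enum_basis: "bij_betw (enum_basis :: 'n::finite bit0 \<Rightarrow> complex^'n) UNIV Basis"
proof -
  have "card (UNIV :: 'n bit0 set) = card (Basis :: (complex^'n) set)" by simp
  then have "\<exists>b. bij_betw b (UNIV :: 'n bit0 set) (Basis :: (complex^'n) set)"
    by (intro finite_same_card_bij) auto
  then show ?thesis unfolding enum_basis_def by (rule someI_ex)
qed

definition toR :: "complex^'n \<Rightarrow> real^('n::finite bit0)" where
  "toR v = (\<chi> i. v \<bullet> enum_basis i)"

definition fromR :: "real^('n::finite bit0) \<Rightarrow> complex^'n" where
  "fromR w = (\<Sum>i\<in>UNIV. (w $ i) *\<^sub>R enum_basis i)"

lemma enum_basis_inner: "enum_basis i \<bullet> (enum_basis j :: complex^'n::finite) = (if i = j then 1 else 0)"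
  using enum_basis bij_betwE[OF enum_basis] bij_betw_imp_inj_on[OF enum_basis]
  by (metis (no_types, lifting) UNIV_I inner_not_same_Basis inner_same_Basis injD)

lemma toR_fromR [simp]: "toR (fromR w) = w"
  by (simp add: vec_eq_iff toR_def fromR_def inner_sum_left enum_basis_inner if_distrib cong: if_cong)

lemma sum_enum_basis: "(\<Sum>i\<in>UNIV. f (enum_basis i)) = (\<Sum>b\<in>(Basis :: (complex^'n::finite) set). f b)"
  by (rule sum.reindex_bij_betw[OF enum_basis])

lemma fromR_toR [simp]: "fromR (toR v) = v"
  using sum_enum_basis[of "\<lambda>b. (v \<bullet> b) *\<^sub>R b"] by (simp add: fromR_def toR_def euclidean_representation)

lemma linear_toR: "linear toR"
  by (rule linearI) (simp_all add: toR_def vec_eq_iff inner_add_left)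

lemma linear_fromR: "linear fromR"
  by (rule linearI) (simp_all add: fromR_def scaleR_add_left sum.distrib scaleR_sum_right)

lemma measurable_toR [measurable]: "toR \<in> borel_measurable borel"
  and measurable_fromR [measurable]: "fromR \<in> borel_measurable borel"
  using linear_continuous_on linear_toR linear_fromR linear_conv_bounded_linear borel_measurable_continuous_onI by blast+

lemma lborel_distr_toR: "lborel = distr lborel borel (toR :: complex^'n::finite \<Rightarrow> _)"
proof (rule lborel_eqI)
  fix l u :: "real^('n bit0)"
  assume le: "\<And>b. b \<in> Basis \<Longrightarrow> l \<bullet> b \<le> u \<bullet> b"
  have l: "l $ i \<le> u $ i" for i using le[of "axis i 1"] by (simp add: inner_axis axis_in_Basis_iff)
  have f: "fromR w \<bullet> enum_basis i = w $ i" for w :: "real^('n bit0)" and i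
    by (simp add: fromR_def inner_sum_left enum_basis_inner if_distrib cong: if_cong)
  have B: "(\<forall>b\<in>(Basis :: (complex^'n) set). P b) \<longleftrightarrow> (\<forall>i. P (enum_basis i))" for P
    using bij_betw_imp_surj_on[OF enum_basis] by (metis UNIV_I image_iff)
  have "toR -` box l u = (box (fromR l) (fromR u) :: (complex^'n) set)"
    by (auto simp: mem_box_cart set_eq_iff) (auto simp: box_def B f toR_def)
  then have "emeasure (distr lborel borel (toR :: complex^'n \<Rightarrow> _)) (box l u) = emeasure lborel (box (fromR l) (fromR u) :: (complex^'n) set)"
    by (simp add: emeasure_distr)
  also have "\<dots> = (\<Prod>b\<in>Basis. (fromR u - fromR l :: complex^'n) \<bullet> b)"
    
    by (rule emeasure_lborel_box) (use B[of "\<lambda>b. fromR l \<bullet> b \<le> fromR u \<bullet> b"] f l in auto)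
  also have "(\<Prod>b\<in>Basis. (fromR u - fromR l :: complex^'n) \<bullet> b) = (\<Prod>i\<in>UNIV. u $ i - l $ i)"
    using prod.reindex_bij_betw[OF enum_basis, of "\<lambda>b. (fromR u - fromR l) \<bullet> b"] by (simp add: inner_diff_left f)
  also have "\<dots> = (\<Prod>b\<in>Basis. (u - l) \<bullet> b)"
    by (simp add: Basis_vec_def prod.UNION_disjoint axis_eq_axis inner_axis prod.reindex inj_on_def UNION_singleton_eq_range axis_eq_axis)
  finally show "emeasure (distr lborel borel (toR :: complex^'n \<Rightarrow> _)) (box l u) = (\<Prod>b\<in>Basis. (u - l) \<bullet> b)" .
qed simp

text \<open>The real matrix of the real linear map underlying a complex matrix.\<close>

definition realify :: "complex^'n^'n \<Rightarrow> real^('n::finite bit0)^('n bit0)" where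
  "realify A = matrix (\<lambda>w. toR (A *v fromR w))"

lemma linear_mv: "linear (\<lambda>v. A *v (v :: complex^'n))" for A :: "complex^'n^'n"
  by (rule linearI) (simp_all add: vec_eq_iff matrix_vector_mult_def algebra_simps sum.distrib scaleR_sum_right)

lemma linear_realify: "linear (\<lambda>w. toR (A *v fromR w))" for A :: "complex^'n^'n::finite"
  using linear_compose[OF linear_compose[OF linear_fromR linear_mv] linear_toR] by (simp add: o_def)

lemma realify_works: "realify A *v w = toR (A *v fromR w)"
  unfolding realify_def using matrix_vector_mul(1)[OF linear_matrix_vector_mul_eq[THEN iffD2, OF linear_realify]] by metis

lemma realify_mult: "realify (A ** B) = realify A ** realify B"
  unfolding matrix_eq by (simp add: realify_works matrix_vector_mul_assoc[symmetric])

lemma realify_one: "realify (mat 1) = mat 1"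
  unfolding matrix_eq by (simp add: realify_works)

lemma realify_add: "realify (A + r *\<^sub>R B) = realify A + r *\<^sub>R realify B"
  for A B :: "complex^'n^'n::finite"
proof -
  have "(A + r *\<^sub>R B) *v v = A *v v + r *\<^sub>R (B *v v)" for v :: "complex^'n"
    by (simp add: vec_eq_iff matrix_vector_mult_def algebra_simps sum.distrib scaleR_sum_right)
  moreover have "(C + r *\<^sub>R D) *v v = C *v v + r *\<^sub>R (D *v v)" for C D :: "real^('n bit0)^('n bit0)" and v
    by (simp add: vec_eq_iff matrix_vector_mult_def algebra_simps sum.distrib scaleR_sum_right sum_distrib_left)
  ultimately show ?thesis
    unfolding matrix_eq by (simp add: realify_works linear_add[OF linear_toR] linear_scale[OF linear_toR])
qed

lemma trace_realify: "(\<Sum>i\<in>UNIV. realify A $ i $ i) = 2 * Re (\<Sum>k\<in>UNIV. A $ k $ k)"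
  for A :: "complex^'n^'n::finite"
proof -
  have e: "fromR (axis i 1) = (enum_basis i :: complex^'n)" for i
    by (simp add: fromR_def axis_def if_distrib[of "\<lambda>r. r *\<^sub>R _"] cong: if_cong)
  have "realify A $ i $ i = (A *v enum_basis i) \<bullet> enum_basis i" for i
  proof -
    have "realify A $ i $ i = toR (A *v fromR (axis i 1)) $ i"
      by (simp add: realify_def matrix_def)
    then show ?thesis by (simp add: e toR_def)
  qed
  then have "(\<Sum>i\<in>UNIV. realify A $ i $ i) = (\<Sum>b\<in>(Basis :: (complex^'n) set). (A *v b) \<bullet> b)"
    using sum_enum_basis[of "\<lambda>b. (A *v b) \<bullet> b"] by simp
  also have "\<dots> = (\<Sum>k\<in>UNIV. (A *v axis k 1) \<bullet> axis k 1 + (A *v axis k \<i>) \<bullet> axis k \<i>)"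
  proof -
    have B: "(Basis :: (complex^'n) set) = (\<lambda>k. axis k 1) ` UNIV \<union> (\<lambda>k. axis k \<i>) ` UNIV"
      by (auto simp: Basis_vec_def Basis_complex_def)
    have "(\<Sum>b\<in>(Basis :: (complex^'n) set). (A *v b) \<bullet> b) =
      (\<Sum>b\<in>(\<lambda>k. axis k 1) ` UNIV. (A *v b) \<bullet> b) + (\<Sum>b\<in>(\<lambda>k. axis k \<i>) ` UNIV. (A *v b) \<bullet> b)"
      unfolding B by (rule sum.union_disjoint) (auto simp: axis_eq_axis)
    then show ?thesis by (simp add: sum.reindex inj_def axis_eq_axis sum.distrib)
  qed
  also have "\<dots> = (\<Sum>k\<in>UNIV. 2 * Re (A $ k $ k))"
  proof (intro sum.cong refl)
    fix k
    have "(A *v axis k c) \<bullet> axis k d = (A $ k $ k * c) \<bullet> d" for c d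
      unfolding inner_axis by (simp add: matrix_vector_mult_def axis_def if_distrib cong: if_cong)
    then show "(A *v axis k 1) \<bullet> axis k 1 + (A *v axis k \<i>) \<bullet> axis k \<i> = 2 * Re (A $ k $ k)"
      by (simp add: inner_complex_def)
  qed
  finally show ?thesis by (simp add: sum_distrib_left)
qed

text \<open>Along the line \<open>1 + t X\<close> both sides satisfy the same linear differential equation near
  \<open>t = 0\<close>, since \<open>tr\<^sub>\<real> = 2 Re tr\<close>; and both are polynomials in \<open>t\<close>.\<close>

lemma det_realify: "det (realify A) = (cmod (det A))\<^sup>2" for A :: "complex^'n^'n::finite"
proof -
  define X where "X = A - mat 1"
  define Y where "Y = realify X"
  define M where "M t = mat 1 + t *\<^sub>R X" for t :: real
  define R where "R t = mat 1 + t *\<^sub>R Y" for t :: real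
  have RM: "realify (M t) = R t" for t by (simp add: M_def R_def Y_def realify_add realify_one)
  have dM: "((\<lambda>t. M t $ i $ j) has_derivative (\<lambda>h. h *\<^sub>R X $ i $ j)) (at t)" for i j t
    unfolding M_def by (auto intro!: derivative_eq_intros)
  have dR: "((\<lambda>t. R t $ i $ j) has_derivative (\<lambda>h. h *\<^sub>R Y $ i $ j)) (at t)" for i j t
    unfolding R_def by (auto intro!: derivative_eq_intros)
  define G where "G t = (cmod (det (M t)))\<^sup>2" for t
  define F where "F t = det (R t)" for t
  have ode: "\<exists>\<tau>. (F has_real_derivative F t * \<tau>) (at t) \<and> (G has_real_derivative G t * \<tau>) (at t) \<and> F t \<noteq> 0"
    if nz: "det (M t) \<noteq> 0" for t
  proof -
    obtain N where N: "N ** M t = mat 1" "M t ** N = mat 1"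
      using nz invertible_det_nz unfolding invertible_def by blast
    then have NR: "realify N ** R t = mat 1" by (metis RM realify_mult realify_one)
    define \<tau> where "\<tau> = (\<Sum>k\<in>UNIV. (X ** N) $ k $ k)"
    have \<tau>: "(\<Sum>i\<in>UNIV. \<Sum>j\<in>UNIV. X $ i $ j * N $ j $ i) = \<tau>"
      by (simp add: \<tau>_def matrix_matrix_mult_def)
    have \<tau>R: "(\<Sum>i\<in>UNIV. \<Sum>j\<in>UNIV. Y $ i $ j * realify N $ j $ i) = 2 * Re \<tau>"
      using trace_realify[of "X ** N"] unfolding realify_mult \<tau>_def Y_def
      by (simp add: matrix_matrix_mult_def)
    have "(F has_derivative (\<lambda>v. F t * (\<Sum>i\<in>UNIV. \<Sum>j\<in>UNIV. v *\<^sub>R Y $ i $ j * realify N $ j $ i))) (at t)"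
      unfolding F_def by (rule has_derivative_det[OF dR NR])
    moreover have "(\<Sum>i\<in>UNIV. \<Sum>j\<in>UNIV. v *\<^sub>R Y $ i $ j * realify N $ j $ i) = v * (2 * Re \<tau>)" for v
      by (simp add: \<tau>R[symmetric] sum_distrib_left mult.assoc)
    ultimately have "(F has_derivative (\<lambda>v. F t * (v * (2 * Re \<tau>)))) (at t)" by (simp only:)
    moreover have "(\<lambda>v. F t * (v * (2 * Re \<tau>))) = (*) (F t * (2 * Re \<tau>))" by (simp add: fun_eq_iff)
    ultimately have 1: "(F has_real_derivative F t * (2 * Re \<tau>)) (at t)"
      by (simp only: has_field_derivative_def)
    have "((\<lambda>t. det (M t)) has_derivative (\<lambda>v. det (M t) * (\<Sum>i\<in>UNIV. \<Sum>j\<in>UNIV. v *\<^sub>R X $ i $ j * N $ j $ i))) (at t)"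
      by (rule has_derivative_det[OF dM N(1)])
    moreover have "(\<Sum>i\<in>UNIV. \<Sum>j\<in>UNIV. v *\<^sub>R X $ i $ j * N $ j $ i) = v *\<^sub>R \<tau>" for v
      by (simp add: \<tau>[symmetric] scaleR_sum_right)
    ultimately have D: "((\<lambda>t. det (M t)) has_vector_derivative det (M t) * \<tau>) (at t)"
      by (simp add: has_vector_derivative_def)
    have "((\<lambda>t. Re (det (M t) * cnj (det (M t)))) has_vector_derivative
        Re (det (M t) * cnj (det (M t) * \<tau>) + det (M t) * \<tau> * cnj (det (M t)))) (at t)"
      by (intro bounded_linear.has_vector_derivative[OF bounded_linear_Re] has_vector_derivative_mult D
          bounded_linear.has_vector_derivative[OF bounded_linear_cnj])
    moreover have "Re (z * cnj (z * \<tau>) + z * \<tau> * cnj z) = (cmod z)\<^sup>2 * (2 * Re \<tau>)" for z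
      unfolding cmod_power2 by (simp add: power2_eq_square algebra_simps)
    moreover have "Re (z * cnj z) = (cmod z)\<^sup>2" for z
      unfolding cmod_power2 by (simp add: power2_eq_square)
    ultimately have 2: "(G has_real_derivative G t * (2 * Re \<tau>)) (at t)"
      by (simp add: G_def[abs_def] has_real_derivative_iff_has_vector_derivative)
    have "F t \<noteq> 0"
      using arg_cong[OF NR, of det] unfolding F_def by (auto simp: det_mul)
    with 1 2 show ?thesis by blast
  qed
  have "continuous (at 0) (\<lambda>t. det (M t))"
    unfolding det_def M_def by (intro continuous_intros)
  moreover have "det (M 0) \<noteq> 0" by (simp add: M_def)
  ultimately have "\<forall>\<^sub>F t in at 0. det (M t) \<noteq> 0"
    by (simp add: continuous_at tendsto_imp_eventually_ne)
  then obtain \<epsilon> where \<epsilon>: "\<epsilon> > 0" "\<And>t. \<bar>t\<bar> < \<epsilon> \<Longrightarrow> det (M t) \<noteq> 0"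
    using \<open>det (M 0) \<noteq> 0\<close> unfolding eventually_at by (metis dist_0_norm dist_commute real_norm_def UNIV_I)
  have near: "F t = G t" if "\<bar>t\<bar> < \<epsilon>" for t
  proof -
    have "((\<lambda>t. G t / F t) has_real_derivative 0) (at s within {-\<epsilon><..<\<epsilon>})" if s: "s \<in> {-\<epsilon><..<\<epsilon>}" for s
    proof -
      obtain \<tau> where t: "(F has_real_derivative F s * \<tau>) (at s)" "(G has_real_derivative G s * \<tau>) (at s)" "F s \<noteq> 0"
        using ode[of s] \<epsilon>(2)[of s] s by auto
      have "((\<lambda>t. G t / F t) has_real_derivative (G s * \<tau> * F s - G s * (F s * \<tau>)) / (F s * F s)) (at s)"
        by (rule DERIV_divide[OF t(2,1,3)])
      then show ?thesis by (simp add: has_field_derivative_at_within)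
    qed
    then obtain k where k: "\<And>s. s \<in> {-\<epsilon><..<\<epsilon>} \<Longrightarrow> G s / F s = k"
      using has_field_derivative_zero_constant[of "{-\<epsilon><..<\<epsilon>}" "\<lambda>t. G t / F t"] by auto
    have "k = 1" using k[of 0] \<epsilon>(1) by (simp add: G_def F_def M_def R_def)
    moreover have "t \<in> {-\<epsilon><..<\<epsilon>}" using that by auto
    ultimately have "G t / F t = 1" using k[of t] by simp
    then show ?thesis using ode[OF \<epsilon>(2)[OF that]] by auto
  qed
  define P where "P = det (\<chi> i j. ([: of_real (mat 1 $ i $ j), of_real (Y $ i $ j) :] :: complex poly))"
  define Q where "Q = det (\<chi> i j. ([: mat 1 $ i $ j, X $ i $ j :] :: complex poly))"
  define Q' where "Q' = det (\<chi> i j. ([: cnj (mat 1 $ i $ j), cnj (X $ i $ j) :] :: complex poly))"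
  have pP: "poly P (of_real t) = of_real (F t)" for t
    by (simp add: P_def F_def R_def det_def poly_sum poly_prod)
  have Mc: "M t $ i $ j = mat 1 $ i $ j + of_real t * X $ i $ j" for t i j
    unfolding M_def by (simp only: vector_add_component vector_scaleR_component) (simp only: scaleR_conv_of_real)
  have pQ: "poly Q (of_real t) = det (M t)" for t
    by (simp add: Q_def Mc det_def poly_sum poly_prod)
  have pQ': "poly Q' (of_real t) = cnj (det (M t))" for t
    by (simp add: Q'_def Mc det_def poly_sum poly_prod)
  have G: "of_real (G t) = poly (Q * Q') (of_real t)" for t
    unfolding poly_mult pQ pQ' G_def by (rule complex_norm_square)
  have "P - Q * Q' = 0"
  proof (rule ccontr)
    assume "P - Q * Q' \<noteq> 0"
    then have "finite {z. poly (P - Q * Q') z = 0}" by (rule poly_roots_finite)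
    moreover have "of_real ` {-\<epsilon><..<\<epsilon>} \<subseteq> {z. poly (P - Q * Q') z = 0}"
    proof
      fix z assume "z \<in> complex_of_real ` {-\<epsilon><..<\<epsilon>}"
      then obtain t where t: "z = of_real t" "\<bar>t\<bar> < \<epsilon>" by auto
      have "poly (P - Q * Q') z = of_real (F t) - of_real (G t)"
        unfolding G t(1) by (simp only: poly_diff pP)
      then show "z \<in> {z. poly (P - Q * Q') z = 0}" using near[OF t(2)] by simp
    qed
    ultimately have "finite (complex_of_real ` {-\<epsilon><..<\<epsilon>})" by (rule rev_finite_subset)
    then have "finite {-\<epsilon><..<\<epsilon>}" by (rule finite_imageD) (simp add: inj_on_def)
    then show False using infinite_Ioo[of "-\<epsilon>" \<epsilon>] \<epsilon>(1) by linarith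
  qed
  then have "poly P (of_real 1) = poly (Q * Q') (of_real 1)" by simp
  then have "F 1 = G 1" unfolding pP G[symmetric] by (simp only: of_real_eq_iff)
  moreover have "M 1 = A" by (simp add: M_def X_def)
  ultimately show ?thesis using RM[of 1] by (simp add: F_def G_def)
qed

text \<open>Images of infinite measure are included: the change of variables theorem for integrable
  functions applies in one case, and in the other it shows that the integral cannot be finite.\<close>

lemma emeasure_differentiable_image:
  fixes f :: "real^'m::{finite,wellorder} \<Rightarrow> real^'m::_"
  assumes S: "S \<in> sets borel" and fS: "f ` S \<in> sets borel"
    and f: "\<And>x. x \<in> S \<Longrightarrow> (f has_derivative f' x) (at x within S)" and inj: "inj_on f S"
    and m: "(\<lambda>x. indicator S x * \<bar>det (matrix (f' x))\<bar>) \<in> borel_measurable borel"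
  shows "emeasure lborel (f ` S) = (\<integral>\<^sup>+x. ennreal (indicator S x * \<bar>det (matrix (f' x))\<bar>) \<partial>lborel)"
proof (cases "f ` S \<in> lmeasurable")
  case True
  have Sl: "S \<in> sets lebesgue" using S sets_completionI_sets[of S lborel] by simp
  have "((\<lambda>x. \<bar>det (matrix (f' x))\<bar>) has_integral measure lebesgue (f ` S)) S"
    using has_measure_differentiable_image[OF Sl f inj] True by blast
  then have "(\<integral>\<^sup>+x. ennreal (indicator S x * \<bar>det (matrix (f' x))\<bar>) \<partial>lborel) = ennreal (measure lebesgue (f ` S))"
    by (intro nn_integral_has_integral_lebesgue) auto
  also have "\<dots> = emeasure lebesgue (f ` S)" by (rule emeasure_eq_measure2[OF True, symmetric])
  also have "\<dots> = emeasure lborel (f ` S)" using fS by simp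
  finally show ?thesis by simp
next
  case False
  have Sl: "S \<in> sets lebesgue" using S sets_completionI_sets[of S lborel] by simp
  have "emeasure lborel (f ` S) = \<infinity>"
  proof (rule ccontr)
    assume "emeasure lborel (f ` S) \<noteq> \<infinity>"
    then have "emeasure lebesgue (f ` S) < \<infinity>" using fS by (simp add: less_top)
    moreover have "f ` S \<in> sets lebesgue" using fS sets_completionI_sets[of "f ` S" lborel] by simp
    ultimately show False using False fmeasurableI by blast
  qed
  moreover have "(\<integral>\<^sup>+x. ennreal (indicator S x * \<bar>det (matrix (f' x))\<bar>) \<partial>lborel) = \<infinity>"
  proof (rule ccontr)
    assume "(\<integral>\<^sup>+x. ennreal (indicator S x * \<bar>det (matrix (f' x))\<bar>) \<partial>lborel) \<noteq> \<infinity>"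
    then have "integrable lborel (\<lambda>x. indicator S x * \<bar>det (matrix (f' x))\<bar>)"
      using m by (intro integrableI_nonneg) (simp_all add: less_top)
    then have "(\<lambda>x. indicator S x * \<bar>det (matrix (f' x))\<bar>) integrable_on UNIV"
      using has_integral_integral_lborel unfolding integrable_on_def by blast
    moreover have "(\<lambda>x. indicator S x * \<bar>det (matrix (f' x))\<bar>) = (\<lambda>x. if x \<in> S then \<bar>det (matrix (f' x))\<bar> else 0)"
      by (auto simp: indicator_def)
    ultimately have "(\<lambda>x. \<bar>det (matrix (f' x))\<bar>) integrable_on S"
      by (simp only: integrable_restrict_UNIV)
    then show False using measurable_differentiable_image_eq[OF Sl f inj] False by simp
  qed
  ultimately show ?thesis by simp
qed

text \<open>The real Jacobian determinant of a holomorphic map is the squared modulus of the complex one.\<close>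

lemma emeasure_holomorphic_image:
  fixes \<phi> :: "complex^'n \<Rightarrow> complex^'n::finite" and J :: "complex^'n \<Rightarrow> complex^'n^'n"
  assumes B: "B \<in> sets borel" and pB: "\<phi> ` B \<in> sets borel"
    and der: "\<And>x. x \<in> B \<Longrightarrow> (\<phi> has_derivative (\<lambda>v. J x *v v)) (at x)" and inj: "inj_on \<phi> B"
    and m: "(\<lambda>x. indicator B x * (cmod (det (J x)))\<^sup>2) \<in> borel_measurable borel"
  shows "emeasure lborel (\<phi> ` B) = (\<integral>\<^sup>+x. ennreal (indicator B x * (cmod (det (J x)))\<^sup>2) \<partial>lborel)"
proof -
  define f where "f w = toR (\<phi> (fromR w))" for w
  define S where "S = toR ` B"
  have S: "S = fromR -` B" unfolding S_def by (auto simp: image_iff) (metis toR_fromR)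
  have fS: "f ` S = fromR -` (\<phi> ` B)" unfolding S_def f_def by (auto simp: image_iff) (metis toR_fromR)
  have borelS: "S \<in> sets borel" unfolding S using measurable_sets[OF measurable_fromR B] by simp
  have borelfS: "f ` S \<in> sets borel" unfolding fS using measurable_sets[OF measurable_fromR pB] by simp
  have m': "matrix (\<lambda>w. toR (J x *v fromR w)) = realify (J x)" for x by (simp add: realify_def)
  have i: "indicator S w = (indicator B (fromR w) :: real)" for w by (simp add: S indicator_def)
  have "emeasure lborel (\<phi> ` B) = emeasure (distr lborel borel toR) (f ` S)"
  proof -
    have "toR -` (f ` S) = \<phi> ` B" unfolding fS by auto
    then show ?thesis using borelfS by (simp add: emeasure_distr)
  qed
  also have "\<dots> = emeasure lborel (f ` S)" by (simp add: lborel_distr_toR[symmetric])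
  also have "\<dots> = (\<integral>\<^sup>+w. ennreal (indicator S w * \<bar>det (matrix (\<lambda>v. toR (J (fromR w) *v fromR v)))\<bar>) \<partial>lborel)"
  proof (rule emeasure_differentiable_image[OF borelS borelfS])
    fix w assume "w \<in> S"
    then have "fromR w \<in> B" by (simp add: S)
    have l: "(fromR has_derivative fromR) (at w)" "(toR has_derivative toR) (at z)" for z
      using linear_fromR linear_toR linear_conv_bounded_linear bounded_linear_imp_has_derivative by blast+
    have "((\<lambda>w. \<phi> (fromR w)) has_derivative (\<lambda>v. J (fromR w) *v fromR v)) (at w)"
      by (rule has_derivative_compose[OF l(1) der]) fact
    then have "(f has_derivative (\<lambda>v. toR (J (fromR w) *v fromR v))) (at w)"
      unfolding f_def by (rule has_derivative_compose[OF _ l(2)])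
    then show "(f has_derivative (\<lambda>v. toR (J (fromR w) *v fromR v))) (at w within S)"
      by (rule has_derivative_at_withinI)
  next
    show "inj_on f S"
    proof (rule inj_onI)
      fix u v assume "u \<in> S" "v \<in> S" "f u = f v"
      then have "\<phi> (fromR u) = \<phi> (fromR v)" unfolding f_def by (metis fromR_toR)
      then have "(fromR u :: complex^'n) = fromR v" using inj \<open>u \<in> S\<close> \<open>v \<in> S\<close> by (simp add: S inj_on_def)
      then show "u = v" by (metis toR_fromR)
    qed
    show "(\<lambda>w. indicator S w * \<bar>det (matrix (\<lambda>v. toR (J (fromR w) *v fromR v)))\<bar>) \<in> borel_measurable borel"
      unfolding m' det_realify i using measurable_compose[OF measurable_fromR m] by simp
  qed
  also have "\<dots> = (\<integral>\<^sup>+w. ennreal (indicator B (fromR w) * (cmod (det (J (fromR w))))\<^sup>2) \<partial>lborel)"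
    unfolding m' det_realify i by simp
  also have "\<dots> = (\<integral>\<^sup>+w. ennreal (indicator B (fromR w) * (cmod (det (J (fromR w))))\<^sup>2) \<partial>distr lborel borel (toR :: complex^'n \<Rightarrow> _))"
    by (simp only: lborel_distr_toR[symmetric])
  also have "\<dots> = (\<integral>\<^sup>+x. ennreal (indicator B (fromR (toR x :: real^('n bit0))) * (cmod (det (J (fromR (toR x)))))\<^sup>2) \<partial>lborel)"
    using measurable_compose[OF measurable_fromR m] by (intro nn_integral_distr) (auto simp: measurable_toR)
  finally show ?thesis by simp
qed

section \<open>Charts of a compact Hermitian manifold\<close>

lemma Ck_on_subset: "Ck_on k f S \<Longrightarrow> T \<subseteq> S \<Longrightarrow> Ck_on k f T"
proof (induction k arbitrary: f)
  case 0 then show ?case using continuous_on_subset by simp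
next
  case (Suc k) then show ?case using differentiable_on_subset[of f S T] by auto
qed

lemma smooth_on_subset: "smooth_on f S \<Longrightarrow> T \<subseteq> S \<Longrightarrow> smooth_on f T"
  unfolding smooth_on_def using Ck_on_subset by blast

text \<open>A positive definite Hermitian matrix is connected to the identity through such matrices, and
  its determinant is real.\<close>

lemma det_herm_pos:
  assumes hf: "hermitian_at g c x"
  shows "Re (det (\<chi> i j. herm g c x i j)) > 0" "Im (det (\<chi> i j. herm g c x i j)) = 0"
proof -
  \<comment> \<open>The straight path from the identity to \<open>h\<close>.\<close>
  define H where "H t = (\<chi> i j. of_real t * herm g c x i j + of_real (1 - t) * (if i = j then 1 else 0))" for t :: real
  have re: "Im (det (H t)) = 0" for t
  proof -
    have "cnj (det (H t)) = det (\<chi> i j. cnj (H t $ i $ j))" by (simp add: det_def)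
    also have "(\<chi> i j. cnj (H t $ i $ j)) = transpose (H t)"
      by (auto simp: vec_eq_iff transpose_def H_def cnj_herm[OF hf])
    also have "det (transpose (H t)) = det (H t)" by (rule det_transpose)
    finally show ?thesis by (metis complex_cnj_cancel_iff complex_eq_iff complex_cnj cnj.simps(2) neg_equal_zero)
  qed
  have nz: "det (H t) \<noteq> 0" if t: "0 \<le> t" "t \<le> 1" for t
  proof -
    have "w = 0" if w: "transpose (H t) *v w = 0" for w
    proof (rule ccontr)
      assume "w \<noteq> 0"
      have z: "(\<Sum>i\<in>UNIV. H t $ i $ j * w $ i) = 0" for j
        using w by (simp add: vec_eq_iff matrix_vector_mult_def transpose_def)
      have "0 = (\<Sum>j\<in>UNIV. (\<Sum>i\<in>UNIV. H t $ i $ j * w $ i) * cnj (w $ j))" by (simp add: z)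
      also have "\<dots> = (\<Sum>j\<in>UNIV. \<Sum>i\<in>UNIV. of_real t * (w $ i * cnj (w $ j) * herm g c x i j) +
          (if i = j then of_real (1 - t) * (w $ i * cnj (w $ j)) else 0))"
        unfolding sum_distrib_right by (intro sum.cong refl) (auto simp: H_def algebra_simps)
      also have "\<dots> = of_real t * (\<Sum>j\<in>UNIV. \<Sum>i\<in>UNIV. w $ i * cnj (w $ j) * herm g c x i j) +
          of_real (1 - t) * (\<Sum>j\<in>UNIV. w $ j * cnj (w $ j))"
        by (simp add: sum.distrib sum_distrib_left)
      also have "(\<Sum>j\<in>UNIV. \<Sum>i\<in>UNIV. w $ i * cnj (w $ j) * herm g c x i j) = of_real (g c x w w / 2)"
        using herm_pos[OF hf, of w] by (subst sum.swap) simp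
      also have "(\<Sum>j\<in>UNIV. w $ j * cnj (w $ j)) = of_real ((norm w)\<^sup>2)"
        by (simp add: norm_vec_def L2_set_def sum_nonneg complex_norm_square[symmetric])
      finally have "complex_of_real (t * (g c x w w / 2) + (1 - t) * (norm w)\<^sup>2) = 0" by simp
      then have "t * (g c x w w / 2) + (1 - t) * (norm w)\<^sup>2 = 0" using of_real_eq_0_iff by blast
      moreover have "t * (g c x w w / 2) \<ge> 0" "(1 - t) * (norm w)\<^sup>2 \<ge> 0"
        using t hf_pos[OF hf \<open>w \<noteq> 0\<close>] by auto
      ultimately have "t * (g c x w w / 2) = 0" "(1 - t) * (norm w)\<^sup>2 = 0" by linarith+
      then show False using hf_pos[OF hf \<open>w \<noteq> 0\<close>] \<open>w \<noteq> 0\<close> by auto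
    qed
    then have "invertible (transpose (H t))"
      using matrix_left_invertible_ker[of "transpose (H t)"] invertible_left_inverse by blast
    then show ?thesis using invertible_det_nz det_transpose by metis
  qed
  have cont: "continuous_on {0..1} (\<lambda>t. Re (det (H t)))"
    unfolding det_def H_def vec_lambda_beta by (intro continuous_intros)
  have "Re (det (H 1)) > 0"
  proof (rule ccontr)
    assume "\<not> Re (det (H 1)) > 0"
    moreover have "Re (det (H 0)) = 1"
    proof -
      have "H 0 = mat 1" by (simp add: H_def mat_def)
      then show ?thesis by simp
    qed
    ultimately obtain t where "0 \<le> t" "t \<le> 1" "Re (det (H t)) = 0"
      using IVT2'[of "\<lambda>t. Re (det (H t))" 1 0 0] cont by auto
    then show False using nz[of t] re[of t] by (simp add: complex_eq_iff)
  qed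
  moreover have "H 1 = (\<chi> i j. herm g c x i j)" by (simp add: H_def)
  ultimately show "Re (det (\<chi> i j. herm g c x i j)) > 0" "Im (det (\<chi> i j. herm g c x i j)) = 0"
    using re[of 1] by simp_all
qed

text \<open>The density of \<open>\<omega>\<^sup>n/n!\<close> with respect to Lebesgue measure.\<close>

definition vdens :: "('m, 'n) metric \<Rightarrow> ('m, 'n::finite) chart \<Rightarrow> complex^'n \<Rightarrow> real" where
  "vdens g c x = 2 ^ CARD('n) * Re (det (\<chi> i j. herm g c x i j))"

abbreviation cinv :: "('m, 'n) chart \<Rightarrow> complex^'n \<Rightarrow> 'm" where
  "cinv c \<equiv> inv_into (fst c) (snd c)"

locale hermitian_manifold =
  fixes A :: "('m::t2_space, 'n::finite) chart set" and g :: "('m, 'n) metric"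
  assumes atlas: "complex_atlas A" and metric: "hermitian_metric A g"
begin

lemma chart_cover: "\<exists>c\<in>A. m \<in> fst c"
  using atlas unfolding complex_atlas_def by blast

lemma chart_open: "c \<in> A \<Longrightarrow> open (fst c)" and im_open: "c \<in> A \<Longrightarrow> open (im c)"
  and chart_homeo: "c \<in> A \<Longrightarrow> homeomorphism (fst c) (im c) (snd c) (cinv c)"
  using atlas unfolding complex_atlas_def by blast+

lemma cinv_snd: "c \<in> A \<Longrightarrow> m \<in> fst c \<Longrightarrow> cinv c (snd c m) = m"
  using chart_homeo unfolding homeomorphism_def by blast

lemma snd_cinv: "c \<in> A \<Longrightarrow> x \<in> im c \<Longrightarrow> snd c (cinv c x) = x"
  and cinv_in: "c \<in> A \<Longrightarrow> x \<in> im c \<Longrightarrow> cinv c x \<in> fst c"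
  using chart_homeo unfolding homeomorphism_def by blast+

lemma snd_in: "m \<in> fst c \<Longrightarrow> snd c m \<in> im c"
  by (simp add: im_def)

lemma cont_snd: "c \<in> A \<Longrightarrow> continuous_on (fst c) (snd c)"
  and cont_cinv: "c \<in> A \<Longrightarrow> continuous_on (im c) (cinv c)"
  using chart_homeo unfolding homeomorphism_def by blast+

lemma hermitian_chart: "c \<in> A \<Longrightarrow> hermitian_chart g c (im c)"
  using metric im_open unfolding hermitian_metric_def hermitian_chart_def hermitian_at_def hermitian_form_def by simp

lemma overlap_sub: "overlap c c' \<subseteq> im c"
  by (auto simp: overlap_def im_def)

lemma overlap_iff: "c \<in> A \<Longrightarrow> x \<in> overlap c c' \<longleftrightarrow> x \<in> im c \<and> cinv c x \<in> fst c'"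
  using cinv_snd snd_cinv cinv_in by (auto simp: overlap_def im_def)

lemma overlap_open: assumes "c \<in> A" "c' \<in> A" shows "open (overlap c c')"
proof -
  have "overlap c c' = im c \<inter> cinv c -` fst c'"
    using overlap_iff[OF assms(1), where c'=c'] by blast
  then show ?thesis
    using continuous_on_open_vimage[OF im_open[OF assms(1)]] cont_cinv[OF assms(1)] chart_open[OF assms(2)]
    by (metis Int_commute)
qed

lemma transition_eq: "c \<in> A \<Longrightarrow> m \<in> fst c \<Longrightarrow> transition c c' (snd c m) = snd c' m"
  by (simp add: transition_def cinv_snd)

lemma transition_in:
  assumes "c \<in> A" "c' \<in> A" "x \<in> overlap c c'"
  shows "transition c c' x \<in> overlap c' c" "transition c' c (transition c c' x) = x"
    "cinv c' (transition c c' x) = cinv c x"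
proof -
  obtain m where m: "x = snd c m" "m \<in> fst c" "m \<in> fst c'" using assms(3) by (auto simp: overlap_def)
  show "transition c c' x \<in> overlap c' c"
    unfolding m(1) transition_eq[OF assms(1) m(2)] overlap_def using m by blast
  show "transition c' c (transition c c' x) = x"
    unfolding m(1) transition_eq[OF assms(1) m(2)] transition_eq[OF assms(2) m(3)] ..
  show "cinv c' (transition c c' x) = cinv c x"
    unfolding m(1) transition_eq[OF assms(1) m(2)] cinv_snd[OF assms(2) m(3)] cinv_snd[OF assms(1) m(2)] ..
qed

lemma chart_change:
  assumes "c \<in> A" "c' \<in> A"
  shows "chart_change g c c' (overlap c c') (im c') (transition c c')"
proof -
  interpret C: hermitian_chart g c "im c" by (rule hermitian_chart) fact
  interpret C': hermitian_chart g c' "im c'" by (rule hermitian_chart) fact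
  show ?thesis
  proof unfold_locales
    show "open (overlap c c')" by (rule overlap_open[OF assms])
    show "hermitian_at g c x" if "x \<in> overlap c c'" for x
      using C.hat overlap_sub that by blast
    show "smooth_on (\<lambda>x. g c x v w) (overlap c c')" for v w
      using smooth_on_subset[OF C.smooth_g overlap_sub] .
    show "holomorphic_map_on (transition c c') (overlap c c')"
      using atlas assms unfolding complex_atlas_def by blast
    show "transition c c' x \<in> im c'" if "x \<in> overlap c c'" for x
      using transition_in(1)[OF assms that] overlap_sub by blast
    show "g c x v w = g c' (transition c c' x) (frechet_derivative (transition c c') (at x) v)
       (frechet_derivative (transition c c') (at x) w)" if "x \<in> overlap c c'" for x v w
      using metric assms that unfolding hermitian_metric_def by blast
  qed
qed

section \<open>The Riemannian volume\<close>

lemma vdens_pos: "c \<in> A \<Longrightarrow> x \<in> im c \<Longrightarrow> vdens g c x > 0"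
  using det_herm_pos(1)[OF hermitian_chart.hat[OF hermitian_chart]] by (simp add: vdens_def)

lemma smooth_vdens: assumes c: "c \<in> A" shows "smooth_on (\<lambda>x. complex_of_real (vdens g c x)) (im c)"
proof -
  interpret C: hermitian_chart g c "im c" by (rule hermitian_chart) fact
  have "smooth_on (\<lambda>x. 2 ^ CARD('n) * det (\<chi> i j. herm g c x i j)) (im c)"
    by (intro smooth_on_mult smooth_on_const smooth_on_det C.U) (simp add: C.smooth_herm)
  then show ?thesis
    by (rule smooth_on_cong[OF C.U]) (use det_herm_pos(2)[OF C.hat] in \<open>simp add: vdens_def complex_eq_iff\<close>)
qed

lemma cont_vdens: assumes c: "c \<in> A" shows "continuous_on (im c) (vdens g c)"
  using continuous_on_Re[OF smooth_on_continuous[OF smooth_vdens[OF c]]] by simp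

text \<open>The determinant of \<open>h\<close> changes by the same factor as Lebesgue measure, so that the volume does
  not depend on the chart.\<close>

lemma vdens_change:
  assumes "c \<in> A" "c' \<in> A" "x \<in> overlap c c'"
  shows "vdens g c x = (cmod (det (\<chi> k a. jac (transition c c') x k a)))\<^sup>2 * vdens g c' (transition c c' x)"
proof -
  interpret chart_change g c c' "overlap c c'" "im c'" "transition c c'" by (rule chart_change[OF assms(1,2)])
  have "Re (z * cnj z * w) = (cmod z)\<^sup>2 * Re w" for z w
    unfolding complex_norm_square[symmetric] of_real_power[symmetric] by simp
  then show ?thesis unfolding vdens_def det_herm_change[OF assms(3)] by simp
qed

lemma cont_transition:
  assumes "c \<in> A" "c' \<in> A" shows "continuous_on (overlap c c') (transition c c')"
proof -
  interpret chart_change g c c' "overlap c c'" "im c'" "transition c c'" by (rule chart_change[OF assms(1,2)])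
  show ?thesis using phi_has has_derivative_continuous by (fastforce intro: continuous_at_imp_continuous_on)
qed

lemma nn_integral_transition:
  assumes cc: "c \<in> A" "c' \<in> A" and f: "f \<in> borel_measurable borel"
  shows "(\<integral>\<^sup>+y. f y * indicator (overlap c' c) y \<partial>lborel) =
    (\<integral>\<^sup>+x. f (transition c c' x) * ennreal ((cmod (det (\<chi> k a. jac (transition c c') x k a)))\<^sup>2) * indicator (overlap c c') x \<partial>lborel)"
proof -
  interpret chart_change g c c' "overlap c c'" "im c'" "transition c c'" by (rule chart_change[OF assms(1,2)])
  let ?S = "overlap c c'" and ?S' = "overlap c' c"
  define \<phi> where "\<phi> x = (if x \<in> ?S then transition c c' x else 0)" for x
  define \<phi>' where "\<phi>' y = (if y \<in> ?S' then transition c' c y else 0)" for y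
  define J where "J x = transpose (\<chi> k a. jac (transition c c') x k a)" for x
  have dJ: "det (J x) = det (\<chi> k a. jac (transition c c') x k a)" for x
    by (simp add: J_def det_transpose)
  have S: "?S \<in> sets borel" "?S' \<in> sets borel" using overlap_open cc by auto
  have m\<phi> [measurable]: "\<phi> \<in> borel_measurable borel"
    unfolding \<phi>_def by (rule borel_measurable_continuous_on_if[OF S(1) cont_transition[OF cc]]) auto
  have m\<phi>' [measurable]: "\<phi>' \<in> borel_measurable borel"
    unfolding \<phi>'_def by (rule borel_measurable_continuous_on_if[OF S(2) cont_transition[OF cc(2,1)]]) auto
  define d where "d x = (if x \<in> ?S then (cmod (det (J x)))\<^sup>2 else 0)" for x
  have cd: "continuous_on ?S (\<lambda>x. (cmod (det (J x)))\<^sup>2)"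
    unfolding dJ unfolding det_def vec_lambda_beta by (intro continuous_intros smooth_on_continuous[OF smooth_jac])
  have md [measurable]: "d \<in> borel_measurable borel"
    unfolding d_def by (rule borel_measurable_continuous_on_if[OF S(1) cd]) auto
  have eq: "distr (density lborel (\<lambda>x. ennreal (d x))) borel \<phi> = density lborel (indicator ?S')"
  proof (rule measure_eqI)
    fix F assume "F \<in> sets (distr (density lborel (\<lambda>x. ennreal (d x))) borel \<phi>)"
    then have F [measurable]: "F \<in> sets borel" by simp
    define B where "B = ?S \<inter> \<phi> -` F"
    have B: "B \<in> sets borel" unfolding B_def using S measurable_sets[OF m\<phi> F] by simp
    have im: "transition c c' ` B = ?S' \<inter> F"
    proof
      show "transition c c' ` B \<subseteq> ?S' \<inter> F" using transition_in(1)[OF cc] by (auto simp: B_def \<phi>_def)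
      show "?S' \<inter> F \<subseteq> transition c c' ` B"
      proof
        fix y assume y: "y \<in> ?S' \<inter> F"
        then have "y = transition c c' (transition c' c y)" "transition c' c y \<in> ?S"
          using transition_in[OF cc(2,1)] by auto
        then show "y \<in> transition c c' ` B" using y by (auto simp: B_def \<phi>_def image_iff intro!: bexI[of _ "transition c' c y"])
      qed
    qed
    have "emeasure lborel (transition c c' ` B) = (\<integral>\<^sup>+x. ennreal (indicator B x * (cmod (det (J x)))\<^sup>2) \<partial>lborel)"
    proof (rule emeasure_holomorphic_image[OF B])
      show "transition c c' ` B \<in> sets borel" unfolding im using S F by simp
      show "(transition c c' has_derivative (\<lambda>v. J x *v v)) (at x)" if "x \<in> B" for x
      proof -
        have "frechet_derivative (transition c c') (at x) = (\<lambda>v. J x *v v)"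
          using that by (intro ext) (simp add: vec_eq_iff phi_frechet B_def J_def matrix_vector_mult_def transpose_def mult.commute)
        then show ?thesis using phi_has[of x] that by (simp add: B_def)
      qed
      show "inj_on (transition c c') B"
        using transition_in(2)[OF cc] by (metis B_def IntD1 inj_on_def)
      have "(\<lambda>x. indicator B x * (cmod (det (J x)))\<^sup>2) = (\<lambda>x. indicator B x * d x)"
        by (auto simp: d_def B_def indicator_def)
      then show "(\<lambda>x. indicator B x * (cmod (det (J x)))\<^sup>2) \<in> borel_measurable borel" using B by simp
    qed
    also have "\<dots> = (\<integral>\<^sup>+x. ennreal (d x) * indicator (\<phi> -` F) x \<partial>lborel)"
      by (intro nn_integral_cong) (auto simp: d_def B_def indicator_def)
    finally have "emeasure lborel (?S' \<inter> F) = (\<integral>\<^sup>+x. ennreal (d x) * indicator (\<phi> -` F) x \<partial>lborel)"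
      unfolding im .
    moreover have "\<phi> -` F \<in> sets borel" using measurable_sets[OF m\<phi> F] by simp
    moreover have "emeasure (density lborel (indicator ?S')) F = emeasure lborel (?S' \<inter> F)"
      using S F by (simp add: emeasure_density indicator_inter_arith[symmetric])
    ultimately show "emeasure (distr (density lborel (\<lambda>x. ennreal (d x))) borel \<phi>) F = emeasure (density lborel (indicator ?S')) F"
      by (simp add: emeasure_distr emeasure_density)
  qed simp
  have "(\<integral>\<^sup>+y. f y * indicator ?S' y \<partial>lborel) = (\<integral>\<^sup>+y. f y \<partial>density lborel (indicator ?S'))"
    using f S by (simp add: nn_integral_density mult.commute)
  also have "\<dots> = (\<integral>\<^sup>+y. f y \<partial>distr (density lborel (\<lambda>x. ennreal (d x))) borel \<phi>)" by (simp only: eq)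
  also have "\<dots> = (\<integral>\<^sup>+x. ennreal (d x) * f (\<phi> x) \<partial>lborel)"
    using f measurable_compose[OF m\<phi> f] by (simp add: nn_integral_distr nn_integral_density)
  also have "\<dots> = (\<integral>\<^sup>+x. f (transition c c' x) * ennreal ((cmod (det (\<chi> k a. jac (transition c c') x k a)))\<^sup>2) * indicator (overlap c c') x \<partial>lborel)"
    by (intro nn_integral_cong) (auto simp: d_def \<phi>_def dJ indicator_def mult.commute)
  finally show ?thesis .
qed

end

context hermitian_manifold
begin

text \<open>The part of the volume that lies in a chart.  The value \<open>undefined\<close> is only attained where the
  density vanishes.\<close>

definition chart_measure :: "('m, 'n) chart \<Rightarrow> 'm measure" where
  "chart_measure c = distr (density lborel (\<lambda>x. ennreal (indicator (im c) x * vdens g c x))) borel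
     (\<lambda>x. if x \<in> im c then cinv c x else undefined)"

lemma measurable_vdens: "c \<in> A \<Longrightarrow> (\<lambda>x. indicator (im c) x * vdens g c x) \<in> borel_measurable borel"
proof -
  assume c: "c \<in> A"
  have "(\<lambda>x. if x \<in> im c then vdens g c x else 0) \<in> borel_measurable borel"
    by (rule borel_measurable_continuous_on_if[OF _ cont_vdens[OF c]]) (simp_all add: im_open[OF c])
  moreover have "(\<lambda>x. indicator (im c) x * vdens g c x) = (\<lambda>x. if x \<in> im c then vdens g c x else 0)"
    by (simp add: indicator_def fun_eq_iff)
  ultimately show ?thesis by simp
qed

lemma measurable_cinv: "c \<in> A \<Longrightarrow> (\<lambda>x. if x \<in> im c then cinv c x else undefined) \<in> borel_measurable borel"
  by (rule borel_measurable_continuous_on_if[OF _ cont_cinv]) (simp_all add: im_open)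

lemma sets_chart_measure [simp]: "sets (chart_measure c) = sets borel"
  by (simp add: chart_measure_def)

lemma emeasure_chart_measure:
  assumes c: "c \<in> A" and B: "B \<in> sets borel"
  shows "emeasure (chart_measure c) B = (\<integral>\<^sup>+x. ennreal (vdens g c x) * indicator (im c \<inter> cinv c -` B) x \<partial>lborel)"
proof -
  have "emeasure (chart_measure c) B = (\<integral>\<^sup>+x. ennreal (indicator (im c) x * vdens g c x) *
      indicator ((\<lambda>x. if x \<in> im c then cinv c x else undefined) -` B) x \<partial>lborel)"
    unfolding chart_measure_def using measurable_cinv[OF c] measurable_vdens[OF c] B measurable_sets[OF measurable_cinv[OF c] B]
    by (simp add: emeasure_distr emeasure_density)
  also have "\<dots> = (\<integral>\<^sup>+x. ennreal (vdens g c x) * indicator (im c \<inter> cinv c -` B) x \<partial>lborel)"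
    by (intro nn_integral_cong) (auto simp: indicator_def)
  finally show ?thesis .
qed

lemma snd_image: "c \<in> A \<Longrightarrow> B \<subseteq> fst c \<Longrightarrow> snd c ` B = im c \<inter> cinv c -` B"
proof (intro set_eqI iffI)
  fix x assume c: "c \<in> A" and B: "B \<subseteq> fst c"
  show "x \<in> im c \<inter> cinv c -` B" if xB: "x \<in> snd c ` B"
  proof -
    obtain m where m: "x = snd c m" "m \<in> B" using xB by blast
    then have "m \<in> fst c" using B by blast
    then show ?thesis using m cinv_snd[OF c] snd_in by simp
  qed
  show "x \<in> snd c ` B" if "x \<in> im c \<inter> cinv c -` B"
  proof -
    have "x = snd c (cinv c x)" "cinv c x \<in> B" using that snd_cinv[OF c] by simp_all
    then show ?thesis by (rule image_eqI)
  qed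
qed

lemma snd_mem_image: "c \<in> A \<Longrightarrow> B \<subseteq> fst c \<Longrightarrow> m \<in> fst c \<Longrightarrow> snd c m \<in> snd c ` B \<longleftrightarrow> m \<in> B"
  by (simp add: snd_image cinv_snd snd_in)

lemma emeasure_chart_measure':
  assumes "c \<in> A" "B \<in> sets borel" "B \<subseteq> fst c"
  shows "emeasure (chart_measure c) B = (\<integral>\<^sup>+x. ennreal (vdens g c x) * indicator (snd c ` B) x \<partial>lborel)"
  unfolding emeasure_chart_measure[OF assms(1,2)] snd_image[OF assms(1,3)] ..

lemma borel_snd_image: assumes "c \<in> A" "B \<in> sets borel" "B \<subseteq> fst c" shows "snd c ` B \<in> sets borel"
proof -
  have "im c \<inter> cinv c -` B = im c \<inter> (\<lambda>x. if x \<in> im c then cinv c x else undefined) -` B" by auto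
  then show ?thesis unfolding snd_image[OF assms(1,3)]
    using measurable_sets[OF measurable_cinv[OF assms(1)] assms(2)] im_open[OF assms(1)] by simp
qed

text \<open>Lebesgue measure changes by the factor by which the density changes.\<close>

lemma chart_measure_agree:
  assumes cc: "c \<in> A" "c' \<in> A" and B: "B \<in> sets borel" "B \<subseteq> fst c" "B \<subseteq> fst c'"
  shows "emeasure (chart_measure c') B = emeasure (chart_measure c) B"
proof -
  have sub: "snd c ` B \<subseteq> overlap c c'" "snd c' ` B \<subseteq> overlap c' c" using B by (auto simp: overlap_def)
  define f where "f y = ennreal (indicator (im c') y * vdens g c' y) * indicator (snd c' ` B) y" for y
  have mf: "f \<in> borel_measurable borel"
    unfolding f_def using measurable_vdens[OF cc(2)] borel_snd_image[OF cc(2) B(1,3)] by measurable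
  have im: "snd c' ` B \<subseteq> im c'" using B by (auto simp: im_def)
  have "emeasure (chart_measure c') B = (\<integral>\<^sup>+y. f y * indicator (overlap c' c) y \<partial>lborel)"
    unfolding emeasure_chart_measure'[OF cc(2) B(1,3)]
    by (intro nn_integral_cong) (use sub im in \<open>auto simp: f_def indicator_def\<close>)
  also have "\<dots> = (\<integral>\<^sup>+x. f (transition c c' x) * ennreal ((cmod (det (\<chi> k a. jac (transition c c') x k a)))\<^sup>2) * indicator (overlap c c') x \<partial>lborel)"
    by (rule nn_integral_transition[OF cc mf])
  also have "\<dots> = (\<integral>\<^sup>+x. ennreal (vdens g c x) * indicator (snd c ` B) x \<partial>lborel)"
  proof (intro nn_integral_cong)
    fix x
    show "f (transition c c' x) * ennreal ((cmod (det (\<chi> k a. jac (transition c c') x k a)))\<^sup>2) * indicator (overlap c c') x =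
      ennreal (vdens g c x) * indicator (snd c ` B) x"
    proof (cases "x \<in> overlap c c'")
      case True
      have t: "transition c c' x \<in> im c'" using transition_in(1)[OF cc True] overlap_sub by blast
      have "transition c c' x \<in> snd c' ` B \<longleftrightarrow> x \<in> snd c ` B"
      proof -
        obtain m where m: "x = snd c m" "m \<in> fst c" "m \<in> fst c'" using True by (auto simp: overlap_def)
        show ?thesis
          unfolding m(1) transition_eq[OF cc(1) m(2)]
          using snd_mem_image[OF cc(1) B(2) m(2)] snd_mem_image[OF cc(2) B(3) m(3)] by simp
      qed
      then show ?thesis
        using True t vdens_change[OF cc True] vdens_pos[OF cc(2) t]
        by (auto simp: f_def indicator_def ennreal_mult mult.commute)
    next
      case False then show ?thesis using sub by (auto simp: indicator_def)
    qed
  qed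
  finally show ?thesis unfolding emeasure_chart_measure'[OF cc(1) B(1,2)] .
qed

end

locale compact_hermitian_manifold = hermitian_manifold A g
  for A :: "('m::t2_space, 'n::finite) chart set" and g +
  assumes compact: "compact (UNIV :: 'm set)"
begin

text \<open>Glue the chart measures along a disjoint refinement of a finite cover by charts.\<close>

lemma ex_volume:
  "\<exists>\<mu>. sets \<mu> = sets borel \<and> (\<forall>c\<in>A. \<forall>B\<in>sets borel. B \<subseteq> fst c \<longrightarrow>
        emeasure \<mu> B = (\<integral>\<^sup>+x. ennreal (2 ^ CARD('n) * Re (det (\<chi> i j. herm g c x i j))) * indicator (snd c ` B) x \<partial>lborel))"
proof -
  obtain C where C: "C \<subseteq> A" "finite C" "(UNIV :: 'm set) \<subseteq> (\<Union>c\<in>C. fst c)"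
    using compactE_image[OF compact, of A fst] chart_open chart_cover by (metis UN_iff subsetI)
  obtain N and cs :: "nat \<Rightarrow> ('m, 'n) chart" where cs: "C = cs ` {i. i < N}"
    using finite_imp_nat_seg_image_inj_on[OF C(2)] by blast
  have csA: "i < N \<Longrightarrow> cs i \<in> A" for i using cs C by auto
  define D where "D = disjointed (\<lambda>i. fst (cs i))"
  have D_sub: "D i \<subseteq> fst (cs i)" for i unfolding D_def by (rule disjointed_subset)
  have D_disj: "disjoint_family D" unfolding D_def by (rule disjoint_family_disjointed)
  have D_cover: "(\<Union>i<N. D i) = UNIV"
    using finite_UN_disjointed_eq[of "\<lambda>i. fst (cs i)" N] C(3) cs by (auto simp: D_def atLeast0LessThan)
  have D_borel: "D i \<in> sets borel" if "i < N" for i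
  proof -
    have "open (fst (cs j))" if "j \<le> i" for j using that \<open>i < N\<close> csA chart_open by auto
    then have "open (fst (cs i))" "open (\<Union>j\<in>{0..<i}. fst (cs j))" by auto
    then show ?thesis unfolding D_def disjointed_def by (intro sets.Diff) auto
  qed
  define \<mu> where "\<mu> = measure_of (UNIV :: 'm set) (sets borel) (\<lambda>B. \<Sum>i<N. emeasure (chart_measure (cs i)) (B \<inter> D i))"
  have sets\<mu>: "sets \<mu> = sets borel" unfolding \<mu>_def using sets.sigma_sets_eq[of borel] by (simp add: space_borel)
  have e\<mu>: "emeasure \<mu> B = (\<Sum>i<N. emeasure (chart_measure (cs i)) (B \<inter> D i))" if B: "B \<in> sets borel" for B
  proof (rule emeasure_measure_of[OF \<mu>_def])
    show "sets borel \<subseteq> Pow (UNIV :: 'm set)" by simp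
    show "B \<in> sets \<mu>" using B sets\<mu> by simp
    show "positive (sets \<mu>) (\<lambda>B. \<Sum>i<N. emeasure (chart_measure (cs i)) (B \<inter> D i))"
      by (simp add: positive_def)
    show "countably_additive (sets \<mu>) (\<lambda>B. \<Sum>i<N. emeasure (chart_measure (cs i)) (B \<inter> D i))"
      unfolding countably_additive_def
    proof (intro allI impI)
      fix F :: "nat \<Rightarrow> 'm set" assume F: "range F \<subseteq> sets \<mu>" "disjoint_family F" "\<Union> (range F) \<in> sets \<mu>"
      have "(\<Sum>n. emeasure (chart_measure (cs i)) (F n \<inter> D i)) = emeasure (chart_measure (cs i)) (\<Union> (range F) \<inter> D i)" if "i < N" for i
      proof -
        have "range (\<lambda>n. F n \<inter> D i) \<subseteq> sets (chart_measure (cs i))" using F(1) D_borel[OF that] by (auto simp: sets\<mu>)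
        moreover have "disjoint_family (\<lambda>n. F n \<inter> D i)" using F(2) by (auto simp: disjoint_family_on_def)
        moreover have "(\<Union>n. F n \<inter> D i) = \<Union> (range F) \<inter> D i" by auto
        ultimately show ?thesis using suminf_emeasure[of "\<lambda>n. F n \<inter> D i" "chart_measure (cs i)"] by simp
      qed
      then show "(\<Sum>n. \<Sum>i<N. emeasure (chart_measure (cs i)) (F n \<inter> D i)) = (\<Sum>i<N. emeasure (chart_measure (cs i)) (\<Union> (range F) \<inter> D i))"
        by (subst suminf_sum) auto
    qed
  qed
  have "emeasure \<mu> B = emeasure (chart_measure c) B" if c: "c \<in> A" and B: "B \<in> sets borel" "B \<subseteq> fst c" for c B
  proof -
    have "emeasure \<mu> B = (\<Sum>i<N. emeasure (chart_measure c) (B \<inter> D i))"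
      unfolding e\<mu>[OF B(1)]
    proof (rule sum.cong[OF refl])
      fix i assume "i \<in> {..<N}"
      then have i: "i < N" by simp
      show "emeasure (chart_measure (cs i)) (B \<inter> D i) = emeasure (chart_measure c) (B \<inter> D i)"
        by (rule chart_measure_agree[OF c csA[OF i]]) (use B D_borel[OF i] D_sub in auto)
    qed
    also have "\<dots> = emeasure (chart_measure c) (\<Union>i<N. B \<inter> D i)"
    proof (rule sum_emeasure)
      show "disjoint_family_on (\<lambda>i. B \<inter> D i) {..<N}"
        using D_disj unfolding disjoint_family_on_def by blast
    qed (use B D_borel in auto)
    also have "(\<Union>i<N. B \<inter> D i) = B" using D_cover by auto
    finally show ?thesis .
  qed
  then show ?thesis using sets\<mu> by (intro exI[of _ \<mu>]) (simp add: emeasure_chart_measure' vdens_def)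
qed

text \<open>Uniqueness: a finite cover by charts splits every Borel set into disjoint pieces that lie in
  one chart each.\<close>

lemma volume_properties:
  shows sets_volume: "sets (volume A g) = sets borel"
    and emeasure_volume: "c \<in> A \<Longrightarrow> B \<in> sets borel \<Longrightarrow> B \<subseteq> fst c \<Longrightarrow> emeasure (volume A g) B = emeasure (chart_measure c) B"
proof -
  let ?P = "\<lambda>\<mu>. sets \<mu> = sets borel \<and> (\<forall>c\<in>A. \<forall>B\<in>sets borel. B \<subseteq> fst c \<longrightarrow>
        emeasure \<mu> B = (\<integral>\<^sup>+x. ennreal (2 ^ CARD('n) * Re (det (\<chi> i j. herm g c x i j))) * indicator (snd c ` B) x \<partial>lborel))"
  obtain C where C: "C \<subseteq> A" "finite C" "(UNIV :: 'm set) \<subseteq> (\<Union>c\<in>C. fst c)"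
    using compactE_image[OF compact, of A fst] chart_open chart_cover by (metis UN_iff subsetI)
  obtain N and cs :: "nat \<Rightarrow> ('m, 'n) chart" where cs: "C = cs ` {i. i < N}"
    using finite_imp_nat_seg_image_inj_on[OF C(2)] by blast
  have uniq: "\<mu> = \<nu>" if \<mu>: "?P \<mu>" and \<nu>: "?P \<nu>" for \<mu> \<nu>
  proof (rule measure_eqI)
    show "sets \<mu> = sets \<nu>" by (simp only: \<mu>[THEN conjunct1] \<nu>[THEN conjunct1])
    fix B assume "B \<in> sets \<mu>"
    then have B: "B \<in> sets borel" by (simp only: \<mu>[THEN conjunct1])
    define D where "D i = B \<inter> disjointed (\<lambda>i. fst (cs i)) i" for i
    have csA: "i < N \<Longrightarrow> cs i \<in> A" for i using cs C by auto
    have D_sub: "D i \<subseteq> fst (cs i)" for i unfolding D_def using disjointed_subset[of "\<lambda>i. fst (cs i)" i] by (rule le_infI2)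
    have D_disj: "disjoint_family_on D {..<N}"
    proof -
      have "disjointed (\<lambda>i. fst (cs i)) m \<inter> disjointed (\<lambda>i. fst (cs i)) n = {}" if "m \<noteq> n" for m n
        using disjoint_family_disjointed[of "\<lambda>i. fst (cs i)"] that unfolding disjoint_family_on_def by simp
      then show ?thesis unfolding D_def disjoint_family_on_def by blast
    qed
    have "(\<Union>i<N. disjointed (\<lambda>i. fst (cs i)) i) = UNIV"
      using finite_UN_disjointed_eq[of "\<lambda>i. fst (cs i)" N] C(3) cs by (auto simp: atLeast0LessThan)
    then have D_cover: "(\<Union>i<N. D i) = B" unfolding D_def by blast
    have D_borel: "D i \<in> sets borel" if "i < N" for i
    proof -
      have "open (fst (cs j))" if "j \<le> i" for j using that \<open>i < N\<close> csA chart_open by auto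
      then have "open (fst (cs i))" "open (\<Union>j\<in>{0..<i}. fst (cs j))" by auto
      then show ?thesis unfolding D_def disjointed_def using B by (intro sets.Int sets.Diff) auto
    qed
    have "emeasure \<mu> (D i) = emeasure \<nu> (D i)" if "i < N" for i
      using \<mu>[THEN conjunct2, rule_format, OF csA[OF that] D_borel[OF that] D_sub]
        \<nu>[THEN conjunct2, rule_format, OF csA[OF that] D_borel[OF that] D_sub] by (rule trans[OF _ sym])
    then have "(\<Sum>i<N. emeasure \<mu> (D i)) = (\<Sum>i<N. emeasure \<nu> (D i))" by simp
    moreover have "emeasure M B = (\<Sum>i<N. emeasure M (D i))" if M: "sets M = sets borel" for M
    proof -
      have "D ` {..<N} \<subseteq> sets M" using D_borel M by blast
      then show ?thesis using sum_emeasure[of D "{..<N}" M] D_disj D_cover by simp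
    qed
    note this[OF \<mu>[THEN conjunct1]] this[OF \<nu>[THEN conjunct1]]
    ultimately show "emeasure \<mu> B = emeasure \<nu> B" by (simp only:)
  qed
  obtain \<mu> where \<mu>: "?P \<mu>" using ex_volume by (elim exE)
  have "volume A g = \<mu>"
    unfolding volume_def by (rule the_equality[of ?P, OF \<mu>]) (rule uniq[OF _ \<mu>])
  then have P: "?P (volume A g)" by (rule subst[of \<mu> "volume A g" ?P, OF sym \<mu>])
  then show "sets (volume A g) = sets borel" by (rule conjunct1)
  show "emeasure (volume A g) B = emeasure (chart_measure c) B" if "c \<in> A" "B \<in> sets borel" "B \<subseteq> fst c"
    unfolding emeasure_chart_measure'[OF that] vdens_def
    using P[THEN conjunct2, rule_format, OF that] .
qed

lemma space_volume [simp]: "space (volume A g) = UNIV"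
  using sets_eq_imp_space_eq[OF sets_volume] by simp

lemma measurable_volume [simp]: "measurable (volume A g) N = measurable borel N"
  by (rule measurable_cong_sets[OF sets_volume refl])

lemma volume_restrict:
  assumes c: "c \<in> A" shows "density (volume A g) (\<lambda>m. ennreal (indicator (fst c) m)) = chart_measure c"
proof (rule measure_eqI)
  fix B assume "B \<in> sets (density (volume A g) (\<lambda>m. ennreal (indicator (fst c) m)))"
  then have B: "B \<in> sets borel" by (simp add: sets_volume)
  have fc: "fst c \<in> sets borel" using chart_open[OF c] by simp
  have "emeasure (density (volume A g) (\<lambda>m. ennreal (indicator (fst c) m))) B = emeasure (volume A g) (B \<inter> fst c)"
    using B fc by (simp add: emeasure_density sets_volume ennreal_indicator indicator_inter_arith[symmetric] Int_commute)
  also have "\<dots> = emeasure (chart_measure c) (B \<inter> fst c)"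
    by (rule emeasure_volume[OF c]) (use B fc in auto)
  also have "\<dots> = emeasure (chart_measure c) B"
    unfolding emeasure_chart_measure[OF c B] emeasure_chart_measure[OF c sets.Int[OF B fc]]
    by (intro nn_integral_cong) (use cinv_in[OF c] in \<open>auto simp: indicator_def\<close>)
  finally show "emeasure (density (volume A g) (\<lambda>m. ennreal (indicator (fst c) m))) B = emeasure (chart_measure c) B" .
qed (simp add: sets_volume)

lemma integral_volume_chart:
  fixes f :: "'m \<Rightarrow> complex"
  assumes c: "c \<in> A" and f: "f \<in> borel_measurable borel" and z: "\<And>m. m \<notin> fst c \<Longrightarrow> f m = 0"
  shows "integral\<^sup>L (volume A g) f = (\<integral>x. (indicator (im c) x * vdens g c x) *\<^sub>R f (cinv c x) \<partial>lborel)"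
proof -
  have fc: "fst c \<in> sets borel" using chart_open[OF c] by simp
  have "integral\<^sup>L (volume A g) f = (\<integral>m. indicator (fst c) m *\<^sub>R f m \<partial>volume A g)"
    by (intro Bochner_Integration.integral_cong refl) (use z in \<open>auto simp: indicator_def\<close>)
  also have "\<dots> = integral\<^sup>L (chart_measure c) f"
    unfolding volume_restrict[OF c, symmetric] using f fc by (subst integral_density) auto
  also have "\<dots> = (\<integral>x. f (if x \<in> im c then cinv c x else undefined) \<partial>density lborel (\<lambda>x. ennreal (indicator (im c) x * vdens g c x)))"
    unfolding chart_measure_def using measurable_cinv[OF c] f by (subst integral_distr) auto
  also have "\<dots> = (\<integral>x. (indicator (im c) x * vdens g c x) *\<^sub>R f (if x \<in> im c then cinv c x else undefined) \<partial>lborel)"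
    using measurable_compose[OF measurable_cinv[OF c] f] measurable_vdens[OF c] vdens_pos[OF c]
    by (subst integral_density) (auto simp: indicator_def less_imp_le intro!: AE_I2)
  also have "\<dots> = (\<integral>x. (indicator (im c) x * vdens g c x) *\<^sub>R f (cinv c x) \<partial>lborel)"
    by (intro Bochner_Integration.integral_cong refl) (auto simp: indicator_def)
  finally show ?thesis .
qed

lemma coord_ball_nbhd:
  assumes c: "c \<in> A" "m \<in> fst c"
  obtains r where "r > 0" "cball (snd c m) r \<subseteq> im c"
  using im_open[OF c(1)] snd_in[OF c(2)] open_contains_cball by blast

lemma open_chart_preimage: "c \<in> A \<Longrightarrow> open W \<Longrightarrow> open (fst c \<inter> snd c -` W)"
  using continuous_on_open_vimage[OF chart_open] cont_snd by (metis Int_commute)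

text \<open>Every point has a neighbourhood on which the density is bounded; finitely many of them suffice
  by compactness.\<close>

lemma finite_volume: "emeasure (volume A g) UNIV < \<infinity>"
proof -
  have "\<exists>W. open W \<and> m \<in> W \<and> emeasure (volume A g) W < \<infinity>" for m
  proof -
    obtain c where c: "c \<in> A" "m \<in> fst c" using chart_cover by blast
    obtain r where r: "r > 0" "cball (snd c m) r \<subseteq> im c" using coord_ball_nbhd[OF c] by blast
    define W where "W = fst c \<inter> snd c -` ball (snd c m) r"
    have W: "open W" "m \<in> W" "W \<subseteq> fst c"
      using open_chart_preimage[OF c(1)] c r by (auto simp: W_def)
    have im: "snd c ` W = ball (snd c m) r"
    proof
      show "ball (snd c m) r \<subseteq> snd c ` W"
      proof
        fix y assume y: "y \<in> ball (snd c m) r"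
        then have "y \<in> im c" using r(2) ball_subset_cball by blast
        then show "y \<in> snd c ` W" using y snd_cinv[OF c(1)] cinv_in[OF c(1)] by (auto simp: W_def image_iff intro!: bexI[of _ "cinv c y"])
      qed
    qed (auto simp: W_def)
    have "bounded (vdens g c ` cball (snd c m) r)"
      by (intro compact_imp_bounded compact_continuous_image continuous_on_subset[OF cont_vdens[OF c(1)] r(2)]) simp
    then obtain K where K0: "\<And>y. y \<in> vdens g c ` cball (snd c m) r \<Longrightarrow> norm y \<le> K"
      unfolding bounded_iff by blast
    have K: "vdens g c x \<le> K" if "x \<in> cball (snd c m) r" for x
      using K0[of "vdens g c x"] that by (simp add: abs_le_iff)
    have "emeasure (volume A g) W = (\<integral>\<^sup>+x. ennreal (vdens g c x) * indicator (ball (snd c m) r) x \<partial>lborel)"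
      using W by (simp add: emeasure_volume[OF c(1)] emeasure_chart_measure'[OF c(1)] im)
    also have "\<dots> \<le> (\<integral>\<^sup>+x. ennreal K * indicator (ball (snd c m) r) x \<partial>lborel)"
      by (intro nn_integral_mono) (use K in \<open>auto simp: indicator_def ennreal_leI\<close>)
    also have "\<dots> = ennreal K * emeasure lborel (ball (snd c m) r)" by (rule nn_integral_cmult_indicator) simp
    also have "\<dots> < \<infinity>" using emeasure_lborel_ball_finite[of "snd c m" r] by (simp add: ennreal_mult_less_top)
    finally show ?thesis using W by blast
  qed
  then obtain W where W: "\<And>m. open (W m)" "\<And>m. m \<in> W m" "\<And>m. emeasure (volume A g) (W m) < \<infinity>" by metis
  obtain C where C: "finite C" "(UNIV :: 'm set) \<subseteq> (\<Union>m\<in>C. W m)"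
    using compactE_image[OF compact, of UNIV W] W by (metis UNIV_I UN_I subsetI)
  have "emeasure (volume A g) UNIV \<le> emeasure (volume A g) (\<Union>m\<in>C. W m)"
    using C(2) W(1) C(1) by (intro emeasure_mono) (auto simp: sets_volume)
  also have "\<dots> \<le> (\<Sum>m\<in>C. emeasure (volume A g) (W m))"
    by (rule emeasure_subadditive_finite[OF C(1)]) (use W in \<open>auto simp: sets_volume\<close>)
  also have "\<dots> < \<infinity>" using W(3) C(1) by simp
  finally show ?thesis .
qed

lemma integrable_volume:
  fixes f :: "'m \<Rightarrow> complex"
  assumes "continuous_on UNIV f" shows "integrable (volume A g) f"
proof -
  have "bounded (range f)"
    using compact_imp_bounded[OF compact_continuous_image[OF assms compact]] .
  then obtain K where K: "\<And>m. norm (f m) \<le> K" unfolding bounded_iff by auto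
  interpret finite_measure "volume A g"
    by standard (use finite_volume in auto)
  show ?thesis
    by (rule integrable_const_bound[of _ K]) (use K borel_measurable_continuous_onI[OF assms] in auto)
qed

text \<open>The density is positive and a nonempty open set is not a Lebesgue null set.\<close>

lemma volume_open_pos:
  assumes c: "c \<in> A" and W: "open W" "m \<in> W" "W \<subseteq> fst c"
  shows "emeasure (volume A g) W \<noteq> 0"
proof
  assume 0: "emeasure (volume A g) W = 0"
  have o: "open (snd c ` W)"
    unfolding snd_image[OF c W(3)] using continuous_on_open_vimage[OF im_open[OF c]] cont_cinv[OF c] W(1) by (metis Int_commute)
  have "(\<integral>\<^sup>+x. ennreal (indicator (im c) x * vdens g c x) * indicator (snd c ` W) x \<partial>lborel) =
      (\<integral>\<^sup>+x. ennreal (vdens g c x) * indicator (snd c ` W) x \<partial>lborel)"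
    by (intro nn_integral_cong) (use W(3) in \<open>auto simp: indicator_def im_def\<close>)
  also have "\<dots> = 0"
    using 0 W by (simp add: emeasure_volume[OF c] emeasure_chart_measure'[OF c])
  finally have "AE x in lborel. ennreal (indicator (im c) x * vdens g c x) * indicator (snd c ` W) x = 0"
    using measurable_vdens[OF c] o by (subst (asm) nn_integral_0_iff_AE) auto
  then have "AE x in lborel. x \<notin> snd c ` W"
  proof (rule AE_mp, intro AE_I2 impI)
    fix x assume "ennreal (indicator (im c) x * vdens g c x) * indicator (snd c ` W) x = 0"
    then show "x \<notin> snd c ` W" using vdens_pos[OF c, of x] W(3) by (auto simp: indicator_def im_def)
  qed
  then have "snd c ` W \<in> null_sets lborel"
    using o by (subst (asm) AE_iff_null_sets[symmetric]) auto
  then have "negligible (snd c ` W)"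
    using null_sets_completionI by (simp add: negligible_iff_null_sets) blast
  then show False using open_not_negligible[OF o] W(2) by blast
qed

text \<open>Otherwise the function would be bounded below by a positive constant on an open set, and such
  a set has positive volume.\<close>

lemma integral_volume_eq_0:
  fixes f :: "'m \<Rightarrow> real"
  assumes f: "continuous_on UNIV f" "\<And>m. f m \<ge> 0" and int: "integral\<^sup>L (volume A g) f = 0"
  shows "f m = 0"
proof (rule ccontr)
  assume m: "f m \<noteq> 0"
  have "integrable (volume A g) (\<lambda>m. complex_of_real (f m))"
    by (intro integrable_volume continuous_intros f)
  then have "integrable (volume A g) f" by (simp add: complex_of_real_integrable_eq)
  then have ae: "AE m in volume A g. f m = 0"
    using integral_nonneg_eq_0_iff_AE[of "volume A g" f] f(2) int by simp
  obtain c where c: "c \<in> A" "m \<in> fst c" using chart_cover by blast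
  define W where "W = fst c \<inter> {m. f m \<noteq> 0}"
  have "open {m. f m \<noteq> 0}" by (rule open_Collect_neq) (use f in \<open>auto intro: continuous_intros\<close>)
  then have W: "open W" "m \<in> W" "W \<subseteq> fst c"
    using m c chart_open[OF c(1)] by (auto simp: W_def)
  have "AE m in volume A g. m \<notin> W" using ae by eventually_elim (auto simp: W_def)
  then have "W \<in> null_sets (volume A g)"
    using W(1) by (subst (asm) AE_iff_null_sets[symmetric]) (auto simp: sets_volume)
  then show False using volume_open_pos[OF c(1) W] by auto
qed

end

section \<open>The divergence theorem\<close>

text \<open>The integral of a derivative of a compactly supported function is the limit of integrals of
  difference quotients, which vanish by translation invariance.\<close>

lemma integral_derivative_compact_support:
  fixes F :: "'a::euclidean_space \<Rightarrow> complex"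
  assumes F: "\<And>x. (F has_derivative F' x) (at x)" and cont: "continuous_on UNIV (\<lambda>x. F' x v)"
    and K: "compact K" "\<And>x. x \<notin> K \<Longrightarrow> F x = 0"
  shows "integrable lborel (\<lambda>x. F' x v)" "(\<integral>x. F' x v \<partial>lborel) = 0"
proof -
  have cF: "continuous_on UNIV F"
    using F has_derivative_continuous continuous_at_imp_continuous_on by blast
  have zero': "F' x v = 0" if "x \<notin> K" for x
  proof -
    have "open (- K)" using K(1) compact_imp_closed by auto
    then have "(F has_derivative (\<lambda>h. 0)) (at x)"
      using has_derivative_transform_within_open[of "\<lambda>_. 0" "\<lambda>_. 0" x UNIV "- K" F] K(2) that by auto
    then show ?thesis using has_derivative_unique[OF F] by metis
  qed
  obtain B where B: "\<And>x. norm (F' x v) \<le> B" "B \<ge> 0"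
  proof -
    have "bounded ((\<lambda>x. F' x v) ` K)"
      using compact_imp_bounded[OF compact_continuous_image[OF continuous_on_subset[OF cont] K(1)]] by simp
    then obtain b where b: "\<And>y. y \<in> (\<lambda>x. F' x v) ` K \<Longrightarrow> norm y \<le> b" unfolding bounded_iff by blast
    show ?thesis
    proof (rule that[of "max b 0"])
      show "norm (F' x v) \<le> max b 0" for x
        using b[of "F' x v"] zero'[of x] by (cases "x \<in> K") auto
    qed simp
  qed
  define h where "h n = inverse (real (Suc n))" for n
  have h: "0 < h n" "h n \<le> 1" for n by (simp_all add: h_def field_simps)
  define G where "G n x = (F (x + h n *\<^sub>R v) - F x) /\<^sub>R h n" for n x
  \<comment> \<open>This set contains the supports of all difference quotients with step at most 1.\<close>
  define K' where "K' = (\<lambda>(y, t). y - t *\<^sub>R v) ` (K \<times> {0..1::real})"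
  have cK': "compact K'"
    unfolding K'_def split_beta by (intro compact_continuous_image compact_Times K continuous_intros) auto
  have KK': "K \<subseteq> K'" unfolding K'_def by (force intro!: image_eqI[of _ _ "(_, 0)"])
  have intF: "integrable lborel (\<lambda>x. F (x + a))" for a
  proof -
    have "continuous_on UNIV (\<lambda>x. F (x + a))"
      by (rule continuous_on_compose2[OF cF]) (auto intro!: continuous_intros)
    then have "continuous_on ((\<lambda>y. y - a) ` K) (\<lambda>x. F (x + a))" by (rule continuous_on_subset) simp
    moreover have "compact ((\<lambda>y. y - a) ` K)" by (intro compact_continuous_image continuous_intros K(1))
    ultimately have "integrable lborel (\<lambda>x. indicator ((\<lambda>y. y - a) ` K) x *\<^sub>R F (x + a))"
      by (intro borel_integrable_compact)
    moreover have "(\<lambda>x. indicator ((\<lambda>y. y - a) ` K) x *\<^sub>R F (x + a)) = (\<lambda>x. F (x + a))"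
    proof
      fix x show "indicator ((\<lambda>y. y - a) ` K) x *\<^sub>R F (x + a) = F (x + a)"
      proof (cases "x + a \<in> K")
        case True
        then have "x \<in> (\<lambda>y. y - a) ` K" by (intro image_eqI[of _ _ "x + a"]) auto
        then show ?thesis by simp
      next
        case False then show ?thesis using K(2) by simp
      qed
    qed
    ultimately show ?thesis by simp
  qed
  have G0: "(\<integral>x. G n x \<partial>lborel) = 0" for n
  proof -
    have "(\<integral>x. F (x + h n *\<^sub>R v) \<partial>lborel) = (\<integral>x. F x \<partial>distr lborel borel (\<lambda>x. x + h n *\<^sub>R v))"
      using borel_measurable_continuous_onI[OF cF] by (intro integral_distr[symmetric]) auto
    also have "distr lborel borel (\<lambda>x. x + h n *\<^sub>R v) = lborel"
    proof -
      have "(\<lambda>x. x + h n *\<^sub>R v) = (+) (h n *\<^sub>R v)" by (rule ext) (rule add.commute)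
      then show ?thesis by (simp only: lborel_distr_plus)
    qed
    finally show ?thesis
      unfolding G_def using intF[of "h n *\<^sub>R v"] intF[of 0] by simp
  qed
  have lim: "(\<lambda>n. G n x) \<longlonglongrightarrow> F' x v" for x
  proof -
    have "((\<lambda>t. F (x + t *\<^sub>R v)) has_vector_derivative F' x v) (at 0)"
      using has_vector_derivative_line[of F "F' x" x 0 v UNIV] F[of x] by simp
    then have D: "((\<lambda>t. norm (F (x + t *\<^sub>R v) - F x - t *\<^sub>R F' x v) / norm t) \<longlongrightarrow> 0) (at 0)"
      unfolding has_vector_derivative_def has_derivative_at by simp
    have "((\<lambda>t. (F (x + t *\<^sub>R v) - F x) /\<^sub>R t - F' x v) \<longlongrightarrow> 0) (at 0)"
    proof (rule Lim_null_comparison[OF _ D], rule eventually_mono[OF eventually_neq_at_within[of 0 0 UNIV]])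
      fix t :: real assume t: "t \<noteq> 0"
      have "(F (x + t *\<^sub>R v) - F x) /\<^sub>R t - F' x v = (F (x + t *\<^sub>R v) - F x - t *\<^sub>R F' x v) /\<^sub>R t"
        using t by (simp add: scaleR_diff_right)
      then show "norm ((F (x + t *\<^sub>R v) - F x) /\<^sub>R t - F' x v) \<le> norm (F (x + t *\<^sub>R v) - F x - t *\<^sub>R F' x v) / norm t"
        by (simp add: divide_inverse mult.commute)
    qed
    then have "((\<lambda>t. (F (x + t *\<^sub>R v) - F x) /\<^sub>R t) \<longlongrightarrow> F' x v) (at 0)" by (rule LIM_zero_cancel)
    moreover have "filterlim h (at 0) sequentially"
      using LIMSEQ_inverse_real_of_nat h(1) unfolding filterlim_at h_def[symmetric] by (simp add: less_imp_neq[symmetric])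
    ultimately show ?thesis unfolding G_def by (rule filterlim_compose)
  qed
  have bound: "norm (G n x) \<le> indicator K' x *\<^sub>R B" for n x
  proof (cases "x \<in> K'")
    case True
    have "norm (F (x + h n *\<^sub>R v) - F (x + 0 *\<^sub>R v)) \<le> B * norm (h n - 0)"
    proof (rule differentiable_bound[of "{0..h n}" "\<lambda>t. F (x + t *\<^sub>R v)" "\<lambda>t s. s *\<^sub>R F' (x + t *\<^sub>R v) v"])
      fix t assume "t \<in> {0..h n}"
      show "((\<lambda>t. F (x + t *\<^sub>R v)) has_derivative (\<lambda>s. s *\<^sub>R F' (x + t *\<^sub>R v) v)) (at t within {0..h n})"
        using has_vector_derivative_line[OF F[of "x + t *\<^sub>R v"]] by (simp add: has_vector_derivative_def)
      show "onorm (\<lambda>s. s *\<^sub>R F' (x + t *\<^sub>R v) v) \<le> B"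
      proof (rule onorm_le)
        fix s :: real
        have "\<bar>s\<bar> * norm (F' (x + t *\<^sub>R v) v) \<le> \<bar>s\<bar> * B" by (intro mult_left_mono B) simp
        then show "norm (s *\<^sub>R F' (x + t *\<^sub>R v) v) \<le> B * norm s" by (simp add: mult.commute)
      qed
    qed (use h[of n] in auto)
    then have "norm (F (x + h n *\<^sub>R v) - F x) / h n \<le> B" using h(1)[of n] by (simp add: field_simps)
    then have "norm (G n x) \<le> B" using h(1)[of n] by (simp add: G_def divide_inverse mult.commute)
    then show ?thesis using True by simp
  next
    case False
    have "x + h n *\<^sub>R v \<notin> K"
    proof
      assume a: "x + h n *\<^sub>R v \<in> K"
      have "x = (\<lambda>(y, t). y - t *\<^sub>R v) (x + h n *\<^sub>R v, h n)" by simp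
      moreover have "(x + h n *\<^sub>R v, h n) \<in> K \<times> {0..1}" using a h[of n] by simp
      ultimately have "x \<in> K'" unfolding K'_def by (rule image_eqI)
      then show False using False by simp
    qed
    moreover have "x \<notin> K" using False KK' by blast
    ultimately show ?thesis using B(2) by (simp add: G_def K(2))
  qed
  have intB: "integrable lborel (\<lambda>x. indicator K' x *\<^sub>R B)"
    by (rule borel_integrable_compact[OF cK' continuous_on_const])
  have intG: "integrable lborel (G n)" for n
  proof -
    have "integrable lborel (\<lambda>x. (F (x + h n *\<^sub>R v) - F (x + 0)) /\<^sub>R h n)"
      by (intro integrable_scaleR_right Bochner_Integration.integrable_diff intF)
    then show ?thesis by (simp add: G_def[abs_def])
  qed
  have mG: "G n \<in> borel_measurable lborel" for n using intG by (rule borel_measurable_integrable)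
  have mF': "(\<lambda>x. F' x v) \<in> borel_measurable lborel"
    using borel_measurable_continuous_onI[OF cont] by simp
  have AEs: "AE x in lborel. (\<lambda>n. G n x) \<longlonglongrightarrow> F' x v" "AE x in lborel. norm (G n x) \<le> indicator K' x *\<^sub>R B" for n
    by (rule AE_I2, rule lim) (rule AE_I2, rule bound)
  show "integrable lborel (\<lambda>x. F' x v)"
    by (rule integrable_dominated_convergence[OF mF' mG intB AEs])
  have "(\<lambda>n. \<integral>x. G n x \<partial>lborel) \<longlonglongrightarrow> (\<integral>x. F' x v \<partial>lborel)"
    by (rule integral_dominated_convergence[OF mF' mG intB AEs])
  then show "(\<integral>x. F' x v \<partial>lborel) = 0"
    unfolding G0 LIMSEQ_const_iff by simp
qed

text \<open>The same for the Wirtinger derivatives of a function supported in a compact subset of an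
  open set.\<close>

lemma integral_cderiv_compact_support:
  fixes F :: "complex^'n::finite \<Rightarrow> complex"
  assumes U: "open U" and F: "Ck_on 1 F U" and K: "compact K" "K \<subseteq> U" "\<And>x. x \<in> U \<Longrightarrow> x \<notin> K \<Longrightarrow> F x = 0"
  shows "integrable lborel (\<lambda>x. indicator U x *\<^sub>R cderiv Z F x)" "(\<integral>x. indicator U x *\<^sub>R cderiv Z F x \<partial>lborel) = 0"
proof -
  define F0 where "F0 x = (if x \<in> U then F x else 0)" for x
  define D where "D x v = (if x \<in> U then frechet_derivative F (at x) v else 0)" for x v
  have F1: "Ck_on (Suc 0) F U" using F by simp
  have oK: "open (- K)" using K(1) compact_imp_closed by auto
  have zK: "F0 x = 0" if "x \<notin> K" for x using K(3) that by (auto simp: F0_def)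
  have D0: "(F0 has_derivative (\<lambda>v. 0)) (at x)" if "x \<notin> K" for x
    using has_derivative_transform_within_open[of "\<lambda>_. 0" "\<lambda>_. 0" x UNIV "- K" F0] oK zK that by auto
  have dU: "(F0 has_derivative D x) (at x)" if "x \<in> U" for x
    unfolding D_def using that
    by (simp, intro has_derivative_transform_within_open[OF Ck_on_SucD(1)[OF U F1 that] U that]) (simp add: F0_def)
  have DK: "D x v = 0" if "x \<notin> K" for x v
  proof (cases "x \<in> U")
    case True then show ?thesis using has_derivative_unique[OF dU[OF True] D0[OF that]] by simp
  qed (simp add: D_def)
  have der: "(F0 has_derivative D x) (at x)" for x
  proof (cases "x \<in> U")
    case False
    then have "x \<notin> K" using K(2) by blast
    then have "D x = (\<lambda>v. 0)" using DK by auto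
    then show ?thesis using D0[OF \<open>x \<notin> K\<close>] by simp
  qed (rule dU)
  have cont: "continuous_on UNIV (\<lambda>x. D x v)" for v
  proof -
    have "continuous_on U (\<lambda>x. D x v)"
      using Ck_on_SucD(2)[OF U F1, of v] by (simp add: D_def cong: continuous_on_cong)
    moreover have "continuous_on (- K) (\<lambda>x. D x v)"
      by (rule continuous_on_eq[OF continuous_on_const[of _ 0]]) (use DK in auto)
    ultimately have "continuous_on (U \<union> - K) (\<lambda>x. D x v)" by (rule continuous_on_open_Un[OF U oK])
    moreover have "U \<union> - K = UNIV" using K(2) by auto
    ultimately show ?thesis by simp
  qed
  note I = integral_derivative_compact_support[OF der cont K(1) zK]
  have e: "(\<lambda>x. indicator U x *\<^sub>R cderiv Z F x) = (\<lambda>x. D x (fst Z) + \<i> * D x (snd Z))"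
    by (auto simp: D_def cderiv_def indicator_def)
  show "integrable lborel (\<lambda>x. indicator U x *\<^sub>R cderiv Z F x)" unfolding e using I(1) by simp
  show "(\<integral>x. indicator U x *\<^sub>R cderiv Z F x \<partial>lborel) = 0" unfolding e using I by simp
qed

section \<open>Partitions of unity of class C1\<close>

text \<open>The square makes the truncation differentiable at 0; one derivative is all that integration by
  parts requires.\<close>

lemma has_derivative_max_0_square:
  fixes s :: "'a::real_normed_vector \<Rightarrow> real"
  assumes s: "(s has_derivative s') (at x)"
  shows "((\<lambda>x. (max 0 (s x))\<^sup>2) has_derivative (\<lambda>v. 2 * max 0 (s x) * s' v)) (at x)"
proof -
  have "((\<lambda>t. (max 0 t)\<^sup>2) has_real_derivative 2 * max 0 a) (at a)" for a :: real
  proof -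
    consider "a > 0" | "a < 0" | "a = 0" by linarith
    then show ?thesis
    proof cases
      case 1
      have "((\<lambda>t. t\<^sup>2) has_real_derivative 2 * max 0 a) (at a)"
        using 1 by (auto intro!: derivative_eq_intros)
      then show ?thesis
        by (rule DERIV_cong_ev[OF refl _ refl, THEN iffD1, rotated])
           (use 1 in \<open>auto intro!: eventually_mono[OF eventually_nhds_in_open[of "{0<..}"]]\<close>)
    next
      case 2
      have "((\<lambda>t. 0) has_real_derivative 2 * max 0 a) (at a)" using 2 by simp
      then show ?thesis
        by (rule DERIV_cong_ev[OF refl _ refl, THEN iffD1, rotated])
           (use 2 in \<open>auto intro!: eventually_mono[OF eventually_nhds_in_open[of "{..<0}"]]\<close>)
    next
      case 3
      have "((\<lambda>h. (max 0 h)\<^sup>2 / h) \<longlongrightarrow> 0) (at (0::real))"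
      proof (rule Lim_null_comparison)
        show "\<forall>\<^sub>F h in at (0::real). norm ((max 0 h)\<^sup>2 / h) \<le> \<bar>h\<bar>"
          by (rule always_eventually) (auto simp: max_def power2_eq_square)
        show "((\<lambda>h. \<bar>h\<bar>) \<longlongrightarrow> 0) (at (0::real))" by (intro tendsto_eq_intros) auto
      qed
      then show ?thesis using 3 by (simp add: DERIV_def)
    qed
  qed
  from has_derivative_compose[OF s this[unfolded has_field_derivative_def]] show ?thesis by simp
qed

lemma Ck_on_max_0_square:
  fixes s :: "'a::euclidean_space \<Rightarrow> real"
  assumes S: "open S" and s: "Ck_on 1 s S"
  shows "Ck_on 1 (\<lambda>x. (max 0 (s x))\<^sup>2) S"
proof -
  have s1: "Ck_on (Suc 0) s S" using s by simp
  have "Ck_on (Suc 0) (\<lambda>x. (max 0 (s x))\<^sup>2) S"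
  proof (rule Ck_on_SucI[OF S has_derivative_max_0_square[OF Ck_on_SucD(1)[OF S s1]]])
    fix v
    have "continuous_on S s" using Ck_on_Suc_imp[OF S s1] by simp
    moreover have "continuous_on S (\<lambda>x. frechet_derivative s (at x) v)" using Ck_on_SucD(2)[OF S s1] by simp
    ultimately show "Ck_on 0 (\<lambda>x. 2 * max 0 (s x) * frechet_derivative s (at x) v) S"
      by (simp, intro continuous_intros)
  qed
  then show ?thesis by simp
qed

lemma Ck_on_open_Un:
  assumes S: "open S" "open T" and f: "Ck_on 1 f S" "Ck_on 1 f T"
  shows "Ck_on 1 f (S \<union> T)"
proof -
  have "\<forall>x\<in>S \<union> T. f differentiable at x"
    using f S by (auto simp: differentiable_on_eq_differentiable_at)
  moreover have "continuous_on (S \<union> T) (\<lambda>x. frechet_derivative f (at x) v)" for v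
    using f by (intro continuous_on_open_Un S) auto
  ultimately show ?thesis using S by (simp add: differentiable_on_eq_differentiable_at open_Un)
qed

context hermitian_manifold
begin

lemma continuous_from_charts:
  fixes f :: "'m \<Rightarrow> complex"
  assumes "\<And>c. c \<in> A \<Longrightarrow> continuous_on (im c) (\<lambda>x. f (cinv c x))"
  shows "continuous_on UNIV f"
proof -
  have "continuous_on (fst c) f" if c: "c \<in> A" for c
  proof -
    have "continuous_on (fst c) (\<lambda>m. f (cinv c (snd c m)))"
      by (rule continuous_on_compose2[OF assms[OF c] cont_snd[OF c]]) (simp add: im_def)
    then show ?thesis by (rule continuous_on_eq) (simp add: cinv_snd[OF c])
  qed
  then have "continuous_on (\<Union>c\<in>A. fst c) f" using chart_open by (intro continuous_on_open_UN) auto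
  moreover have "(\<Union>c\<in>A. fst c) = UNIV" using chart_cover by blast
  ultimately show ?thesis by simp
qed

text \<open>A bump function of class C1; its regularity in other charts uses that the support is compact,
  hence closed in the whole manifold.\<close>

lemma ex_bump:
  assumes c: "c \<in> A" and m: "m \<in> fst c"
  obtains b :: "'m \<Rightarrow> real" and K where "compact K" "K \<subseteq> fst c" "\<And>p. p \<notin> K \<Longrightarrow> b p = 0" "\<And>p. b p \<ge> 0" "b m > 0"
    "\<And>c'. c' \<in> A \<Longrightarrow> Ck_on 1 (\<lambda>x. complex_of_real (b (cinv c' x))) (im c')"
proof -
  obtain r where r: "r > 0" "cball (snd c m) r \<subseteq> im c"
    using im_open[OF c] snd_in[OF m] open_contains_cball by blast
  define x0 where "x0 = snd c m"
  \<comment> \<open>This is \<open>r\<^sup>2 - \<bar>y - x0\<bar>\<^sup>2\<close>, written with operations that are known to be smooth.\<close>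
  define s where "s y = r\<^sup>2 - Re (\<Sum>a\<in>UNIV. (y $ a - x0 $ a) * cnj (y $ a - x0 $ a))" for y
  have s: "s y = r\<^sup>2 - (dist x0 y)\<^sup>2" for y
  proof -
    have "Re (\<Sum>a\<in>UNIV. (y $ a - x0 $ a) * cnj (y $ a - x0 $ a)) = (\<Sum>a\<in>UNIV. (cmod (y $ a - x0 $ a))\<^sup>2)"
      by (simp only: complex_norm_square[symmetric] of_real_sum[symmetric] Re_complex_of_real)
    also have "\<dots> = (norm (y - x0))\<^sup>2" by (simp add: norm_vec_def L2_set_def sum_nonneg)
    finally show ?thesis by (simp add: s_def dist_norm norm_minus_commute)
  qed
  define b where "b p = (if p \<in> fst c then (max 0 (s (snd c p)))\<^sup>2 else 0)" for p
  define K where "K = cinv c ` cball x0 r"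
  have K: "compact K" unfolding K_def x0_def
    by (intro compact_continuous_image continuous_on_subset[OF cont_cinv[OF c] r(2)]) simp
  have Ks: "K \<subseteq> fst c" using r(2) cinv_in[OF c] by (auto simp: K_def x0_def)
  have z: "b p = 0" if "p \<notin> K" for p
  proof (cases "p \<in> fst c")
    case True
    have "snd c p \<notin> cball x0 r"
    proof
      assume "snd c p \<in> cball x0 r"
      then have "cinv c (snd c p) \<in> K" unfolding K_def by (rule imageI)
      then show False using that cinv_snd[OF c True] by simp
    qed
    then have "dist x0 (snd c p) > r" by simp
    then have "r\<^sup>2 < (dist x0 (snd c p))\<^sup>2" using r(1) by (intro power_strict_mono) auto
    then show ?thesis using True by (simp add: b_def s)
  qed (simp add: b_def)
  have bm: "b m > 0" using m r(1) by (simp add: b_def s x0_def[symmetric])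
  have "Ck_on 1 (\<lambda>x. complex_of_real (b (cinv c' x))) (im c')" if c': "c' \<in> A" for c'
  proof -
    interpret chart_change g c' c "overlap c' c" "im c" "transition c' c" by (rule chart_change[OF c' c])
    have "smooth_on (\<lambda>x. s (transition c' c x)) (overlap c' c)"
      unfolding s_def
      by (intro smooth_on_diff smooth_on_const smooth_on_bounded_linear[OF bounded_linear_Re] smooth_on_sum
          smooth_on_mult smooth_on_cnj holo_on_smooth[OF C1.U holo_phi] C1.U)
    then have "Ck_on 1 (\<lambda>x. complex_of_real ((max 0 (s (transition c' c x)))\<^sup>2)) (overlap c' c)"
      unfolding smooth_on_def
      by (intro Ck_on_bounded_linear[OF bounded_linear_of_real C1.U] Ck_on_max_0_square C1.U) blast
    then have 1: "Ck_on 1 (\<lambda>x. complex_of_real (b (cinv c' x))) (overlap c' c)"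
    proof (rule Ck_on_cong[OF C1.U, rotated])
      fix x assume x: "x \<in> overlap c' c"
      then have "cinv c' x \<in> fst c" using overlap_iff[OF c'] by blast
      moreover have "snd c (cinv c' x) = transition c' c x" by (simp add: transition_def)
      ultimately show "complex_of_real ((max 0 (s (transition c' c x)))\<^sup>2) = complex_of_real (b (cinv c' x))"
        by (simp add: b_def)
    qed
    let ?W = "im c' \<inter> cinv c' -` (- K)"
    have oW: "open ?W"
    proof -
      have "open (- K)" using K compact_imp_closed by auto
      from continuous_on_open_vimage[OF im_open[OF c'], THEN iffD1, rule_format, OF cont_cinv[OF c'] this]
      show ?thesis by (subst Int_commute)
    qed
    have 2: "Ck_on 1 (\<lambda>x. complex_of_real (b (cinv c' x))) ?W"
      by (rule Ck_on_cong[OF oW _ Ck_on_const[OF oW, of 1 0]]) (simp add: z)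
    have "overlap c' c \<union> ?W = im c'"
      using overlap_iff[OF c', where c'=c] Ks by blast
    then show ?thesis using Ck_on_open_Un[OF C1.U oW 1 2] by simp
  qed
  moreover have "b p \<ge> 0" for p by (simp add: b_def)
  ultimately show thesis using that[OF K Ks, of b] z bm by blast
qed

end

context compact_hermitian_manifold
begin

text \<open>Normalise the sum of finitely many bump functions whose positivity sets cover the manifold.\<close>

lemma ex_partition_of_unity:
  obtains I :: "'m set" and \<rho> :: "'m \<Rightarrow> 'm \<Rightarrow> complex" where "finite I" "\<And>p. (\<Sum>i\<in>I. \<rho> i p) = 1"
    "\<And>i c. i \<in> I \<Longrightarrow> c \<in> A \<Longrightarrow> Ck_on 1 (\<lambda>x. \<rho> i (cinv c x)) (im c)"
    "\<And>i. i \<in> I \<Longrightarrow> \<exists>c\<in>A. \<exists>K. compact K \<and> K \<subseteq> fst c \<and> (\<forall>p. p \<notin> K \<longrightarrow> \<rho> i p = 0)"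
proof -
  have "\<exists>b :: 'm \<Rightarrow> real. (\<exists>c\<in>A. \<exists>K. compact K \<and> K \<subseteq> fst c \<and> (\<forall>p. p \<notin> K \<longrightarrow> b p = 0)) \<and> (\<forall>p. b p \<ge> 0) \<and> b m > 0 \<and>
     (\<forall>c'\<in>A. Ck_on 1 (\<lambda>x. complex_of_real (b (cinv c' x))) (im c'))" for m
  proof -
    obtain c where c: "c \<in> A" "m \<in> fst c" using chart_cover by blast
    from ex_bump[OF c] show ?thesis using c(1) by metis
  qed
  then obtain b :: "'m \<Rightarrow> 'm \<Rightarrow> real" where b: "\<And>m. \<exists>c\<in>A. \<exists>K. compact K \<and> K \<subseteq> fst c \<and> (\<forall>p. p \<notin> K \<longrightarrow> b m p = 0)"
    "\<And>m p. b m p \<ge> 0" "\<And>m. b m m > 0" "\<And>m c. c \<in> A \<Longrightarrow> Ck_on 1 (\<lambda>x. complex_of_real (b m (cinv c x))) (im c)"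
    by metis
  have cont: "continuous_on UNIV (b m)" for m
  proof -
    have "continuous_on UNIV (\<lambda>p. complex_of_real (b m p))"
    proof (rule continuous_from_charts)
      fix c assume c: "c \<in> A"
      then have "Ck_on (Suc 0) (\<lambda>x. complex_of_real (b m (cinv c x))) (im c)" using b(4) by simp
      from Ck_on_Suc_imp[OF im_open[OF c] this] show "continuous_on (im c) (\<lambda>x. complex_of_real (b m (cinv c x)))" by simp
    qed
    from continuous_on_Re[OF this] show ?thesis by simp
  qed
  have "open {p. b m p > 0}" for m by (rule open_Collect_less) (use cont in auto)
  then obtain I where I: "finite I" "(UNIV :: 'm set) \<subseteq> (\<Union>m\<in>I. {p. b m p > 0})"
    using compactE_image[OF compact, of UNIV "\<lambda>m. {p. b m p > 0}"] b(3) by (metis (mono_tags, lifting) UNIV_I UN_I mem_Collect_eq subsetI)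
  define B where "B p = (\<Sum>m\<in>I. b m p)" for p
  have B: "B p > 0" for p
  proof -
    obtain m where "m \<in> I" "b m p > 0" using I(2) by blast
    then show ?thesis unfolding B_def using I(1) b(2) by (intro sum_pos2[of _ m]) auto
  qed
  define \<rho> where "\<rho> m p = complex_of_real (b m p) * inverse (\<Sum>m\<in>I. complex_of_real (b m p))" for m p
  have sB: "(\<Sum>m\<in>I. complex_of_real (b m p)) \<noteq> 0" for p
  proof -
    have "(\<Sum>m\<in>I. complex_of_real (b m p)) = complex_of_real (B p)" by (simp add: B_def)
    then show ?thesis using B[of p] by simp
  qed
  show thesis
  proof (rule that[of I \<rho>])
    show "(\<Sum>i\<in>I. \<rho> i p) = 1" for p
      unfolding \<rho>_def sum_distrib_right[symmetric] using sB by simp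
    show "Ck_on 1 (\<lambda>x. \<rho> i (cinv c x)) (im c)" if "c \<in> A" for i c
      unfolding \<rho>_def by (intro Ck_on_mult Ck_on_inverse Ck_on_sum im_open b(4) that sB)
    show "\<exists>c\<in>A. \<exists>K. compact K \<and> K \<subseteq> fst c \<and> (\<forall>p. p \<notin> K \<longrightarrow> \<rho> i p = 0)" for i
    proof -
      obtain c K where "c \<in> A" "compact K" "K \<subseteq> fst c" "\<forall>p. p \<notin> K \<longrightarrow> b i p = 0" using b(1)[of i] by blast
      then show ?thesis by (intro bexI[of _ c] exI[of _ K]) (simp_all add: \<rho>_def)
    qed
  qed (fact I(1))
qed

end

section \<open>Integration by parts for \<open>(0,1)\<close>-forms\<close>

text \<open>For a \<open>(0,1)\<close>-form \<open>\<eta>\<close> this is \<open>\<langle>\<partial>\<eta>, \<omega>\<rangle> - \<langle>\<eta>, \<partial>\<^sup>*\<omega>\<rangle>\<close> in a chart.\<close>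

definition divop :: "('m, 'n) metric \<Rightarrow> ('m, 'n::finite) chart \<Rightarrow> (complex^'n \<Rightarrow> 'n \<Rightarrow> complex) \<Rightarrow> complex^'n \<Rightarrow> complex" where
  "divop g c \<eta> x = - \<i> * tr2 (hinv g c x) (\<lambda>k j. cderiv (dz k) (\<lambda>y. \<eta> y j) x)
     - tr2 (hinv g c x) (\<lambda>k j. cnj (psi g c x k) * \<eta> x j)"

context hermitian_manifold
begin

text \<open>Jacobi's formula.\<close>

lemma cderiv_vdens:
  assumes c: "c \<in> A" and x: "x \<in> im c"
  shows "cderiv (dz k) (\<lambda>y. complex_of_real (vdens g c y)) x =
    complex_of_real (vdens g c x) * tr2 (hinv g c x) (dh g c x k)"
proof -
  interpret C: hermitian_chart g c "im c" by (rule hermitian_chart[OF c])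
  define N where "N = (\<chi> m k. hinv g c x k m)"
  have N: "N ** (\<chi> i j. herm g c x i j) = mat 1"
    using herm_hinv[OF C.hat[OF x]] by (auto simp: vec_eq_iff matrix_matrix_mult_def N_def mat_def)
  have v: "complex_of_real (vdens g c y) = 2 ^ CARD('n) * det (\<chi> i j. herm g c y i j)" if "y \<in> im c" for y
    using det_herm_pos(2)[OF C.hat[OF that]] by (simp add: vdens_def complex_eq_iff)
  have d: "((\<lambda>y. det (\<chi> i j. herm g c y i j)) has_derivative (\<lambda>v. det (\<chi> i j. herm g c x i j) *
     (\<Sum>i\<in>UNIV. \<Sum>j\<in>UNIV. frechet_derivative (\<lambda>y. herm g c y i j) (at x) v * N $ j $ i))) (at x)"
  proof (rule has_derivative_det[where M = "\<lambda>y. \<chi> i j. herm g c y i j", OF _ N])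
    fix i j show "((\<lambda>y. (\<chi> i j. herm g c y i j) $ i $ j) has_derivative frechet_derivative (\<lambda>y. herm g c y i j) (at x)) (at x)"
      using has_frechet[OF C.diff_herm[OF x]] by simp
  qed
  have "cderiv (dz k) (\<lambda>y. complex_of_real (vdens g c y)) x = cderiv (dz k) (\<lambda>y. 2 ^ CARD('n) * det (\<chi> i j. herm g c y i j)) x"
    by (rule cderiv_cong_open[OF C.U x v])
  also have "\<dots> = 2 ^ CARD('n) * cderiv (dz k) (\<lambda>y. det (\<chi> i j. herm g c y i j)) x"
    by (rule cderiv_cmult) (use d in \<open>auto simp: differentiable_def\<close>)
  also have "cderiv (dz k) (\<lambda>y. det (\<chi> i j. herm g c y i j)) x = det (\<chi> i j. herm g c x i j) * tr2 (hinv g c x) (dh g c x k)"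
  proof -
    have "(\<Sum>i\<in>UNIV. \<Sum>j\<in>UNIV. a i j * f i j) + \<i> * (\<Sum>i\<in>UNIV. \<Sum>j\<in>UNIV. b i j * f i j) =
      (\<Sum>i\<in>UNIV. \<Sum>j\<in>UNIV. f i j * (a i j + \<i> * b i j))" for a b f :: "'n \<Rightarrow> 'n \<Rightarrow> complex"
      unfolding sum_distrib_left sum.distrib[symmetric] by (intro sum.cong refl) (simp add: algebra_simps)
    note e = this
    show ?thesis
      unfolding cderiv_has[OF d] unfolding tr2_def dh_def cderiv_def e[symmetric] by (simp add: N_def distrib_left mult.left_commute)
  qed
  finally show ?thesis by (simp add: v[OF x])
qed

text \<open>The first order terms are exactly those needed to write \<open>divop\<close> as a divergence.\<close>

lemma divop_divergence:
  assumes c: "c \<in> A" and x: "x \<in> im c" and d: "\<And>j. (\<lambda>y. \<eta> y j) differentiable at x"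
  shows "complex_of_real (vdens g c x) * divop g c \<eta> x =
    - \<i> * (\<Sum>k\<in>UNIV. cderiv (dz k) (\<lambda>y. \<Sum>j\<in>UNIV. hinv g c y k j * complex_of_real (vdens g c y) * \<eta> y j) x)"
proof -
  interpret C: hermitian_chart g c "im c" by (rule hermitian_chart[OF c])
  let ?h = "hinv g c x" and ?v = "complex_of_real (vdens g c x)" and ?a = "dh g c x"
  have dv: "(\<lambda>y. complex_of_real (vdens g c y)) differentiable at x"
    by (rule smooth_on_differentiable[OF C.U smooth_vdens[OF c] x])
  have 1: "(\<Sum>k\<in>UNIV. cderiv (dz k) (\<lambda>y. \<Sum>j\<in>UNIV. hinv g c y k j * complex_of_real (vdens g c y) * \<eta> y j) x) =
    (\<Sum>k\<in>UNIV. \<Sum>j\<in>UNIV. (cderiv (dz k) (\<lambda>y. hinv g c y k j) x * ?v + ?h k j * (?v * tr2 ?h (?a k))) * \<eta> x j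
       + ?h k j * ?v * cderiv (dz k) (\<lambda>y. \<eta> y j) x)"
    by (simp add: cderiv_sum cderiv_mult differentiable_mult d dv C.diff_hinv[OF x] cderiv_vdens[OF c x])
  have 2: "(\<Sum>k\<in>UNIV. \<Sum>j\<in>UNIV. cderiv (dz k) (\<lambda>y. hinv g c y k j) x * \<eta> x j) =
     - tr2 ?h (\<lambda>k j. tr2 ?h (\<lambda>p q. ?a p k q) * \<eta> x j)"
  proof -
    have "(\<Sum>k\<in>UNIV. \<Sum>j\<in>UNIV. cderiv (dz k) (\<lambda>y. hinv g c y k j) x * \<eta> x j) =
      - (\<Sum>k\<in>UNIV. \<Sum>j\<in>UNIV. \<Sum>p\<in>UNIV. \<Sum>q\<in>UNIV. ?h k q * (?h p j * (?a k p q * \<eta> x j)))"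
      unfolding C.cderiv_hinv[OF x] by (simp add: sum_distrib_right sum_negf mult.assoc)
    also have "(\<Sum>k\<in>UNIV. \<Sum>j\<in>UNIV. \<Sum>p\<in>UNIV. \<Sum>q\<in>UNIV. ?h k q * (?h p j * (?a k p q * \<eta> x j))) =
       (\<Sum>k\<in>UNIV. \<Sum>q\<in>UNIV. \<Sum>p\<in>UNIV. \<Sum>j\<in>UNIV. ?h k q * (?h p j * (?a k p q * \<eta> x j)))"
    proof (rule sum.cong[OF refl])
      fix k
      have r: "(\<Sum>j\<in>UNIV. \<Sum>p\<in>UNIV. \<Sum>q\<in>UNIV. F j p q) = (\<Sum>q\<in>UNIV. \<Sum>p\<in>UNIV. \<Sum>j\<in>UNIV. F j p q)" for F :: "'n \<Rightarrow> 'n \<Rightarrow> 'n \<Rightarrow> complex"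
      proof -
        have "(\<Sum>j\<in>UNIV. \<Sum>p\<in>UNIV. \<Sum>q\<in>UNIV. F j p q) = (\<Sum>p\<in>UNIV. \<Sum>j\<in>UNIV. \<Sum>q\<in>UNIV. F j p q)" by (rule sum.swap)
        also have "\<dots> = (\<Sum>p\<in>UNIV. \<Sum>q\<in>UNIV. \<Sum>j\<in>UNIV. F j p q)" by (intro sum.cong refl sum.swap)
        also have "\<dots> = (\<Sum>q\<in>UNIV. \<Sum>p\<in>UNIV. \<Sum>j\<in>UNIV. F j p q)" by (rule sum.swap)
        finally show ?thesis .
      qed
      show "(\<Sum>j\<in>UNIV. \<Sum>p\<in>UNIV. \<Sum>q\<in>UNIV. ?h k q * (?h p j * (?a k p q * \<eta> x j))) =
       (\<Sum>q\<in>UNIV. \<Sum>p\<in>UNIV. \<Sum>j\<in>UNIV. ?h k q * (?h p j * (?a k p q * \<eta> x j)))" by (rule r)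
    qed
    also have "\<dots> = tr2 ?h (\<lambda>k q. tr2 ?h (\<lambda>p j. ?a k p q * \<eta> x j))"
      by (simp add: tr2_def sum_distrib_left)
    also have "\<dots> = tr2 ?h (\<lambda>p j. tr2 ?h (\<lambda>k q. ?a k p q * \<eta> x j))" by (rule tr2_swap)
    also have "\<dots> = tr2 ?h (\<lambda>k j. tr2 ?h (\<lambda>p q. ?a p k q) * \<eta> x j)"
      by (simp add: tr2_def sum_distrib_right mult.assoc)
    finally show ?thesis .
  qed
  have 3: "cnj (psi g c x k) = \<i> * (tr2 ?h (?a k) - tr2 ?h (\<lambda>p q. ?a p k q))" for k
    unfolding psi_def by (simp add: cnj_tr2 cnj_hinv[OF C.hat[OF x]] tr2_diff)
  have 4: "(\<Sum>k\<in>UNIV. \<Sum>j\<in>UNIV. (X k j * v + h k j * (v * T k)) * e j + h k j * v * D k j) =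
      v * ((\<Sum>k\<in>UNIV. \<Sum>j\<in>UNIV. X k j * e j) + tr2 h (\<lambda>k j. T k * e j) + tr2 h D)"
    for X h D :: "'n \<Rightarrow> 'n \<Rightarrow> complex" and T e v
    unfolding tr2_def sum_distrib_left distrib_left sum.distrib[symmetric]
    by (intro sum.cong refl) (simp add: algebra_simps)
  have "- \<i> * (\<Sum>k\<in>UNIV. cderiv (dz k) (\<lambda>y. \<Sum>j\<in>UNIV. hinv g c y k j * complex_of_real (vdens g c y) * \<eta> y j) x) =
    - \<i> * (?v * ((\<Sum>k\<in>UNIV. \<Sum>j\<in>UNIV. cderiv (dz k) (\<lambda>y. hinv g c y k j) x * \<eta> x j) +
       tr2 ?h (\<lambda>k j. tr2 ?h (?a k) * \<eta> x j) + tr2 ?h (\<lambda>k j. cderiv (dz k) (\<lambda>y. \<eta> y j) x)))"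
    by (simp only: 1 4)
  also have "\<dots> = ?v * divop g c \<eta> x"
  proof -
    have 5: "tr2 ?h (\<lambda>k j. cnj (psi g c x k) * \<eta> x j) = \<i> * (tr2 ?h (\<lambda>k j. tr2 ?h (?a k) * \<eta> x j)
        - tr2 ?h (\<lambda>k j. tr2 ?h (\<lambda>p q. ?a p k q) * \<eta> x j))"
      by (simp only: 3 left_diff_distrib right_diff_distrib mult.assoc tr2_diff tr2_cmult)
    show ?thesis unfolding 2 divop_def 5 by (simp add: algebra_simps)
  qed
  finally show ?thesis by simp
qed

end

subsection \<open>Functions given in charts\<close>

text \<open>The function on the manifold which is described by \<open>f c\<close> in the chart \<open>c\<close>.\<close>

definition glue :: "('m, 'n) chart set \<Rightarrow> (('m, 'n) chart \<Rightarrow> complex^'n \<Rightarrow> complex) \<Rightarrow> 'm \<Rightarrow> complex" where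
  "glue A f m = f (chart_at A m) (snd (chart_at A m) m)"

lemma inner_prod_glue: "inner_prod A g p q \<phi> \<psi> = integral\<^sup>L (volume A g) (glue A (pt_inner g p q \<phi> \<psi>))"
  by (simp add: inner_prod_def glue_def[abs_def])

context hermitian_manifold
begin

lemma chart_at: "chart_at A m \<in> A" "m \<in> fst (chart_at A m)"
proof -
  have "\<exists>c. c \<in> A \<and> m \<in> fst c" using chart_cover by blast
  from someI_ex[OF this] show "chart_at A m \<in> A" "m \<in> fst (chart_at A m)" by (simp_all add: chart_at_def)
qed

lemma glue_cinv:
  assumes inv: "\<And>c c' x. c \<in> A \<Longrightarrow> c' \<in> A \<Longrightarrow> x \<in> overlap c c' \<Longrightarrow> f c x = f c' (transition c c' x)"
    and c: "c \<in> A" and x: "x \<in> im c"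
  shows "glue A f (cinv c x) = f c x"
proof -
  have "x \<in> overlap c (chart_at A (cinv c x))" using overlap_iff[OF c] x chart_at(2) by blast
  from inv[OF c chart_at(1) this] show ?thesis by (simp add: glue_def transition_def)
qed

lemma continuous_glue:
  assumes inv: "\<And>c c' x. c \<in> A \<Longrightarrow> c' \<in> A \<Longrightarrow> x \<in> overlap c c' \<Longrightarrow> f c x = f c' (transition c c' x)"
    and cont: "\<And>c. c \<in> A \<Longrightarrow> continuous_on (im c) (f c)"
  shows "continuous_on UNIV (glue A f)"
proof (rule continuous_from_charts)
  fix c assume c: "c \<in> A"
  show "continuous_on (im c) (\<lambda>x. glue A f (cinv c x))"
    by (rule continuous_on_eq[OF cont[OF c]]) (rule glue_cinv[OF inv c, symmetric])
qed

lemma cinv_transition: "c \<in> A \<Longrightarrow> c' \<in> A \<Longrightarrow> x \<in> overlap c c' \<Longrightarrow> cinv c' (transition c c' x) = cinv c x"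
  using overlap_iff[of c x c'] cinv_snd[of c'] by (simp add: transition_def)

subsection \<open>The integral of the divergence\<close>

text \<open>The components of a (0,1)-form of class C1.  Multiplication by a partition of unity of class C1
  leads out of the smooth forms.\<close>

definition C1_form01 :: "(('m, 'n) chart \<Rightarrow> complex^'n \<Rightarrow> 'n \<Rightarrow> complex) \<Rightarrow> bool" where
  "C1_form01 \<eta> \<longleftrightarrow> (\<forall>c\<in>A. \<forall>j. Ck_on 1 (\<lambda>x. \<eta> c x j) (im c)) \<and>
     (\<forall>c\<in>A. \<forall>c'\<in>A. \<forall>x\<in>overlap c c'. \<forall>j. \<eta> c x j =
        (\<Sum>b\<in>UNIV. cnj (jac (transition c c') x j b) * \<eta> c' (transition c c' x) b))"

lemma C1_form01_diff:
  assumes "C1_form01 \<eta>" "c \<in> A" "x \<in> im c"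
  shows "(\<lambda>y. \<eta> c y j) differentiable at x"
proof -
  have "Ck_on (Suc 0) (\<lambda>y. \<eta> c y j) (im c)" using assms by (simp add: C1_form01_def)
  from Ck_on_SucD(1)[OF im_open[OF assms(2)] this assms(3)] show ?thesis by (auto simp: differentiable_def)
qed

text \<open>Both terms are full contractions of tensors: of \<open>\<partial>\<eta>\<close>, and of \<open>\<eta>\<close> with \<open>psi\<close>.\<close>

lemma divop_change:
  assumes eta: "C1_form01 \<eta>" and c: "c \<in> A" "c' \<in> A" and x: "x \<in> overlap c c'"
  shows "divop g c (\<eta> c) x = divop g c' (\<eta> c') (transition c c' x)"
proof -
  interpret chart_change g c c' "overlap c c'" "im c'" "transition c c'" by (rule chart_change[OF c])
  have e: "\<And>y j. y \<in> overlap c c' \<Longrightarrow> \<eta> c y j = (\<Sum>b\<in>UNIV. cnj (jac (transition c c') y j b) * \<eta> c' (transition c c' y) b)"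
    using eta c unfolding C1_form01_def by blast
  have 1: "cderiv (dz k) (\<lambda>y. \<eta> c y j) x = tr2 (pull x k j) (\<lambda>a b. cderiv (dz a) (\<lambda>z. \<eta> c' z b) (transition c c' x))" for k j
    by (rule dz_change01[OF x e C1_form01_diff[OF eta c(2) maps[OF x]]])
  have 2: "cnj (psi g c x k) * \<eta> c x j = tr2 (pull x k j) (\<lambda>a b. cnj (psi g c' (transition c c' x) a) * \<eta> c' (transition c c' x) b)" for k j
    unfolding psi_change[OF x] e[OF x] tr2_def pull_def by (simp add: sum_product mult_ac, rule sum.swap)
  show ?thesis unfolding divop_def 1 2 tr2_pull[OF x] ..
qed

lemma continuous_divop:
  assumes eta: "C1_form01 \<eta>" and c: "c \<in> A"
  shows "continuous_on (im c) (divop g c (\<eta> c))"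
proof -
  interpret C: hermitian_chart g c "im c" by (rule hermitian_chart[OF c])
  have C: "Ck_on (Suc 0) (\<lambda>x. \<eta> c x j) (im c)" for j using eta c by (simp add: C1_form01_def)
  have 1: "continuous_on (im c) (\<lambda>x. \<eta> c x j)" for j using Ck_on_Suc_imp[OF C.U C] by simp
  have 2: "continuous_on (im c) (cderiv Z (\<lambda>y. \<eta> c y j))" for Z j
    unfolding cderiv_def using Ck_on_SucD(2)[OF C.U C] by (intro continuous_intros) simp_all
  show ?thesis
    unfolding divop_def[abs_def] tr2_def
    by (intro continuous_intros 1 2 smooth_on_continuous[OF C.smooth_hinv] smooth_on_continuous[OF C.smooth_psi])
qed

lemma continuous_glue_divop: "C1_form01 \<eta> \<Longrightarrow> continuous_on UNIV (glue A (\<lambda>c. divop g c (\<eta> c)))"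
  by (intro continuous_glue divop_change continuous_divop)

lemma divop_sum:
  assumes "finite I" "\<And>i j. i \<in> I \<Longrightarrow> (\<lambda>y. F i y j) differentiable at x"
  shows "divop g c (\<lambda>y j. \<Sum>i\<in>I. F i y j) x = (\<Sum>i\<in>I. divop g c (F i) x)"
proof -
  have "tr2 h (\<lambda>k j. \<Sum>i\<in>I. G i k j) = (\<Sum>i\<in>I. tr2 h (G i))" for h :: "'n \<Rightarrow> 'n \<Rightarrow> complex" and G
  proof (induction I rule: infinite_finite_induct)
    case (insert a I) then show ?case by (simp add: tr2_add)
  qed (simp_all add: tr2_def)
  note t = this
  show ?thesis
    by (simp add: divop_def cderiv_sum assms sum_distrib_left t sum_subtractf sum_negf)
qed

end

context compact_hermitian_manifold
begin

text \<open>In coordinates the integrand is a sum of derivatives of functions with compact support.\<close>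

lemma integral_divop_chart:
  assumes eta: "C1_form01 \<eta>" and c: "c \<in> A" and K: "compact K" "K \<subseteq> fst c"
    and z: "\<And>c x j. c \<in> A \<Longrightarrow> x \<in> im c \<Longrightarrow> cinv c x \<notin> K \<Longrightarrow> \<eta> c x j = 0"
  shows "integral\<^sup>L (volume A g) (glue A (\<lambda>c. divop g c (\<eta> c))) = 0"
proof -
  interpret C: hermitian_chart g c "im c" by (rule hermitian_chart[OF c])
  let ?f = "glue A (\<lambda>c. divop g c (\<eta> c))"
  have zero: "?f m = 0" if m: "m \<notin> K" for m
  proof -
    define c' where "c' = chart_at A m"
    have c': "c' \<in> A" "m \<in> fst c'" unfolding c'_def by (rule chart_at)+
    let ?W = "im c' \<inter> cinv c' -` (- K)"
    have "open (- K)" using K compact_imp_closed by auto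
    from continuous_on_open_vimage[OF im_open[OF c'(1)], THEN iffD1, rule_format, OF cont_cinv[OF c'(1)] this]
    have W: "open ?W" by (subst Int_commute)
    have x: "snd c' m \<in> ?W" using snd_in[OF c'(2)] cinv_snd[OF c'] m by simp
    have e: "\<eta> c' y j = 0" if "y \<in> ?W" for y j using z[OF c'(1)] that by simp
    have "cderiv (dz k) (\<lambda>y. \<eta> c' y j) (snd c' m) = 0" for k j
    proof -
      have "cderiv (dz k) (\<lambda>y. \<eta> c' y j) (snd c' m) = cderiv (dz k) (\<lambda>y. 0) (snd c' m)"
        by (rule cderiv_cong_open[OF W x e])
      then show ?thesis by (simp add: cderiv_const)
    qed
    then show ?thesis using e[OF x] by (simp add: glue_def c'_def[symmetric] divop_def tr2_def)
  qed
  define F where "F k y = (\<Sum>j\<in>UNIV. hinv g c y k j * complex_of_real (vdens g c y) * \<eta> c y j)" for k y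
  have F: "Ck_on 1 (F k) (im c)" for k
  proof -
    have "Ck_on 1 (\<lambda>y. \<eta> c y j) (im c)" for j using eta c by (simp add: C1_form01_def)
    moreover have "Ck_on 1 (\<lambda>y. hinv g c y k j) (im c)" for j using C.smooth_hinv unfolding smooth_on_def by blast
    moreover have "Ck_on 1 (\<lambda>y. complex_of_real (vdens g c y)) (im c)" using smooth_vdens[OF c] unfolding smooth_on_def by blast
    ultimately show ?thesis unfolding F_def by (intro Ck_on_sum Ck_on_mult C.U)
  qed
  have K': "compact (snd c ` K)" "snd c ` K \<subseteq> im c"
    using K by (auto simp: im_def intro!: compact_continuous_image continuous_on_subset[OF cont_snd[OF c]])
  have F0: "F k x = 0" if "x \<in> im c" "x \<notin> snd c ` K" for k x
  proof -
    have "cinv c x \<notin> K"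
    proof
      assume "cinv c x \<in> K"
      then have "snd c (cinv c x) \<in> snd c ` K" by (rule imageI)
      then show False using that snd_cinv[OF c] by simp
    qed
    then show ?thesis using z[OF c that(1)] by (simp add: F_def)
  qed
  have I: "integrable lborel (\<lambda>x. indicator (im c) x *\<^sub>R cderiv (dz k) (F k) x)"
    "(\<integral>x. indicator (im c) x *\<^sub>R cderiv (dz k) (F k) x \<partial>lborel) = 0" for k
    by (rule integral_cderiv_compact_support[OF C.U F K'], rule F0, assumption+)+
  have "integral\<^sup>L (volume A g) ?f = (\<integral>x. (indicator (im c) x * vdens g c x) *\<^sub>R ?f (cinv c x) \<partial>lborel)"
    by (rule integral_volume_chart[OF c borel_measurable_continuous_onI[OF continuous_glue_divop[OF eta]]])
       (use zero K(2) in blast)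
  also have "\<dots> = (\<integral>x. - \<i> * (\<Sum>k\<in>UNIV. indicator (im c) x *\<^sub>R cderiv (dz k) (F k) x) \<partial>lborel)"
  proof (rule Bochner_Integration.integral_cong[OF refl])
    fix x
    show "(indicator (im c) x * vdens g c x) *\<^sub>R ?f (cinv c x) = - \<i> * (\<Sum>k\<in>UNIV. indicator (im c) x *\<^sub>R cderiv (dz k) (F k) x)"
    proof (cases "x \<in> im c")
      case True
      have "?f (cinv c x) = divop g c (\<eta> c) x" by (rule glue_cinv[OF divop_change[OF eta] c True])
      then show ?thesis
        using divop_divergence[OF c True C1_form01_diff[OF eta c True]] True
        by (simp add: scaleR_conv_of_real F_def[abs_def])
    qed simp
  qed
  also have "\<dots> = - \<i> * (\<Sum>k\<in>UNIV. \<integral>x. indicator (im c) x *\<^sub>R cderiv (dz k) (F k) x \<partial>lborel)"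
  proof -
    have "integrable lborel (\<lambda>x. indicator (im c) x *\<^sub>R cderiv (dz k) (F k) x)" for k by (rule I(1))
    then have "(\<integral>x. (\<Sum>k\<in>UNIV. indicator (im c) x *\<^sub>R cderiv (dz k) (F k) x) \<partial>lborel) =
        (\<Sum>k\<in>UNIV. \<integral>x. indicator (im c) x *\<^sub>R cderiv (dz k) (F k) x \<partial>lborel)"
      by (rule Bochner_Integration.integral_sum)
    then show ?thesis by (simp only: integral_mult_right_zero)
  qed
  also have "\<dots> = 0" by (simp only: I(2)) simp
  finally show ?thesis .
qed

text \<open>A partition of unity reduces the global divergence theorem to the local one.\<close>

lemma integral_divop:
  assumes eta: "C1_form01 \<eta>"
  shows "integral\<^sup>L (volume A g) (glue A (\<lambda>c. divop g c (\<eta> c))) = 0"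
proof -
  obtain I :: "'m set" and \<rho> :: "'m \<Rightarrow> 'm \<Rightarrow> complex" where I: "finite I" "\<And>p. (\<Sum>i\<in>I. \<rho> i p) = 1"
    "\<And>i c. i \<in> I \<Longrightarrow> c \<in> A \<Longrightarrow> Ck_on 1 (\<lambda>x. \<rho> i (cinv c x)) (im c)"
    "\<And>i. i \<in> I \<Longrightarrow> \<exists>c\<in>A. \<exists>K. compact K \<and> K \<subseteq> fst c \<and> (\<forall>p. p \<notin> K \<longrightarrow> \<rho> i p = 0)"
    using ex_partition_of_unity by metis
  define \<mu> where "\<mu> i c x j = \<rho> i (cinv c x) * \<eta> c x j" for i c x j
  have C1: "C1_form01 (\<mu> i)" if i: "i \<in> I" for i
    unfolding C1_form01_def
  proof (intro conjI ballI allI)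
    fix c j assume c: "c \<in> A"
    then have "Ck_on 1 (\<lambda>x. \<eta> c x j) (im c)" using eta by (simp add: C1_form01_def)
    then show "Ck_on 1 (\<lambda>x. \<mu> i c x j) (im c)" unfolding \<mu>_def by (intro Ck_on_mult im_open[OF c] I(3)[OF i c])
  next
    fix c c' x j assume c: "c \<in> A" "c' \<in> A" and x: "x \<in> overlap c c'"
    have "\<eta> c x j = (\<Sum>b\<in>UNIV. cnj (jac (transition c c') x j b) * \<eta> c' (transition c c' x) b)"
      using eta c x unfolding C1_form01_def by blast
    then show "\<mu> i c x j = (\<Sum>b\<in>UNIV. cnj (jac (transition c c') x j b) * \<mu> i c' (transition c c' x) b)"
      by (simp add: \<mu>_def cinv_transition[OF c x] sum_distrib_left mult_ac)
  qed
  have zero: "integral\<^sup>L (volume A g) (glue A (\<lambda>c. divop g c (\<mu> i c))) = 0" if i: "i \<in> I" for i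
  proof -
    obtain c K where K: "c \<in> A" "compact K" "K \<subseteq> fst c" "\<And>p. p \<notin> K \<Longrightarrow> \<rho> i p = 0" using I(4)[OF i] by blast
    show ?thesis by (rule integral_divop_chart[OF C1[OF i] K(1-3)]) (simp add: \<mu>_def K(4))
  qed
  have s: "\<eta> c = (\<lambda>y j. \<Sum>i\<in>I. \<mu> i c y j)" for c
    unfolding \<mu>_def sum_distrib_right[symmetric] I(2) by simp
  have g: "glue A (\<lambda>c. divop g c (\<eta> c)) = (\<lambda>m. \<Sum>i\<in>I. glue A (\<lambda>c. divop g c (\<mu> i c)) m)"
    unfolding glue_def s
    by (rule ext, rule divop_sum[OF I(1)]) (rule C1_form01_diff[OF C1 chart_at(1) snd_in[OF chart_at(2)]])
  have "integral\<^sup>L (volume A g) (glue A (\<lambda>c. divop g c (\<eta> c))) =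
      (\<integral>m. (\<Sum>i\<in>I. glue A (\<lambda>c. divop g c (\<mu> i c)) m) \<partial>volume A g)"
    by (simp only: g)
  also have "\<dots> = (\<Sum>i\<in>I. integral\<^sup>L (volume A g) (glue A (\<lambda>c. divop g c (\<mu> i c))))"
    by (rule Bochner_Integration.integral_sum) (rule integrable_volume[OF continuous_glue_divop[OF C1]])
  also have "\<dots> = 0" by (simp add: zero)
  finally show ?thesis .
qed

end

section \<open>Forms of low degree\<close>

lemma sum_lists_0: "(\<Sum>I | length I = 0. f I) = f []"
  by simp

lemma sum_lists_Suc:
  fixes f :: "'n::finite list \<Rightarrow> complex"
  shows "(\<Sum>I | length I = Suc n. f I) = (\<Sum>i\<in>UNIV. \<Sum>I | length I = n. f (i # I))"
proof -
  have e: "{I :: 'n list. length I = Suc n} = (\<lambda>(i, I). i # I) ` (UNIV \<times> {I. length I = n})"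
  proof (intro equalityI subsetI)
    fix I :: "'n list" assume "I \<in> {I. length I = Suc n}"
    then obtain i I' where "I = i # I'" "length I' = n" by (auto simp: length_Suc_conv)
    then show "I \<in> (\<lambda>(i, I). i # I) ` (UNIV \<times> {I. length I = n})" by force
  qed auto
  have "(\<Sum>I | length I = Suc n. f I) = (\<Sum>(i, I)\<in>UNIV \<times> {I. length I = n}. f (i # I))"
    unfolding e by (subst sum.reindex) (auto simp: inj_on_def intro!: sum.cong)
  then show ?thesis by (simp add: sum.cartesian_product)
qed

lemma sum_lists_1:
  fixes f :: "'n::finite list \<Rightarrow> complex"
  shows "(\<Sum>I | length I = Suc 0. f I) = (\<Sum>i\<in>UNIV. f [i])"
  by (subst sum_lists_Suc) (simp del: length_0_conv add: sum_lists_0)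

lemma sum_lists_2:
  fixes f :: "'n::finite list \<Rightarrow> complex"
  shows "(\<Sum>I | length I = 2. f I) = (\<Sum>i\<in>UNIV. \<Sum>j\<in>UNIV. f [i, j])"
  unfolding numeral_2_eq_2 by (subst sum_lists_Suc) (simp add: sum_lists_1)

lemma pt_inner01: "pt_inner g 0 1 \<phi> \<psi> c x = tr2 (hinv g c x) (\<lambda>k j. \<phi> c x [] [j] * cnj (\<psi> c x [] [k]))"
proof -
  have "pt_inner g 0 1 \<phi> \<psi> c x = (\<Sum>j\<in>UNIV. \<Sum>k\<in>UNIV. hinv g c x k j * (\<phi> c x [] [j] * cnj (\<psi> c x [] [k])))"
    by (simp add: pt_inner_def sum_lists_1 mult.assoc)
  then show ?thesis unfolding tr2_def by (subst sum.swap)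
qed

lemma pt_inner10: "pt_inner g 1 0 \<phi> \<psi> c x = tr2 (hinv g c x) (\<lambda>i l. \<phi> c x [i] [] * cnj (\<psi> c x [l] []))"
  by (simp add: pt_inner_def sum_lists_1 tr2_def mult.assoc)

lemma pt_inner11: "pt_inner g 1 1 \<phi> \<psi> c x =
  tr2 (hinv g c x) (\<lambda>i l. tr2 (hinv g c x) (\<lambda>k j. \<phi> c x [i] [j] * cnj (\<psi> c x [l] [k])))"
proof -
  have "pt_inner g 1 1 \<phi> \<psi> c x = (\<Sum>i\<in>UNIV. \<Sum>l\<in>UNIV. \<Sum>j\<in>UNIV. \<Sum>k\<in>UNIV.
      hinv g c x i l * (hinv g c x k j * (\<phi> c x [i] [j] * cnj (\<psi> c x [l] [k]))))"
    by (simp add: pt_inner_def sum_lists_1 mult.assoc)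
  also have "\<dots> = (\<Sum>i\<in>UNIV. \<Sum>l\<in>UNIV. \<Sum>k\<in>UNIV. \<Sum>j\<in>UNIV.
      hinv g c x i l * (hinv g c x k j * (\<phi> c x [i] [j] * cnj (\<psi> c x [l] [k]))))"
    by (rule sum.cong[OF refl], rule sum.cong[OF refl], rule sum.swap)
  finally show ?thesis by (simp add: tr2_def sum_distrib_left)
qed

text \<open>Rearrange the sums so that each inverse metric stands next to the indices that it contracts.\<close>

lemma pt_inner22:
  fixes c :: "('m, 'n::finite) chart"
  shows "pt_inner g 2 2 \<phi> \<psi> c x =
  1 / 4 * tr2 (hinv g c x) (\<lambda>i l. tr2 (hinv g c x) (\<lambda>i' l'. tr2 (hinv g c x) (\<lambda>k j. tr2 (hinv g c x) (\<lambda>k' j'.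
    \<phi> c x [i, i'] [j, j'] * cnj (\<psi> c x [l, l'] [k, k'])))))"
proof -
  let ?h = "hinv g c x"
  let ?G = "\<lambda>i i' l l' j j' k k'. ?h i l * (?h i' l' * (?h k j * (?h k' j' * (\<phi> c x [i, i'] [j, j'] * cnj (\<psi> c x [l, l'] [k, k'])))))"
  have l: "{..<2} = {0, 1::nat}" by auto
  have "pt_inner g 2 2 \<phi> \<psi> c x = 1 / 4 * (\<Sum>i\<in>UNIV. \<Sum>i'\<in>UNIV. \<Sum>l\<in>UNIV. \<Sum>l'\<in>UNIV. \<Sum>j\<in>UNIV. \<Sum>j'\<in>UNIV. \<Sum>k\<in>UNIV. \<Sum>k'\<in>UNIV. ?G i i' l l' j j' k k')"
    by (simp add: pt_inner_def sum_lists_2 l mult.assoc)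
  also have "(\<Sum>i\<in>UNIV. \<Sum>i'\<in>UNIV. \<Sum>l\<in>UNIV. \<Sum>l'\<in>UNIV. \<Sum>j\<in>UNIV. \<Sum>j'\<in>UNIV. \<Sum>k\<in>UNIV. \<Sum>k'\<in>UNIV. ?G i i' l l' j j' k k') =
     (\<Sum>i\<in>UNIV. \<Sum>l\<in>UNIV. \<Sum>i'\<in>UNIV. \<Sum>l'\<in>UNIV. \<Sum>k\<in>UNIV. \<Sum>j\<in>UNIV. \<Sum>k'\<in>UNIV. \<Sum>j'\<in>UNIV. ?G i i' l l' j j' k k')"
  proof (rule sum.cong[OF refl])
    fix i
    have r: "(\<Sum>j\<in>UNIV. \<Sum>j'\<in>UNIV. \<Sum>k\<in>UNIV. \<Sum>k'\<in>UNIV. F j j' k k') = (\<Sum>k\<in>UNIV. \<Sum>j\<in>UNIV. \<Sum>k'\<in>UNIV. \<Sum>j'\<in>UNIV. F j j' k k')"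
      for F :: "'n \<Rightarrow> 'n \<Rightarrow> 'n \<Rightarrow> 'n \<Rightarrow> complex"
    proof -
      have "(\<Sum>j\<in>UNIV. \<Sum>j'\<in>UNIV. \<Sum>k\<in>UNIV. \<Sum>k'\<in>UNIV. F j j' k k') = (\<Sum>j\<in>UNIV. \<Sum>k\<in>UNIV. \<Sum>j'\<in>UNIV. \<Sum>k'\<in>UNIV. F j j' k k')"
        by (rule sum.cong[OF refl], rule sum.swap)
      also have "\<dots> = (\<Sum>k\<in>UNIV. \<Sum>j\<in>UNIV. \<Sum>j'\<in>UNIV. \<Sum>k'\<in>UNIV. F j j' k k')" by (rule sum.swap)
      also have "\<dots> = (\<Sum>k\<in>UNIV. \<Sum>j\<in>UNIV. \<Sum>k'\<in>UNIV. \<Sum>j'\<in>UNIV. F j j' k k')"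
        by (rule sum.cong[OF refl], rule sum.cong[OF refl], rule sum.swap)
      finally show ?thesis .
    qed
    show "(\<Sum>i'\<in>UNIV. \<Sum>l\<in>UNIV. \<Sum>l'\<in>UNIV. \<Sum>j\<in>UNIV. \<Sum>j'\<in>UNIV. \<Sum>k\<in>UNIV. \<Sum>k'\<in>UNIV. ?G i i' l l' j j' k k') =
       (\<Sum>l\<in>UNIV. \<Sum>i'\<in>UNIV. \<Sum>l'\<in>UNIV. \<Sum>k\<in>UNIV. \<Sum>j\<in>UNIV. \<Sum>k'\<in>UNIV. \<Sum>j'\<in>UNIV. ?G i i' l l' j j' k k')"
      by (subst sum.swap) (rule sum.cong[OF refl], rule sum.cong[OF refl], rule sum.cong[OF refl], rule r)
  qed
  finally show ?thesis by (simp add: tr2_def sum_distrib_left)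
qed

subsection \<open>Conjugation\<close>

lemma conj_form_conj_form [simp]:
  fixes \<phi> :: "('m, 'n) form"
  shows "conj_form (conj_form \<phi>) = \<phi>"
proof (intro ext)
  fix c x and I J :: "'n list"
  have "(-1) ^ (length I * length J) * ((-1) ^ (length J * length I) :: complex) = 1"
    by (simp add: mult.commute[of "length J"] flip: power_add mult_2)
  then show "conj_form (conj_form \<phi>) c x I J = \<phi> c x I J"
    by (simp add: conj_form_def mult.assoc[symmetric])
qed

lemma formsD:
  assumes "\<phi> \<in> forms A p q"
  shows "\<forall>c x I J. \<not> (c \<in> A \<and> x \<in> im c \<and> length I = p \<and> length J = q) \<longrightarrow> \<phi> c x I J = 0"
    "\<forall>c x I J a b. a < b \<and> b < length I \<longrightarrow> \<phi> c x (I[a := I!b, b := I!a]) J = - \<phi> c x I J"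
    "\<forall>c x I J a b. a < b \<and> b < length J \<longrightarrow> \<phi> c x I (J[a := J!b, b := J!a]) = - \<phi> c x I J"
    "\<forall>c\<in>A. \<forall>I J. smooth_on (\<lambda>x. \<phi> c x I J) (im c)"
    "\<forall>c\<in>A. \<forall>c'\<in>A. \<forall>x\<in>overlap c c'. \<forall>I J. \<phi> c x I J =
        (\<Sum>K | length K = length I. \<Sum>L | length L = length J.
           (\<Prod>a<length I. cderiv (dz (I!a)) (\<lambda>y. transition c c' y $ (K!a)) x) *
           (\<Prod>b<length J. cnj (cderiv (dz (J!b)) (\<lambda>y. transition c c' y $ (L!b)) x)) *
           \<phi> c' (transition c c' x) K L)"
  by (insert assms[unfolded forms_def mem_Collect_eq], elim conjE, assumption)+

lemma conj_form_in_forms: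
  fixes A :: "('m::t2_space, 'n::finite) chart set"
  assumes f: "\<phi> \<in> forms A p q" and o: "\<And>c. c \<in> A \<Longrightarrow> open (im c)"
  shows "conj_form \<phi> \<in> forms A q p"
proof -
  note F = formsD[OF f, rule_format]
  show ?thesis unfolding forms_def
  proof (intro CollectI conjI allI ballI impI)
    fix c x and I J :: "'n list" assume "\<not> (c \<in> A \<and> x \<in> im c \<and> length I = q \<and> length J = p)"
    then have "\<phi> c x J I = 0" by (intro F(1)) blast
    then show "conj_form \<phi> c x I J = 0" by (simp add: conj_form_def)
  next
    fix c x and I J :: "'n list" and a b assume "a < b \<and> b < length (I :: 'n list)"
    then show "conj_form \<phi> c x (I[a := I!b, b := I!a]) J = - conj_form \<phi> c x I J"
      using F(3)[of a b I c x J] by (simp add: conj_form_def)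
  next
    fix c x and I J :: "'n list" and a b assume "a < b \<and> b < length (J :: 'n list)"
    then show "conj_form \<phi> c x I (J[a := J!b, b := J!a]) = - conj_form \<phi> c x I J"
      using F(2)[of a b J c x I] by (simp add: conj_form_def)
  next
    fix c and I J :: "'n list" assume c: "c \<in> A"
    show "smooth_on (\<lambda>x. conj_form \<phi> c x I J) (im c)"
      unfolding conj_form_def by (intro smooth_on_mult smooth_on_const smooth_on_cnj F(4) o c)
  next
    fix c c' x and I J :: "'n list" assume c: "c \<in> A" "c' \<in> A" and x: "x \<in> overlap c c'"
    let ?s = "(-1) ^ (length I * length J) :: complex"
    let ?P = "\<lambda>I K. \<Prod>a<length I. cderiv (dz (I!a)) (\<lambda>y. transition c c' y $ (K!a)) x"
    have "conj_form \<phi> c x I J = ?s * (\<Sum>K | length K = length J. \<Sum>L | length L = length I.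
       cnj (?P J K) * ?P I L * cnj (\<phi> c' (transition c c' x) K L))"
      unfolding conj_form_def F(5)[OF c x, of J I] by simp
    also have "\<dots> = ?s * (\<Sum>L | length L = length I. \<Sum>K | length K = length J.
       cnj (?P J K) * ?P I L * cnj (\<phi> c' (transition c c' x) K L))"
      by (subst sum.swap) (rule refl)
    also have "\<dots> = (\<Sum>L | length L = length I. \<Sum>K | length K = length J.
       ?P I L * (\<Prod>b<length J. cnj (cderiv (dz (J!b)) (\<lambda>y. transition c c' y $ (K!b)) x)) * conj_form \<phi> c' (transition c c' x) L K)"
      unfolding sum_distrib_left by (intro sum.cong refl) (simp add: conj_form_def mult_ac)
    finally show "conj_form \<phi> c x I J = \<dots>" .
  qed
qed

section \<open>Forms on a Hermitian manifold\<close>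

definition form01 :: "('m, 'n) chart set \<Rightarrow> (('m, 'n) chart \<Rightarrow> complex^'n \<Rightarrow> 'n \<Rightarrow> complex) \<Rightarrow> ('m, 'n) form" where
  "form01 A a = (\<lambda>c x I J. if c \<in> A \<and> x \<in> im c \<and> length I = 0 \<and> length J = 1 then a c x (hd J) else 0)"

lemma length_1_cases: "length I = Suc 0 \<longleftrightarrow> (\<exists>i. I = [i])"
  by (auto simp: length_Suc_conv)

context hermitian_manifold
begin

lemma form01_in_forms:
  assumes s: "\<And>c j. c \<in> A \<Longrightarrow> smooth_on (\<lambda>x. a c x j) (im c)"
    and t: "\<And>c c' x j. c \<in> A \<Longrightarrow> c' \<in> A \<Longrightarrow> x \<in> overlap c c' \<Longrightarrow>
      a c x j = (\<Sum>e\<in>UNIV. cnj (jac (transition c c') x j e) * a c' (transition c c' x) e)"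
  shows "form01 A a \<in> forms A 0 1"
  unfolding forms_def
proof (intro CollectI conjI allI ballI impI)
  fix c and I J :: "'n list" assume c: "c \<in> A"
  show "smooth_on (\<lambda>x. form01 A a c x I J) (im c)"
  proof (cases "I = [] \<and> length J = 1")
    case True
    show ?thesis by (rule smooth_on_cong[OF im_open[OF c] s[OF c, of "hd J"]]) (use True c in \<open>simp add: form01_def\<close>)
  next
    case False
    show ?thesis by (rule smooth_on_cong[OF im_open[OF c] smooth_on_const[OF im_open[OF c], of 0]]) (use False in \<open>auto simp: form01_def\<close>)
  qed
next
  fix c c' x and I J :: "'n list" assume c: "c \<in> A" "c' \<in> A" and x: "x \<in> overlap c c'"
  have y: "x \<in> im c" "transition c c' x \<in> im c'"
    using x overlap_sub transition_in(1)[OF c x] by blast+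
  show "form01 A a c x I J = (\<Sum>K | length K = length I. \<Sum>L | length L = length J.
           (\<Prod>a<length I. cderiv (dz (I!a)) (\<lambda>y. transition c c' y $ (K!a)) x) *
           (\<Prod>b<length J. cnj (cderiv (dz (J!b)) (\<lambda>y. transition c c' y $ (L!b)) x)) *
           form01 A a c' (transition c c' x) K L)" (is "_ = ?r")
  proof (cases "I = [] \<and> length J = 1")
    case True
    then obtain j where J: "I = []" "J = [j]" by (auto simp: length_1_cases)
    show ?thesis using c y t[OF c x, of j] by (simp add: J sum_lists_1 form01_def jac_def)
  next
    case False
    then have z: "form01 A a c' y K L = 0" if "length K = length I" "length L = length J" for y K L
      using that by (auto simp: form01_def)
    have "?r = 0" by (intro sum.neutral ballI) (simp add: z)
    then show ?thesis using False by (auto simp: form01_def)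
  qed
qed (auto simp: form01_def)

lemma form11_in_forms:
  assumes s: "\<And>c i j. c \<in> A \<Longrightarrow> smooth_on (\<lambda>x. a c x i j) (im c)"
    and t: "\<And>c c' x i j. c \<in> A \<Longrightarrow> c' \<in> A \<Longrightarrow> x \<in> overlap c c' \<Longrightarrow>
      a c x i j = tr2 (\<lambda>d e. jac (transition c c') x i d * cnj (jac (transition c c') x j e)) (a c' (transition c c' x))"
  shows "form11 A a \<in> forms A 1 1"
  unfolding forms_def
proof (intro CollectI conjI allI ballI impI)
  fix c and I J :: "'n list" assume c: "c \<in> A"
  show "smooth_on (\<lambda>x. form11 A a c x I J) (im c)"
  proof (cases "length I = 1 \<and> length J = 1")
    case True
    show ?thesis by (rule smooth_on_cong[OF im_open[OF c] s[OF c, of "hd I" "hd J"]]) (use True c in \<open>simp add: form11_def\<close>)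
  next
    case False
    show ?thesis by (rule smooth_on_cong[OF im_open[OF c] smooth_on_const[OF im_open[OF c], of 0]]) (use False in \<open>auto simp: form11_def\<close>)
  qed
next
  fix c c' x and I J :: "'n list" assume c: "c \<in> A" "c' \<in> A" and x: "x \<in> overlap c c'"
  have y: "x \<in> im c" "transition c c' x \<in> im c'"
    using x overlap_sub transition_in(1)[OF c x] by blast+
  show "form11 A a c x I J = (\<Sum>K | length K = length I. \<Sum>L | length L = length J.
           (\<Prod>a<length I. cderiv (dz (I!a)) (\<lambda>y. transition c c' y $ (K!a)) x) *
           (\<Prod>b<length J. cnj (cderiv (dz (J!b)) (\<lambda>y. transition c c' y $ (L!b)) x)) *
           form11 A a c' (transition c c' x) K L)" (is "_ = ?r")
  proof (cases "length I = 1 \<and> length J = 1")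
    case True
    then obtain i j where J: "I = [i]" "J = [j]" by (auto simp: length_1_cases)
    show ?thesis using c y t[OF c x, of i j] by (simp add: J sum_lists_1 form11_def jac_def tr2_def)
  next
    case False
    then have z: "form11 A a c' y K L = 0" if "length K = length I" "length L = length J" for y K L
      using that by (auto simp: form11_def)
    have "?r = 0" by (intro sum.neutral ballI) (simp add: z)
    then show ?thesis using False by (auto simp: form11_def)
  qed
qed (auto simp: form11_def)

lemma forms01_change:
  assumes "\<phi> \<in> forms A 0 1" "c \<in> A" "c' \<in> A" "x \<in> overlap c c'"
  shows "\<phi> c x [] [j] = (\<Sum>e\<in>UNIV. cnj (jac (transition c c') x j e) * \<phi> c' (transition c c' x) [] [e])"
proof -
  have "\<phi> c x [] [j] = (\<Sum>K | length K = length ([]::'n list). \<Sum>L | length L = length [j].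
           (\<Prod>a<length ([]::'n list). cderiv (dz ([]!a)) (\<lambda>y. transition c c' y $ (K!a)) x) *
           (\<Prod>b<length [j]. cnj (cderiv (dz ([j]!b)) (\<lambda>y. transition c c' y $ (L!b)) x)) *
           \<phi> c' (transition c c' x) K L)"
    using assms unfolding forms_def by blast
  then show ?thesis by (simp add: sum_lists_1 jac_def)
qed

lemma forms11_change:
  assumes "\<phi> \<in> forms A 1 1" "c \<in> A" "c' \<in> A" "x \<in> overlap c c'"
  shows "\<phi> c x [i] [j] = tr2 (\<lambda>d e. jac (transition c c') x i d * cnj (jac (transition c c') x j e))
    (\<lambda>d e. \<phi> c' (transition c c' x) [d] [e])"
proof -
  have "\<phi> c x [i] [j] = (\<Sum>K | length K = length [i]. \<Sum>L | length L = length [j].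
           (\<Prod>a<length [i]. cderiv (dz ([i]!a)) (\<lambda>y. transition c c' y $ (K!a)) x) *
           (\<Prod>b<length [j]. cnj (cderiv (dz ([j]!b)) (\<lambda>y. transition c c' y $ (L!b)) x)) *
           \<phi> c' (transition c c' x) K L)"
    using assms unfolding forms_def by blast
  then show ?thesis by (simp add: sum_lists_1 jac_def tr2_def)
qed

lemma forms_smooth: "\<phi> \<in> forms A p q \<Longrightarrow> c \<in> A \<Longrightarrow> smooth_on (\<lambda>x. \<phi> c x I J) (im c)"
  by (rule formsD(4)[rule_format])

lemma forms_zero: "\<phi> \<in> forms A p q \<Longrightarrow> \<not> (c \<in> A \<and> x \<in> im c \<and> length I = p \<and> length J = q) \<Longrightarrow> \<phi> c x I J = 0"
  by (rule formsD(1)[rule_format])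

lemma forms_diff:
  assumes "\<phi> \<in> forms A p q" "\<psi> \<in> forms A p q"
  shows "\<phi> - \<psi> \<in> forms A p q"
proof -
  note F = formsD[OF assms(1), rule_format] and G = formsD[OF assms(2), rule_format]
  show ?thesis unfolding forms_def fun_diff_def
  proof (intro CollectI conjI allI ballI impI)
    fix c x and I J :: "'n list" assume "\<not> (c \<in> A \<and> x \<in> im c \<and> length I = p \<and> length J = q)"
    then show "\<phi> c x I J - \<psi> c x I J = 0" using F(1) G(1) by simp
  next
    fix c and I J :: "'n list" assume c: "c \<in> A"
    show "smooth_on (\<lambda>x. \<phi> c x I J - \<psi> c x I J) (im c)" by (intro smooth_on_diff im_open F(4) G(4) c)
  next
    fix c c' x and I J :: "'n list" assume "c \<in> A" "c' \<in> A" "x \<in> overlap c c'"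
    note F(5)[OF this, of I J] G(5)[OF this, of I J]
    then show "\<phi> c x I J - \<psi> c x I J = (\<Sum>K | length K = length I. \<Sum>L | length L = length J.
           (\<Prod>a<length I. cderiv (dz (I!a)) (\<lambda>y. transition c c' y $ (K!a)) x) *
           (\<Prod>b<length J. cnj (cderiv (dz (J!b)) (\<lambda>y. transition c c' y $ (L!b)) x)) *
           (\<phi> c' (transition c c' x) K L - \<psi> c' (transition c c' x) K L))"
      by (simp only: right_diff_distrib sum_subtractf)
  qed (simp_all add: F(2,3) G(2,3))
qed

lemma pt_inner01_change:
  assumes f: "\<phi> \<in> forms A 0 1" "\<psi> \<in> forms A 0 1" and c: "c \<in> A" "c' \<in> A" and x: "x \<in> overlap c c'"
  shows "pt_inner g 0 1 \<phi> \<psi> c x = pt_inner g 0 1 \<phi> \<psi> c' (transition c c' x)"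
proof -
  interpret chart_change g c c' "overlap c c'" "im c'" "transition c c'" by (rule chart_change[OF c])
  have "\<phi> c x [] [j] * cnj (\<psi> c x [] [k]) =
    tr2 (pull x k j) (\<lambda>d e. \<phi> c' (transition c c' x) [] [e] * cnj (\<psi> c' (transition c c' x) [] [d]))" for k j
    unfolding forms01_change[OF f(1) c x] forms01_change[OF f(2) c x] tr2_def pull_def
    by (simp add: sum_product mult_ac; rule sum.swap)
  then show ?thesis unfolding pt_inner01 by (simp only: tr2_pull[OF x])
qed

text \<open>A product of two (1,1)-tensors is a tensor in the pair of its unconjugated and in the pair of
  its conjugated indices, so both traces are invariant.\<close>

lemma pt_inner11_change:
  assumes f: "\<phi> \<in> forms A 1 1" "\<psi> \<in> forms A 1 1" and c: "c \<in> A" "c' \<in> A" and x: "x \<in> overlap c c'"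
  shows "pt_inner g 1 1 \<phi> \<psi> c x = pt_inner g 1 1 \<phi> \<psi> c' (transition c c' x)"
proof -
  interpret chart_change g c c' "overlap c c'" "im c'" "transition c c'" by (rule chart_change[OF c])
  let ?x = "transition c c' x"
  have p: "tr2 (pull x i j) (\<lambda>a b. F a b) * cnj (tr2 (pull x l k) (\<lambda>a b. G a b)) =
    tr2 (pull x i l) (\<lambda>a e. tr2 (pull x k j) (\<lambda>f b. F a b * cnj (G e f)))" for i j k l F G
  proof -
    let ?H = "\<lambda>a e f b. pull x i l a e * (pull x k j f b * (F a b * cnj (G e f)))"
    have "tr2 (pull x i j) (\<lambda>a b. F a b) * cnj (tr2 (pull x l k) (\<lambda>a b. G a b)) =
      (\<Sum>e\<in>UNIV. \<Sum>f\<in>UNIV. \<Sum>a\<in>UNIV. \<Sum>b\<in>UNIV. ?H a e f b)"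
      unfolding tr2_def pull_def cnj_sum sum_distrib_left sum_distrib_right by (intro sum.cong refl) (simp add: mult_ac)
    also have "\<dots> = (\<Sum>e\<in>UNIV. \<Sum>a\<in>UNIV. \<Sum>f\<in>UNIV. \<Sum>b\<in>UNIV. ?H a e f b)"
      by (rule sum.cong[OF refl], rule sum.swap)
    also have "\<dots> = (\<Sum>a\<in>UNIV. \<Sum>e\<in>UNIV. \<Sum>f\<in>UNIV. \<Sum>b\<in>UNIV. ?H a e f b)"
      by (rule sum.swap)
    finally show ?thesis by (simp add: tr2_def sum_distrib_left)
  qed
  have f': "\<phi> c x [i] [j] = tr2 (pull x i j) (\<lambda>d e. \<phi> c' ?x [d] [e])" "\<psi> c x [i] [j] = tr2 (pull x i j) (\<lambda>d e. \<psi> c' ?x [d] [e])" for i j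
    using forms11_change[OF f(1) c x, of i j] forms11_change[OF f(2) c x, of i j] by (simp_all add: pull_def)
  have "pt_inner g 1 1 \<phi> \<psi> c x = tr2 (hinv g c x) (\<lambda>i l. tr2 (hinv g c x) (\<lambda>k j. tr2 (pull x i l) (\<lambda>a e. tr2 (pull x k j)
     (\<lambda>f b. \<phi> c' ?x [a] [b] * cnj (\<psi> c' ?x [e] [f])))))"
    unfolding pt_inner11 f' p ..
  also have "\<dots> = tr2 (hinv g c x) (\<lambda>i l. tr2 (pull x i l) (\<lambda>a e. tr2 (hinv g c x) (\<lambda>k j. tr2 (pull x k j)
     (\<lambda>f b. \<phi> c' ?x [a] [b] * cnj (\<psi> c' ?x [e] [f])))))"
    by (subst (2) tr2_swap) (rule refl)
  finally show ?thesis by (simp only: pt_inner11 tr2_pull[OF x])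
qed

lemma continuous_inner01:
  assumes f: "\<phi> \<in> forms A 0 1" "\<psi> \<in> forms A 0 1"
  shows "continuous_on UNIV (glue A (pt_inner g 0 1 \<phi> \<psi>))"
proof (rule continuous_glue[OF pt_inner01_change[OF f]])
  fix c assume c: "c \<in> A"
  interpret C: hermitian_chart g c "im c" by (rule hermitian_chart[OF c])
  show "continuous_on (im c) (pt_inner g 0 1 \<phi> \<psi> c)"
    unfolding pt_inner01[abs_def] by (intro smooth_on_continuous C.smooth_tr2 smooth_on_mult smooth_on_cnj C.U forms_smooth[OF f(1) c] forms_smooth[OF f(2) c])
qed

lemma continuous_inner11:
  assumes f: "\<phi> \<in> forms A 1 1" "\<psi> \<in> forms A 1 1"
  shows "continuous_on UNIV (glue A (pt_inner g 1 1 \<phi> \<psi>))"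
proof (rule continuous_glue[OF pt_inner11_change[OF f]])
  fix c assume c: "c \<in> A"
  interpret C: hermitian_chart g c "im c" by (rule hermitian_chart[OF c])
  show "continuous_on (im c) (pt_inner g 1 1 \<phi> \<psi> c)"
    unfolding pt_inner11[abs_def] by (intro smooth_on_continuous C.smooth_tr2 smooth_on_mult smooth_on_cnj C.U forms_smooth[OF f(1) c] forms_smooth[OF f(2) c])
qed

end

section \<open>Positivity and uniqueness of adjoints\<close>

lemma tr2_sum: "tr2 h (\<lambda>k l. \<Sum>e\<in>E. f e k l) = (\<Sum>e\<in>E. tr2 h (f e))"
  by (induction E rule: infinite_finite_induct) (simp_all add: tr2_add, simp_all add: tr2_def)

text \<open>Sets of vectors that diagonalise the inverse metric.  The last condition says that the set
  spans.\<close>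

definition frame :: "('m, 'n) metric \<Rightarrow> ('m, 'n::finite) chart \<Rightarrow> complex^'n \<Rightarrow> (complex^'n) set \<Rightarrow> bool" where
  "frame g c x E \<longleftrightarrow> finite E \<and>
     (\<forall>u v. tr2 (hinv g c x) (\<lambda>i l. u i * v l) = (\<Sum>e\<in>E. (\<Sum>i\<in>UNIV. e $ i * u i) * (\<Sum>l\<in>UNIV. cnj (e $ l) * v l))) \<and>
     (\<forall>w. (\<forall>e\<in>E. (\<Sum>i\<in>UNIV. e $ i * w i) = 0) \<longrightarrow> (\<forall>k. w k = 0))"

lemma frameD:
  assumes "frame g c x E"
  shows "tr2 (hinv g c x) (\<lambda>i l. u i * v l) = (\<Sum>e\<in>E. (\<Sum>i\<in>UNIV. e $ i * u i) * (\<Sum>l\<in>UNIV. cnj (e $ l) * v l))"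
    "finite E" "(\<And>e. e \<in> E \<Longrightarrow> (\<Sum>i\<in>UNIV. e $ i * w i) = 0) \<Longrightarrow> w k = 0"
proof -
  note F = assms[unfolded frame_def, THEN conjunct2]
  show "tr2 (hinv g c x) (\<lambda>i l. u i * v l) = (\<Sum>e\<in>E. (\<Sum>i\<in>UNIV. e $ i * u i) * (\<Sum>l\<in>UNIV. cnj (e $ l) * v l))"
    by (rule F[THEN conjunct1, rule_format])
  show "finite E" by (rule assms[unfolded frame_def, THEN conjunct1])
  show "w k = 0" if "\<And>e. e \<in> E \<Longrightarrow> (\<Sum>i\<in>UNIV. e $ i * w i) = 0"
    by (rule F[THEN conjunct2, rule_format]) (rule that)
qed

lemma ex_frame:
  fixes c :: "('m, 'n::finite) chart"
  assumes hf: "hermitian_at g c x"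
  shows "\<exists>E. frame g c x E"
proof -
  obtain E where E: "orthonormal_basis g c x E" using ex_orthonormal_basis[OF hf] by blast
  note h = hinv_orthonormal[OF hf E]
  have c: "card E = 2 * CARD('n)" using E by (simp add: orthonormal_basis_def)
  have f: "finite E" by (rule card_ge_0_finite) (simp add: c)
  have t: "tr2 (hinv g c x) (\<lambda>i l. u i * v l) = (\<Sum>e\<in>E. (\<Sum>i\<in>UNIV. e $ i * u i) * (\<Sum>l\<in>UNIV. cnj (e $ l) * v l))" for u v
  proof -
    have "tr2 (hinv g c x) (\<lambda>i l. u i * v l) = (\<Sum>i\<in>UNIV. \<Sum>l\<in>UNIV. \<Sum>e\<in>E. (e $ i * u i) * (cnj (e $ l) * v l))"
      unfolding tr2_def h sum_distrib_right by (intro sum.cong refl) (simp add: mult_ac)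
    also have "\<dots> = (\<Sum>i\<in>UNIV. \<Sum>e\<in>E. \<Sum>l\<in>UNIV. (e $ i * u i) * (cnj (e $ l) * v l))"
      by (rule sum.cong[OF refl], rule sum.swap)
    also have "\<dots> = (\<Sum>e\<in>E. \<Sum>i\<in>UNIV. \<Sum>l\<in>UNIV. (e $ i * u i) * (cnj (e $ l) * v l))" by (rule sum.swap)
    finally show ?thesis by (simp add: sum_product)
  qed
  have z: "w k = 0" if w: "\<And>e. e \<in> E \<Longrightarrow> (\<Sum>i\<in>UNIV. e $ i * w i) = 0" for w k
  proof -
    have "w k = (\<Sum>i\<in>UNIV. w i * (if i = k then 1 else 0))" by simp
    also have "\<dots> = tr2 (hinv g c x) (\<lambda>i l. w i * herm g c x k l)"
      unfolding hinv_herm[OF hf, symmetric] tr2_def by (simp add: sum_distrib_left mult_ac)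
    also have "\<dots> = 0" unfolding t by (simp add: w)
    finally show ?thesis .
  qed
  show ?thesis unfolding frame_def by (intro exI[of _ E] conjI allI impI) (rule f, rule t, rule z, simp)
qed

text \<open>In an orthonormal basis the expression is a sum of squares.\<close>

lemma norm01_nonneg:
  assumes hf: "hermitian_at g c x"
  shows "Re (tr2 (hinv g c x) (\<lambda>k j. v j * cnj (v k))) \<ge> 0"
    "Re (tr2 (hinv g c x) (\<lambda>k j. v j * cnj (v k))) = 0 \<Longrightarrow> v k = 0"
proof -
  obtain E where "frame g c x E" using ex_frame[OF hf] by blast
  note E = frameD[OF this]
  have e: "Re (tr2 (hinv g c x) (\<lambda>k j. v j * cnj (v k))) = (\<Sum>e\<in>E. (cmod (\<Sum>i\<in>UNIV. e $ i * cnj (v i)))\<^sup>2)"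
  proof -
    have "tr2 (hinv g c x) (\<lambda>k j. v j * cnj (v k)) = tr2 (hinv g c x) (\<lambda>k j. cnj (v k) * v j)" by (simp add: mult.commute)
    also have "\<dots> = (\<Sum>e\<in>E. (\<Sum>i\<in>UNIV. e $ i * cnj (v i)) * cnj (\<Sum>i\<in>UNIV. e $ i * cnj (v i)))"
      unfolding E(1) by simp
    also have "\<dots> = complex_of_real (\<Sum>e\<in>E. (cmod (\<Sum>i\<in>UNIV. e $ i * cnj (v i)))\<^sup>2)"
      by (simp only: complex_norm_square[symmetric] of_real_sum)
    finally show ?thesis by (simp only: Re_complex_of_real)
  qed
  show "Re (tr2 (hinv g c x) (\<lambda>k j. v j * cnj (v k))) \<ge> 0" unfolding e by (intro sum_nonneg) simp
  assume "Re (tr2 (hinv g c x) (\<lambda>k j. v j * cnj (v k))) = 0"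
  then have n: "\<forall>e\<in>E. (cmod (\<Sum>i\<in>UNIV. e $ i * cnj (v i)))\<^sup>2 = 0"
    unfolding e by (subst (asm) sum_nonneg_eq_0_iff[OF E(2)]) auto
  have "cnj (v k) = 0" by (rule E(3)[of "\<lambda>i. cnj (v i)" k]) (use n in simp)
  then show "v k = 0" by simp
qed

text \<open>Diagonalise the first trace and apply the previous lemma to each summand.\<close>

lemma norm11_nonneg:
  assumes hf: "hermitian_at g c x"
  shows "Re (tr2 (hinv g c x) (\<lambda>i l. tr2 (hinv g c x) (\<lambda>k j. F i j * cnj (F l k)))) \<ge> 0"
    "Re (tr2 (hinv g c x) (\<lambda>i l. tr2 (hinv g c x) (\<lambda>k j. F i j * cnj (F l k)))) = 0 \<Longrightarrow> F i j = 0"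
proof -
  obtain E where "frame g c x E" using ex_frame[OF hf] by blast
  note E = frameD[OF this]
  define \<Phi> where "\<Phi> e j = (\<Sum>i\<in>UNIV. e $ i * F i j)" for e j
  let ?N = "\<lambda>e. tr2 (hinv g c x) (\<lambda>k j. \<Phi> e j * cnj (\<Phi> e k))"
  have e: "tr2 (hinv g c x) (\<lambda>i l. tr2 (hinv g c x) (\<lambda>k j. F i j * cnj (F l k))) = (\<Sum>e\<in>E. ?N e)"
  proof -
    have "tr2 (hinv g c x) (\<lambda>i l. tr2 (hinv g c x) (\<lambda>k j. F i j * cnj (F l k))) =
       tr2 (hinv g c x) (\<lambda>k j. tr2 (hinv g c x) (\<lambda>i l. F i j * cnj (F l k)))" by (rule tr2_swap)
    also have "\<dots> = tr2 (hinv g c x) (\<lambda>k j. \<Sum>e\<in>E. \<Phi> e j * cnj (\<Phi> e k))"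
      unfolding E(1) \<Phi>_def by simp
    finally show ?thesis by (simp only: tr2_sum)
  qed
  show "Re (tr2 (hinv g c x) (\<lambda>i l. tr2 (hinv g c x) (\<lambda>k j. F i j * cnj (F l k)))) \<ge> 0"
    unfolding e Re_sum by (intro sum_nonneg norm01_nonneg(1)[OF hf])
  assume "Re (tr2 (hinv g c x) (\<lambda>i l. tr2 (hinv g c x) (\<lambda>k j. F i j * cnj (F l k)))) = 0"
  then have "\<forall>e\<in>E. Re (?N e) = 0"
    unfolding e Re_sum by (subst (asm) sum_nonneg_eq_0_iff[OF E(2)]) (auto intro: norm01_nonneg(1)[OF hf])
  then have "\<Phi> e j = 0" if "e \<in> E" for e using norm01_nonneg(2)[OF hf, of "\<Phi> e" j] that by blast
  then show "F i j = 0" unfolding \<Phi>_def by (rule E(3)[of "\<lambda>i. F i j"])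
qed

context hermitian_manifold
begin

lemma glue_cong:
  assumes "\<And>c x. c \<in> A \<Longrightarrow> x \<in> im c \<Longrightarrow> f c x = f' c x"
  shows "glue A f = glue A f'"
  unfolding glue_def using assms[OF chart_at(1) snd_in[OF chart_at(2)]] by (intro ext)

end

context compact_hermitian_manifold
begin

text \<open>If two forms have the same inner product with their difference \<open>d\<close>, then the integral of the
  nonnegative continuous function \<open>\<langle>d, d\<rangle>\<close> is 0.\<close>

lemma inner_unique_aux:
  fixes f :: "('m, 'n) form \<Rightarrow> ('m, 'n) form \<Rightarrow> ('m, 'n) chart \<Rightarrow> complex^'n \<Rightarrow> complex"
  assumes c1: "continuous_on UNIV (glue A (f d \<psi>1))" and c2: "continuous_on UNIV (glue A (f d \<psi>2))"
    and cd: "continuous_on UNIV (glue A (f d d))"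
    and d: "\<And>c x. c \<in> A \<Longrightarrow> x \<in> im c \<Longrightarrow> f d d c x = f d \<psi>1 c x - f d \<psi>2 c x"
    and pos: "\<And>c x. c \<in> A \<Longrightarrow> x \<in> im c \<Longrightarrow> Re (f d d c x) \<ge> 0"
    and inv: "\<And>c c' x. c \<in> A \<Longrightarrow> c' \<in> A \<Longrightarrow> x \<in> overlap c c' \<Longrightarrow> f d d c x = f d d c' (transition c c' x)"
    and eq: "integral\<^sup>L (volume A g) (glue A (f d \<psi>1)) = integral\<^sup>L (volume A g) (glue A (f d \<psi>2))"
    and c: "c \<in> A" and x: "x \<in> im c"
  shows "Re (f d d c x) = 0"
proof -
  have G: "glue A (f d d) = glue A (\<lambda>c x. f d \<psi>1 c x - f d \<psi>2 c x)" by (rule glue_cong) (rule d)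
  have "integral\<^sup>L (volume A g) (glue A (f d d)) = (\<integral>m. glue A (f d \<psi>1) m - glue A (f d \<psi>2) m \<partial>volume A g)"
    unfolding G by (simp add: glue_def[abs_def])
  also have "\<dots> = 0"
    using Bochner_Integration.integral_diff[OF integrable_volume[OF c1] integrable_volume[OF c2]] eq by simp
  finally have "(\<integral>m. Re (glue A (f d d) m) \<partial>volume A g) = 0"
    using integral_Re[OF integrable_volume[OF cd]] by simp
  moreover have "Re (glue A (f d d) m) \<ge> 0" for m
    unfolding glue_def by (rule pos[OF chart_at(1) snd_in[OF chart_at(2)]])
  ultimately have "Re (glue A (f d d) (cinv c x)) = 0"
    by (intro integral_volume_eq_0[of "\<lambda>m. Re (glue A (f d d) m)"] continuous_on_Re cd)
  then show ?thesis using glue_cinv[of "f d d", OF inv c x] by simp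
qed

lemma inner01_unique:
  assumes f: "\<psi>1 \<in> forms A 0 1" "\<psi>2 \<in> forms A 0 1"
    and eq: "\<And>\<eta>. \<eta> \<in> forms A 0 1 \<Longrightarrow> inner_prod A g 0 1 \<eta> \<psi>1 = inner_prod A g 0 1 \<eta> \<psi>2"
  shows "\<psi>1 = \<psi>2"
proof -
  define d where "d = \<psi>1 - \<psi>2"
  have d: "d \<in> forms A 0 1" unfolding d_def by (rule forms_diff[OF f])
  have di: "pt_inner g 0 1 d d c x = pt_inner g 0 1 d \<psi>1 c x - pt_inner g 0 1 d \<psi>2 c x" for c x
    unfolding pt_inner01 tr2_diff[symmetric] by (simp add: d_def right_diff_distrib)
  have hat: "hermitian_at g c x" if "c \<in> A" "x \<in> im c" for c x
  proof -
    interpret C: hermitian_chart g c "im c" by (rule hermitian_chart[OF that(1)])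
    show ?thesis by (rule C.hat[OF that(2)])
  qed
  have z: "d c x [] [j] = 0" if cx: "c \<in> A" "x \<in> im c" for c x j
  proof -
    have pos: "Re (pt_inner g 0 1 d d c x) \<ge> 0" if "c \<in> A" "x \<in> im c" for c x
      unfolding pt_inner01 by (rule norm01_nonneg(1)[OF hat[OF that]])
    have "Re (pt_inner g 0 1 d d c x) = 0"
      by (rule inner_unique_aux[where f = "pt_inner g 0 1", OF continuous_inner01[OF d f(1)] continuous_inner01[OF d f(2)] continuous_inner01[OF d d] di pos
           pt_inner01_change[OF d d] eq[OF d, unfolded inner_prod_glue] cx])
    then show ?thesis unfolding pt_inner01 by (rule norm01_nonneg(2)[OF hat[OF cx], of "\<lambda>j. d c x [] [j]"])
  qed
  have "d c x I J = 0" for c x I J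
  proof (cases "c \<in> A \<and> x \<in> im c \<and> length I = 0 \<and> length J = 1")
    case True
    then obtain j where "I = []" "J = [j]" by (auto simp: length_1_cases)
    then show ?thesis using True z by simp
  qed (rule forms_zero[OF d])
  then have "\<psi>1 c x I J = \<psi>2 c x I J" for c x I J
    using eq_iff_diff_eq_0[of "\<psi>1 c x I J"] by (simp add: d_def)
  then show ?thesis by (intro ext)
qed

lemma inner11_unique:
  assumes f: "\<psi>1 \<in> forms A 1 1" "\<psi>2 \<in> forms A 1 1"
    and eq: "\<And>\<eta>. \<eta> \<in> forms A 1 1 \<Longrightarrow> inner_prod A g 1 1 \<eta> \<psi>1 = inner_prod A g 1 1 \<eta> \<psi>2"
  shows "\<psi>1 = \<psi>2"
proof -
  define d where "d = \<psi>1 - \<psi>2"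
  have d: "d \<in> forms A 1 1" unfolding d_def by (rule forms_diff[OF f])
  have di: "pt_inner g 1 1 d d c x = pt_inner g 1 1 d \<psi>1 c x - pt_inner g 1 1 d \<psi>2 c x" for c x
    unfolding pt_inner11 tr2_diff[symmetric] by (simp add: d_def right_diff_distrib)
  have hat: "hermitian_at g c x" if "c \<in> A" "x \<in> im c" for c x
  proof -
    interpret C: hermitian_chart g c "im c" by (rule hermitian_chart[OF that(1)])
    show ?thesis by (rule C.hat[OF that(2)])
  qed
  have z: "d c x [i] [j] = 0" if cx: "c \<in> A" "x \<in> im c" for c x i j
  proof -
    have pos: "Re (pt_inner g 1 1 d d c x) \<ge> 0" if "c \<in> A" "x \<in> im c" for c x
      unfolding pt_inner11 by (rule norm11_nonneg(1)[OF hat[OF that]])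
    have "Re (pt_inner g 1 1 d d c x) = 0"
      by (rule inner_unique_aux[where f = "pt_inner g 1 1", OF continuous_inner11[OF d f(1)] continuous_inner11[OF d f(2)] continuous_inner11[OF d d] di pos
           pt_inner11_change[OF d d] eq[OF d, unfolded inner_prod_glue] cx])
    then show ?thesis unfolding pt_inner11 by (rule norm11_nonneg(2)[OF hat[OF cx], of "\<lambda>i j. d c x [i] [j]"])
  qed
  have "d c x I J = 0" for c x I J
  proof (cases "c \<in> A \<and> x \<in> im c \<and> length I = 1 \<and> length J = 1")
    case True
    then obtain i j where "I = [i]" "J = [j]" by (auto simp: length_1_cases)
    then show ?thesis using True z by simp
  qed (rule forms_zero[OF d])
  then have "\<psi>1 c x I J = \<psi>2 c x I J" for c x I J
    using eq_iff_diff_eq_0[of "\<psi>1 c x I J"] by (simp add: d_def)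
  then show ?thesis by (intro ext)
qed

end

section \<open>The adjoints of \<open>\<partial>\<close> and its conjugate at \<open>\<omega>\<close>\<close>

lemma omega_component: "c \<in> A \<Longrightarrow> x \<in> im c \<Longrightarrow> omega A g c x [i] [j] = \<i> * herm g c x i j"
  by (simp add: omega_def form11_def)

lemma tr2_herm:
  assumes "hermitian_at g c x"
  shows "tr2 (hinv g c x) (\<lambda>k l. f k * herm g c x i l) = f i"
proof -
  have "tr2 (hinv g c x) (\<lambda>k l. f k * herm g c x i l) = (\<Sum>k\<in>UNIV. f k * (\<Sum>l\<in>UNIV. hinv g c x k l * herm g c x i l))"
    by (simp add: tr2_def sum_distrib_left mult_ac)
  then show ?thesis by (simp add: hinv_herm[OF assms])
qed

context hermitian_manifold
begin

lemma psi_in_forms: "form01 A (psi g) \<in> forms A 0 1"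
proof (rule form01_in_forms)
  fix c j assume c: "c \<in> A"
  interpret C: hermitian_chart g c "im c" by (rule hermitian_chart[OF c])
  show "smooth_on (\<lambda>x. psi g c x j) (im c)" by (rule C.smooth_psi)
next
  fix c c' x j assume c: "c \<in> A" "c' \<in> A" and x: "x \<in> overlap c c'"
  interpret chart_change g c c' "overlap c c'" "im c'" "transition c c'" by (rule chart_change[OF c])
  show "psi g c x j = (\<Sum>e\<in>UNIV. cnj (jac (transition c c') x j e) * psi g c' (transition c c' x) e)"
    by (rule psi_change[OF x])
qed

lemma del01: "x \<in> im c \<Longrightarrow> del \<eta> c x [i] [j] = cderiv (dz i) (\<lambda>y. \<eta> c y [] [j]) x"
  by (simp add: del_def omit_def)

lemma delbar10: "x \<in> im c \<Longrightarrow> delbar \<eta> c x [i] [j] = - cderiv (dzb j) (\<lambda>y. \<eta> c y [i] []) x"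
  by (simp add: delbar_def omit_def)

text \<open>The contraction of \<open>\<partial>\<eta>\<close> with \<open>\<omega>\<close> is \<open>- \<i>\<close> times the trace of \<open>\<partial>\<^sub>k \<eta>\<^sub>j\<close>, which is the leading term of
  \<open>divop\<close>.\<close>

lemma inner_del_omega:
  assumes c: "c \<in> A" and x: "x \<in> im c"
  shows "pt_inner g 1 1 (del \<eta>) (omega A g) c x =
    pt_inner g 0 1 \<eta> (form01 A (psi g)) c x + divop g c (\<lambda>y j. \<eta> c y [] [j]) x"
proof -
  interpret C: hermitian_chart g c "im c" by (rule hermitian_chart[OF c])
  note hat = C.hat[OF x]
  let ?D = "\<lambda>i j. cderiv (dz i) (\<lambda>y. \<eta> c y [] [j]) x"
  have "pt_inner g 1 1 (del \<eta>) (omega A g) c x =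
     tr2 (hinv g c x) (\<lambda>i l. tr2 (hinv g c x) (\<lambda>k j. - \<i> * (?D i j * herm g c x k l)))"
    unfolding pt_inner11 by (simp add: del01[OF x] omega_component[OF c x] cnj_herm[OF hat] mult_ac)
  also have "\<dots> = tr2 (hinv g c x) (\<lambda>k j. tr2 (hinv g c x) (\<lambda>i l. - \<i> * (?D i j * herm g c x k l)))"
    by (rule tr2_swap)
  also have "\<dots> = - \<i> * tr2 (hinv g c x) ?D"
    by (simp only: tr2_cmult tr2_herm[OF hat, of "\<lambda>i. ?D i _"])
  finally show ?thesis
    unfolding pt_inner01 divop_def using c x by (simp add: form01_def mult.commute)
qed

end

context compact_hermitian_manifold
begin

lemma inner_prod_del_omega:
  assumes eta: "\<eta> \<in> forms A 0 1"
  shows "inner_prod A g 1 1 (del \<eta>) (omega A g) = inner_prod A g 0 1 \<eta> (form01 A (psi g))"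
proof -
  let ?v = "\<lambda>c x j. \<eta> c x [] [j]"
  have C1: "C1_form01 ?v"
    unfolding C1_form01_def using forms_smooth[OF eta] forms01_change[OF eta] unfolding smooth_on_def by blast
  have "glue A (pt_inner g 1 1 (del \<eta>) (omega A g)) =
    (\<lambda>m. glue A (pt_inner g 0 1 \<eta> (form01 A (psi g))) m + glue A (\<lambda>c. divop g c (?v c)) m)"
    unfolding glue_def by (rule ext) (rule inner_del_omega[OF chart_at(1) snd_in[OF chart_at(2)]])
  then show ?thesis unfolding inner_prod_glue
    using Bochner_Integration.integral_add[OF integrable_volume[OF continuous_inner01[OF eta psi_in_forms]]
       integrable_volume[OF continuous_glue_divop[OF C1]]]
    by (simp add: integral_divop[OF C1])
qed

text \<open>The adjoint is characterised by \<open>inner_prod_del_omega\<close>, and it is unique by positivity.\<close>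

lemma del_star_omega: "del_star A g 0 1 (omega A g) = form01 A (psi g)"
  unfolding del_star_def formal_adjoint_def
proof (rule the_equality)
  show "form01 A (psi g) \<in> forms A 0 1 \<and>
    (\<forall>\<eta>\<in>forms A 0 1. inner_prod A g (0 + 1) 1 (del \<eta>) (omega A g) = inner_prod A g 0 1 \<eta> (form01 A (psi g)))"
    using psi_in_forms inner_prod_del_omega by simp
next
  fix \<psi> assume p: "\<psi> \<in> forms A 0 1 \<and> (\<forall>\<eta>\<in>forms A 0 1. inner_prod A g (0 + 1) 1 (del \<eta>) (omega A g) = inner_prod A g 0 1 \<eta> \<psi>)"
  show "\<psi> = form01 A (psi g)"
  proof (rule inner01_unique[OF _ psi_in_forms])
    fix \<eta> assume "\<eta> \<in> forms A 0 1"
    then show "inner_prod A g 0 1 \<eta> \<psi> = inner_prod A g 0 1 \<eta> (form01 A (psi g))"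
      using p inner_prod_del_omega by simp
  qed (use p in blast)
qed

text \<open>The statement for \<open>delbar\<close> is the complex conjugate, since \<open>\<omega>\<close> is real.\<close>

lemma inner_prod_delbar_omega:
  assumes eta: "\<eta> \<in> forms A 1 0"
  shows "inner_prod A g 1 1 (delbar \<eta>) (omega A g) = cnj (inner_prod A g 1 1 (del (conj_form \<eta>)) (omega A g))"
proof -
  have e: "pt_inner g 1 1 (delbar \<eta>) (omega A g) c x = cnj (pt_inner g 1 1 (del (conj_form \<eta>)) (omega A g) c x)"
    if c: "c \<in> A" and x: "x \<in> im c" for c x
  proof -
    interpret C: hermitian_chart g c "im c" by (rule hermitian_chart[OF c])
    note hat = C.hat[OF x]
    let ?f = "del (conj_form \<eta>) c x" and ?w = "omega A g c x"
    have d: "delbar \<eta> c x [i] [j] = - cnj (?f [j] [i])" for i j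
    proof -
      have "(\<lambda>y. \<eta> c y [i] []) differentiable at x"
        by (rule smooth_on_differentiable[OF C.U forms_smooth[OF eta c] x])
      then show ?thesis unfolding del01[OF x] delbar10[OF x]
        by (simp add: conj_form_def cderiv_cnj)
    qed
    have w: "?w [i] [j] = - cnj (?w [j] [i])" for i j
      by (simp add: omega_component[OF c x] cnj_herm[OF hat])
    have "pt_inner g 1 1 (delbar \<eta>) (omega A g) c x = tr2 (hinv g c x) (\<lambda>i l. tr2 (hinv g c x) (\<lambda>k j. cnj (?f [j] [i]) * ?w [k] [l]))"
      unfolding pt_inner11 d by (subst w) simp
    also have "\<dots> = tr2 (hinv g c x) (\<lambda>k j. tr2 (hinv g c x) (\<lambda>i l. cnj (?f [j] [i]) * ?w [k] [l]))" by (rule tr2_swap)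
    also have "\<dots> = cnj (pt_inner g 1 1 (del (conj_form \<eta>)) (omega A g) c x)"
      unfolding pt_inner11 by (simp add: cnj_tr2[where h = "hinv g c x", OF cnj_hinv[OF hat]])
    finally show ?thesis .
  qed
  have "glue A (pt_inner g 1 1 (delbar \<eta>) (omega A g)) = glue A (\<lambda>c x. cnj (pt_inner g 1 1 (del (conj_form \<eta>)) (omega A g) c x))"
    by (rule glue_cong) (rule e)
  also have "\<dots> = (\<lambda>m. cnj (glue A (pt_inner g 1 1 (del (conj_form \<eta>)) (omega A g)) m))"
    by (simp add: glue_def[abs_def])
  finally have "glue A (pt_inner g 1 1 (delbar \<eta>) (omega A g)) = \<dots>" .
  then show ?thesis by (simp add: inner_prod_glue)
qed

lemma inner_prod_conj_form:
  "inner_prod A g 1 0 (conj_form \<eta>) (conj_form \<psi>) = cnj (inner_prod A g 0 1 \<eta> \<psi>)"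
proof -
  have e: "pt_inner g 1 0 (conj_form \<eta>) (conj_form \<psi>) c x = cnj (pt_inner g 0 1 \<eta> \<psi> c x)"
    if c: "c \<in> A" and x: "x \<in> im c" for c x
  proof -
    interpret C: hermitian_chart g c "im c" by (rule hermitian_chart[OF c])
    show ?thesis unfolding pt_inner10 pt_inner01
      by (simp add: cnj_tr2[where h = "hinv g c x", OF cnj_hinv[OF C.hat[OF x]]] conj_form_def)
  qed
  have "glue A (pt_inner g 1 0 (conj_form \<eta>) (conj_form \<psi>)) = glue A (\<lambda>c x. cnj (pt_inner g 0 1 \<eta> \<psi> c x))"
    by (rule glue_cong) (rule e)
  also have "\<dots> = (\<lambda>m. cnj (glue A (pt_inner g 0 1 \<eta> \<psi>) m))" by (simp add: glue_def[abs_def])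
  finally have "glue A (pt_inner g 1 0 (conj_form \<eta>) (conj_form \<psi>)) = \<dots>" .
  then show ?thesis by (simp add: inner_prod_glue)
qed

lemma delbar_star_omega: "delbar_star A g 1 0 (omega A g) = conj_form (form01 A (psi g))"
  unfolding delbar_star_def formal_adjoint_def
proof (rule the_equality)
  have "inner_prod A g 1 1 (delbar \<eta>) (omega A g) = inner_prod A g 1 0 \<eta> (conj_form (form01 A (psi g)))"
    if eta: "\<eta> \<in> forms A 1 0" for \<eta>
    using inner_prod_conj_form[of "conj_form \<eta>" "form01 A (psi g)"] inner_prod_delbar_omega[OF eta]
      inner_prod_del_omega[OF conj_form_in_forms[OF eta im_open]] by simp
  then show "conj_form (form01 A (psi g)) \<in> forms A 1 0 \<and>
    (\<forall>\<eta>\<in>forms A 1 0. inner_prod A g 1 (0 + 1) (delbar \<eta>) (omega A g) = inner_prod A g 1 0 \<eta> (conj_form (form01 A (psi g))))"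
    using conj_form_in_forms[OF psi_in_forms im_open] by simp
next
  fix \<psi> assume p: "\<psi> \<in> forms A 1 0 \<and> (\<forall>\<eta>\<in>forms A 1 0. inner_prod A g 1 (0 + 1) (delbar \<eta>) (omega A g) = inner_prod A g 1 0 \<eta> \<psi>)"
  have "conj_form \<psi> = form01 A (psi g)"
  proof (rule inner01_unique[OF conj_form_in_forms[OF _ im_open] psi_in_forms])
    show "\<psi> \<in> forms A 1 0" using p by blast
    fix \<eta> assume eta: "\<eta> \<in> forms A 0 1"
    have e: "conj_form \<eta> \<in> forms A 1 0" by (rule conj_form_in_forms[OF eta im_open])
    have "cnj (inner_prod A g 0 1 \<eta> (conj_form \<psi>)) = inner_prod A g 1 1 (delbar (conj_form \<eta>)) (omega A g)"
      using p e inner_prod_conj_form[of \<eta> "conj_form \<psi>"] by simp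
    also have "\<dots> = cnj (inner_prod A g 0 1 \<eta> (form01 A (psi g)))"
      using inner_prod_delbar_omega[OF e] inner_prod_del_omega[OF eta] by simp
    finally show "inner_prod A g 0 1 \<eta> (conj_form \<psi>) = inner_prod A g 0 1 \<eta> (form01 A (psi g))" by simp
  qed
  then show "\<psi> = conj_form (form01 A (psi g))" using conj_form_conj_form[of \<psi>] by simp
qed

end

section \<open>The operator \<open>\<Lambda>\<close> on \<open>\<partial>\<partial>\<omega>\<close> (second \<open>\<partial>\<close> barred)\<close>

lemma tr4_swap_inner: "tr2 h (\<lambda>i l. tr2 h (\<lambda>i' l'. tr2 h (\<lambda>k j. tr2 h (\<lambda>k' j'. F i l i' l' k' j' k j)))) =
   tr2 h (\<lambda>i l. tr2 h (\<lambda>i' l'. tr2 h (\<lambda>k j. tr2 h (\<lambda>k' j'. F i l i' l' k j k' j'))))"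
  by (rule arg_cong[where f = "tr2 h"], rule ext, rule ext, rule arg_cong[where f = "tr2 h"], rule ext, rule ext, rule tr2_swap)

text \<open>The product \<open>\<omega> \<and> \<eta>\<close> has four terms; by the antisymmetry of \<open>\<psi>\<close> and relabelling of the
  contracted pairs they contribute equally, which cancels the factor 1/4 in the inner product.
  In the remaining term one inverse metric is contracted with \<open>\<omega>\<close>.\<close>

lemma wedge_omega_inner:
  assumes hat: "hermitian_at g c x" and w: "\<And>i j. \<omega> c x [i] [j] = \<i> * herm g c x i j"
    and a1: "\<And>p q r s. \<psi> c x [q, p] [r, s] = - \<psi> c x [p, q] [r, s]"
    and a2: "\<And>p q r s. \<psi> c x [p, q] [s, r] = - \<psi> c x [p, q] [r, s]"
  shows "pt_inner g 2 2 (wedge11 \<omega> \<eta>) \<psi> c x = tr2 (hinv g c x) (\<lambda>i l. tr2 (hinv g c x) (\<lambda>k j.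
    \<eta> c x [i] [j] * cnj (\<i> * tr2 (hinv g c x) (\<lambda>p q. \<psi> c x [p, l] [q, k]))))"
proof -
  let ?h = "hinv g c x"
  define M where "M i l i' l' k j k' j' = \<i> * (herm g c x i j * (\<eta> c x [i'] [j'] * cnj (\<psi> c x [l, l'] [k, k'])))" for i l i' l' k j k' j'
  define T where "T F = tr2 ?h (\<lambda>i l. tr2 ?h (\<lambda>i' l'. tr2 ?h (\<lambda>k j. tr2 ?h (\<lambda>k' j'. F i l i' l' k j k' j'))))" for F
  have T1: "T (\<lambda>i l i' l' k j k' j'. F i l i' l' k' j' k j) = T F" for F
    unfolding T_def by (rule tr4_swap_inner)
  have T2: "T (\<lambda>i l i' l' k j k' j'. F i' l' i l k j k' j') = T F" for F
    unfolding T_def by (rule tr2_swap)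
  have W: "wedge11 \<omega> \<eta> c x [i, i'] [j, j'] * cnj (\<psi> c x [l, l'] [k, k']) =
     - (M i l i' l' k j k' j' + M i l i' l' k' j' k j + M i' l' i l k j k' j' + M i' l' i l k' j' k j)" for i i' j j' l l' k k'
  proof -
    have W1: "wedge11 \<omega> \<eta> c x [i, i'] [j, j'] = - (\<omega> c x [i] [j] * \<eta> c x [i'] [j'] - \<omega> c x [i] [j'] * \<eta> c x [i'] [j]
       - \<omega> c x [i'] [j] * \<eta> c x [i] [j'] + \<omega> c x [i'] [j'] * \<eta> c x [i] [j])"
      by (simp add: wedge11_def omit_def algebra_simps)
    have s: "\<psi> c x [l, l'] [k', k] = - \<psi> c x [l, l'] [k, k']" "\<psi> c x [l', l] [k, k'] = - \<psi> c x [l, l'] [k, k']"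
      "\<psi> c x [l', l] [k', k] = \<psi> c x [l, l'] [k, k']"
      using a2[of l l' k' k] a1[of l' l k k'] a1[of l' l k' k] a2[of l l' k' k] by simp_all
    show ?thesis unfolding W1 M_def w s by (simp add: algebra_simps)
  qed
  have "pt_inner g 2 2 (wedge11 \<omega> \<eta>) \<psi> c x = 1 / 4 * T (\<lambda>i l i' l' k j k' j'. -1 * (M i l i' l' k j k' j' + M i l i' l' k' j' k j + M i' l' i l k j k' j' + M i' l' i l k' j' k j))"
    unfolding pt_inner22 W T_def by simp
  also have "\<dots> = 1 / 4 * (-1 * (T M + T (\<lambda>i l i' l' k j k' j'. M i l i' l' k' j' k j)
      + T (\<lambda>i l i' l' k j k' j'. M i' l' i l k j k' j') + T (\<lambda>i l i' l' k j k' j'. M i' l' i l k' j' k j)))"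
    unfolding T_def by (simp only: tr2_cmult tr2_add)
  also have "T (\<lambda>i l i' l' k j k' j'. M i' l' i l k' j' k j) = T M"
    using T1[of "\<lambda>i l i' l' k j k' j'. M i' l' i l k j k' j'"] T2[of M] by simp
  also have "T (\<lambda>i l i' l' k j k' j'. M i l i' l' k' j' k j) = T M" by (rule T1)
  also have "T (\<lambda>i l i' l' k j k' j'. M i' l' i l k j k' j') = T M" by (rule T2)
  also have "1 / 4 * (-1 * (T M + T M + T M + T M)) = - T M" by simp
  also have "T M = tr2 ?h (\<lambda>i' l'. tr2 ?h (\<lambda>k' j'. tr2 ?h (\<lambda>i l. tr2 ?h (\<lambda>k j. M i l i' l' k j k' j'))))"
  proof -
    have "T M = tr2 ?h (\<lambda>i' l'. tr2 ?h (\<lambda>i l. tr2 ?h (\<lambda>k j. tr2 ?h (\<lambda>k' j'. M i l i' l' k j k' j'))))"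
      unfolding T_def by (rule tr2_swap)
    also have "\<dots> = tr2 ?h (\<lambda>i' l'. tr2 ?h (\<lambda>i l. tr2 ?h (\<lambda>k' j'. tr2 ?h (\<lambda>k j. M i l i' l' k j k' j'))))"
      by (rule arg_cong[where f = "tr2 ?h"], rule ext, rule ext, rule arg_cong[where f = "tr2 ?h"], rule ext, rule ext, rule tr2_swap)
    also have "\<dots> = tr2 ?h (\<lambda>i' l'. tr2 ?h (\<lambda>k' j'. tr2 ?h (\<lambda>i l. tr2 ?h (\<lambda>k j. M i l i' l' k j k' j'))))"
      by (rule arg_cong[where f = "tr2 ?h"], rule ext, rule ext, rule tr2_swap)
    finally show ?thesis .
  qed
  also have "\<dots> = tr2 ?h (\<lambda>i' l'. tr2 ?h (\<lambda>k' j'. - (\<eta> c x [i'] [j'] * cnj (\<i> * tr2 ?h (\<lambda>p q. \<psi> c x [p, l'] [q, k'])))))"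
  proof -
    have "tr2 ?h (\<lambda>i l. tr2 ?h (\<lambda>k j. M i l i' l' k j k' j')) = - (\<eta> c x [i'] [j'] * cnj (\<i> * tr2 ?h (\<lambda>p q. \<psi> c x [p, l'] [q, k'])))"
      for i' l' k' j'
    proof -
      have m: "M i l i' l' k j k' j' = (\<i> * \<eta> c x [i'] [j'] * cnj (\<psi> c x [l, l'] [k, k'])) * herm g c x i j" for i l k j
        by (simp add: M_def mult_ac)
      have "tr2 ?h (\<lambda>i l. tr2 ?h (\<lambda>k j. M i l i' l' k j k' j')) =
         tr2 ?h (\<lambda>i l. \<i> * \<eta> c x [i'] [j'] * cnj (\<psi> c x [l, l'] [i, k']))"
      proof (rule arg_cong[where f = "tr2 ?h"], rule ext, rule ext)
        fix i l show "tr2 ?h (\<lambda>k j. M i l i' l' k j k' j') = \<i> * \<eta> c x [i'] [j'] * cnj (\<psi> c x [l, l'] [i, k'])"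
          unfolding m by (rule tr2_herm[OF hat])
      qed
      also have "\<dots> = \<i> * \<eta> c x [i'] [j'] * tr2 ?h (\<lambda>i l. cnj (\<psi> c x [l, l'] [i, k']))" by (rule tr2_cmult)
      also have "\<dots> = - (\<eta> c x [i'] [j'] * cnj (\<i> * tr2 ?h (\<lambda>p q. \<psi> c x [p, l'] [q, k'])))"
        by (simp add: cnj_tr2[where h = ?h, OF cnj_hinv[OF hat]])
      finally show ?thesis .
    qed
    then show ?thesis by (simp only:)
  qed
  also have "- \<dots> = tr2 ?h (\<lambda>i l. tr2 ?h (\<lambda>k j. \<eta> c x [i] [j] * cnj (\<i> * tr2 ?h (\<lambda>p q. \<psi> c x [p, l] [q, k]))))"
    unfolding tr2_def sum_negf mult_minus_right minus_minus ..
  finally show ?thesis .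
qed

context hermitian_manifold
begin

lemma del_delbar_omega:
  assumes c: "c \<in> A" and x: "x \<in> im c"
  shows "del (delbar (omega A g)) c x [i, k] [j, l] =
    - \<i> * (ddh g c x i j k l - ddh g c x i l k j - ddh g c x k j i l + ddh g c x k l i j)"
proof -
  interpret C: hermitian_chart g c "im c" by (rule hermitian_chart[OF c])
  have d: "(\<lambda>z. herm g c z k l) differentiable at y" if "y \<in> im c" for k l y by (rule C.diff_herm[OF that])
  have dd: "(\<lambda>y. cderiv (dzb j) (\<lambda>z. herm g c z k l) y) differentiable at x" for j k l
    by (rule smooth_on_differentiable[OF C.U smooth_on_cderiv[OF C.U C.smooth_herm] x])
  have w: "cderiv (dzb j) (\<lambda>z. omega A g c z [k] [l]) y = \<i> * cderiv (dzb j) (\<lambda>z. herm g c z k l) y" if "y \<in> im c" for j k l y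
  proof -
    have "cderiv (dzb j) (\<lambda>z. omega A g c z [k] [l]) y = cderiv (dzb j) (\<lambda>z. \<i> * herm g c z k l) y"
      by (rule cderiv_cong_open[OF C.U that]) (rule omega_component[OF c])
    then show ?thesis by (simp add: cderiv_cmult d[OF that])
  qed
  have 1: "delbar (omega A g) c y [k] [j, l] = - \<i> * (cderiv (dzb j) (\<lambda>z. herm g c z k l) y - cderiv (dzb l) (\<lambda>z. herm g c z k j) y)"
    if "y \<in> im c" for y k
    using that by (simp add: delbar_def omit_def w algebra_simps)
  have 2: "cderiv (dz i) (\<lambda>y. delbar (omega A g) c y [k] [j, l]) x = - \<i> * (ddh g c x i j k l - ddh g c x i l k j)" for i k
  proof -
    have "cderiv (dz i) (\<lambda>y. delbar (omega A g) c y [k] [j, l]) x =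
       cderiv (dz i) (\<lambda>y. - \<i> * (cderiv (dzb j) (\<lambda>z. herm g c z k l) y - cderiv (dzb l) (\<lambda>z. herm g c z k j) y)) x"
      by (rule cderiv_cong_open[OF C.U x]) (rule 1)
    also have "\<dots> = - \<i> * (ddh g c x i j k l - ddh g c x i l k j)"
      unfolding ddh_def by (subst cderiv_cmult) (simp_all only: cderiv_diff dd differentiable_diff)
    finally show ?thesis .
  qed
  have "del (delbar (omega A g)) c x [i, k] [j, l] =
     cderiv (dz i) (\<lambda>y. delbar (omega A g) c y [k] [j, l]) x - cderiv (dz k) (\<lambda>y. delbar (omega A g) c y [i] [j, l]) x"
    using x by (simp add: del_def omit_def)
  then show ?thesis unfolding 2 by (simp add: algebra_simps)
qed

end

context compact_hermitian_manifold
begin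

text \<open>The pointwise adjoint of \<open>\<omega> \<and>\<close> is a global smooth form because \<open>\<partial>\<partial>\<omega>\<close> is a tensor, so that it is
  also the adjoint for the integrated inner products.\<close>

lemma Lambda_del_delbar_omega:
  "Lambda A g 1 1 (del (delbar (omega A g))) = form11 A (\<lambda>c x i j. - \<i> * Lform (hinv g c x) (ddh g c x) i j)" (is "_ = ?\<Lambda>")
proof -
  let ?\<phi> = "del (delbar (omega A g))"
  have in_forms: "?\<Lambda> \<in> forms A 1 1"
  proof (rule form11_in_forms)
    fix c i j assume c: "c \<in> A"
    interpret C: hermitian_chart g c "im c" by (rule hermitian_chart[OF c])
    show "smooth_on (\<lambda>x. - \<i> * Lform (hinv g c x) (ddh g c x) i j) (im c)"
      unfolding Lform_def
      by (intro smooth_on_mult smooth_on_const C.smooth_tr2 smooth_on_add smooth_on_diff C.smooth_ddh C.U)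
  next
    fix c c' x i j assume c: "c \<in> A" "c' \<in> A" and x: "x \<in> overlap c c'"
    interpret chart_change g c c' "overlap c c'" "im c'" "transition c c'" by (rule chart_change[OF c])
    show "- \<i> * Lform (hinv g c x) (ddh g c x) i j = tr2 (\<lambda>d e. jac (transition c c') x i d * cnj (jac (transition c c') x j e))
      (\<lambda>d e. - \<i> * Lform (hinv g c' (transition c c' x)) (ddh g c' (transition c c' x)) d e)"
      unfolding Lform_change[OF x] pull_def tr2_cmult ..
  qed
  have pt: "pt_inner g 2 2 (wedge11 (omega A g) \<eta>) ?\<phi> c x = pt_inner g 1 1 \<eta> ?\<Lambda> c x"
    if c: "c \<in> A" and x: "x \<in> im c" for \<eta> c x
  proof -
    interpret C: hermitian_chart g c "im c" by (rule hermitian_chart[OF c])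
    note f = del_delbar_omega[OF c x]
    have L: "\<i> * tr2 (hinv g c x) (\<lambda>p q. ?\<phi> c x [p, l] [q, k]) = - \<i> * Lform (hinv g c x) (ddh g c x) l k" for l k
      unfolding f Lform_def tr2_cmult by simp
    have "pt_inner g 2 2 (wedge11 (omega A g) \<eta>) ?\<phi> c x = tr2 (hinv g c x) (\<lambda>i l. tr2 (hinv g c x) (\<lambda>k j.
        \<eta> c x [i] [j] * cnj (\<i> * tr2 (hinv g c x) (\<lambda>p q. ?\<phi> c x [p, l] [q, k]))))"
      by (rule wedge_omega_inner[where g = g and c = c and x = x and \<omega> = "omega A g", OF C.hat[OF x] omega_component[OF c x]]) (simp_all add: f algebra_simps)
    also have "\<dots> = pt_inner g 1 1 \<eta> ?\<Lambda> c x"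
      unfolding pt_inner11 L using c x by (simp add: form11_def)
    finally show ?thesis .
  qed
  have adj: "inner_prod A g (1 + 1) (1 + 1) (wedge11 (omega A g) \<eta>) ?\<phi> = inner_prod A g 1 1 \<eta> ?\<Lambda>" for \<eta>
  proof -
    have "glue A (pt_inner g 2 2 (wedge11 (omega A g) \<eta>) ?\<phi>) = glue A (pt_inner g 1 1 \<eta> ?\<Lambda>)"
      by (rule glue_cong) (rule pt)
    then show ?thesis unfolding inner_prod_glue one_add_one by (rule arg_cong)
  qed
  show ?thesis unfolding Lambda_def formal_adjoint_def
  proof (rule the_equality)
    show "?\<Lambda> \<in> forms A 1 1 \<and> (\<forall>\<eta>\<in>forms A 1 1. inner_prod A g (1 + 1) (1 + 1) (wedge11 (omega A g) \<eta>) ?\<phi> = inner_prod A g 1 1 \<eta> ?\<Lambda>)"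
      using in_forms adj by blast
  next
    fix \<psi> assume p: "\<psi> \<in> forms A 1 1 \<and> (\<forall>\<eta>\<in>forms A 1 1. inner_prod A g (1 + 1) (1 + 1) (wedge11 (omega A g) \<eta>) ?\<phi> = inner_prod A g 1 1 \<eta> \<psi>)"
    show "\<psi> = ?\<Lambda>"
    proof (rule inner11_unique[OF _ in_forms])
      show "\<psi> \<in> forms A 1 1" using p by blast
      fix \<eta> assume "\<eta> \<in> forms A 1 1"
      then have "inner_prod A g (1 + 1) (1 + 1) (wedge11 (omega A g) \<eta>) ?\<phi> = inner_prod A g 1 1 \<eta> \<psi>" using p by blast
      then show "inner_prod A g 1 1 \<eta> \<psi> = inner_prod A g 1 1 \<eta> ?\<Lambda>" unfolding adj by (rule sym)
    qed
  qed
qed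

end

section \<open>The curvature identities\<close>

lemma omit_eq_Nil: "a < length I \<Longrightarrow> omit a I = [] \<longleftrightarrow> length I = 1"
  by (auto simp: omit_def le_Suc_eq)

lemma form11_cong:
  assumes "\<And>c x i j. c \<in> A \<Longrightarrow> x \<in> im c \<Longrightarrow> a c x i j = b c x i j"
  shows "form11 A a = form11 A b"
  unfolding form11_def using assms by (intro ext) simp

lemma form11_add: "form11 A a + form11 A b = form11 A (\<lambda>c x i j. a c x i j + b c x i j)"
  and form11_diff: "form11 A a - form11 A b = form11 A (\<lambda>c x i j. a c x i j - b c x i j)"
  and form11_scale: "s \<cdot> form11 A a = form11 A (\<lambda>c x i j. s * a c x i j)"
  by (auto simp: form11_def scale_def intro!: ext)

lemma conj_form11: "conj_form (form11 A a) = form11 A (\<lambda>c x i j. - cnj (a c x j i))"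
  by (auto simp: form11_def conj_form_def intro!: ext)

context hermitian_manifold
begin

lemma del_psi: "del (form01 A (psi g)) = form11 A (\<lambda>c x i j. dpsi (hinv g c x) (dh g c x) (ddh g c x) i j)"
proof (intro ext)
  fix c x and I J :: "'n list"
  let ?r = "form11 A (\<lambda>c x i j. dpsi (hinv g c x) (dh g c x) (ddh g c x) i j)"
  show "del (form01 A (psi g)) c x I J = ?r c x I J"
  proof (cases "c \<in> A \<and> x \<in> im c \<and> length I = 1 \<and> length J = 1")
    case True
    then obtain i j where ij: "I = [i]" "J = [j]" by (auto simp: length_1_cases)
    have c: "c \<in> A" and x: "x \<in> im c" using True by auto
    interpret C: hermitian_chart g c "im c" by (rule hermitian_chart[OF c])
    have "cderiv (dz i) (\<lambda>y. form01 A (psi g) c y [] [j]) x = cderiv (dz i) (\<lambda>y. psi g c y j) x"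
      by (rule cderiv_cong_open[OF C.U x]) (use c in \<open>simp add: form01_def\<close>)
    then show ?thesis using c x by (simp add: ij del01[OF x] C.cderiv_psi[OF x] form11_def)
  next
    case False
    have "(\<lambda>y. form01 A (psi g) c y (omit a I) J) = (\<lambda>y. 0)" if "a < length I" "x \<in> im c" for a
      by (rule ext) (use False that in \<open>auto simp: form01_def omit_eq_Nil\<close>)
    then have "del (form01 A (psi g)) c x I J = 0" by (simp add: del_def)
    then show ?thesis using False by (auto simp: form11_def)
  qed
qed

lemma delbar_cnj_psi: "delbar (conj_form (form01 A (psi g))) =
  form11 A (\<lambda>c x i j. dbpsi (hinv g c x) (dh g c x) (ddh g c x) i j)"
proof (intro ext)
  fix c x and I J :: "'n list"
  let ?r = "form11 A (\<lambda>c x i j. dbpsi (hinv g c x) (dh g c x) (ddh g c x) i j)"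
  show "delbar (conj_form (form01 A (psi g))) c x I J = ?r c x I J"
  proof (cases "c \<in> A \<and> x \<in> im c \<and> length I = 1 \<and> length J = 1")
    case True
    then obtain i j where ij: "I = [i]" "J = [j]" by (auto simp: length_1_cases)
    have c: "c \<in> A" and x: "x \<in> im c" using True by auto
    interpret C: hermitian_chart g c "im c" by (rule hermitian_chart[OF c])
    have "cderiv (dzb j) (\<lambda>y. conj_form (form01 A (psi g)) c y [i] []) x = cderiv (dzb j) (\<lambda>y. cnj (psi g c y i)) x"
      by (rule cderiv_cong_open[OF C.U x]) (use c in \<open>simp add: form01_def conj_form_def\<close>)
    then show ?thesis using c x C.cderiv_cnj_psi[OF x, of j i] by (simp add: ij delbar10[OF x] form11_def)
  next
    case False
    have "(\<lambda>y. conj_form (form01 A (psi g)) c y I (omit a J)) = (\<lambda>y. 0)" if "a < length J" "x \<in> im c" for a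
      by (rule ext) (use False that in \<open>auto simp: form01_def omit_eq_Nil conj_form_def\<close>)
    then have "delbar (conj_form (form01 A (psi g))) c x I J = 0" by (simp add: delbar_def)
    then show ?thesis using False by (auto simp: form11_def)
  qed
qed

lemma T_box_form: "T_box A g = form11 A (\<lambda>c x i j. TBform (hinv g c x) (dh g c x) i j)"
  unfolding T_box_def
proof (rule form11_cong)
  fix c x i j assume c: "c \<in> A" and x: "x \<in> im c"
  interpret C: hermitian_chart g c "im c" by (rule hermitian_chart[OF c])
  show "(\<Sum>p\<in>UNIV. \<Sum>q\<in>UNIV. \<Sum>k\<in>UNIV. \<Sum>l\<in>UNIV.
     hinv g c x p q * herm g c x k l * torsion g c x i p k * cnj (torsion g c x j q l)) =
     TBform (hinv g c x) (dh g c x) i j" by (rule C.T_box_component[OF x])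
qed

lemma T_circ_form: "T_circ A g = form11 A (\<lambda>c x i j. TCform (hinv g c x) (dh g c x) i j)"
  unfolding T_circ_def
proof (rule form11_cong)
  fix c x i j assume c: "c \<in> A" and x: "x \<in> im c"
  interpret C: hermitian_chart g c "im c" by (rule hermitian_chart[OF c])
  show "(\<Sum>p\<in>UNIV. \<Sum>q\<in>UNIV. \<Sum>s\<in>UNIV. \<Sum>t\<in>UNIV. \<Sum>k\<in>UNIV. \<Sum>l\<in>UNIV.
       hinv g c x p q * hinv g c x s t * herm g c x k j * herm g c x i l *
       torsion g c x s p k * cnj (torsion g c x t q l)) = TCform (hinv g c x) (dh g c x) i j"
    by (rule C.T_circ_component[OF x])
qed

lemma T_sharp_form: "T_sharp A g (form01 A (psi g)) = form11 A (\<lambda>c x i j. TSform (hinv g c x) (dh g c x) i j)"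
  unfolding T_sharp_def
proof (rule form11_cong)
  fix c x i j assume c: "c \<in> A" and x: "x \<in> im c"
  interpret C: hermitian_chart g c "im c" by (rule hermitian_chart[OF c])
  show "(\<Sum>p\<in>UNIV. \<Sum>k\<in>UNIV. herm g c x k j * torsion g c x p i k * (\<Sum>s\<in>UNIV. hinv g c x p s * form01 A (psi g) c x [] [s])) =
    TSform (hinv g c x) (dh g c x) i j"
    using C.T_sharp_component[OF x, of j i] c x by (simp add: form01_def)
qed

lemma conj_T_sharp_form: "conj_form (T_sharp A g (form01 A (psi g))) = form11 A (\<lambda>c x i j. cTSform (hinv g c x) (dh g c x) i j)"
  unfolding T_sharp_form conj_form11
proof (rule form11_cong)
  fix c x i j assume c: "c \<in> A" and x: "x \<in> im c"
  interpret C: hermitian_chart g c "im c" by (rule hermitian_chart[OF c])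
  show "- cnj (TSform (hinv g c x) (dh g c x) j i) = cTSform (hinv g c x) (dh g c x) i j" by (rule C.cnj_TSform[OF x])
qed

end

context hermitian_manifold
begin

lemma chern_ricci:
  assumes c: "c \<in> A" and x: "x \<in> im c"
  defines "h \<equiv> hinv g c x" and "a \<equiv> dh g c x" and "D \<equiv> ddh g c x"
  shows "\<i> * (\<Sum>k\<in>UNIV. \<Sum>l\<in>UNIV. hinv g c x k l * chern g c x i j k l) = Th1 h a D i j"
    "\<i> * (\<Sum>k\<in>UNIV. \<Sum>l\<in>UNIV. hinv g c x k l * chern g c x k l i j) = Th1 h a D i j - Lform h D i j - (dpsi h a D i j + dbpsi h a D i j) + \<i> * TBform h a i j"
    "\<i> * (\<Sum>k\<in>UNIV. \<Sum>l\<in>UNIV. hinv g c x k l * chern g c x i l k j) = Th1 h a D i j - dpsi h a D i j"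
    "\<i> * (\<Sum>k\<in>UNIV. \<Sum>l\<in>UNIV. hinv g c x k l * chern g c x k j i l) = Th1 h a D i j - dbpsi h a D i j"
proof -
  interpret C: hermitian_chart g c "im c" by (rule hermitian_chart[OF c])
  note t = C.chern_trace[OF x] and d = h_def a_def D_def
  show "\<i> * (\<Sum>k\<in>UNIV. \<Sum>l\<in>UNIV. hinv g c x k l * chern g c x i j k l) = Th1 h a D i j"
    unfolding t[of "\<lambda>k l. i" "\<lambda>k l. j" "\<lambda>k l. k" "\<lambda>k l. l"] Th1_def d ..
  show "\<i> * (\<Sum>k\<in>UNIV. \<Sum>l\<in>UNIV. hinv g c x k l * chern g c x k l i j) = Th1 h a D i j - Lform h D i j - (dpsi h a D i j + dbpsi h a D i j) + \<i> * TBform h a i j"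
    unfolding t[of "\<lambda>k l. k" "\<lambda>k l. l" "\<lambda>k l. i" "\<lambda>k l. j"] d
    using tr_chern2[where h = "hinv g c x" and D = "ddh g c x" and a = "dh g c x" and i = i and j = j] by (simp add: algebra_simps)
  show "\<i> * (\<Sum>k\<in>UNIV. \<Sum>l\<in>UNIV. hinv g c x k l * chern g c x i l k j) = Th1 h a D i j - dpsi h a D i j"
    unfolding t[of "\<lambda>k l. i" "\<lambda>k l. l" "\<lambda>k l. k" "\<lambda>k l. j"] d
    using tr_chern3[where h = "hinv g c x" and D = "ddh g c x" and a = "dh g c x" and i = i and j = j] by (simp add: algebra_simps)
  show "\<i> * (\<Sum>k\<in>UNIV. \<Sum>l\<in>UNIV. hinv g c x k l * chern g c x k j i l) = Th1 h a D i j - dbpsi h a D i j"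
    unfolding t[of "\<lambda>k l. k" "\<lambda>k l. j" "\<lambda>k l. i" "\<lambda>k l. l"] d
    using tr_chern4[where h = "hinv g c x" and D = "ddh g c x" and a = "dh g c x" and i = i and j = j] by (simp add: algebra_simps)
qed

lemma lc_ricci:
  assumes c: "c \<in> A" and x: "x \<in> im c"
  defines "h \<equiv> hinv g c x" and "a \<equiv> dh g c x" and "D \<equiv> ddh g c x"
  shows "\<i> * (\<Sum>k\<in>UNIV. \<Sum>l\<in>UNIV. hinv g c x k l * lc_curv g c x i j k l) = Th1 h a D i j - 1/2 * (dpsi h a D i j + dbpsi h a D i j)"
    "\<i> * (\<Sum>k\<in>UNIV. \<Sum>l\<in>UNIV. hinv g c x k l * lc_curv g c x k l i j) = Th1 h a D i j - 1/2 * (dpsi h a D i j + dbpsi h a D i j) - \<i>/4 * TCform h a i j + \<i>/4 * TBform h a i j"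
    "\<i> * (\<Sum>k\<in>UNIV. \<Sum>l\<in>UNIV. hinv g c x k l * lc_curv g c x i l k j) = Th1 h a D i j - 1/2 * (Lform h D i j + (dpsi h a D i j + dbpsi h a D i j)) + \<i>/4 * TBform h a i j + 1/4 * TSform h a i j"
    "\<i> * (\<Sum>k\<in>UNIV. \<Sum>l\<in>UNIV. hinv g c x k l * lc_curv g c x k j i l) = Th1 h a D i j - 1/2 * (Lform h D i j + (dpsi h a D i j + dbpsi h a D i j)) + \<i>/4 * TBform h a i j + 1/4 * cTSform h a i j"
proof -
  interpret C: hermitian_chart g c "im c" by (rule hermitian_chart[OF c])
  note t = C.lc_trace[OF x] and d = h_def a_def D_def
  show "\<i> * (\<Sum>k\<in>UNIV. \<Sum>l\<in>UNIV. hinv g c x k l * lc_curv g c x i j k l) = Th1 h a D i j - 1/2 * (dpsi h a D i j + dbpsi h a D i j)"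
    unfolding t[of "\<lambda>k l. i" "\<lambda>k l. j" "\<lambda>k l. k" "\<lambda>k l. l"] d
    using tr_lc1[where h = "hinv g c x" and D = "ddh g c x" and a = "dh g c x" and i = i and j = j] by (simp add: algebra_simps)
  show "\<i> * (\<Sum>k\<in>UNIV. \<Sum>l\<in>UNIV. hinv g c x k l * lc_curv g c x k l i j) = Th1 h a D i j - 1/2 * (dpsi h a D i j + dbpsi h a D i j) - \<i>/4 * TCform h a i j + \<i>/4 * TBform h a i j"
    unfolding t[of "\<lambda>k l. k" "\<lambda>k l. l" "\<lambda>k l. i" "\<lambda>k l. j"] d
    using tr_lc2[where h = "hinv g c x" and D = "ddh g c x" and a = "dh g c x" and i = i and j = j] by (simp add: algebra_simps)
  show "\<i> * (\<Sum>k\<in>UNIV. \<Sum>l\<in>UNIV. hinv g c x k l * lc_curv g c x i l k j) = Th1 h a D i j - 1/2 * (Lform h D i j + (dpsi h a D i j + dbpsi h a D i j)) + \<i>/4 * TBform h a i j + 1/4 * TSform h a i j"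
    unfolding t[of "\<lambda>k l. i" "\<lambda>k l. l" "\<lambda>k l. k" "\<lambda>k l. j"] d
    using tr_lc3[where h = "hinv g c x" and D = "ddh g c x" and a = "dh g c x" and i = i and j = j] by (simp add: algebra_simps)
  show "\<i> * (\<Sum>k\<in>UNIV. \<Sum>l\<in>UNIV. hinv g c x k l * lc_curv g c x k j i l) = Th1 h a D i j - 1/2 * (Lform h D i j + (dpsi h a D i j + dbpsi h a D i j)) + \<i>/4 * TBform h a i j + 1/4 * cTSform h a i j"
    unfolding t[of "\<lambda>k l. k" "\<lambda>k l. j" "\<lambda>k l. i" "\<lambda>k l. l"] d
    using tr_lc4[where h = "hinv g c x" and D = "ddh g c x" and a = "dh g c x" and i = i and j = j] by (simp add: algebra_simps)
qed

lemma riem_ricci: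
  assumes c: "c \<in> A" and x: "x \<in> im c"
  defines "h \<equiv> hinv g c x" and "a \<equiv> dh g c x" and "D \<equiv> ddh g c x"
  shows "\<i> * (\<Sum>k\<in>UNIV. \<Sum>l\<in>UNIV. hinv g c x k l * riem g c x i j k l) = Th1 h a D i j - 1/2 * (dpsi h a D i j + dbpsi h a D i j) - \<i>/4 * TCform h a i j"
    "\<i> * (\<Sum>k\<in>UNIV. \<Sum>l\<in>UNIV. hinv g c x k l * riem g c x k l i j) = Th1 h a D i j - 1/2 * (dpsi h a D i j + dbpsi h a D i j) - \<i>/4 * TCform h a i j"
    "\<i> * (\<Sum>k\<in>UNIV. \<Sum>l\<in>UNIV. hinv g c x k l * riem g c x i l k j) = Th1 h a D i j - 1/2 * (Lform h D i j + (dpsi h a D i j + dbpsi h a D i j)) + \<i>/4 * TBform h a i j + 1/4 * (cTSform h a i j + TSform h a i j)"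
    "\<i> * (\<Sum>k\<in>UNIV. \<Sum>l\<in>UNIV. hinv g c x k l * riem g c x k j i l) = Th1 h a D i j - 1/2 * (Lform h D i j + (dpsi h a D i j + dbpsi h a D i j)) + \<i>/4 * TBform h a i j + 1/4 * (cTSform h a i j + TSform h a i j)"
proof -
  interpret C: hermitian_chart g c "im c" by (rule hermitian_chart[OF c])
  note t = C.riem_trace[OF x] and d = h_def a_def D_def
  show "\<i> * (\<Sum>k\<in>UNIV. \<Sum>l\<in>UNIV. hinv g c x k l * riem g c x i j k l) = Th1 h a D i j - 1/2 * (dpsi h a D i j + dbpsi h a D i j) - \<i>/4 * TCform h a i j"
    unfolding t[of "\<lambda>k l. i" "\<lambda>k l. j" "\<lambda>k l. k" "\<lambda>k l. l"] d
    using tr_riem1[where h = "hinv g c x" and D = "ddh g c x" and a = "dh g c x" and i = i and j = j] by (simp add: algebra_simps)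
  show "\<i> * (\<Sum>k\<in>UNIV. \<Sum>l\<in>UNIV. hinv g c x k l * riem g c x k l i j) = Th1 h a D i j - 1/2 * (dpsi h a D i j + dbpsi h a D i j) - \<i>/4 * TCform h a i j"
    unfolding t[of "\<lambda>k l. k" "\<lambda>k l. l" "\<lambda>k l. i" "\<lambda>k l. j"] d
    using tr_riem2[where h = "hinv g c x" and D = "ddh g c x" and a = "dh g c x" and i = i and j = j] by (simp add: algebra_simps)
  show "\<i> * (\<Sum>k\<in>UNIV. \<Sum>l\<in>UNIV. hinv g c x k l * riem g c x i l k j) = Th1 h a D i j - 1/2 * (Lform h D i j + (dpsi h a D i j + dbpsi h a D i j)) + \<i>/4 * TBform h a i j + 1/4 * (cTSform h a i j + TSform h a i j)"
    unfolding t[of "\<lambda>k l. i" "\<lambda>k l. l" "\<lambda>k l. k" "\<lambda>k l. j"] d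
    using tr_riem3[where h = "hinv g c x" and D = "ddh g c x" and a = "dh g c x" and i = i and j = j] by (simp add: algebra_simps)
  show "\<i> * (\<Sum>k\<in>UNIV. \<Sum>l\<in>UNIV. hinv g c x k l * riem g c x k j i l) = Th1 h a D i j - 1/2 * (Lform h D i j + (dpsi h a D i j + dbpsi h a D i j)) + \<i>/4 * TBform h a i j + 1/4 * (cTSform h a i j + TSform h a i j)"
    unfolding t[of "\<lambda>k l. k" "\<lambda>k l. j" "\<lambda>k l. i" "\<lambda>k l. l"] d
    using tr_riem4[where h = "hinv g c x" and D = "ddh g c x" and a = "dh g c x" and i = i and j = j] by (simp add: algebra_simps)
qed

text \<open>The Ricci tensor is the combination \<open>R\<^sup>(\<^sup>3\<^sup>) + R\<^sup>(\<^sup>4\<^sup>) - R\<^sup>(\<^sup>1\<^sup>)\<close> of Hermitian traces.\<close>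

lemma Ric_component:
  assumes c: "c \<in> A" and x: "x \<in> im c"
  defines "h \<equiv> hinv g c x" and "a \<equiv> dh g c x" and "D \<equiv> ddh g c x"
  shows "\<i> * Ric g c x (dz i) (dzb j) = Th1 h a D i j - Lform h D i j - 1/2 * (dpsi h a D i j + dbpsi h a D i j) + \<i>/4 * (2 * TBform h a i j + TCform h a i j) + 1/2 * (TSform h a i j + cTSform h a i j)"
proof -
  interpret C: hermitian_chart g c "im c" by (rule hermitian_chart[OF c])
  let ?s = "\<lambda>f. \<i> * (\<Sum>k\<in>UNIV. \<Sum>l\<in>UNIV. hinv g c x k l * f k l)"
  have "\<i> * Ric g c x (dz i) (dzb j) = ?s (\<lambda>k l. riem g c x i l k j) + ?s (\<lambda>k l. riem g c x k j i l) - ?s (\<lambda>k l. riem g c x i j k l)"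
    unfolding C.Ric_formula[OF x] by (simp add: distrib_left right_diff_distrib sum.distrib sum_subtractf)
  also have "\<dots> = Th1 h a D i j - Lform h D i j - 1/2 * (dpsi h a D i j + dbpsi h a D i j) + \<i>/4 * (2 * TBform h a i j + TCform h a i j) + 1/2 * (TSform h a i j + cTSform h a i j)"
    unfolding riem_ricci[OF c x] h_def a_def D_def by (simp add: field_simps)
  finally show ?thesis .
qed

end

theorem theorem1p12:
  fixes A :: "('m::t2_space, 'n::finite) chart set"
    and g :: "('m, 'n) metric"
  assumes "complex_atlas A"
    and "compact (UNIV :: 'm set)"
    and "hermitian_metric A g"
  shows
    "let \<omega> = omega A g;
         ds\<omega> = del_star A g 0 1 \<omega>;
         S = del ds\<omega> + delbar (delbar_star A g 1 0 \<omega>);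
         L = \<i> \<cdot> Lambda A g 1 1 (del (delbar \<omega>));
         \<Theta>1 = ric1 A g (chern g);
         TB = T_box A g;
         TC = T_circ A g;
         TS = T_sharp A g ds\<omega>
     in
      (ric1 A g (lc_curv g) = \<Theta>1 - (1/2) \<cdot> S \<and>
       ric2 A g (lc_curv g) = \<Theta>1 - (1/2) \<cdot> S - (\<i>/4) \<cdot> TC + (\<i>/4) \<cdot> TB \<and>
       ric3 A g (lc_curv g) = \<Theta>1 - (1/2) \<cdot> (L + S) + (\<i>/4) \<cdot> TB + (1/4) \<cdot> TS \<and>
       ric4 A g (lc_curv g) = \<Theta>1 - (1/2) \<cdot> (L + S) + (\<i>/4) \<cdot> TB + (1/4) \<cdot> conj_form TS)
      \<and>
      (ric2 A g (chern g) = \<Theta>1 - L - S + \<i> \<cdot> TB \<and>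
       ric3 A g (chern g) = \<Theta>1 - del ds\<omega> \<and>
       ric4 A g (chern g) = \<Theta>1 - delbar (delbar_star A g 1 0 \<omega>))
      \<and>
      (Ric_H A g = ric1 A g (riem g) \<and>
       ric1 A g (riem g) = ric2 A g (riem g) \<and>
       ric2 A g (riem g) = \<Theta>1 - (1/2) \<cdot> S - (\<i>/4) \<cdot> TC \<and>
       ric3 A g (riem g) = ric4 A g (riem g) \<and>
       ric4 A g (riem g) = \<Theta>1 - (1/2) \<cdot> (L + S) + (\<i>/4) \<cdot> TB + (1/4) \<cdot> (conj_form TS + TS))
      \<and>
      scr_Ric A g = \<Theta>1 - L - (1/2) \<cdot> S + (\<i>/4) \<cdot> (2 \<cdot> TB + TC) + (1/2) \<cdot> (TS + conj_form TS)"
proof -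
  interpret compact_hermitian_manifold A g
    by unfold_locales (fact assms)+
  \<comment> \<open>Both sides of every identity are combinations of forms given by components.\<close>
  note forms = form11_scale form11_add form11_diff
  show ?thesis
    unfolding Let_def del_star_omega delbar_star_omega Lambda_del_delbar_omega del_psi delbar_cnj_psi
      conj_T_sharp_form T_box_form T_circ_form ric1_def ric2_def ric3_def ric4_def Ric_H_def scr_Ric_def
    unfolding T_sharp_form forms
    by (intro conjI refl form11_cong)
       (simp_all only: lc_ricci chern_ricci riem_ricci Ric_component, simp_all add: mult.assoc[symmetric])
qed

end
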